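(* Let $m\ge 2$, and for $i\in\{1,\dots,m\}$ let $\epsilon^i_1,\epsilon^i_2,\epsilon^i_3>0$ be constants and ${}^{(i)}\square:=-\partial_t^2+\epsilon^i_1\partial_1^2+\epsilon^i_2\partial_2^2+\epsilon^i_3\partial_3^2$ on $\mathbb{R}^{1+3}$. Consider the coupled system $${}^{(i)}\square\phi_i=N_i,\qquad N_i:=\sum_{a_1,a_2,a_3\in\{1,\dots,m\}}C^i_{a_1,a_2,a_3}(\partial\phi_{a_1},\partial\phi_{a_2},\partial\phi_{a_3}),\qquad i=1,\dots,m,$$ where the $C^i_{a_1,a_2,a_3}(\cdot,\cdot,\cdot)$ are smooth functions which are of cubic or higher order, in the sense that whenever $|\partial\phi_a|\le1$ for all $a\in\{1,\dots,m\}$, for all $i,a_1,a_2,a_3\in\{1,\dots,m\}$, $$|C^i_{a_1,a_2,a_3}(\partial\phi_{a_1},\partial\phi_{a_2},\partial\phi_{a_3})|\lesssim\sum_{a\in\{1,\dots,m\}}|\partial\phi_a|^3.$$ Then there exists a sufficiently small absolute constant $\epsilon_0>0$ such that, if the initial data satisfy $$\sum_{i\in\{1,\dots,m\}}\|\partial\Gamma^{\le 30}\phi_i\|_{L^2_x\cap L^1_x}\Big|_{t=0}\le\epsilon_0,$$ then the coupled system has a unique global solution. Moreover, for every $i\in\{1,\dots,m\}$, the nonlinear wave $\phi_i$ scatters to a linear wave.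
   Context: Coordinates on $\mathbb{R}^{1+3}$ are $(t,x)=(t,x_1,x_2,x_3)$, $\partial_i=\partial_{x_i}$; $\partial\psi=(\partial_t\psi,\partial_1\psi,\partial_2\psi,\partial_3\psi)$ is the spacetime gradient. $S=t\partial_t+\sum_{i=1}^3x_i\partial_i$, and $\Gamma$ denotes any element of $\{S,\partial_1,\partial_2,\partial_3\}$; $\Gamma^{\le k}\psi$ is the collection of all compositions of at most $k$ such vector fields applied to $\psi$, and norms of such collections are sums over the collection. $\|\cdot\|_{L^2_x\cap L^1_x}=\|\cdot\|_{L^2_x}+\|\cdot\|_{L^1_x}$. $A\lesssim B$ means $A\le CB$ for a constant $C$. The system (the numbers $\epsilon^i_j$ and the functions $C^i_{a_1,a_2,a_3}$) is fixed; "absolute constant" means in particular not depending on the initial data. "Global" means defined for all $t\ge0$. "Scatters to a linear wave" means that, as $t\to\infty$, $\phi_i$ approaches in the energy norm ($\|\partial(\cdot)\|_{L^2_x}$) a solution of the homogeneous linear equation ${}^{(i)}\square\psi=0$. *)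

theory Defs
  imports "HOL-Analysis.Analysis"
begin

text \<open>Functions of class C^k on S: the (relative) Frechet derivative exists on S and all its
  directional derivatives are again of class C^(k-1). It is only used for S open or S a closed
  half-space, where the relative derivative is unique; on the boundary of the half-space it is the
  one-sided derivative.\<close>

fun Ck_on :: "nat \<Rightarrow> 'a::euclidean_space set \<Rightarrow> ('a \<Rightarrow> real) \<Rightarrow> bool" where
  "Ck_on 0 S f \<longleftrightarrow> continuous_on S f"
| "Ck_on (Suc k) S f \<longleftrightarrow> f differentiable_on S \<and>
     (\<forall>b\<in>Basis. Ck_on k S (\<lambda>x. frechet_derivative f (at x within S) b))"

definition smooth_on :: "'a::euclidean_space set \<Rightarrow> ('a \<Rightarrow> real) \<Rightarrow> bool" where
  "smooth_on S f \<longleftrightarrow> (\<forall>k. Ck_on k S f)"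


text \<open>A point of spacetime is \<open>z = (t, x)\<close>; all functions are considered on \<open>t \<ge> 0\<close> only, and
  time derivatives at \<open>t = 0\<close> are one-sided. Values at \<open>t < 0\<close> are irrelevant.\<close>

type_synonym spacetime = "real \<times> (real^3)"

definition future :: "spacetime set" where
  "future = {0..} \<times> UNIV"

definition dt :: "(spacetime \<Rightarrow> real) \<Rightarrow> spacetime \<Rightarrow> real" where
  "dt \<psi> z = frechet_derivative \<psi> (at z within future) (1, 0)"

definition dx :: "3 \<Rightarrow> (spacetime \<Rightarrow> real) \<Rightarrow> spacetime \<Rightarrow> real" where
  "dx j \<psi> z = frechet_derivative \<psi> (at z within future) (0, axis j 1)"

text \<open>The Euclidean norm on \<open>real \<times> (real^3)\<close> makes \<open>norm (grad \<psi> z)\<close> the length of the spacetime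
  gradient.\<close>

definition grad :: "(spacetime \<Rightarrow> real) \<Rightarrow> spacetime \<Rightarrow> real \<times> (real^3)" where
  "grad \<psi> z = (dt \<psi> z, \<chi> j. dx j \<psi> z)"

definition box_op :: "(3 \<Rightarrow> real) \<Rightarrow> (spacetime \<Rightarrow> real) \<Rightarrow> spacetime \<Rightarrow> real" where
  "box_op e \<psi> z = - dt (dt \<psi>) z + (\<Sum>j\<in>UNIV. e j * dx j (dx j \<psi>) z)"


datatype vfield = Scaling | Transl 3

fun vf_apply :: "vfield \<Rightarrow> (spacetime \<Rightarrow> real) \<Rightarrow> spacetime \<Rightarrow> real" where
  "vf_apply Scaling \<psi> = (\<lambda>z. fst z * dt \<psi> z + (\<Sum>j\<in>UNIV. snd z $ j * dx j \<psi> z))"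
| "vf_apply (Transl j) \<psi> = dx j \<psi>"

definition vf_word :: "vfield list \<Rightarrow> (spacetime \<Rightarrow> real) \<Rightarrow> spacetime \<Rightarrow> real" where
  "vf_word w \<psi> = foldr vf_apply w \<psi>"

lemma finite_vf_words: "finite {w :: vfield list. length w \<le> k}"
proof -
  have "(UNIV :: vfield set) = insert Scaling (range Transl)"
    using vfield.exhaust by (auto simp: image_iff)
  then have "finite (UNIV :: vfield set)"
    by (metis finite_class.finite_UNIV finite_imageI finite_insert)
  from finite_lists_length_le[OF this, of k] show ?thesis
    by simp
qed


text \<open>Norms of functions of the space variable, with value \<open>\<infinity>\<close> when the integral diverges.\<close>

definition L1norm :: "(real^3 \<Rightarrow> 'b::real_normed_vector) \<Rightarrow> ennreal" where
  "L1norm u = (\<integral>\<^sup>+x. ennreal (norm (u x)) \<partial>lborel)"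

definition L2norm :: "(real^3 \<Rightarrow> 'b::real_normed_vector) \<Rightarrow> ennreal" where
  "L2norm u = (let I = (\<integral>\<^sup>+x. ennreal ((norm (u x))\<^sup>2) \<partial>lborel)
     in if I = \<infinity> then \<infinity> else ennreal (sqrt (enn2real I)))"

definition Gamma_norm_at_0 :: "nat \<Rightarrow> (spacetime \<Rightarrow> real) \<Rightarrow> ennreal" where
  "Gamma_norm_at_0 k \<psi> = (\<Sum>w | length w \<le> k.
     L2norm (\<lambda>x. grad (vf_word w \<psi>) (0, x)) + L1norm (\<lambda>x. grad (vf_word w \<psi>) (0, x)))"

text \<open>The fields S and \<open>\<partial>\<^sub>j\<close> satisfy \<open>S \<psi> = \<Sum>j. x\<^sub>j \<partial>\<^sub>j \<psi>\<close> at \<open>t = 0\<close> and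
  \<open>\<partial>\<^sub>t S = S \<partial>\<^sub>t + \<partial>\<^sub>t\<close>, \<open>\<partial>\<^sub>t \<partial>\<^sub>j = \<partial>\<^sub>j \<partial>\<^sub>t\<close>. Hence the restriction of
  \<open>grad (vf_word w \<psi>)\<close> to \<open>t = 0\<close> depends only on the Cauchy data \<open>f = \<psi>(0, \<cdot>)\<close> and
  \<open>g = \<partial>\<^sub>t \<psi>(0, \<cdot>)\<close>, and may be computed from any function with these data; the affine one
  below is such a function. The gradients with \<open>length w \<le> k\<close> involve derivatives of f up to
  order \<open>k + 1\<close> and of g up to order k.\<close>

definition cauchy_ext :: "(real^3 \<Rightarrow> real) \<Rightarrow> (real^3 \<Rightarrow> real) \<Rightarrow> spacetime \<Rightarrow> real" where
  "cauchy_ext f g z = f (snd z) + fst z * g (snd z)"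

definition data_norm :: "('m::finite \<Rightarrow> real^3 \<Rightarrow> real) \<Rightarrow> ('m \<Rightarrow> real^3 \<Rightarrow> real) \<Rightarrow> ennreal" where
  "data_norm f g = (\<Sum>i\<in>UNIV. Gamma_norm_at_0 30 (cauchy_ext (f i) (g i)))"


type_synonym 'm nonlinearity =
  "'m \<Rightarrow> 'm \<Rightarrow> 'm \<Rightarrow> 'm \<Rightarrow> (real \<times> (real^3)) \<times> (real \<times> (real^3)) \<times> (real \<times> (real^3)) \<Rightarrow> real"

definition cubic_or_higher :: "('m::finite) nonlinearity \<Rightarrow> bool" where
  "cubic_or_higher C \<longleftrightarrow> (\<exists>K. \<forall>p :: 'm \<Rightarrow> real \<times> (real^3). (\<forall>a. norm (p a) \<le> 1) \<longrightarrow>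
     (\<forall>i a1 a2 a3. \<bar>C i a1 a2 a3 (p a1, p a2, p a3)\<bar> \<le> K * (\<Sum>a\<in>UNIV. norm (p a) ^ 3)))"

definition nonlin ::
  "('m::finite) nonlinearity \<Rightarrow> ('m \<Rightarrow> spacetime \<Rightarrow> real) \<Rightarrow> 'm \<Rightarrow> spacetime \<Rightarrow> real" where
  "nonlin C \<phi> i z = (\<Sum>a1\<in>UNIV. \<Sum>a2\<in>UNIV. \<Sum>a3\<in>UNIV.
     C i a1 a2 a3 (grad (\<phi> a1) z, grad (\<phi> a2) z, grad (\<phi> a3) z))"

definition global_solution ::
  "('m::finite \<Rightarrow> 3 \<Rightarrow> real) \<Rightarrow> 'm nonlinearity \<Rightarrow> ('m \<Rightarrow> real^3 \<Rightarrow> real) \<Rightarrow>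
   ('m \<Rightarrow> real^3 \<Rightarrow> real) \<Rightarrow> ('m \<Rightarrow> spacetime \<Rightarrow> real) \<Rightarrow> bool" where
  "global_solution e C f g \<phi> \<longleftrightarrow> (\<forall>i.
     Ck_on 2 future (\<phi> i) \<and>
     (\<forall>z\<in>future. box_op (e i) (\<phi> i) z = nonlin C \<phi> i z) \<and>
     (\<forall>x. \<phi> i (0, x) = f i x) \<and> (\<forall>x. dt (\<phi> i) (0, x) = g i x))"

definition scatters_to_linear :: "(3 \<Rightarrow> real) \<Rightarrow> (spacetime \<Rightarrow> real) \<Rightarrow> bool" where
  "scatters_to_linear e u \<longleftrightarrow> (\<exists>\<psi>. Ck_on 2 future \<psi> \<and> (\<forall>z\<in>future. box_op e \<psi> z = 0) \<and>
     ((\<lambda>t. L2norm (\<lambda>x. grad (\<lambda>z. u z - \<psi> z) (t, x))) \<longlongrightarrow> 0) at_top)"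

end

theory Submission imports Defs "HOL-Analysis.Analysis" begin

text \<open>The system is written as an integral equation for the first derivatives of the \<open>\<phi>\<^sub>i\<close>, by
 Kirchhoff's formula: \<open>LA\<close> is the contribution of the data and \<open>Duh\<close> that of the source. Only space derivatives
 are used. The kernels are bounded on L^2 by the energy identity, and their sup at time r is at most a
 constant times 1/(1+r) times four derivatives in L^1. Suppose that 12 derivatives of the unknown are bounded in L^2 and
 8 derivatives decay like t^(-1/2) in L^4 and t^(-3/4) in sup. Then the cubic source decays
 like t^(-3/2) in L^2 and t^(-1) in L^1, which is enough to recover these bounds with a small constant. The iteration uses
 sources mollified at scale 2^(-n), contracts in L^2 only, and converges in the other norms by
 interpolation. Uniqueness follows from the energy in backward cones and Gronwall's
 inequality, and the scattering state is obtained by extending the Duhamel integral to infinite times.\<close>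

text \<open>The kernels are convolutions in x, so they commute with space derivatives whatever the
  coefficients. The rates close as follows. By Hoelder a cubic term has L^1 size 1 * t^(-1/2) *
  t^(-1/2) and L^2 size 1 * t^(-3/4) * t^(-3/4). Conversely a source of L^1 size 1/(1+s) meets the
  kernel bound 1/(1+t-s); the time integral carries a logarithm, hence the sup rate 3/4 instead of
  1. Interpolating with L^2 leaves (1+t-s)^(-1/2) (1+s)^(-5/4) in L^4, which is integrable with
  decay t^(-1/2). The numbers 12 and 8: the sup of 8 derivatives costs 4 more in L^1, and since 12
  <= 2 * 8 + 1 at most one factor of a product of total order 12 carries more than 8 derivatives.
  The obstacle is that Kirchhoff's formula contains a derivative of the source, whereas by the
  energy identity none is lost in L^2. Every step is carried out with classical derivatives, so the
  sources are mollified to have them; the mollification error costs one derivative of the source,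
  and for this reason the contraction is sought in L^2 without derivatives.\<close>

notation scaleR (infixr "*R" 75)

abbreviation cts :: "('a::topological_space => 'b::topological_space) => bool" where
 "cts f == continuous_on UNIV f"

abbreviation nnint_of :: "('a::euclidean_space => real) => ennreal" (binder "nnint " 10) where
 "nnint_of f == nn_integral lborel (\<lambda>x. ennreal (f x))"

abbreviation nnlb_of :: "('a::euclidean_space => ennreal) => ennreal" (binder "nnlb " 10) where
 "nnlb_of f == nn_integral lborel f"

section \<open>Parameter integrals\<close>

lemma cts_comp:
 "cts u ==> continuous_on S g ==> continuous_on S (\<lambda>x. u (g x))"
 by (rule continuous_on_compose2[of UNIV]) auto

lemma continuous_slice:
 assumes "cts (\<lambda>p. H (fst p) (snd p))" shows "cts (H z)"
proof -
 have "cts (\<lambda>w. (\<lambda>p. H (fst p) (snd p)) (z, w))"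
  by (rule cts_comp[OF assms]) (intro continuous_intros)
 then show ?thesis by simp
qed

lemma uniform_on_compact_parameter:
 fixes h :: "'a::euclidean_space => 'b::euclidean_space => real"
 assumes h: "cts (\<lambda>p. h (fst p) (snd p))" and K: "compact K" and \<epsilon>: "\<epsilon> > 0"
 shows "\<exists>\<delta>>0. \<forall>z. dist z z0 < \<delta> --> (\<forall>w\<in>K. dist (h z w) (h z0 w) < \<epsilon>)"
proof -
 have "compact (cball z0 1 \<times> K)" by (intro compact_Times K) auto
 then have "uniformly_continuous_on (cball z0 1 \<times> K) (\<lambda>p. h (fst p) (snd p))"
  by (intro compact_uniformly_continuous continuous_on_subset[OF h]) auto
 then obtain d where d: "d > 0" "\<And>p q. p \<in> cball z0 1 \<times> K ==> q \<in> cball z0 1 \<times> K ==> dist q p < d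
   ==> dist (h (fst q) (snd q)) (h (fst p) (snd p)) < \<epsilon>"
  unfolding uniformly_continuous_on_def using \<epsilon> by metis
 show ?thesis
 proof (intro exI[of _ "min d 1"] conjI allI impI ballI)
  fix z w assume z: "dist z z0 < min d 1" and w: "w \<in> K"
  have "dist (z, w) (z0, w) < d" using z by (simp add: dist_Pair_Pair)
  with d(2)[of "(z0,w)" "(z,w)"] z w show "dist (h z w) (h z0 w) < \<epsilon>"
   by (auto simp: dist_commute)
 qed (use d in auto)
qed

text \<open>All parameter integrals below are over finite Borel measures carried by a compact set, so that
 joint continuity of the integrand is the only hypothesis needed to differentiate under them.\<close>

locale cmeas = finite_measure \<mu> for \<mu> :: "'b::euclidean_space measure" +
 fixes K :: "'b set"
 assumes sets_mu: "sets \<mu> = sets borel" and compact_K: "compact K" and AE_K: "AE w in \<mu>. w \<in> K"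
begin

lemma space_mu: "space \<mu> = UNIV" using sets_eq_imp_space_eq[OF sets_mu] by simp

lemma meas_cont: "cts h ==> h \<in> borel_measurable \<mu>"
 using borel_measurable_continuous_onI[of h] sets_mu measurable_cong_sets by blast

lemma integrable_cont:
 fixes h :: "'b => real"
 assumes "cts h" shows "integrable \<mu> h"
proof -
 have "bounded (h ` K)"
  by (intro compact_imp_bounded compact_continuous_image compact_K continuous_on_subset[OF assms]) auto
 then obtain B where "\<And>w. w \<in> K ==> norm (h w) <= B" by (auto simp: bounded_iff)
 then have "AE w in \<mu>. norm (h w) <= B" using AE_K by auto
 then show ?thesis by (rule integrable_const_bound) (rule meas_cont[OF assms])
qed

lemma integral_bound:
 fixes h :: "'b => real"
 assumes "cts h" and "\<And>w. w \<in> K ==> abs (h w) <= B"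
 shows "abs (LINT w|\<mu>. h w) <= B * measure \<mu> UNIV"
proof -
 have "abs (LINT w|\<mu>. h w) <= (LINT w|\<mu>. abs (h w))" by (rule integral_abs_bound)
 also have "... <= (LINT w|\<mu>. B)"
  by (rule integral_mono_AE) (use AE_K assms in \<open>auto intro!: integrable_cont integrable_abs\<close>)
 finally show ?thesis by (simp add: space_mu mult.commute)
qed

lemma continuous_param:
 fixes H :: "'a::euclidean_space => 'b => real"
 assumes H: "cts (\<lambda>p. H (fst p) (snd p))"
 shows "cts (\<lambda>z. \<integral>w. H z w \<partial>\<mu>)" unfolding continuous_on_iff
proof (intro ballI allI impI)
 fix z0 :: 'a and \<epsilon> :: real assume \<epsilon>: "\<epsilon> > 0"
 define m where "m = measure \<mu> UNIV + 1"
 have m: "m > 0" "measure \<mu> UNIV < m" by (auto simp: m_def add_nonneg_pos)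
 from uniform_on_compact_parameter[OF H compact_K, of "\<epsilon>/m" z0] \<epsilon> m
 obtain \<delta> where d: "\<delta> > 0" "\<And>z w. dist z z0 < \<delta> ==> w \<in> K ==> dist (H z w) (H z0 w) < \<epsilon>/m" by auto
 show "\<exists>d>0. \<forall>x'\<in>UNIV. dist x' z0 < d --> dist (LINT w|\<mu>. H x' w) (LINT w|\<mu>. H z0 w) < \<epsilon>"
 proof (intro exI[of _ \<delta>] conjI ballI impI)
  fix z assume z: "dist z z0 < \<delta>"
  have c: "cts (H z)" for z by (rule continuous_slice[OF H])
  have "(LINT w|\<mu>. H z w) - (LINT w|\<mu>. H z0 w) = (LINT w|\<mu>. H z w - H z0 w)"
   by (intro Bochner_Integration.integral_diff[symmetric] integrable_cont c)
  also have "abs ... <= \<epsilon>/m * measure \<mu> UNIV"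
   using d(2)[OF z] by (intro integral_bound continuous_intros c) (force simp: dist_real_def)
  also have "... < \<epsilon>/m * m" using m \<epsilon> by (intro mult_strict_left_mono) auto
  finally show "dist (LINT w|\<mu>. H z w) (LINT w|\<mu>. H z0 w) < \<epsilon>" using m by (simp add: dist_real_def)
 qed (use d in auto)
qed

lemma deriv_param:
 fixes H :: "real => 'b => real"
 assumes H: "\<And>s. s \<in> U ==> cts (H s)"
  and H': "cts (\<lambda>p. H' (fst p) (snd p))"
  and U: "open U" "s0 \<in> U"
  and der: "\<And>s w. s \<in> U ==> DERIV (\<lambda>s. H s w) s :> H' s w"
 shows "DERIV (\<lambda>s. \<integral>w. H s w \<partial>\<mu>) s0 :> (LINT w|\<mu>. H' s0 w)"
proof -
 have cH': "cts (H' s)" for s by (rule continuous_slice[OF H'])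
 define F where "F = (\<lambda>s. \<integral>w. H s w \<partial>\<mu>)"
 have "((\<lambda>s. F s) has_derivative (\<lambda>h. (LINT w|\<mu>. H' s0 w) * h)) (at s0)"
  unfolding has_derivative_at_alt
 proof (intro conjI allI impI)
  show "bounded_linear (\<lambda>h. (LINT w|\<mu>. H' s0 w) * h)" by (rule bounded_linear_mult_right)
  fix \<epsilon> :: real assume \<epsilon>: "\<epsilon> > 0"
  define m where "m = measure \<mu> UNIV + 1"
  have m: "m > 0" "measure \<mu> UNIV <= m" by (auto simp: m_def add_nonneg_pos)
  from uniform_on_compact_parameter[OF H' compact_K, of "\<epsilon>/m" s0] \<epsilon> m
  obtain \<delta> where d: "\<delta> > 0" "\<And>z w. dist z s0 < \<delta> ==> w \<in> K ==> dist (H' z w) (H' s0 w) < \<epsilon>/m" by auto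
  obtain \<rho> where r: "\<rho> > 0" "ball s0 \<rho> \<subseteq> U" using U open_contains_ball by blast
  show "\<exists>d>0. \<forall>y. norm (y - s0) < d -->
    norm (F y - F s0 - (LINT w|\<mu>. H' s0 w) * (y - s0)) <= \<epsilon> * norm (y - s0)"
  proof (intro exI[of _ "min \<delta> \<rho>"] conjI allI impI)
   fix y assume y: "norm (y - s0) < min \<delta> \<rho>"
   have yU: "y \<in> U" using y r by (auto simp: dist_norm norm_minus_commute subset_iff)
   have b: "abs (H y w - H s0 w - H' s0 w * (y - s0)) <= \<epsilon>/m * abs (y - s0)" if w: "w \<in> K" for w
   proof -
    have D: "((\<lambda>s. H s w - H' s0 w * s) has_field_derivative (H' s w - H' s0 w)) (at s within cball s0 (abs (y-s0)))"
     if "s \<in> cball s0 (abs (y-s0))" for s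
    proof -
     have "s \<in> U" using that y r by (auto simp: dist_norm subset_iff)
     then show ?thesis by (auto intro!: derivative_eq_intros DERIV_subset[OF der])
    qed
    have B: "norm (H' s w - H' s0 w) <= \<epsilon>/m" if "s \<in> cball s0 (abs (y-s0))" for s
     using d(2)[of s w] that y w by (force simp: dist_real_def)
    have "norm ((H y w - H' s0 w * y) - (H s0 w - H' s0 w * s0)) <= \<epsilon>/m * norm (y - s0)"
     by (rule field_differentiable_bound[OF _ D B]) (auto simp: dist_real_def)
    then show ?thesis by (simp add: algebra_simps)
   qed
   have "F y - F s0 - (LINT w|\<mu>. H' s0 w) * (y - s0) = (LINT w|\<mu>. H y w - H s0 w - H' s0 w * (y - s0))"
    unfolding F_def by (simp add: integrable_cont H U yU cH')
   also have "abs ... <= \<epsilon>/m * abs (y - s0) * measure \<mu> UNIV"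
    by (rule integral_bound) (use b in \<open>auto intro!: continuous_intros H U yU cH'\<close>)
   also have "... <= \<epsilon>/m * abs (y - s0) * m" using m \<epsilon> by (intro mult_left_mono) auto
   finally show "norm (F y - F s0 - (LINT w|\<mu>. H' s0 w) * (y - s0)) <= \<epsilon> * norm (y - s0)"
    using m by simp
  qed (use d r in auto)
 qed
 then show ?thesis unfolding F_def has_field_derivative_def .
qed

text \<open>Cauchy-Schwarz against the constant 1, read off the nonnegative integral of
  \<open>(m * h w - I)^2\<close>. Dividing by the total mass \<open>m\<close> excludes the null
  measure, which is settled by \<open>integral_bound\<close>.\<close>

lemma square_integral_le:
 fixes h :: "'b => real"
 assumes h: "cts h" shows "(LINT w|\<mu>. h w)^2 <= measure \<mu> UNIV * (LINT w|\<mu>. (h w)^2)"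
proof -
 define I where "I = (LINT w|\<mu>. h w)"
 define m where "m = measure \<mu> UNIV"
 have m0: "m >= 0" by (simp add: m_def)
 have "0 <= (LINT w|\<mu>. (m * h w - I)^2)" by simp
 also have "... = (LINT w|\<mu>. m^2 * (h w)^2 - 2 * m * I * h w + I^2)"
  by (simp add: power2_eq_square algebra_simps)
 also have "... = m^2 * (LINT w|\<mu>. (h w)^2) - 2 * m * I * I + m * I^2"
  by (simp add: integrable_cont h continuous_intros I_def m_def space_mu)
 finally have *: "m * I^2 <= m * (m * (LINT w|\<mu>. (h w)^2))" by (simp add: power2_eq_square algebra_simps)
 show ?thesis
 proof (cases "m = 0")
  case True
  have "abs I <= abs (SUP w\<in>K. abs (h w)) * measure \<mu> UNIV" unfolding I_def
  proof (rule integral_bound[OF h])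
   fix w assume "w \<in> K"
   have "bdd_above ((\<lambda>w. abs (h w)) ` K)"
    by (intro bounded_imp_bdd_above compact_imp_bounded compact_continuous_image compact_K
       continuous_intros continuous_on_subset[OF h]) auto
   then show "abs (h w) <= abs (SUP w\<in>K. abs (h w))"
    using \<open>w \<in> K\<close> by (meson abs_ge_self cSUP_upper order_trans)
  qed
  with True show ?thesis by (simp add: I_def m_def)
 next
  case False
  then have "m > 0" using m0 by simp
  then show ?thesis using * mult_left_le_imp_le by (fastforce simp: I_def m_def)
 qed
qed

end

section \<open>Lebesgue measure: compact restriction, translation, scaling\<close>

lemma cmeas_lborel:
 assumes "compact S" shows "cmeas (density lborel (indicator S)) (S::'b::euclidean_space set)"
proof (intro cmeas.intro finite_measureI cmeas_axioms.intro)
 have S: "S \<in> sets borel" using assms by (simp add: compact_imp_closed borel_closed)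
 show "emeasure (density lborel (indicator S)) (space (density lborel (indicator S))) \<noteq> \<infinity>"
  using emeasure_compact_finite[OF assms] S by (simp add: emeasure_density nn_integral_indicator)
 show "AE w in density lborel (indicator S). w \<in> S"
  using S by (subst AE_density) (auto simp: indicator_def)
qed (use assms in simp_all)

lemma integral_density_indicator:
 fixes h :: "'b::euclidean_space => real"
 assumes "compact S" "h \<in> borel_measurable borel"
 shows "(LINT w|density lborel (indicator S). h w) = (LINT w|lborel. indicator S w * h w)"
proof -
 have S: "S \<in> sets borel" using assms by (simp add: compact_imp_closed borel_closed)
 have "density lborel (indicator S) = density lborel (\<lambda>x. ennreal (indicator S x))"
  by (simp add: ennreal_indicator)
 then show ?thesis using S assms by (simp add: integral_real_density)
qed

lemma nn_integral_translate:
 fixes f :: "'b::euclidean_space => ennreal"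
 assumes [measurable]: "f \<in> borel_measurable borel" shows "(nnlb x. f (x + a)) = (nnlb x. f x)"
 by (subst lborel_distr_plus[of a, symmetric]) (simp add: nn_integral_distr add.commute)

lemma integral_translate:
 fixes f :: "'b::euclidean_space => real"
 assumes [measurable]: "f \<in> borel_measurable borel"
 shows "(LINT x|lborel. f (x + a)) = (LINT x|lborel. f x)"
 by (subst lborel_distr_plus[of a, symmetric]) (simp add: integral_distr add.commute)

lemma nn_integral_scale:
 fixes f :: "'b::euclidean_space => ennreal"
 assumes [measurable]: "f \<in> borel_measurable borel" and c: "c > 0"
 shows "(nnlb x. f x) = ennreal (c ^ DIM('b)) * (nnlb x. f (c *R x))"
 using c by (subst lborel_affine[of c 0])
   (simp_all add: nn_integral_density nn_integral_distr nn_integral_cmult ennreal_power)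

section \<open>Directional derivatives\<close>

text \<open>Derivatives are taken along one direction at a time, as derivatives of functions of a
  real variable. Space derivatives of a source thus make sense although nothing is known about its
  time derivative.\<close>

definition hasdd :: "'a::real_normed_vector => ('a => real) => 'a => real => bool" where
 "hasdd v u z d \<longleftrightarrow> DERIV (\<lambda>s. u (z + s *R v)) 0 :> d"

definition dd :: "'a::real_normed_vector => ('a => real) => 'a => real" where
 "dd v u z = deriv (\<lambda>s. u (z + s *R v)) 0"

text \<open>For \<open>V\<close> the three space directions this is joint continuity in (t, x) of
  the space derivatives up to order \<open>k\<close>, the regularity that the Duhamel operator
  propagates; for \<open>V = Basis\<close> it is ordinary C^k.\<close>

fun CD :: "'a::real_normed_vector set => nat => ('a => real) => bool" where
 "CD V 0 u \<longleftrightarrow> cts u"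
| "CD V (Suc k) u \<longleftrightarrow> cts u \<and>
   (\<forall>v\<in>V. (\<forall>z. hasdd v u z (dd v u z)) \<and> CD V k (dd v u))"

lemma hasdd_imp_dd: "hasdd v u z d ==> dd v u z = d"
 unfolding hasdd_def dd_def by (rule DERIV_imp_deriv)

lemma hasdd_line:
 assumes "hasdd v u (z + s *R v) d" shows "DERIV (\<lambda>s. u (z + s *R v)) s :> d"
proof -
 have "DERIV (\<lambda>r. u (z + (s + r) *R v)) 0 :> d"
  using assms by (simp add: hasdd_def scaleR_add_left add.assoc)
 then have "DERIV (\<lambda>r. u (z + (r + s) *R v)) 0 :> d" by (simp add: add.commute)
 then show ?thesis using DERIV_shift[of "\<lambda>s. u (z + s *R v)" d 0 s] by simp
qed

lemma CD_cont: "CD V k u ==> cts u" by (cases k) auto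

lemma CD_hasdd: "CD V (Suc k) u ==> v \<in> V ==> hasdd v u z (dd v u z)" by simp

lemma CD_dd: "CD V (Suc k) u ==> v \<in> V ==> CD V k (dd v u)" by simp

lemma CD_SucI:
 assumes "cts u" "\<And>v z. v \<in> V ==> hasdd v u z (u' v z)" "\<And>v. v \<in> V ==> CD V k (u' v)"
 shows "CD V (Suc k) u"
proof -
 have "dd v u = u' v" if "v \<in> V" for v using assms(2)[OF that] hasdd_imp_dd by blast
 with assms show ?thesis by auto
qed

lemma CD_Suc_lower: "CD V (Suc k) u ==> CD V k u" by (induction k arbitrary: u) auto

lemma CD_mono: "CD V k u ==> l <= k ==> CD V l u"
 by (induction k) (auto simp: le_Suc_eq simp del: CD.simps dest: CD_Suc_lower)

lemma hasdd_const: "hasdd v (\<lambda>_. c) z 0" by (simp add: hasdd_def)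

lemma hasdd_add: "hasdd v f z a ==> hasdd v g z b ==> hasdd v (\<lambda>z. f z + g z) z (a + b)"
 unfolding hasdd_def by (rule DERIV_add)

lemma hasdd_cmult: "hasdd v f z a ==> hasdd v (\<lambda>z. c * f z) z (c * a)"
 unfolding hasdd_def by (rule DERIV_cmult)

lemma hasdd_mult: "hasdd v f z a ==> hasdd v g z b ==> hasdd v (\<lambda>z. f z * g z) z (a * g z + b * f z)"
 unfolding hasdd_def using DERIV_mult[of "\<lambda>s. f (z + s *R v)" a 0 _ "\<lambda>s. g (z + s *R v)" b] by simp

lemma hasdd_sum:
 "(\<And>i. i \<in> I ==> hasdd v (f i) z (a i)) ==> hasdd v (\<lambda>z. \<Sum>i\<in>I. f i z) z (\<Sum>i\<in>I. a i)"
 unfolding hasdd_def by (rule DERIV_sum)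

lemma CD_const: "CD V k (\<lambda>_. c)"
proof (induction k arbitrary: c)
 case (Suc k)
 show ?case by (rule CD_SucI[of _ _ "\<lambda>_ _. 0"]) (auto intro: hasdd_const Suc)
qed simp

lemma CD_add: "CD V k f ==> CD V k g ==> CD V k (\<lambda>z. f z + g z)"
proof (induction k arbitrary: f g)
 case 0 then show ?case by (auto intro: continuous_intros)
next
 case (Suc k)
 show ?case by (rule CD_SucI[of _ _ "\<lambda>v z. dd v f z + dd v g z"])
    (use Suc in \<open>auto intro: hasdd_add continuous_intros\<close>)
qed

lemma CD_mult: "CD V k f ==> CD V k g ==> CD V k (\<lambda>z. f z * g z)"
proof (induction k arbitrary: f g)
 case 0 then show ?case by (auto intro: continuous_intros)
next
 case (Suc k)
 show ?case by (rule CD_SucI[of _ _ "\<lambda>v z. dd v f z * g z + dd v g z * f z"])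
    (use Suc in \<open>auto intro!: hasdd_mult CD_add Suc.IH intro: continuous_intros CD_Suc_lower simp del: CD.simps(2) simp: CD_cont CD_hasdd CD_dd\<close>)
qed

lemma CD_cmult: "CD V k f ==> CD V k (\<lambda>z. c * f z)" by (intro CD_mult CD_const)

lemma CD_sum: "finite I ==> (\<And>i. i \<in> I ==> CD V k (f i)) ==> CD V k (\<lambda>z. \<Sum>i\<in>I. f i z)"
 by (induction I rule: finite_induct) (auto intro: CD_const CD_add)

text \<open>The coordinates are changed one at a time, each change being estimated by the mean value
  inequality. The base point \<open>y\<close> is variable because the induction hypothesis is
  applied at the point reached after the first change.\<close>

lemma partials_bound:
 fixes u :: "'a::euclidean_space => real"
 assumes S: "finite S" "S \<subseteq> Basis" and d: "\<And>b z. b \<in> Basis ==> hasdd b u z (u' b z)"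
  and c: "\<And>b. b \<in> Basis ==> cts (u' b)" and \<epsilon>: "\<epsilon> > 0"
 shows "\<exists>\<delta>>0. \<forall>y h. norm (y - z) < \<delta> --> norm h < \<delta> -->
   abs (u (y + (\<Sum>b\<in>S. (h \<bullet> b) *R b)) - u y - (\<Sum>b\<in>S. (h \<bullet> b) * u' b z)) <= \<epsilon> * (\<Sum>b\<in>S. abs (h \<bullet> b))"
 using S
proof (induction S rule: finite_induct)
 case empty
 show ?case by (auto intro: exI[of _ 1])
next
 case (insert b S)
 then obtain \<delta>1 where d1: "\<delta>1 > 0" "\<And>y h. norm (y - z) < \<delta>1 ==> norm h < \<delta>1 ==>
   abs (u (y + (\<Sum>b\<in>S. (h \<bullet> b) *R b)) - u y - (\<Sum>b\<in>S. (h \<bullet> b) * u' b z)) <= \<epsilon> * (\<Sum>b\<in>S. abs (h \<bullet> b))"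
  by auto
 have b: "b \<in> Basis" using insert by auto
 from c[OF b] \<epsilon> obtain \<delta>2 where d2: "\<delta>2 > 0" "\<And>y. dist y z < \<delta>2 ==> dist (u' b y) (u' b z) < \<epsilon>"
  unfolding continuous_on_iff by blast
 \<comment> \<open>The half keeps the shifted base point \<open>y'\<close> within
   \<open>\<delta>1\<close> of \<open>z\<close>.\<close>
 define \<delta> where "\<delta> = min \<delta>1 \<delta>2 / 2"
 show ?case
 proof (intro exI[of _ \<delta>] conjI allI impI)
  show "\<delta> > 0" using d1 d2 by (simp add: \<delta>_def)
  fix y h :: 'a assume y: "norm (y - z) < \<delta>" and h: "norm h < \<delta>"
  have hb: "abs (h \<bullet> b) < \<delta>" using Basis_le_norm[OF b, of h] h by linarith
  define y' where "y' = y + (h \<bullet> b) *R b"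
  have "norm (y' - z) <= norm (y - z) + norm ((h \<bullet> b) *R b)"
   unfolding y'_def using norm_triangle_ineq[of "y - z" "(h \<bullet> b) *R b"] by (simp add: algebra_simps)
  then have y': "norm (y' - z) < \<delta>1" using y hb b by (simp add: \<delta>_def)
  have 1: "abs (u (y' + (\<Sum>b\<in>S. (h \<bullet> b) *R b)) - u y' - (\<Sum>b\<in>S. (h \<bullet> b) * u' b z)) <= \<epsilon> * (\<Sum>b\<in>S. abs (h \<bullet> b))"
   using d1(2)[OF y'] h d1 by (simp add: \<delta>_def)
  have 2: "abs (u y' - u y - (h \<bullet> b) * u' b z) <= \<epsilon> * abs (h \<bullet> b)"
  proof -
   let ?g = "\<lambda>s. u (y + s *R b) - s * u' b z"
   have D: "(?g has_field_derivative (u' b (y + s *R b) - u' b z)) (at s within cball 0 (abs (h \<bullet> b)))" for s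
   proof -
    have "DERIV (\<lambda>s. u (y + s *R b)) s :> u' b (y + s *R b)"
     by (rule hasdd_line[OF d[OF b]])
    from DERIV_diff[OF this DERIV_cmult_right[OF DERIV_ident, of "u' b z"]]
    show ?thesis by (auto intro: has_field_derivative_at_within)
   qed
   have B: "norm (u' b (y + s *R b) - u' b z) <= \<epsilon>" if "s \<in> cball 0 (abs (h \<bullet> b))" for s
   proof -
    have "norm (y + s *R b - z) <= norm (y - z) + norm (s *R b)"
     using norm_triangle_ineq[of "y - z" "s *R b"] by (simp add: algebra_simps)
    also have "... < \<delta>2" using y hb that b by (simp add: \<delta>_def)
    finally show ?thesis using d2(2)[of "y + s *R b"] by (simp add: dist_norm)
   qed
   have "norm (?g (h \<bullet> b) - ?g 0) <= \<epsilon> * norm (h \<bullet> b - 0)"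
    by (rule field_differentiable_bound[OF convex_cball D B]) auto
   then show ?thesis by (simp add: y'_def algebra_simps)
  qed
  have "y + (\<Sum>b\<in>insert b S. (h \<bullet> b) *R b) = y' + (\<Sum>b\<in>S. (h \<bullet> b) *R b)"
   using insert by (simp add: y'_def algebra_simps)
  with 1 2 show "abs (u (y + (\<Sum>b\<in>insert b S. (h \<bullet> b) *R b)) - u y - (\<Sum>b\<in>insert b S. (h \<bullet> b) * u' b z))
    <= \<epsilon> * (\<Sum>b\<in>insert b S. abs (h \<bullet> b))"
   unfolding sum.insert[OF insert.hyps] distrib_left by (simp only:)
 qed
qed

lemma has_derivative_partials:
 fixes u :: "'a::euclidean_space => real"
 assumes d: "\<And>b z. b \<in> Basis ==> hasdd b u z (u' b z)"
  and c: "\<And>b. b \<in> Basis ==> cts (u' b)"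
 shows "(u has_derivative (\<lambda>h. \<Sum>b\<in>Basis. (h \<bullet> b) * u' b z)) (at z)"
 unfolding has_derivative_at_alt
proof (intro conjI allI impI)
 show "bounded_linear (\<lambda>h. \<Sum>b\<in>Basis. (h \<bullet> b) * u' b z)"
  by (intro bounded_linear_sum bounded_linear_mult_const bounded_linear_inner_left)
 fix \<epsilon> :: real assume \<epsilon>: "\<epsilon> > 0"
 let ?n = "real DIM('a)"
 have n: "?n > 0" by simp
 from partials_bound[OF finite_Basis order_refl d c, of "\<epsilon> / ?n" z] \<epsilon> n
 obtain \<delta> where d: "\<delta> > 0" "\<And>y h. norm (y - z) < \<delta> ==> norm h < \<delta> ==>
   abs (u (y + (\<Sum>b\<in>Basis. (h \<bullet> b) *R b)) - u y - (\<Sum>b\<in>Basis. (h \<bullet> b) * u' b z)) <= \<epsilon>/?n * (\<Sum>b\<in>Basis. abs (h \<bullet> b))"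
  by auto
 show "\<exists>d>0. \<forall>y. norm (y - z) < d -->
   norm (u y - u z - (\<Sum>b\<in>Basis. ((y - z) \<bullet> b) * u' b z)) <= \<epsilon> * norm (y - z)"
 proof (intro exI[of _ \<delta>] conjI allI impI)
  fix y assume y: "norm (y - z) < \<delta>"
  have "norm (u y - u z - (\<Sum>b\<in>Basis. ((y - z) \<bullet> b) * u' b z)) <= \<epsilon>/?n * (\<Sum>b\<in>Basis. abs ((y - z) \<bullet> b))"
   using d(2)[of z "y - z"] y d(1) by (simp add: euclidean_representation)
  also have "... <= \<epsilon>/?n * (\<Sum>b\<in>(Basis::'a set). norm (y - z))"
   using \<epsilon> n by (intro mult_left_mono sum_mono Basis_le_norm) auto
  also have "... = \<epsilon> * norm (y - z)" by simp
  finally show "norm (u y - u z - (\<Sum>b\<in>Basis. ((y - z) \<bullet> b) * u' b z)) <= \<epsilon> * norm (y - z)" .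
 qed (use d in auto)
qed

lemma has_derivative_imp_hasdd:
 assumes "(u has_derivative D) (at z)" shows "hasdd v u z (D v)"
proof -
 interpret D: bounded_linear D using assms by (rule has_derivative_bounded_linear)
 have 1: "((\<lambda>s. z + s *R v) has_derivative (\<lambda>s. s *R v)) (at 0)"
  by (auto intro!: derivative_eq_intros)
 have "((\<lambda>s. u (z + s *R v)) has_derivative (\<lambda>s. D (s *R v))) (at 0)"
  using has_derivative_compose[OF 1, of u D] assms by simp
 then show ?thesis
  by (auto simp: hasdd_def has_field_derivative_def D.scaleR mult.commute[of _ "D v"] elim: has_derivative_eq_rhs)
qed

text \<open>Two applications of the mean value theorem, first along \<open>v\<close> to the
  difference in \<open>w\<close>, then along \<open>w\<close>.\<close>

lemma second_difference:
 fixes f :: "'a::real_normed_vector => real"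
 assumes s: "s > 0" and U: "\<And>a b. 0 <= a ==> a <= s ==> 0 <= b ==> b <= s ==> z + (a *R v + b *R w) \<in> U"
  and d1: "\<And>y. y \<in> U ==> hasdd v f y (f1 y)" and d12: "\<And>y. y \<in> U ==> hasdd w f1 y (f12 y)"
 obtains a b where "0 <= a" "a <= s" "0 <= b" "b <= s"
  "f (z + (s *R v + s *R w)) - f (z + s *R v) - f (z + s *R w) + f z = s * (s * f12 (z + (a *R v + b *R w)))"
proof -
 let ?p = "\<lambda>a b. z + (a *R v + b *R w)"
 have v: "DERIV (\<lambda>a. f (?p a c)) a :> f1 (?p a c)" if "0 <= a" "a <= s" "0 <= c" "c <= s" for a c
  using hasdd_line[of v f "z + c *R w" a] d1[OF U[OF that]] by (simp add: add_ac)
 have w: "DERIV (\<lambda>b. f1 (?p a b)) b :> f12 (?p a b)" if "0 <= a" "a <= s" "0 <= b" "b <= s" for a b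
  using hasdd_line[of w f1 "z + a *R v" b] d12[OF U[OF that]] by (simp add: add_ac)
 have "\<exists>a>0. a < s \<and> (f (?p s s) - f (?p s 0)) - (f (?p 0 s) - f (?p 0 0)) = (s - 0) * (f1 (?p a s) - f1 (?p a 0))"
  by (rule MVT2[OF s]) (use s in \<open>intro DERIV_diff v, auto\<close>)
 then obtain a where a: "0 < a" "a < s" "(f (?p s s) - f (?p s 0)) - (f (?p 0 s) - f (?p 0 0)) = (s - 0) * (f1 (?p a s) - f1 (?p a 0))" by blast
 have "\<exists>b>0. b < s \<and> f1 (?p a s) - f1 (?p a 0) = (s - 0) * f12 (?p a b)"
  by (rule MVT2[OF s]) (use a in \<open>intro w, auto\<close>)
 then obtain b where "0 < b" "b < s" "f1 (?p a s) - f1 (?p a 0) = (s - 0) * f12 (?p a b)" by blast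
 with a show ?thesis by (intro that[of a b]) simp_all
qed

text \<open>The second difference is symmetric in \<open>v\<close> and \<open>w\<close>, so the two
  mixed derivatives agree at two points of every small parallelogram at \<open>z\<close>; continuity
  does the rest. An open set \<open>U\<close> is allowed because solutions have two-sided time
  derivatives only for t > 0.\<close>

lemma clairaut:
 fixes f :: "'a::real_normed_vector => real"
 assumes U: "open U" "z \<in> U"
  and d1: "\<And>y. y \<in> U ==> hasdd v f y (f1 y)" and d2: "\<And>y. y \<in> U ==> hasdd w f y (f2 y)"
  and d12: "\<And>y. y \<in> U ==> hasdd w f1 y (f12 y)" and d21: "\<And>y. y \<in> U ==> hasdd v f2 y (f21 y)"
  and c12: "continuous_on U f12" and c21: "continuous_on U f21" shows "f12 z = f21 z"
proof (rule ccontr)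
 assume ne: "f12 z \<noteq> f21 z"
 define \<epsilon> where "\<epsilon> = dist (f12 z) (f21 z) / 2"
 have \<epsilon>: "\<epsilon> > 0" using ne by (simp add: \<epsilon>_def)
 obtain \<rho> where r: "\<rho> > 0" "ball z \<rho> \<subseteq> U" using U open_contains_ball by blast
 obtain \<delta>1 where e1: "\<delta>1 > 0" "\<And>y. y \<in> U ==> dist y z < \<delta>1 ==> dist (f12 y) (f12 z) < \<epsilon>"
  using c12 U \<epsilon> unfolding continuous_on_iff by blast
 obtain \<delta>2 where e2: "\<delta>2 > 0" "\<And>y. y \<in> U ==> dist y z < \<delta>2 ==> dist (f21 y) (f21 z) < \<epsilon>"
  using c21 U \<epsilon> unfolding continuous_on_iff by blast
 define m where "m = min \<rho> (min \<delta>1 \<delta>2)"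
 define s where "s = m / (norm v + norm w + 1)"
 have m: "m > 0" using r e1 e2 by (simp add: m_def)
 have nn: "norm v + norm w + 1 > 0" by (simp add: add_nonneg_pos)
 have s: "s > 0" "s * (norm v + norm w + 1) = m" using m nn by (simp_all add: s_def)
 let ?p = "\<lambda>a b. z + (a *R v + b *R w)"
 have near: "?p a b \<in> U" "dist (?p a b) z < \<delta>1" "dist (?p a b) z < \<delta>2" if "0 <= a" "a <= s" "0 <= b" "b <= s" for a b
 proof -
  have "dist (?p a b) z <= a * norm v + b * norm w"
   using norm_triangle_ineq[of "a *R v" "b *R w"] that by (simp add: dist_norm)
  also have "... <= s * norm v + s * norm w" using that by (intro add_mono mult_right_mono) auto
  also have "... < m" using s by (simp add: algebra_simps)
  finally show "?p a b \<in> U" "dist (?p a b) z < \<delta>1" "dist (?p a b) z < \<delta>2"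
   using r by (auto simp: m_def dist_commute subset_iff)
 qed
 let ?d = "f (?p s s) - f (z + s *R v) - f (z + s *R w) + f z"
 obtain a b where a: "0 <= a" "a <= s" "0 <= b" "b <= s" "?d = s * (s * f12 (?p a b))"
  by (rule second_difference[of s z v w U f f1 f12, OF s(1)]) (rule near(1) d1 d12 that, assumption+)+
 obtain b' a' where b: "0 <= b'" "b' <= s" "0 <= a'" "a' <= s"
  "f (z + (s *R w + s *R v)) - f (z + s *R w) - f (z + s *R v) + f z = s * (s * f21 (z + (b' *R w + a' *R v)))"
  by (rule second_difference[of s z w v U f f2 f21, OF s(1)]) (rule near(1)[unfolded add.commute[of "_ *R v"]] d2 d21 that, assumption+)+
 have "s * (s * f12 (?p a b)) = s * (s * f21 (?p a' b'))"
  using b(5) unfolding a(5)[symmetric] add.commute[of "_ *R w" "_ *R v"] by simp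
 then have "f12 (?p a b) = f21 (?p a' b')" using s(1) by simp
 then have "dist (f12 z) (f21 z) < \<epsilon> + \<epsilon>"
  using e1(2)[OF near(1,2)[OF a(1-4)]] e2(2)[OF near(1,3)[OF b(3,4,1,2)]] dist_triangle3[of "f12 z" "f21 z" "f12 (?p a b)"] by simp
 then show False by (simp add: \<epsilon>_def)
qed

section \<open>Iterated space derivatives\<close>

abbreviation spv :: "3 => spacetime" where "spv j \<equiv> (0, axis j 1)"
abbreviation sd :: "3 => (spacetime => real) => spacetime => real" where "sd j \<equiv> dd (spv j)"
abbreviation CX :: "nat => (spacetime => real) => bool" where "CX \<equiv> CD (range spv)"

definition Dx :: "3 list => (spacetime => real) => spacetime => real" where
 "Dx w u = foldr sd w u"

lemma Dx_Nil [simp]: "Dx [] u = u" and Dx_Cons: "Dx (j # w) u = sd j (Dx w u)"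
 and Dx_append: "Dx (v @ w) u = Dx v (Dx w u)" by (auto simp: Dx_def)

lemma CX_SucI:
 assumes "cts u" "\<And>j z. hasdd (spv j) u z (u' j z)" "\<And>j. CX k (u' j)" shows "CX (Suc k) u"
proof -
 have "sd j u = u' j" for j using assms(2) hasdd_imp_dd by blast
 then show ?thesis using assms by auto
qed

lemma CX_Dx: "CX (length w + k) u ==> CX k (Dx w u)"
proof (induction w arbitrary: k)
 case (Cons j w)
 from Cons.prems have "CX (length w + Suc k) u" by (simp del: CD.simps)
 from Cons.IH[OF this] show ?case by (auto simp: Dx_Cons)
qed simp

lemma CX_Dx': "CX n u ==> length w + k <= n ==> CX k (Dx w u)" by (rule CX_Dx) (rule CD_mono)

lemma CX_sd: "CX (Suc k) u ==> CX k (sd j u)" by auto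

lemma CX_hasdd: "CX (Suc k) u ==> hasdd (spv j) u z (sd j u z)" by (erule CD_hasdd) (rule rangeI)

lemma CX_cont_sd: "CX (Suc k) u ==> cts (sd j u)" by (rule CD_cont[OF CX_sd])

lemma sd_commute:
 assumes "CX (Suc (Suc k)) u" shows "sd i (sd j u) = sd j (sd i u)"
proof
 fix z
 show "sd i (sd j u) z = sd j (sd i u) z"
  by (rule clairaut[of UNIV z "spv j" u "sd j u" "spv i" "sd i u"]) (use assms in \<open>auto intro!: CX_hasdd CX_cont_sd simp del: CD.simps intro: CX_sd\<close>)
qed

section \<open>Spherical means\<close>

definition diagm :: "(3 => real) => real^3 => real^3" where
 "diagm e y = (\<chi> j. sqrt (e j) * y $ j)"

text \<open>The normalised surface measure of the unit sphere, as the image of the uniform measure of the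
 ball under radial projection; \<open>sph e\<close> is its image under the matrix that turns the Laplacian
 into the operator with coefficients e.\<close>

definition usph :: "(real^3) measure" where
 "usph = distr (uniform_measure lborel (cball 0 1)) borel (\<lambda>y. y /\<^sub>R norm y)"

definition sph :: "(3 => real) => (real^3) measure" where
 "sph e = distr usph borel (diagm e)"

definition sph_rad :: "(3 => real) => real" where
 "sph_rad e = (\<Sum>j\<in>UNIV. sqrt (e j))"

lemma Basis_sum3: "(\<Sum>b\<in>(Basis :: (real^3) set). g b) = (\<Sum>i\<in>UNIV. g (axis i 1))"
proof -
 have "(Basis :: (real^3) set) = range (\<lambda>i. axis i 1)" by (auto simp: Basis_vec_def)
 then show ?thesis by (subst \<open>Basis = _\<close>, subst sum.reindex) (auto simp: inj_on_def axis_eq_axis)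
qed

lemma linear_diagm: "linear (diagm e)"
 by (rule linearI) (auto simp: diagm_def vec_eq_iff algebra_simps)

lemma continuous_diagm: "continuous_on S (diagm e)"
 using linear_diagm by (rule linear_continuous_on[OF linear_conv_bounded_linear[THEN iffD1]])

lemma diagm_measurable [measurable]: "diagm e \<in> borel_measurable borel"
 by (rule borel_measurable_continuous_onI[OF continuous_diagm])

lemma diagm_simps: "diagm e (c *R y) = c *R diagm e y" "diagm e (- y) = - diagm e y" "diagm e y $ j = sqrt (e j) * y $ j"
 by (auto simp: diagm_def vec_eq_iff)

lemma radial_measurable [measurable]: "(\<lambda>y::real^3. y /\<^sub>R norm y) \<in> borel_measurable borel"
 by measurable

lemma emeasure_cball3: "emeasure lborel (cball (0::real^3) 1) \<noteq> 0" "emeasure lborel (cball (0::real^3) 1) \<noteq> \<infinity>"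
proof -
 have "emeasure lborel (cball (0::real^3) 1) >= emeasure lborel (ball (0::real^3) 1)"
  by (intro emeasure_mono) auto
 moreover have "emeasure lborel (ball (0::real^3) 1) \<noteq> 0"
  using open_not_negligible[of "ball (0::real^3) 1"] by (simp add: negligible_iff_null_sets null_sets_def)
 ultimately show "emeasure lborel (cball (0::real^3) 1) \<noteq> 0" by auto
 show "emeasure lborel (cball (0::real^3) 1) \<noteq> \<infinity>"
  using emeasure_compact_finite[of "cball (0::real^3) 1"] by auto
qed

lemma emeasure_unif: "emeasure (uniform_measure lborel (cball (0::real^3) 1)) UNIV = 1"
 using emeasure_cball3 by (subst emeasure_uniform_measure) (auto simp: ennreal_divide_self top.not_eq_extremum)

lemma sets_usph [measurable_cong, simp]: "sets usph = sets borel" and sets_sph [measurable_cong, simp]: "sets (sph e) = sets borel"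
 by (auto simp: usph_def sph_def)

lemma space_usph [simp]: "space usph = UNIV" and space_sph [simp]: "space (sph e) = UNIV"
 by (auto simp: usph_def sph_def)

lemma emeasure_usph: "emeasure usph UNIV = 1"
 unfolding usph_def by (subst emeasure_distr) (auto simp: emeasure_unif)

lemma emeasure_sph: "emeasure (sph e) UNIV = 1"
 unfolding sph_def by (subst emeasure_distr) (auto simp: emeasure_usph)

lemma measure_sph [simp]: "measure (sph e) UNIV = 1" and measure_usph [simp]: "measure usph UNIV = 1"
 by (auto simp: measure_def emeasure_sph emeasure_usph)

lemma AE_usph: "AE w in usph. norm w = 1"
proof -
 have "AE y in lborel. (y::real^3) \<noteq> 0" by (rule AE_lborel_singleton)
 then have "AE y in uniform_measure lborel (cball 0 1). norm ((y::real^3) /\<^sub>R norm y) = 1"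
  using emeasure_cball3 by (intro AE_uniform_measureI) auto
 then show ?thesis unfolding usph_def by (subst AE_distr_iff) auto
qed

lemma norm_diagm: assumes "norm w <= 1" "\<And>j. e j > 0" shows "norm (diagm e w) <= sph_rad e"
proof -
 have "norm (diagm e w) <= (\<Sum>j\<in>UNIV. abs (diagm e w $ j))" by (rule norm_le_l1_cart)
 also have "... <= sph_rad e" unfolding sph_rad_def
 proof (rule sum_mono)
  fix j :: 3
  have "abs (w $ j) <= 1" using component_le_norm_cart[of w j] assms by linarith
  then show "abs (diagm e w $ j) <= sqrt (e j)"
   using assms(2)[of j] by (simp add: diagm_def abs_mult mult_left_le)
 qed
 finally show ?thesis .
qed

lemma cmeas_usph: "cmeas usph (cball 0 1)" by (intro cmeas.intro finite_measureI cmeas_axioms.intro)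
   (use AE_usph in \<open>auto simp: sets_eq_imp_space_eq[OF sets_usph] emeasure_usph\<close>)

lemma cmeas_sph: assumes "\<And>j. e j > 0" shows "cmeas (sph e) (cball 0 (sph_rad e))"
proof (intro cmeas.intro finite_measureI cmeas_axioms.intro)
 have "AE w in usph. diagm e w \<in> cball 0 (sph_rad e)"
  using AE_usph by eventually_elim (use norm_diagm assms in auto)
 then show "AE w in sph e. w \<in> cball 0 (sph_rad e)"
  unfolding sph_def by (subst AE_distr_iff) auto
qed (auto simp: sets_eq_imp_space_eq[OF sets_sph] emeasure_sph)

lemma integral_sph: "h \<in> borel_measurable borel ==> (LINT w|sph e. h w) = (LINT w|usph. (h (diagm e w) :: real))"
 unfolding sph_def by (subst integral_distr) auto

lemma det_diagm_pos: "(\<And>j. e j > 0) ==> (\<Prod>j\<in>(UNIV::3 set). sqrt (e j)) > 0"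
 by (intro prod_pos) auto

lemma nn_integral_diagm:
 assumes e: "\<And>j. e j > 0" and [measurable]: "f \<in> borel_measurable borel"
 shows "(nnlb y. f y) = ennreal (\<Prod>j\<in>UNIV. sqrt (e j)) * (nnlb y. f (x + diagm e y))"
proof -
 define c where "c b = diagm e b \<bullet> b" for b
 have c: "c (axis i 1) = sqrt (e i)" for i unfolding c_def inner_axis by (simp add: diagm_def axis_def)
 have T: "x + (\<Sum>b\<in>Basis. (c b * (y \<bullet> b)) *R b) = x + diagm e y" for y :: "real^3"
  unfolding Basis_sum3 c by (simp add: vec_eq_iff diagm_simps inner_axis if_distrib[of "\<lambda>x. _ * x"] cong: if_cong) (simp add: axis_def if_distrib[of "\<lambda>x. _ * x"] cong: if_cong)
 have P: "(\<Prod>b\<in>Basis. abs (c b)) = (\<Prod>j\<in>UNIV. sqrt (e j))"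
 proof -
  have "(Basis :: (real^3) set) = range (\<lambda>i. axis i 1)" by (auto simp: Basis_vec_def)
  then show ?thesis
   by (subst \<open>Basis = _\<close>, subst prod.reindex) (use e in \<open>auto simp: inj_on_def axis_eq_axis c less_imp_le\<close>)
 qed
 have "c b \<noteq> 0" if "b \<in> Basis" for b
  using that e by (auto simp: Basis_vec_def c) (metis less_irrefl)
 from lborel_affine_euclidean[of c x, OF this, unfolded T P]
 have "(nnlb y. f y) = (\<integral>\<^sup>+y. f y \<partial>density (distr lborel borel (\<lambda>y. x + diagm e y)) (\<lambda>_. \<Prod>j\<in>UNIV. sqrt (e j)))"
  by simp
 also have "... = ennreal (\<Prod>j\<in>UNIV. sqrt (e j)) * (nnlb y. f (x + diagm e y))"
  by (simp add: nn_integral_density nn_integral_distr nn_integral_cmult)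
 finally show ?thesis .
qed

lemma nn_integral_usph:
 assumes [measurable]: "f \<in> borel_measurable borel"
 shows "(\<integral>\<^sup>+w. f w \<partial>sph e) = (nnlb y. f (diagm e (y /\<^sub>R norm y)) * indicator (cball 0 1) y) / emeasure lborel (cball (0::real^3) 1)"
 unfolding sph_def usph_def
 by (subst nn_integral_distr, simp, simp, subst nn_integral_distr, simp, simp)
   (subst nn_integral_uniform_measure; simp)

text \<open>The radial integral left over in \<open>sph_polar\<close> once the point of space is
  fixed.\<close>

lemma nn_integral_power4:
 assumes a: "a > 0"
 shows "(nnlb s. ennreal (1 / s^4) * indicator {a..} s) = ennreal (1 / (3 * a^3))"
proof -
 have "(nnlb s. ennreal (if s > 0 then 1 / s^4 else 0) * indicator {a..} s) = ennreal (0 - (- 1 / (3 * a^3)))"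
 proof (rule nn_integral_FTC_atLeast)
  fix s :: real assume "a <= s"
  then have "s > 0" using a by simp
  then show "DERIV (\<lambda>s. - 1 / (3 * s^3)) s :> (if s > 0 then 1 / s^4 else 0)"
   by (auto intro!: derivative_eq_intros simp: field_simps power2_eq_square power3_eq_cube power4_eq_xxxx)
 next
  have "filterlim (\<lambda>s::real. 3 * s^3) at_infinity at_top"
   by (intro filterlim_at_top_imp_at_infinity filterlim_tendsto_pos_mult_at_top[OF tendsto_const]
      filterlim_pow_at_top filterlim_ident) auto
  from tendsto_divide_0[OF tendsto_const this] show "((\<lambda>s::real. - 1 / (3 * s^3)) \<longlongrightarrow> 0) at_top" .
 qed auto
 also have "(nnlb s. ennreal (if s > 0 then 1 / s^4 else 0) * indicator {a..} s) = (nnlb s. ennreal (1 / s^4) * indicator {a..} s)"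
  using a by (intro nn_integral_cong) (auto simp: indicator_def)
 finally show ?thesis by simp
qed

abbreviation pweight :: "real => ennreal" where
 "pweight \<rho> \<equiv> ennreal (\<rho>^2) * indicator {0<..} \<rho>"

text \<open>Polar coordinates adapted to \<open>sph e\<close>. Since the sphere measure is a
  projection of the ball measure, the left side is an integral over \<rho> and over \<open>y\<close>
  in the ball; the substitutions \<open>\<rho> = s * norm y\<close> and \<open>z = s *R y\<close>
  turn it into an integral over \<open>z\<close> and \<open>s >= norm z\<close>, in which
  \<open>s\<close> can be integrated out.\<close>

lemma sph_polar:
 assumes e: "\<And>j. e j > 0"
 shows "\<exists>C\<ge>0. \<forall>f x. f \<in> borel_measurable borel -->
  (nnlb \<rho>. (\<integral>\<^sup>+w. f (x + \<rho> *R w) \<partial>sph e) * pweight \<rho>) <= ennreal C * (nnlb y. f y)"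
proof -
 let ?V = "emeasure lborel (cball (0::real^3) 1)"
 let ?d = "\<Prod>j\<in>(UNIV::3 set). sqrt (e j)"
 have d: "?d > 0" using det_diagm_pos[OF e] .
 have [measurable]: "cball (0::real^3) 1 \<in> sets borel" "{0::real<..} \<in> sets borel" by auto
 have [measurable]: "Measurable.pred (borel \<Otimes>\<^sub>M borel) (\<lambda>x. snd x \<in> {norm (fst x :: real^3)..})"
  unfolding atLeast_iff by measurable
 have main: "(nnlb \<rho>. (\<integral>\<^sup>+w. f (x + \<rho> *R w) \<partial>sph e) * pweight \<rho>)
   = (ennreal (1/3) * (nnlb y. f (x + diagm e y))) / ?V"
  if f[measurable]: "f \<in> borel_measurable borel" for f x
 proof -
  let ?D = "diagm e"
  let ?R = "\<lambda>\<rho> y. f (x + \<rho> *R ?D (y /\<^sub>R norm y)) * indicator (cball 0 1) y"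
  let ?F = "\<lambda>s y. f (x + s *R ?D y) * indicator (cball 0 1) y * ennreal (norm y ^ 3)"
  let ?H = "\<lambda>s z. f (x + ?D z) * ennreal (norm z ^ 3) * (ennreal (1 / s^4) * indicator {norm z..} s * indicator {0<..} s)"
  have "(nnlb \<rho>. (\<integral>\<^sup>+w. f (x + \<rho> *R w) \<partial>sph e) * pweight \<rho>)
   = (nnlb \<rho>. (nnlb y. ?R \<rho> y * pweight \<rho>) / ?V)"
  proof (rule nn_integral_cong)
   fix \<rho> :: real
   have "(nnlb y. ?R \<rho> y * pweight \<rho>)
    = (nnlb y. ?R \<rho> y) * pweight \<rho>" by (rule nn_integral_multc) measurable
   then show "(\<integral>\<^sup>+w. f (x + \<rho> *R w) \<partial>sph e) * pweight \<rho>
    = (nnlb y. ?R \<rho> y * pweight \<rho>) / ?V"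
    by (subst nn_integral_usph, measurable) (simp add: divide_ennreal_def mult_ac)
  qed
  also have "... = (nnlb \<rho>. (nnlb y. ?R \<rho> y * pweight \<rho>)) / ?V"
   by (rule nn_integral_divide) measurable
  also have "(nnlb \<rho>. (nnlb y. ?R \<rho> y * pweight \<rho>))
   = (nnlb y. (nnlb \<rho>. ?R \<rho> y * pweight \<rho>))" by (rule lborel_pair.Fubini') measurable
  \<comment> \<open>Substitution \<open>\<rho> = s * norm y\<close>, which removes the normalisation
    of \<open>y\<close>; the Jacobian and the weight produce \<open>norm y ^ 3\<close>.\<close>
  also have "... = (nnlb y. (nnlb s. ?F s y * pweight s))"
  proof (rule nn_integral_cong_AE, rule AE_mp[OF AE_lborel_singleton[of 0]], rule AE_I2, intro impI)
   fix y :: "real^3" assume y: "y \<noteq> 0"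
   show "(nnlb \<rho>. ?R \<rho> y * pweight \<rho>)
    = (nnlb s. ?F s y * pweight s)"
    apply (subst nn_integral_real_affine[where c="norm y" and t=0]) using y apply (simp, simp)
    apply (subst nn_integral_cmult[symmetric], measurable)
    apply (rule nn_integral_cong)
    using y by (auto simp: diagm_simps indicator_def zero_less_mult_iff power_mult_distrib
       ennreal_mult' power2_eq_square power3_eq_cube mult_ac)
  qed
  also have "... = (nnlb s. (nnlb y. ?F s y * pweight s))"
   by (rule lborel_pair.Fubini'[symmetric]) measurable
  \<comment> \<open>Substitution \<open>z = s *R y\<close> for fixed \<open>s\<close>; the condition
    \<open>norm y <= 1\<close> becomes \<open>s >= norm z\<close>.\<close>
  also have "... = (nnlb s. (nnlb z. ?H s z))"
  proof (rule nn_integral_cong)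
   fix s :: real
   show "(nnlb y. ?F s y * pweight s)
    = (nnlb z. ?H s z)"
   proof (cases "s > 0")
    case True
    then have i: "indicator {0<..} s = (1::ennreal)" by simp
    show ?thesis unfolding i mult_1_right
    proof -
     let ?g = "\<lambda>z. f (x + ?D z) * ennreal (norm z ^ 3) * (ennreal (1 / s^4) * indicator (cball 0 s) z)"
     have [measurable]: "cball (0::real^3) s \<in> sets borel" by simp
     have g[measurable]: "?g \<in> borel_measurable borel" by measurable
     have "(nnlb z. ?g z) = ennreal (s ^ 3) * (nnlb y. ?g (s *R y))"
      using nn_integral_scale[OF g True] by simp
     also have "... = (nnlb y. ennreal (s ^ 3) * ?g (s *R y))"
      by (rule nn_integral_cmult[symmetric]) measurable
     also have "... = (nnlb y. ?F s y * ennreal (s^2))"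
     proof (rule nn_integral_cong)
      fix y :: "real^3"
      have "s^3 * ((s * norm y)^3 * (1 / s^4)) = norm y ^ 3 * s^2"
       using True by (simp add: power_mult_distrib power2_eq_square power3_eq_cube power4_eq_xxxx)
      then have 1: "ennreal (s^3) * (ennreal ((s * norm y)^3) * ennreal (1 / s^4)) = ennreal (norm y ^ 3) * ennreal (s^2)"
       using True by (simp add: ennreal_mult'[symmetric])
      have 2: "indicator (cball 0 s) (s *R y) = (indicator (cball 0 1) y :: ennreal)"
       using True by (auto simp: indicator_def)
      have 3: "norm (s *R y) = s * norm y" using True by simp
      have "ennreal (s ^ 3) * ?g (s *R y) = f (x + s *R ?D y) * indicator (cball 0 1) y *
        (ennreal (s^3) * (ennreal ((s * norm y)^3) * ennreal (1 / s^4)))"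
       unfolding diagm_simps 2 3 by (simp only: mult_ac)
      then show "ennreal (s ^ 3) * ?g (s *R y)
        = ?F s y * ennreal (s^2)" unfolding 1 by (simp only: mult_ac)
     qed
     also have "(nnlb z. ?g z) = (nnlb z. f (x + ?D z) * ennreal (norm z ^ 3) * (ennreal (1 / s^4) * indicator {norm z..} s))"
      by (rule nn_integral_cong) (simp add: indicator_def)
     finally show "(nnlb y. ?F s y * ennreal (s^2))
      = (nnlb z. f (x + ?D z) * ennreal (norm z ^ 3) * (ennreal (1 / s^4) * indicator {norm z..} s))" ..
    qed
   qed (auto simp: indicator_def)
  qed
  also have "... = (nnlb z. (nnlb s. ?H s z))" by (rule lborel_pair.Fubini') measurable
  \<comment> \<open>The integral of \<open>1 / s^4\<close> over \<open>s >= norm z\<close> cancels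
    the factor \<open>norm z ^ 3\<close>.\<close>
  also have "... = (nnlb z. ennreal (1/3) * f (x + ?D z))"
  proof (rule nn_integral_cong_AE, rule AE_mp[OF AE_lborel_singleton[of 0]], rule AE_I2, intro impI)
   fix z :: "real^3" assume z: "z \<noteq> 0"
   have "(nnlb s. ?H s z)
    = (nnlb s. f (x + ?D z) * ennreal (norm z ^ 3) * (ennreal (1 / s^4) * indicator {norm z..} s))"
    by (rule nn_integral_cong) (use z in \<open>auto simp: indicator_def dest: order.strict_trans2[of 0 "norm z", OF zero_less_norm_iff[THEN iffD2]]\<close>)
   also have "... = f (x + ?D z) * ennreal (norm z ^ 3) * ennreal (1 / (3 * norm z ^ 3))"
    by (subst nn_integral_cmult) (use z in \<open>auto simp: nn_integral_power4\<close>)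
   also have "... = ennreal (1/3) * f (x + ?D z)"
    using z by (simp add: mult.assoc ennreal_mult'[symmetric]) (simp add: mult.commute)
   finally show "(nnlb s. ?H s z)
    = ennreal (1/3) * f (x + ?D z)" .
  qed
  also have "... = ennreal (1/3) * (nnlb z. f (x + ?D z))" by (rule nn_integral_cmult) measurable
  finally show ?thesis .
 qed
 define C where "C = 1 / (3 * enn2real ?V * ?d)"
 have V: "?V = ennreal (enn2real ?V)" "enn2real ?V > 0"
  using emeasure_cball3 by (auto simp: enn2real_positive_iff top.not_eq_extremum zero_less_iff_neq_zero)
 have C: "C >= 0" using d V by (simp add: C_def)
 show ?thesis
 proof (intro exI[of _ C] conjI allI impI C)
  fix f :: "real^3 => ennreal" and x assume f[measurable]: "f \<in> borel_measurable borel"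
  have "ennreal C * (nnlb y. f y) = ennreal C * (ennreal ?d * (nnlb y. f (x + diagm e y)))"
   by (subst nn_integral_diagm[OF e f]) simp
  also have "... = ennreal (C * ?d) * (nnlb y. f (x + diagm e y))"
   using C d by (simp add: ennreal_mult mult.assoc)
  also have "C * ?d = (1/3) / enn2real ?V"
  proof -
   have "1 / (3 * v * p) * p = (1/3) / v" if "p > 0" "v > 0" for v p :: real using that by simp
   from this[OF d V(2)] show ?thesis by (simp only: C_def)
  qed
  also have "ennreal ((1/3) / enn2real ?V) = ennreal (1/3) / ?V"
   using V by (metis divide_ennreal zero_le_divide_1_iff zero_le_numeral)
  finally show "(nnlb \<rho>. (\<integral>\<^sup>+w. f (x + \<rho> *R w) \<partial>sph e) * pweight \<rho>) <= ennreal C * (nnlb y. f y)"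
   unfolding main[OF f] by (simp add: divide_ennreal_def mult_ac)
 qed
qed

section \<open>Rotation invariance of the sphere measure\<close>

lemma distr_lborel_orthogonal:
 fixes f :: "real^3 => real^3"
 assumes f: "orthogonal_transformation f" shows "distr lborel borel f = lborel"
proof (rule lborel_eqI[symmetric])
 have lin: "linear f" using f by (rule orthogonal_transformation_linear)
 have [measurable]: "f \<in> borel_measurable borel"
  by (intro borel_measurable_continuous_onI linear_continuous_on linear_conv_bounded_linear[THEN iffD1] lin)
 have bij: "bij f" by (rule orthogonal_transformation_bij[OF f])
 have inv: "orthogonal_transformation (inv f)" by (rule orthogonal_transformation_inv[OF f])
 fix l u :: "real^3" assume le: "\<And>b. b \<in> Basis ==> l \<bullet> b <= u \<bullet> b"
 have eq: "f -` box l u = inv f ` box l u" by (rule bij_vimage_eq_inv_image[OF bij])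
 have m: "inv f ` box l u \<in> lmeasurable" by (rule measurable_orthogonal_image[OF inv]) simp
 have b: "f -` box l u \<in> sets borel" using measurable_sets[of f borel borel "box l u"] by simp
 have "emeasure (distr lborel borel f) (box l u) = emeasure lborel (f -` box l u)"
  by (subst emeasure_distr) auto
 also have "... = emeasure lebesgue (inv f ` box l u)" using b by (simp add: eq[symmetric] emeasure_completion main_part_sets)
 also have "... = ennreal (measure lebesgue (inv f ` box l u))" by (rule emeasure_eq_measure2[OF m])
 also have "measure lebesgue (inv f ` box l u) = measure lebesgue (box l u)"
  by (rule measure_orthogonal_image[OF inv]) simp
 also have "... = (\<Prod>b\<in>Basis. (u - l) \<bullet> b)"
  using le by (simp add: measure_completion measure_lborel_box_eq inner_diff_left)
 finally show "emeasure (distr lborel borel f) (box l u) = ennreal (\<Prod>b\<in>Basis. (u - l) \<bullet> b)" .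
qed simp

text \<open>An orthogonal map preserves Lebesgue measure and the unit ball, and it commutes with the
  radial projection.\<close>

lemma distr_usph_orthogonal:
 fixes f :: "real^3 => real^3"
 assumes f: "orthogonal_transformation f" shows "distr usph borel f = usph"
proof -
 let ?U = "uniform_measure lborel (cball (0::real^3) 1)"
 have lin: "linear f" using f by (rule orthogonal_transformation_linear)
 have [measurable]: "f \<in> borel_measurable borel"
  by (intro borel_measurable_continuous_onI linear_continuous_on linear_conv_bounded_linear[THEN iffD1] lin)
 have nf: "norm (f y) = norm y" for y by (rule orthogonal_transformation_norm[OF f])
 have "distr ?U borel f = ?U"
 proof (rule measure_eqI)
  fix A :: "(real^3) set" assume "A \<in> sets (distr ?U borel f)"
  then have A[measurable]: "A \<in> sets borel" by simp
  have "emeasure lborel (cball (0::real^3) 1 \<inter> f -` A) = emeasure (distr lborel borel f) (cball (0::real^3) 1 \<inter> A)"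
   by (subst emeasure_distr) (auto simp: nf intro!: arg_cong[of _ _ "emeasure lborel"])
  also have "distr lborel borel f = lborel" by (rule distr_lborel_orthogonal[OF f])
  finally show "emeasure (distr ?U borel f) A = emeasure ?U A"
   using measurable_sets[of f borel borel A] A
   by (subst emeasure_distr) (auto simp: emeasure_uniform_measure)
 qed simp
 moreover have "distr (distr ?U borel f) borel (\<lambda>y. y /\<^sub>R norm y) = distr usph borel f"
  unfolding usph_def by (subst distr_distr, simp, simp, subst distr_distr, simp, simp)
   (simp add: comp_def nf linear_cmul[OF lin])
 ultimately show ?thesis by (simp add: usph_def)
qed

lemma integral_sph_uminus:
 assumes [measurable]: "h \<in> borel_measurable borel"
 shows "(LINT w|sph e. (h (- w) :: real)) = (LINT w|sph e. h w)"
proof -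
 have "(LINT w|sph e. h (- w)) = (LINT w|usph. h (diagm e (- w)))"
  by (subst integral_sph) (auto simp: diagm_simps)
 also have "... = (LINT w|distr usph borel uminus. h (diagm e w))" by (subst integral_distr) auto
 finally show ?thesis using distr_usph_orthogonal[of uminus] by (simp add: integral_sph orthogonal_transformation_neg orthogonal_transformation_id)
qed

text \<open>Rotation by the angle \<theta> in the plane of the axes \<open>j\<close> and
  \<open>k\<close>, written as the identity plus a correction so that continuity and the derivative
  in \<theta> can be read off.\<close>

definition rot :: "3 => 3 => real => real^3 => real^3" where
 "rot j k \<theta> w = w + (cos \<theta> - 1) *R (axis j (w $ j) + axis k (w $ k)) + sin \<theta> *R (axis k (w $ j) - axis j (w $ k))"

lemma orthogonal_rot: assumes "j \<noteq> k" shows "orthogonal_transformation (rot j k \<theta>)"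
 unfolding orthogonal_transformation
proof (intro conjI allI)
 show "linear (rot j k \<theta>)"
  by (rule linearI) (auto simp: rot_def vec_eq_iff axis_def algebra_simps)
 fix v
 have e: "sin \<theta> ^ 2 + cos \<theta> ^ 2 = 1" by simp
 have "(\<Sum>i\<in>UNIV. (rot j k \<theta> v $ i)^2) = (\<Sum>i\<in>UNIV. (v $ i)^2)"
 proof -
  have *: "(a + (c - 1) * a - s * b)^2 + (b + (c - 1) * b + s * a)^2 = a^2 + b^2" if "s^2 + c^2 = 1" for a b c s :: real
  proof -
   have "(a + (c - 1) * a - s * b)^2 + (b + (c - 1) * b + s * a)^2 = (a^2 + b^2) * (s^2 + c^2)"
    by (simp add: power2_eq_square algebra_simps)
   then show ?thesis using that by simp
  qed
  have r: "rot j k \<theta> v $ i = (if i = j then v $ j + (cos \<theta> - 1) * v $ j - sin \<theta> * v $ k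
    else if i = k then v $ k + (cos \<theta> - 1) * v $ k + sin \<theta> * v $ j else v $ i)" for i
   using assms by (auto simp: rot_def axis_def)
  have s: "(\<Sum>i\<in>UNIV. f i) = f j + f k + (\<Sum>i\<in>UNIV - {j, k}. f i)" for f :: "3 => real"
   using assms by (subst sum.subset_diff[of "{j, k}"]) auto
  show ?thesis unfolding s[of "\<lambda>i. (rot j k \<theta> v $ i)^2"] s[of "\<lambda>i. (v $ i)^2"]
   using *[OF e, of "v $ j" "v $ k"] assms by (simp add: r)
 qed
 then show "norm (rot j k \<theta> v) = norm v" by (simp add: norm_vec_def L2_set_def)
qed

lemma has_derivative_partials3:
 fixes P :: "real^3 => real"
 assumes d: "\<And>i z. hasdd (axis i 1) P z (P' i z)" and c: "\<And>i. cts (P' i)"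
 shows "(P has_derivative (\<lambda>h. \<Sum>i\<in>UNIV. h $ i * P' i z)) (at z)"
proof -
 define Q where "Q b = P' (SOME i. b = axis i 1)" for b :: "real^3"
 have Q: "Q (axis i 1) = P' i" for i by (simp add: Q_def axis_eq_axis)
 have "(P has_derivative (\<lambda>h. \<Sum>b\<in>Basis. (h \<bullet> b) * Q b z)) (at z)"
  by (rule has_derivative_partials) (use d c in \<open>auto simp: Basis_vec_def Q\<close>)
 then show ?thesis by (simp add: Basis_sum3 Q inner_axis)
qed

text \<open>The mean of \<open>P\<close> over the rotated sphere does not depend on the angle;
  differentiating at angle 0 shows that an angular derivative has mean zero. This is the integration
  by parts on the sphere that \<open>darboux\<close> needs.\<close>

lemma usph_rotation:
 assumes d: "\<And>i z. hasdd (axis i 1) P z (P' i z)" and c: "\<And>i. cts (P' i)" and jk: "j \<noteq> k"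
 shows "(LINT w|usph. w $ j * P' k w - w $ k * P' j w) = 0"
proof -
 interpret cmeas usph "cball 0 1" by (rule cmeas_usph)
 note FD = has_derivative_partials3[OF d c]
 have contP: "cts P"
  by (intro continuous_at_imp_continuous_on ballI has_derivative_continuous[OF FD])
 define H where "H \<theta> w = P (rot j k \<theta> w)" for \<theta> w
 define V where "V \<theta> w = (- sin \<theta>) *R (axis j (w $ j) + axis k (w $ k)) + cos \<theta> *R (axis k (w $ j) - axis j (w $ k))" for \<theta> and w :: "real^3"
 define H' where "H' \<theta> w = (\<Sum>i\<in>UNIV. V \<theta> w $ i * P' i (rot j k \<theta> w))" for \<theta> w
 have axc: "cts (\<lambda>p::real \<times> (real^3). axis i (snd p $ l) :: real^3)" for i l
 proof -
  have "(\<lambda>p::real \<times> (real^3). axis i (snd p $ l) :: real^3) = (\<lambda>p. (snd p $ l) *R axis i 1)"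
   by (simp add: fun_eq_iff vec_eq_iff axis_def)
  then show ?thesis by (rule ssubst) (intro continuous_intros)
 qed
 have contR: "cts (\<lambda>p. rot j k (fst p) (snd p))"
  unfolding rot_def by (intro continuous_intros axc)
 have contH: "cts (\<lambda>p. H (fst p) (snd p))"
  unfolding H_def by (rule cts_comp[OF contP contR])
 have contH': "cts (\<lambda>p. H' (fst p) (snd p))"
  unfolding H'_def V_def by (intro continuous_intros axc cts_comp[OF c contR])
 have der: "DERIV (\<lambda>\<theta>. H \<theta> w) \<theta> :> H' \<theta> w" for \<theta> w
 proof -
  have 1: "((\<lambda>\<theta>. rot j k \<theta> w) has_derivative (\<lambda>h. h *R V \<theta> w)) (at \<theta>)"
   unfolding rot_def V_def by (auto intro!: derivative_eq_intros simp: algebra_simps)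
  from has_derivative_compose[OF 1 FD]
  show ?thesis unfolding H_def H'_def has_field_derivative_def
   by (rule has_derivative_eq_rhs) (auto simp: sum_distrib_left sum_distrib_right mult_ac fun_eq_iff)
 qed
 have "DERIV (\<lambda>\<theta>. \<integral>w. H \<theta> w \<partial>usph) 0 :> (LINT w|usph. H' 0 w)"
  by (rule deriv_param[of UNIV]) (use der contH contH' continuous_slice[OF contH] in auto)
 moreover have "(LINT w|usph. H \<theta> w) = (LINT w|usph. P w)" for \<theta>
 proof -
  have [measurable]: "rot j k \<theta> \<in> borel_measurable borel" "P \<in> borel_measurable borel"
   by (auto intro!: borel_measurable_continuous_onI contP continuous_slice[OF contR])
  have "(LINT w|usph. P w) = (LINT w|distr usph borel (rot j k \<theta>). P w)"
   by (simp add: distr_usph_orthogonal orthogonal_rot jk)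
  also have "... = (LINT w|usph. H \<theta> w)" unfolding H_def by (rule integral_distr) auto
  finally show ?thesis ..
 qed
 ultimately have "(LINT w|usph. H' 0 w) = 0"
  by (metis (no_types, lifting) DERIV_const DERIV_unique ext)
 moreover have "H' 0 w = w $ j * P' k w - w $ k * P' j w" for w
  using jk exhaust_3[of j] exhaust_3[of k] by (auto simp: H'_def V_def rot_def axis_def sum_3)
 ultimately show ?thesis by simp
qed

section \<open>Kirchhoff's formula\<close>

text \<open>Besides the weight 1, the weights \<open>w $ j\<close> and \<open>w $ l * w $ i\<close>
  occur: they arise when spherical means are differentiated in the radius.\<close>

definition SW :: "(3 => real) => (real^3 => real) => (spacetime => real) => real => real => real^3 => real" where
 "SW e q N r s x = (LINT w|sph e. q w * N (s, x + r *R w))"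

definition TT :: "(3 => real) => (spacetime => real) => real => real => real^3 => real" where
 "TT e N r s x = r * SW e (\<lambda>_. 1) N r s x"

text \<open>\<open>TT e N r s\<close> is Kirchhoff's solution at time r of the wave equation with Cauchy data
 \<open>0\<close> and \<open>N (s, _)\<close>; \<open>AA e None\<close> is its time derivative and \<open>AA e (Some j)\<close> its j-th space
 derivative.\<close>

fun AA :: "(3 => real) => 3 option => (spacetime => real) => real => real => real^3 => real" where
 "AA e None N r s x = SW e (\<lambda>_. 1) N r s x + r * (\<Sum>j\<in>UNIV. SW e (\<lambda>w. w $ j) (sd j N) r s x)"
| "AA e (Some j) N r s x = r * SW e (\<lambda>_. 1) (sd j N) r s x"

lemma CX_line:
 assumes "CX (Suc k) N"
 shows "DERIV (\<lambda>h. N (s, y + h *R axis j 1)) h :> sd j N (s, y + h *R axis j 1)"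
 using hasdd_line[of "spv j" N "(s, y)" h, OF CX_hasdd[OF assms]] by simp

lemma CX_slice_derivative:
 assumes "CX (Suc k) N"
 shows "((\<lambda>y. N (s, y)) has_derivative (\<lambda>h. \<Sum>i\<in>UNIV. h $ i * sd i N (s, y))) (at y)"
proof (rule has_derivative_partials3[of "\<lambda>y. N (s, y)" "\<lambda>i y. sd i N (s, y)"])
 fix i z show "hasdd (axis i 1) (\<lambda>y. N (s, y)) z (sd i N (s, z))"
  using CX_hasdd[OF assms, of i "(s, z)"] by (simp add: hasdd_def)
 show "cts (\<lambda>y. sd i N (s, y))"
  by (intro cts_comp[OF CX_cont_sd[OF assms]] continuous_intros)
qed

lemma CX_ray:
 assumes "CX (Suc k) N"
 shows "DERIV (\<lambda>r. N (s, x + r *R w)) r :> ((\<Sum>i\<in>UNIV. w $ i * sd i N (s, x + r *R w)))"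
proof -
 have 1: "((\<lambda>r. x + r *R w) has_derivative (\<lambda>h. h *R w)) (at r)"
  by (auto intro!: derivative_eq_intros)
 from has_derivative_compose[OF 1 CX_slice_derivative[OF assms]]
 show ?thesis unfolding has_field_derivative_def
  by (rule has_derivative_eq_rhs) (auto simp: sum_distrib_left sum_distrib_right mult_ac fun_eq_iff)
qed

lemmas CX_cont = CD_cont[where V="range spv"]

locale ellip =
 fixes e :: "3 => real" assumes e_pos: "e j > 0"
begin

sublocale cmeas "sph e" "cball 0 (sph_rad e)" by (rule cmeas_sph) (rule e_pos)

lemma SW_integrand_cont:
 fixes N :: "spacetime => real"
 assumes "cts N" "cts q" shows "cts (\<lambda>w. q w * N (s, x + r *R w))"
 by (rule continuous_on_mult[OF assms(2)]) (intro continuous_intros cts_comp[OF assms(1)])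

lemma SW_cont:
 assumes N: "cts N" and q: "cts q"
 shows "cts (\<lambda>p. SW e q N (fst p) (fst (snd p)) (snd (snd p)))" unfolding SW_def
 by (rule continuous_param) (intro continuous_intros cts_comp[OF N] cts_comp[OF q])

lemma SW_cont_comp:
 assumes "cts N" "cts q" "continuous_on S f" "continuous_on S g" "continuous_on S h"
 shows "continuous_on S (\<lambda>p. SW e q N (f p) (g p) (h p))"
 using cts_comp[OF SW_cont[OF assms(1,2)], of S "\<lambda>p. (f p, g p, h p)"] assms(3-)
 by (simp add: continuous_on_Pair)

lemma SW_deriv_x:
 assumes N: "CX (Suc k) N" and q: "cts q"
 shows "DERIV (\<lambda>h. SW e q N r s (x + h *R axis j 1)) h :> SW e q (sd j N) r s (x + h *R axis j 1)"
 unfolding SW_def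
proof (rule deriv_param[of UNIV])
 show "cts (\<lambda>p. q (snd p) * sd j N (s, x + fst p *R axis j 1 + r *R snd p))"
  by (intro continuous_intros cts_comp[OF CX_cont_sd[OF N]] cts_comp[OF q])
 fix h w
 have "DERIV (\<lambda>h. N (s, (x + r *R w) + h *R axis j 1)) h :> sd j N (s, (x + r *R w) + h *R axis j 1)"
  by (rule CX_line[OF N])
 from DERIV_cmult[OF this, of "q w"]
 show "DERIV (\<lambda>h. q w * N (s, x + h *R axis j 1 + r *R w)) h :> q w * sd j N (s, x + h *R axis j 1 + r *R w)"
  by (simp add: add_ac)
qed (use SW_integrand_cont[OF CX_cont[OF N] q] in auto)

lemma SW_deriv_r:
 assumes N: "CX (Suc k) N" and q: "cts q"
 shows "DERIV (\<lambda>r. SW e q N r s x) r :> ((\<Sum>j\<in>UNIV. SW e (\<lambda>w. q w * w $ j) (sd j N) r s x))"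
proof -
 have "DERIV (\<lambda>r. SW e q N r s x) r :> ((LINT w|sph e. (\<Sum>j\<in>UNIV. q w * w $ j * sd j N (s, x + r *R w))))"
  unfolding SW_def
 proof (rule deriv_param[of UNIV])
  show "cts (\<lambda>p. \<Sum>j\<in>UNIV. q (snd p) * snd p $ j * sd j N (s, x + fst p *R snd p))"
   by (intro continuous_intros cts_comp[OF CX_cont_sd[OF N]] cts_comp[OF q])
  fix r w
  from DERIV_cmult[OF CX_ray[OF N], of "q w"]
  show "DERIV (\<lambda>r. q w * N (s, x + r *R w)) r :> ((\<Sum>j\<in>UNIV. q w * w $ j * sd j N (s, x + r *R w)))"
   by (simp add: sum_distrib_left mult_ac)
 qed (use SW_integrand_cont[OF CX_cont[OF N] q] in auto)
 also have "(LINT w|sph e. (\<Sum>j\<in>UNIV. q w * w $ j * sd j N (s, x + r *R w))) = (\<Sum>j\<in>UNIV. SW e (\<lambda>w. q w * w $ j) (sd j N) r s x)"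
  unfolding SW_def
  by (intro Bochner_Integration.integral_sum integrable_cont continuous_intros cts_comp[OF CX_cont_sd[OF N]] cts_comp[OF q])
 finally show ?thesis .
qed

text \<open>Darboux's equation for spherical means. With \<open>G i\<close> the derivative in
  \<open>v $ i\<close> of \<open>N (s, x + r *R diagm e v)\<close>, the functions
  \<open>v $ j * G k v - v $ k * G j v\<close> are its angular derivatives. By
  \<open>usph_rotation\<close> their angular derivatives again have mean zero. Summed over the three
  planes these second derivatives form the spherical Laplacian, the difference between the full
  operator and its radial part.\<close>

lemma darboux:
 assumes N: "CX (Suc (Suc k)) N"
 shows "r * (\<Sum>i\<in>UNIV. e i * SW e (\<lambda>_. 1) (sd i (sd i N)) r s x)
  = r * (\<Sum>l\<in>UNIV. \<Sum>i\<in>UNIV. SW e (\<lambda>w. w $ l * w $ i) (sd i (sd l N)) r s x)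
   + 2 * (\<Sum>i\<in>UNIV. SW e (\<lambda>w. w $ i) (sd i N) r s x)"
proof -
 define q where "q i = sqrt (e i)" for i
 have qq: "q i * q i = e i" for i using e_pos[of i] by (simp add: q_def)
 define G where "G i v = r * q i * sd i N (s, x + r *R diagm e v)" for i v
 define GG where "GG i l v = r * q i * (r * q l) * sd i (sd l N) (s, x + r *R diagm e v)" for i l v
 have N1: "CX (Suc k) (sd i N)" for i using N by (rule CX_sd)
 have cG: "cts (G i)" for i
  unfolding G_def by (intro continuous_intros cts_comp[OF CX_cont_sd[OF N]] continuous_diagm)
 have cGG: "cts (GG i l)" for i l
  unfolding GG_def by (intro continuous_intros cts_comp[OF CX_cont_sd[OF N1]] continuous_diagm)
 have dG: "hasdd (axis i 1) (G l) v (GG i l v)" for i l v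
 proof -
  have D: "diagm e (v + h *R axis i 1) = diagm e v + (h * q i) *R axis i 1" for h
   by (simp add: diagm_def vec_eq_iff axis_def q_def algebra_simps)
  have "((\<lambda>h. sd l N (s, (x + r *R diagm e v) + h *R axis i 1)) has_real_derivative
    sd i (sd l N) (s, (x + r *R diagm e v) + (r * q i * 0) *R axis i 1)) (at (r * q i * 0))"
   by (rule CX_line[OF N1])
  from DERIV_chain2[OF this DERIV_cmult[OF DERIV_ident]]
  have "((\<lambda>h. sd l N (s, (x + r *R diagm e v) + (r * q i * h) *R axis i 1)) has_real_derivative
    sd i (sd l N) (s, x + r *R diagm e v) * (r * q i)) (at 0)" by simp
  from DERIV_cmult[OF this, of "r * q l"]
  show ?thesis unfolding hasdd_def G_def GG_def D by (simp add: algebra_simps)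
 qed
 interpret U: cmeas usph "cball 0 1" by (rule cmeas_usph)
 have R: "(LINT v|usph. v $ j * (v $ j * GG k k v - G j v - v $ k * GG k j v) - v $ k * (G k v + v $ j * GG j k v - v $ k * GG j j v)) = 0"
  if jk: "j \<noteq> k" for j k
 proof -
  \<comment> \<open>The angular derivative of \<open>N\<close> in the plane of \<open>j\<close> and
    \<open>k\<close>; \<open>P'\<close> is its gradient.\<close>
  define P where "P v = v $ j * G k v - v $ k * G j v" for v
  define P' where "P' i v = (if i = j then G k v else 0) + v $ j * GG i k v - ((if i = k then G j v else 0) + v $ k * GG i j v)" for i v
  have dc: "DERIV (\<lambda>s. (v + s *R axis i 1) $ j) 0 :> (if i = j then 1 else 0)" for v :: "real^3" and i j
   by (auto simp: axis_def intro!: derivative_eq_intros)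
  have "hasdd (axis i 1) P v (P' i v)" for i v unfolding hasdd_def P_def P'_def
   using dG[of i k v] dG[of i j v] unfolding hasdd_def
   by (auto intro!: derivative_eq_intros dc simp: axis_def)
  moreover have "cts (P' i)" for i
   unfolding P'_def by (cases "i = j"; cases "i = k") (auto intro!: continuous_intros cG cGG)
  ultimately have "(LINT w|usph. w $ j * P' k w - w $ k * P' j w) = 0"
   using jk by (rule usph_rotation)
  then show ?thesis using jk by (simp add: P'_def algebra_simps)
 qed
 \<comment> \<open>The integrand of the difference of the two sides, multiplied by \<open>r\<close>:
   this factor turns all derivatives of \<open>N\<close> into values of \<open>G\<close> and
   \<open>GG\<close>.\<close>
 define E where "E w = (\<Sum>i\<in>UNIV. e i * sd i (sd i N) (s, x + r *R w)) * r^2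
   - r\<^sup>2 * (\<Sum>l\<in>UNIV. \<Sum>i\<in>UNIV. w $ l * w $ i * sd i (sd l N) (s, x + r *R w))
   - 2 * r * (\<Sum>i\<in>UNIV. w $ i * sd i N (s, x + r *R w))" for w
 define F where "F v j k = v $ j * (v $ j * GG k k v - G j v - v $ k * GG k j v) - v $ k * (G k v + v $ j * GG j k v - v $ k * GG j j v)" for v j k
 have cF: "cts (\<lambda>v. F v j k)" for j k unfolding F_def by (intro continuous_intros cG cGG)
 have EF: "E (diagm e v) = F v 1 2 + F v 1 3 + F v 2 3" if "norm v = 1" for v
 proof -
  have n: "v$1 * v$1 + v$2 * v$2 + v$3 * v$3 = 1"
   using that norm_eq_1[of v] by (simp add: inner_vec_def sum_3)
  have "E (diagm e v) = (\<Sum>i\<in>UNIV. GG i i v) - (\<Sum>l\<in>UNIV. \<Sum>i\<in>UNIV. v $ l * v $ i * GG i l v) - 2 * (\<Sum>i\<in>UNIV. v $ i * G i v)"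
   unfolding E_def GG_def G_def diagm_simps q_def[symmetric] sum_3 qq[of 1, symmetric] qq[of 2, symmetric] qq[of 3, symmetric]
   by (simp add: algebra_simps power2_eq_square)
  \<comment> \<open>The first sum is multiplied by the squared norm of \<open>v\<close>, which is 1;
    the identity with the \<open>F\<close> is then polynomial.\<close>
  also have "... = (\<Sum>i\<in>UNIV. GG i i v) * (v$1 * v$1 + v$2 * v$2 + v$3 * v$3) - (\<Sum>l\<in>UNIV. \<Sum>i\<in>UNIV. v $ l * v $ i * GG i l v) - 2 * (\<Sum>i\<in>UNIV. v $ i * G i v)"
   by (simp only: n mult_1_right)
  also have "... = F v 1 2 + F v 1 3 + F v 2 3" by (simp add: F_def sum_3 algebra_simps)
  finally show ?thesis .
 qed
 have cE: "cts E"
  unfolding E_def by (intro continuous_intros cts_comp[OF CX_cont_sd[OF N1]] cts_comp[OF CX_cont_sd[OF N]])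
 have "(LINT w|sph e. E w) = (LINT v|usph. E (diagm e v))"
  by (rule integral_sph) (rule borel_measurable_continuous_onI[OF cE])
 also have "... = (LINT v|usph. F v 1 2 + F v 1 3 + F v 2 3)" using AE_usph
  by (intro integral_cong_AE U.meas_cont continuous_intros cF cts_comp[OF cE] continuous_diagm)
    (auto elim!: eventually_mono simp: EF)
 also have "... = 0"
  using R[of 1 2] R[of 1 3] R[of 2 3] by (simp add: U.integrable_cont cF continuous_intros) (simp add: F_def)
 finally have "(LINT w|sph e. E w) = 0" .
 moreover have "(LINT w|sph e. E w) = r * (r * (\<Sum>i\<in>UNIV. e i * SW e (\<lambda>_. 1) (sd i (sd i N)) r s x)
  - r * (\<Sum>l\<in>UNIV. \<Sum>i\<in>UNIV. SW e (\<lambda>w. w $ l * w $ i) (sd i (sd l N)) r s x)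
   - 2 * (\<Sum>i\<in>UNIV. SW e (\<lambda>w. w $ i) (sd i N) r s x))"
 proof -
  have c1: "cts (\<lambda>w. sd i (sd l N) (s, x + r *R w))" for i l
   by (intro continuous_intros cts_comp[OF CX_cont_sd[OF N1]])
  have c2: "cts (\<lambda>w. sd i N (s, x + r *R w))" for i
   by (intro continuous_intros cts_comp[OF CX_cont_sd[OF N]])
  show ?thesis unfolding E_def SW_def
   by (simp add: integrable_cont c1 c2 continuous_intros Bochner_Integration.integral_sum sum_subtractf) (simp add: algebra_simps power2_eq_square sum_distrib_left)
 qed
 \<comment> \<open>Only \<open>r\<close> times the identity has been obtained. At
   \<open>r = 0\<close> the remaining term is the mean of an odd function.\<close>
 ultimately have "r = 0 \<or> ?thesis" by auto
 moreover have ?thesis if "r = 0"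
 proof -
  have "(LINT w|sph e. w $ i) = 0" for i
  proof -
   have "(LINT w|sph e. (- w) $ i) = (LINT w|sph e. w $ i)"
    by (rule integral_sph_uminus) (intro borel_measurable_continuous_onI continuous_intros)
   then show ?thesis by simp
  qed
  then show ?thesis using that by (simp add: SW_def)
 qed
 ultimately show ?thesis by blast
qed

end

text \<open>All time integrals are transported to this fixed interval, so that their endpoints
  become parameters of the integrand and the lemmas of \<open>cmeas\<close> apply.\<close>

definition lam :: "real measure" where
 "lam = density lborel (indicator {0..1})"

interpretation lam: cmeas lam "{0..1}" unfolding lam_def by (rule cmeas_lborel) simp

lemma lam_FTC:
 fixes f f' :: "real => real"
 assumes "\<And>\<theta>. 0 <= \<theta> ==> \<theta> <= 1 ==> DERIV f \<theta> :> f' \<theta>" "cts f'"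
 shows "(LINT \<theta>|lam. f' \<theta>) = f 1 - f 0"
proof -
 have "(LINT \<theta>|lam. f' \<theta>) = (LINT \<theta>|lborel. f' \<theta> * indicator {0..1} \<theta>)"
  unfolding lam_def by (subst integral_density_indicator) (auto intro!: borel_measurable_continuous_onI assms simp: mult.commute)
 also have "... = f 1 - f 0"
  by (rule integral_FTC_Icc_real) (use assms in \<open>auto simp: continuous_on_eq_continuous_at\<close>)
 finally show ?thesis .
qed

text \<open>With \<open>s = fst z * \<theta>\<close> this is the integral over source times
  \<open>s\<close> between 0 and t of the kernel at elapsed time \<open>t - s\<close>; the factor
  \<open>fst z\<close> is the Jacobian.\<close>

definition Duh :: "(3 => real) => 3 option => (spacetime => real) => spacetime => real" where
 "Duh e b N z = (LINT \<theta>|lam. fst z * AA e b N (fst z * (1 - \<theta>)) (fst z * \<theta>) (snd z))"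

definition LA :: "(3 => real) => 3 option => (spacetime => real) => spacetime => real" where
 "LA e b g z = AA e b g (fst z) 0 (snd z)"

text \<open>The operators that occur are translation invariant in x, so they commute with space
  derivatives; \<open>m\<close> is the number of derivatives spent to obtain a continuous result.
  Bounds for derivatives of \<open>Q N\<close> thereby reduce to bounds for \<open>Q\<close> applied
  to derivatives of \<open>N\<close>.\<close>

definition smooth_op :: "nat => ((spacetime => real) => spacetime => real) => bool" where
 "smooth_op m Q \<longleftrightarrow> (\<forall>N. CX m N --> cts (Q N)) \<and>
   (\<forall>N j z. CX (Suc m) N --> hasdd (spv j) (Q N) z (Q (sd j N) z))"

lemma smooth_op_cont: "smooth_op m Q ==> CX m N ==> cts (Q N)" unfolding smooth_op_def by blast

lemma smooth_op_hasdd: "smooth_op m Q ==> CX (Suc m) N ==> hasdd (spv j) (Q N) z (Q (sd j N) z)"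
 unfolding smooth_op_def by blast

lemma smooth_op_CX: "smooth_op m Q ==> CX (m + k) N ==> CX k (Q N)"
proof (induction k arbitrary: N)
 case 0 then show ?case by (simp add: smooth_op_def)
next
 case (Suc k)
 have 1: "CX (Suc (m + k)) N" using Suc.prems(2) by (simp del: CD.simps)
 have 2: "CX (Suc m) N" by (rule CD_mono[OF 1]) simp
 have 3: "CX m N" by (rule CD_mono[OF 1]) simp
 show ?case
  by (rule CX_SucI[where u'="\<lambda>j. Q (sd j N)"], rule smooth_op_cont[OF Suc.prems(1) 3],
    rule smooth_op_hasdd[OF Suc.prems(1) 2], rule Suc.IH[OF Suc.prems(1) CX_sd[OF 1]])
qed

lemma smooth_op_Dx: "smooth_op m Q ==> CX (m + length w) N ==> Dx w (Q N) = Q (Dx w N)"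
proof (induction w)
 case (Cons j w)
 have 1: "CX (length w + Suc m) N" using Cons.prems(2) by (simp del: CD.simps add: add_ac)
 have 2: "CX (Suc m) (Dx w N)" by (rule CX_Dx[OF 1])
 have "CX (m + length w) N" by (rule CD_mono[OF 1]) simp
 then have "Dx w (Q N) = Q (Dx w N)" using Cons by blast
 moreover have "sd j (Q (Dx w N)) = Q (sd j (Dx w N))"
 proof
  fix z show "sd j (Q (Dx w N)) z = Q (sd j (Dx w N)) z"
   by (rule hasdd_imp_dd[OF smooth_op_hasdd[OF Cons.prems(1) 2]])
 qed
 ultimately show ?case by (simp add: Dx_Cons)
qed simp

context ellip
begin

lemma TT_cont_comp:
 assumes "cts N" "continuous_on S f" "continuous_on S g" "continuous_on S h"
 shows "continuous_on S (\<lambda>p. TT e N (f p) (g p) (h p))"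
 unfolding TT_def by (intro continuous_intros SW_cont_comp assms)

lemma AA_cont_comp:
 assumes N: "CX (Suc k) N" and "continuous_on S f" "continuous_on S g" "continuous_on S h"
 shows "continuous_on S (\<lambda>p. AA e b N (f p) (g p) (h p))"
 by (cases b) (auto intro!: continuous_intros SW_cont_comp assms CX_cont[OF N] CX_cont_sd[OF N] simp del: CD.simps)

lemma TT_deriv_r:
 assumes N: "CX (Suc k) N" shows "DERIV (\<lambda>r. TT e N r s x) r :> AA e None N r s x"
 unfolding TT_def by (rule derivative_eq_intros SW_deriv_r[OF N] continuous_intros refl)+ simp

lemma TT_deriv_x:
 assumes N: "CX (Suc k) N"
 shows "DERIV (\<lambda>h. TT e N r s (x + h *R axis j 1)) h :> AA e (Some j) N r s (x + h *R axis j 1)"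
 unfolding TT_def by (rule derivative_eq_intros SW_deriv_x[OF N] continuous_intros refl)+ simp

lemma AA_Some_deriv_r:
 assumes N: "CX (Suc (Suc k)) N"
 shows "DERIV (\<lambda>r. AA e (Some j) N r s x) r :> AA e None (sd j N) r s x"
 using TT_deriv_r[OF CX_sd[OF N], of j s x r] by (simp add: TT_def)

text \<open>The wave equation for the kernel: differentiating \<open>AA e None\<close> in the radius
  produces exactly the radial side of \<open>darboux\<close>.\<close>

lemma AA_None_deriv_r:
 assumes N: "CX (Suc (Suc k)) N"
 shows "DERIV (\<lambda>r. AA e None N r s x) r :> ((\<Sum>i\<in>UNIV. e i * AA e (Some i) (sd i N) r s x))"
proof -
 have "((\<lambda>r. AA e None N r s x) has_real_derivative
   (\<Sum>j\<in>UNIV. SW e (\<lambda>w. 1 * w $ j) (sd j N) r s x) +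
   (1 * (\<Sum>j\<in>UNIV. SW e (\<lambda>w. w $ j) (sd j N) r s x) +
    (\<Sum>j\<in>UNIV. \<Sum>i\<in>UNIV. SW e (\<lambda>w. w $ j * w $ i) (sd i (sd j N)) r s x) * r)) (at r)"
  unfolding AA.simps
  by (rule DERIV_add DERIV_mult DERIV_ident DERIV_sum SW_deriv_r[OF N] SW_deriv_r[OF CX_sd[OF N]] continuous_intros)+
 then show ?thesis using darboux[OF N, of r s x] by (simp add: sum_distrib_left algebra_simps)
qed

lemma AA_deriv_x:
 assumes N: "CX (Suc (Suc k)) N"
 shows "DERIV (\<lambda>h. AA e b N r s (x + h *R axis j 1)) h :> AA e b (sd j N) r s (x + h *R axis j 1)"
proof (cases b)
 case None
 have "((\<lambda>h. AA e None N r s (x + h *R axis j 1)) has_real_derivative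
   SW e (\<lambda>_. 1) (sd j N) r s (x + h *R axis j 1) + r * (\<Sum>i\<in>UNIV. SW e (\<lambda>w. w $ i) (sd j (sd i N)) r s (x + h *R axis j 1))) (at h)"
  unfolding AA.simps
  by (rule DERIV_add DERIV_cmult DERIV_sum SW_deriv_x[OF N] SW_deriv_x[OF CX_sd[OF N]] continuous_intros)+
 then show ?thesis by (simp add: None sd_commute[OF N, of j])
next
 case (Some i)
 then show ?thesis using TT_deriv_x[OF CX_sd[OF N, of i], where r=r and s=s and x=x and j=j and h=h] sd_commute[OF N, of j i]
  by (simp add: TT_def)
qed

lemma AA_zero: "AA e None N 0 s x = N (s, x)" "AA e (Some j) N 0 s x = 0" and TT_zero: "TT e N 0 s x = 0"
 by (simp_all add: SW_def TT_def)

lemma SW_uminus_r: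
 assumes N: "cts N" and q: "cts q" shows "SW e q N (- r) s x = SW e (\<lambda>w. q (- w)) N r s x"
proof -
 have "(LINT w|sph e. q (- w) * N (s, x + (- r) *R (- w))) = (LINT w|sph e. q w * N (s, x + (- r) *R w))"
  by (rule integral_sph_uminus) (rule borel_measurable_continuous_onI[OF SW_integrand_cont[OF N q]])
 then show ?thesis by (simp add: SW_def)
qed

text \<open>Parity in the elapsed time, from the symmetry of the sphere. Negative elapsed times
  occur in the scattering state, where the source time may exceed t.\<close>

lemma AA_uminus_r:
 assumes N: "CX (Suc k) N"
 shows "AA e None N (- r) s x = AA e None N r s x" "AA e (Some j) N (- r) s x = - AA e (Some j) N r s x"
proof -
 have 1: "SW e (\<lambda>w. w $ j) (sd j N) (- r) s x = - SW e (\<lambda>w. w $ j) (sd j N) r s x" for j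
  by (subst SW_uminus_r) (auto intro!: continuous_intros CX_cont_sd[OF N] simp: SW_def simp del: CD.simps)
 have 2: "SW e (\<lambda>_. 1) N (- r) s x = SW e (\<lambda>_. 1) N r s x"
  by (subst SW_uminus_r) (auto intro!: continuous_intros CX_cont[OF N])
 show "AA e None N (- r) s x = AA e None N r s x" by (simp add: 1 2 sum_negf)
 have "SW e (\<lambda>_. 1) (sd j N) (- r) s x = SW e (\<lambda>_. 1) (sd j N) r s x"
  by (subst SW_uminus_r) (auto intro!: continuous_intros CX_cont_sd[OF N] simp del: CD.simps)
 then show "AA e (Some j) N (- r) s x = - AA e (Some j) N r s x" by simp
qed

lemma SW_diff:
 assumes "cts M" "cts N" "cts q"
 shows "SW e q (\<lambda>z. M z - N z) r s x = SW e q M r s x - SW e q N r s x" unfolding SW_def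
 by (simp add: right_diff_distrib integrable_cont SW_integrand_cont assms)

lemma sd_diff:
 assumes "CX (Suc k) M" "CX (Suc k) N"
 shows "sd j (\<lambda>z. M z - N z) = (\<lambda>z. sd j M z - sd j N z)"
proof
 fix z
 show "sd j (\<lambda>z. M z - N z) z = sd j M z - sd j N z"
  using CX_hasdd[OF assms(1), of j z] CX_hasdd[OF assms(2), of j z]
  by (intro hasdd_imp_dd) (auto simp: hasdd_def intro: DERIV_diff)
qed

lemma AA_diff:
 assumes M: "CX (Suc k) M" and N: "CX (Suc k) N"
 shows "AA e b (\<lambda>z. M z - N z) r s x = AA e b M r s x - AA e b N r s x"
proof -
 have q: "cts (\<lambda>w::real^3. w $ j)" for j by (intro continuous_intros)
 show ?thesis by (cases b) (simp_all add: sd_diff[OF M N] SW_diff[OF CX_cont[OF M] CX_cont[OF N]]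
    SW_diff[OF CX_cont_sd[OF M] CX_cont_sd[OF N]] q sum_subtractf algebra_simps)
qed

lemma smooth_op_Duh: "smooth_op 1 (Duh e b)" unfolding smooth_op_def
proof (intro conjI allI impI)
 fix N assume N: "CX 1 N"
 then have N': "CX (Suc 0) N" by simp
 show "cts (Duh e b N)" unfolding Duh_def[abs_def]
  by (rule lam.continuous_param) (intro continuous_intros AA_cont_comp[OF N'])
next
 fix N j z assume N: "CX (Suc 1) N"
 then have N': "CX (Suc (Suc 0)) N" by (simp del: CD.simps)
 show "hasdd (spv j) (Duh e b N) z (Duh e b (sd j N) z)" unfolding hasdd_def Duh_def
  apply simp
  apply (rule DERIV_cmult)
  apply (rule DERIV_cong[OF lam.deriv_param[where U=UNIV and H'="\<lambda>h \<theta>. AA e b (sd j N) (fst z * (1 - \<theta>)) (fst z * \<theta>) (snd z + h *R axis j 1)"]])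
    apply (intro continuous_intros AA_cont_comp[OF N'])
    apply (intro continuous_intros AA_cont_comp[OF CX_sd[OF N']])
   apply simp
   apply simp
   apply (intro AA_deriv_x[OF N'])
  apply simp
  done
qed

lemma smooth_op_LA: "smooth_op 1 (LA e b)" unfolding smooth_op_def
proof (intro conjI allI impI)
 fix N assume N: "CX 1 N"
 then have N': "CX (Suc 0) N" by simp
 show "cts (LA e b N)" unfolding LA_def[abs_def] by (intro continuous_intros AA_cont_comp[OF N'])
next
 fix N j z assume N: "CX (Suc 1) N"
 then have N': "CX (Suc (Suc 0)) N" by (simp del: CD.simps)
 show "hasdd (spv j) (LA e b N) z (LA e b (sd j N) z)"
  unfolding hasdd_def LA_def using AA_deriv_x[OF N', of b "fst z" 0 "snd z" j 0] by simp
qed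

end

section \<open>Local energies\<close>

text \<open>Compactly supported integrands are integrated against this finite measure, which brings
  them under \<open>cmeas\<close>.\<close>

definition lb :: "real => (real^3) measure" where
 "lb R = density lborel (indicator (cball 0 R))"

lemma cmeas_lb: "cmeas (lb R) (cball 0 R)" unfolding lb_def by (rule cmeas_lborel) simp

lemma integral_lb:
 fixes h :: "real^3 => real"
 assumes h: "cts h" and z: "\<And>x. norm x > R ==> h x = 0"
 shows "(LINT x|lb R. h x) = (LINT x|lborel. h x)" unfolding lb_def
 by (subst integral_density_indicator)
   (use z in \<open>auto intro!: borel_measurable_continuous_onI h Bochner_Integration.integral_cong simp: indicator_def not_le\<close>)

text \<open>The integral of a translate of \<open>h\<close> is constant in the translation;
  differentiate at 0. Translations by less than 1 stay inside the ball of radius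
  \<open>R + 1\<close>.\<close>

lemma integral_divergence_zero:
 fixes h :: "real^3 => real"
 assumes h: "cts h" and h': "cts h'"
  and d: "\<And>x. hasdd (axis j 1) h x (h' x)" and z: "\<And>x. norm x > R ==> h x = 0"
 shows "(LINT x|lb (R + 1). h' x) = 0"
proof -
 interpret cmeas "lb (R + 1)" "cball 0 (R + 1)" by (rule cmeas_lb)
 define \<Psi> where "\<Psi> s = (LINT x|lb (R + 1). h (x + s *R axis j 1))" for s :: real
 have "DERIV \<Psi> 0 :> (LINT x|lb (R + 1). h' (x + 0 *R axis j 1))" unfolding \<Psi>_def
  by (rule deriv_param[of UNIV])
    (auto intro!: continuous_intros cts_comp[OF h] cts_comp[OF h'] hasdd_line d)
 moreover have "DERIV \<Psi> 0 :> 0"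
 proof (rule has_field_derivative_transform_within[OF DERIV_const[of "\<integral>x. h x \<partial>lborel"], of 1])
  fix s :: real assume s: "dist s 0 < 1"
  have "\<Psi> s = (LINT x|lborel. h (x + s *R axis j 1))" unfolding \<Psi>_def
  proof (rule integral_lb)
   show "cts (\<lambda>x. h (x + s *R axis j 1))" by (intro cts_comp[OF h] continuous_intros)
   fix x :: "real^3" assume "R + 1 < norm x"
   moreover have "norm x <= norm (x + s *R axis j 1) + norm (s *R axis j (1::real))"
    by (metis add_diff_cancel_right' norm_triangle_ineq4)
   ultimately show "h (x + s *R axis j 1) = 0" using s by (intro z) (simp add: norm_axis_1)
  qed
  also have "... = (LINT x|lborel. h x)"
   by (rule integral_translate) (rule borel_measurable_continuous_onI[OF h])
  finally show "(LINT x|lborel. h x) = \<Psi> s" ..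
 qed simp_all
 ultimately show ?thesis using DERIV_unique by fastforce
qed

text \<open>The square makes the cut-off continuously differentiable across the boundary of the
  cone, where the argument changes sign.\<close>

lemma DERIV_max_square: "DERIV (\<lambda>y. (max 0 y)^2) (y::real) :> 2 * max 0 y"
proof -
 consider "y < 0" | "y = 0" | "y > 0" by linarith
 then show ?thesis
 proof cases
  case 1
  have "DERIV (\<lambda>_. 0) y :> 0" by simp
  then have "DERIV (\<lambda>y. (max 0 y)^2) y :> 0"
   by (rule has_field_derivative_transform_within[where d="-y"]) (use 1 in \<open>auto simp: dist_real_def max_def\<close>)
  then show ?thesis using 1 by (simp add: max_def)
 next
  case 2
  have "((\<lambda>h::real. (max 0 h)^2 / h) \<longlongrightarrow> 0) (at 0)"
  proof (rule Lim_null_comparison)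
   show "\<forall>\<^sub>F h::real in at 0. norm ((max 0 h)^2 / h) <= abs h"
    by (rule eventuallyI) (simp add: max_def power2_eq_square abs_mult)
   show "((\<lambda>h::real. abs h) \<longlongrightarrow> 0) (at 0)" by (intro tendsto_rabs_zero tendsto_ident_at)
  qed
  then show ?thesis using 2 by (simp add: has_field_derivative_iff)
 next
  case 3
  have "DERIV (\<lambda>y. y^2) y :> 2 * y" by (auto intro!: derivative_eq_intros)
  then have "DERIV (\<lambda>y. (max 0 y)^2) y :> 2 * y"
   by (rule has_field_derivative_transform_within[where d="y"]) (use 3 in \<open>auto simp: dist_real_def max_def\<close>)
  then show ?thesis using 3 by (simp add: max_def)
 qed
qed

text \<open>A weight supported in a backward cone of slope c; it makes energies finite and local.\<close>

definition cm :: "real => real => spacetime => real" where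
 "cm c \<rho> z = max 0 (\<rho> - c * fst z - sqrt (1 + snd z \<bullet> snd z))"

definition cw :: "real => real => spacetime => real" where
 "cw c \<rho> z = (cm c \<rho> z)^2"

lemma continuous_cm [continuous_intros]: "continuous_on S f ==> continuous_on S (\<lambda>p. cm c \<rho> (f p))"
 unfolding cm_def by (intro continuous_intros)

lemma continuous_cw [continuous_intros]: "continuous_on S f ==> continuous_on S (\<lambda>p. cw c \<rho> (f p))"
 unfolding cw_def by (intro continuous_intros)

lemma cm_nonneg: "0 <= cm c \<rho> z" and cw_nonneg: "0 <= cw c \<rho> z"
 by (auto simp: cm_def cw_def)

lemma norm_le_sqrt1: "norm (x::real^3) <= sqrt (1 + x \<bullet> x)"
 by (simp add: norm_eq_sqrt_inner)

lemma cm_zero: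
 assumes "c >= 0" "fst z >= 0" "norm (snd z) >= \<rho>" shows "cm c \<rho> z = 0"
proof -
 have "\<rho> - c * fst z - sqrt (1 + snd z \<bullet> snd z) <= 0"
  using norm_le_sqrt1[of "snd z"] mult_nonneg_nonneg[OF assms(1,2)] assms(3) by linarith
 then show ?thesis by (simp add: cm_def)
qed

lemma cw_zero: "c >= 0 ==> fst z >= 0 ==> norm (snd z) >= \<rho> ==> cw c \<rho> z = 0"
 by (simp add: cw_def cm_zero)

lemma cw_deriv_t: "DERIV (\<lambda>t. cw c \<rho> (t, x)) t :> (- 2 * c * cm c \<rho> (t, x))"
proof -
 have "DERIV (\<lambda>t. \<rho> - c * t - sqrt (1 + x \<bullet> x)) t :> (- c)"
  by (auto intro!: derivative_eq_intros)
 from DERIV_chain2[OF DERIV_max_square this]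
 show ?thesis unfolding cw_def cm_def by (simp add: mult_ac)
qed

text \<open>With \<open>sqrt (1 + x \<bullet> x)\<close> in place of \<open>norm x\<close> the
  weight is differentiable at the origin too, and the slope in each direction is still at most
  1.\<close>

lemma cw_deriv_x: "hasdd (spv j) (cw c \<rho>) (t, x) (- 2 * cm c \<rho> (t, x) * (x $ j / sqrt (1 + x \<bullet> x)))"
proof -
 have p: "1 + x \<bullet> x > 0" by (simp add: add_pos_nonneg)
 have 1: "DERIV (\<lambda>s. 1 + (x + s *R axis j 1) \<bullet> (x + s *R axis j 1)) 0 :> 2 * x $ j"
 proof -
  have "(x + s *R axis j 1) \<bullet> (x + s *R axis j 1) = x \<bullet> x + 2 * s * x $ j + s^2" for s
   by (simp add: inner_add_left inner_add_right inner_axis inner_axis' power2_eq_square) (simp add: algebra_simps)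
  moreover have "DERIV (\<lambda>s. 1 + (x \<bullet> x + 2 * s * x $ j + s^2)) 0 :> 2 * x $ j"
   by (auto intro!: derivative_eq_intros)
  ultimately show ?thesis by presburger
 qed
 have "DERIV (\<lambda>s. \<rho> - c * t - sqrt (1 + (x + s *R axis j 1) \<bullet> (x + s *R axis j 1))) 0 :> (- (x $ j / sqrt (1 + x \<bullet> x)))"
  by (rule DERIV_cong[OF DERIV_diff[OF DERIV_const DERIV_chain2[OF DERIV_real_sqrt 1]]]) (use p in \<open>auto simp: field_simps\<close>)
 from DERIV_chain2[OF DERIV_max_square this]
 show ?thesis unfolding hasdd_def cw_def cm_def by simp
qed

text \<open>For c >= 0 and t >= 0 the weight vanishes where \<open>norm x >= \<rho>\<close>; the
  ball of radius \<open>\<rho> + 1\<close> leaves the margin that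
  \<open>integral_divergence_zero\<close> asks for.\<close>

definition energy :: "(3 => real) => real => real => (spacetime => real) => (3 => spacetime => real) => real => real" where
 "energy e c \<rho> a b t = (LINT x|lb (\<rho> + 1). cw c \<rho> (t, x) * ((a (t, x))^2 + (\<Sum>j\<in>UNIV. e j * (b j (t, x))^2)))"

lemma energy_cont:
 assumes a: "cts a" and b: "\<And>j. cts (b j)" shows "cts (energy e c \<rho> a b)"
 unfolding energy_def[abs_def] by (rule cmeas.continuous_param[OF cmeas_lb])
   (intro continuous_intros cts_comp[OF a] cts_comp[OF b])

text \<open>The functions \<open>a\<close> and \<open>b j\<close> stand for the time and space
  derivatives of a solution, but only the relations between their derivatives are assumed: so the
  lemma serves both the kernels and the difference of two solutions. The latter are only one-sided
  at t = 0, hence \<open>t > 0\<close>. The decay of the weight in time outweighs the flux through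
  the cone because \<open>c\<close> is at least the sum of the speeds.\<close>

lemma energy_ineq:
 fixes a n att :: "spacetime => real" and b ax bx :: "3 => spacetime => real"
 assumes e: "\<And>j. e j > 0" and c: "c >= (\<Sum>j\<in>UNIV. sqrt (e j))"
  and ca: "cts a" and cb: "\<And>j. cts (b j)" and catt: "cts att"
  and cax: "\<And>j. cts (ax j)" and cbx: "\<And>j. cts (bx j)" and cn: "cts n"
  and da: "\<And>t x. t > 0 ==> DERIV (\<lambda>t. a (t, x)) t :> att (t, x)"
  and db: "\<And>t x j. t > 0 ==> DERIV (\<lambda>t. b j (t, x)) t :> ax j (t, x)"
  and dax: "\<And>t x j. t > 0 ==> hasdd (spv j) a (t, x) (ax j (t, x))"
  and dbx: "\<And>t x j. t > 0 ==> hasdd (spv j) (b j) (t, x) (bx j (t, x))"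
  and eq: "\<And>t x. t > 0 ==> att (t, x) = (\<Sum>j\<in>UNIV. e j * bx j (t, x)) + n (t, x)"
  and t: "t > 0" shows "\<exists>D. DERIV (energy e c \<rho> a b) t :> D \<and>
   D <= (LINT x|lb (\<rho> + 1). cw c \<rho> (t, x) * (2 * (a (t, x) * n (t, x))))"
proof -
 interpret cmeas "lb (\<rho> + 1)" "cball 0 (\<rho> + 1)" by (rule cmeas_lb)
 have c0: "c >= 0" using c e by (meson order_trans sum_nonneg real_sqrt_ge_zero less_imp_le)
 note ci = continuous_intros cts_comp[OF ca] cts_comp[OF cb] cts_comp[OF catt]
  cts_comp[OF cax] cts_comp[OF cbx] cts_comp[OF cn]
 have sq: "sqrt (1 + x \<bullet> x) \<noteq> 0" for x :: "real^3" by (metis add_pos_nonneg inner_ge_zero less_irrefl real_sqrt_gt_0_iff zero_less_one)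
 define w where "w = cw c \<rho>"
 define m where "m = cm c \<rho>"
 define wj where "wj j x = - 2 * m (t, x) * (x $ j / sqrt (1 + x \<bullet> x))" for j x
 define F where "F z = (a z)^2 + (\<Sum>j\<in>UNIV. e j * (b j z)^2)" for z
 define H' where "H' t x = (- 2 * c * m (t, x)) * F (t, x) + w (t, x) * (2 * a (t, x) * att (t, x) + (\<Sum>j\<in>UNIV. e j * (2 * b j (t, x) * ax j (t, x))))" for t x
 have D: "DERIV (energy e c \<rho> a b) t :> (LINT x|lb (\<rho> + 1). H' t x)"
  unfolding energy_def[abs_def]
 proof (rule deriv_param[of "{0<..}"])
  show "cts (\<lambda>p. H' (fst p) (snd p))" unfolding H'_def F_def w_def m_def by (intro ci)
  show "cts (\<lambda>x. cw c \<rho> (s, x) * ((a (s, x))^2 + (\<Sum>j\<in>UNIV. e j * (b j (s, x))^2)))" for s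
   by (intro ci)
  fix s x assume s: "s \<in> {0::real<..}"
  have sq': "DERIV (\<lambda>s. (f s)^2) s :> 2 * f s * d" if "DERIV f s :> d" for f :: "real => real" and d
   by (rule DERIV_cong[OF DERIV_power[OF that]]) simp
  have s0: "s > 0" using s by simp
  have "((\<lambda>s. (a (s, x))^2 + (\<Sum>j\<in>UNIV. e j * (b j (s, x))^2)) has_real_derivative
    2 * a (s, x) * att (s, x) + (\<Sum>j\<in>UNIV. e j * (2 * b j (s, x) * ax j (s, x)))) (at s)"
   by (intro DERIV_add DERIV_sum DERIV_cmult sq' da[OF s0] db[OF s0])
  from DERIV_mult[OF cw_deriv_t this]
  show "DERIV (\<lambda>s. cw c \<rho> (s, x) * ((a (s, x))^2 + (\<Sum>j\<in>UNIV. e j * (b j (s, x))^2))) s :> H' s x"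
   unfolding H'_def F_def w_def m_def by (rule DERIV_cong) (simp add: mult.commute)
 qed (use t in auto)
 \<comment> \<open>The \<open>x $ j\<close> derivative of the energy flux
   \<open>w * e j * b j * a\<close>.\<close>
 have I0: "(LINT x|lb (\<rho> + 1). wj j x * (e j * b j (t, x) * a (t, x)) + w (t, x) * (e j * bx j (t, x) * a (t, x) + e j * b j (t, x) * ax j (t, x))) = 0" for j
 proof (rule integral_divergence_zero[of "\<lambda>x. w (t, x) * (e j * b j (t, x) * a (t, x))" _ j])
  show "cts (\<lambda>x. w (t, x) * (e j * b j (t, x) * a (t, x)))" unfolding w_def by (intro ci)
  show "cts (\<lambda>x. wj j x * (e j * b j (t, x) * a (t, x)) + w (t, x) * (e j * bx j (t, x) * a (t, x) + e j * b j (t, x) * ax j (t, x)))"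
   unfolding w_def wj_def m_def using sq by (intro ci) auto
  show "w (t, x) * (e j * b j (t, x) * a (t, x)) = 0" if "\<rho> < norm x" for x
   using that t c0 by (simp add: w_def cw_zero)
  show "hasdd (axis j 1) (\<lambda>x. w (t, x) * (e j * b j (t, x) * a (t, x))) x
    (wj j x * (e j * b j (t, x) * a (t, x)) + w (t, x) * (e j * bx j (t, x) * a (t, x) + e j * b j (t, x) * ax j (t, x)))" for x
   using hasdd_mult[OF cw_deriv_x[of j c \<rho> t x] hasdd_mult[OF hasdd_cmult[OF dbx[OF t, of j x], of "e j"] dax[OF t, of j x]]]
   unfolding w_def wj_def m_def hasdd_def by (simp add: algebra_simps)
 qed
 define G where "G j x = wj j x * (e j * b j (t, x) * a (t, x)) + w (t, x) * (e j * bx j (t, x) * a (t, x) + e j * b j (t, x) * ax j (t, x))" for j x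
 have cG: "cts (G j)" for j unfolding G_def w_def wj_def m_def using sq by (intro ci) auto
 have cH': "cts (H' t)" unfolding H'_def F_def w_def m_def by (intro ci)
 have cR: "cts (\<lambda>x. w (t, x) * (2 * (a (t, x) * n (t, x))))" unfolding w_def by (intro ci)
 \<comment> \<open>Subtracting the divergences, whose integrals are zero, removes every product with
   a derivative of \<open>a\<close> or \<open>b\<close>; the terms with derivatives of the weight
   and the source term remain.\<close>
 have "(LINT x|lb (\<rho> + 1). H' t x) = (LINT x|lb (\<rho> + 1). H' t x - 2 * (\<Sum>j\<in>UNIV. G j x))"
  using I0 by (simp add: integrable_cont cG cH' continuous_intros G_def[symmetric] Bochner_Integration.integral_sum)
 also have "... <= (LINT x|lb (\<rho> + 1). w (t, x) * (2 * (a (t, x) * n (t, x))))"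
 proof (rule integral_mono)
  show "integrable (lb (\<rho> + 1)) (\<lambda>x. H' t x - 2 * (\<Sum>j\<in>UNIV. G j x))"
   by (intro integrable_cont continuous_intros cG cH')
  show "integrable (lb (\<rho> + 1)) (\<lambda>x. w (t, x) * (2 * (a (t, x) * n (t, x))))"
   by (intro integrable_cont cR)
  fix x :: "real^3"
  let ?z = "(t, x)"
  have A: "H' t x - 2 * (\<Sum>j\<in>UNIV. G j x) = - 2 * c * m ?z * F ?z - 2 * (\<Sum>j\<in>UNIV. wj j x * (e j * b j ?z * a ?z)) + w ?z * (2 * (a ?z * n ?z))"
   unfolding H'_def G_def eq[OF t] by (simp add: sum_3 algebra_simps)
  have m0: "m ?z >= 0" by (simp add: m_def cm_nonneg)
  have F0: "F ?z >= 0"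
   unfolding F_def using e by (intro add_nonneg_nonneg sum_nonneg mult_nonneg_nonneg) (auto simp: less_imp_le)
  \<comment> \<open>Young's inequality with weights,
    \<open>2 * q * |a| * |b| <= a^2 + q^2 * b^2\<close> for \<open>q = sqrt (e j)\<close>, matches
    the flux to the energy density.\<close>
  have B: "- 2 * (wj j x * (e j * b j ?z * a ?z)) <= 2 * m ?z * (sqrt (e j) * ((a ?z)^2 + e j * (b j ?z)^2))" for j
  proof -
   define q where "q = sqrt (e j)"
   have q: "q > 0" "e j = q^2" using e[of j] by (auto simp: q_def)
   define y where "y = x $ j / sqrt (1 + x \<bullet> x)"
   have y: "abs y <= 1"
   proof -
    have "abs (x $ j) <= sqrt (1 + x \<bullet> x)" using component_le_norm_cart[of x j] norm_le_sqrt1[of x] by linarith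
    moreover have "sqrt (1 + x \<bullet> x) > 0" by (intro real_sqrt_gt_zero add_pos_nonneg) auto
    ultimately show ?thesis unfolding y_def by (metis abs_divide abs_of_pos divide_le_eq_1_pos)
   qed
   have "2 * (y * (q^2 * b j ?z * a ?z)) <= abs (2 * (y * (q^2 * b j ?z * a ?z)))" by simp
   also have "... = abs y * (2 * q^2 * abs (b j ?z) * abs (a ?z))" by (simp add: abs_mult)
   also have "... <= 1 * (2 * q^2 * abs (b j ?z) * abs (a ?z))" using y by (intro mult_right_mono) auto
   also have "... <= q * ((a ?z)^2 + q^2 * (b j ?z)^2)"
   proof -
    have "0 <= q * (abs (a ?z) - q * abs (b j ?z))^2" using q by simp
    then show ?thesis by (simp add: power2_eq_square algebra_simps)
   qed
   finally have "2 * m ?z * (2 * (y * (q^2 * b j ?z * a ?z))) <= 2 * m ?z * (q * ((a ?z)^2 + q^2 * (b j ?z)^2))"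
    using m0 by (intro mult_left_mono) auto
   then show ?thesis unfolding wj_def y_def[symmetric] q_def[symmetric] q(2) using q(1) by (simp add: algebra_simps)
  qed
  have "- 2 * (\<Sum>j\<in>UNIV. wj j x * (e j * b j ?z * a ?z)) = (\<Sum>j\<in>UNIV. - 2 * (wj j x * (e j * b j ?z * a ?z)))"
   by (rule sum_distrib_left)
  also have "... <= (\<Sum>j\<in>UNIV. 2 * m ?z * (sqrt (e j) * ((a ?z)^2 + e j * (b j ?z)^2)))"
   by (intro sum_mono B)
  also have "... <= (\<Sum>j\<in>UNIV. 2 * m ?z * (sqrt (e j) * F ?z))"
  proof (intro sum_mono mult_left_mono)
   fix j :: 3
   show "(a ?z)^2 + e j * (b j ?z)^2 <= F ?z"
    unfolding F_def using e by (intro add_left_mono member_le_sum) (auto simp: less_imp_le)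
  qed (use m0 e in \<open>auto simp: less_imp_le\<close>)
  also have "... = 2 * m ?z * F ?z * (\<Sum>j\<in>UNIV. sqrt (e j))" by (simp add: sum_distrib_left mult_ac)
  also have "... <= 2 * m ?z * F ?z * c" by (rule mult_left_mono[OF c]) (use m0 F0 in simp)
  also have "... = 2 * c * m ?z * F ?z" by (simp only: mult_ac)
  finally show "H' t x - 2 * (\<Sum>j\<in>UNIV. G j x) <= w ?z * (2 * (a ?z * n ?z))"
   unfolding A by linarith
 qed
 finally have fin: "(LINT x|lb (\<rho> + 1). H' t x) <= (LINT x|lb (\<rho> + 1). w (t, x) * (2 * (a (t, x) * n (t, x))))" .
 show ?thesis by (rule exI, rule conjI[OF D fin[unfolded w_def]])
qed

declare AA.simps [simp del]

section \<open>L^2 bounds for the kernels\<close>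

definition n1 :: "(spacetime => real) => real => ennreal" where
 "n1 u t = (nnint x. abs (u (t, x)))"

text \<open>\<open>n2\<close> and \<open>n4\<close> are the second and fourth powers of the norms.
  As integrals with values in \<open>ennreal\<close> they make sense before finiteness is known, and
  no roots have to be carried along.\<close>

definition n2 :: "(spacetime => real) => real => ennreal" where
 "n2 u t = (nnint x. (u (t, x))^2)"

definition n4 :: "(spacetime => real) => real => ennreal" where
 "n4 u t = (nnint x. (u (t, x))^4)"

lemma slice_measurable: "cts u ==> (\<lambda>x::real^3. (u (t::real, x) :: real)) \<in> borel_measurable borel"
 by (rule borel_measurable_continuous_onI, rule cts_comp) (auto intro: continuous_intros)

lemma borel_measurable_continuous_onI2: "cts f ==> f \<in> borel_measurable lborel"
 by (simp add: borel_measurable_continuous_onI)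

lemma cts_ennreal: "cts f ==> (\<lambda>x. ennreal (f x)) \<in> borel_measurable lborel"
 by (intro measurable_compose[OF borel_measurable_continuous_onI2[of f]] measurable_ennreal)

lemma nn_integral_Fatou_real:
 fixes u :: "nat => 'a => real"
 assumes m: "\<And>n. u n \<in> borel_measurable M" and l: "\<And>x. (\<lambda>n. u n x) \<longlonglongrightarrow> v x"
  and b: "\<forall>\<^sub>F n in sequentially. (\<integral>\<^sup>+x. ennreal (u n x) \<partial>M) <= B"
 shows "(\<integral>\<^sup>+x. ennreal (v x) \<partial>M) <= B"
proof -
 have "(\<integral>\<^sup>+x. ennreal (v x) \<partial>M) = (\<integral>\<^sup>+x. liminf (\<lambda>n. ennreal (u n x)) \<partial>M)"
  by (intro nn_integral_cong lim_imp_Liminf[symmetric] tendsto_ennrealI l) simp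
 also have "... <= liminf (\<lambda>n. \<integral>\<^sup>+x. ennreal (u n x) \<partial>M)"
  by (intro nn_integral_liminf) (use m in measurable)
 also have "... <= B" using Liminf_le[of sequentially, OF _ b] by simp
 finally show ?thesis .
qed

lemma nn_integral_lb:
 assumes [measurable]: "f \<in> borel_measurable borel"
 shows "(\<integral>\<^sup>+x. f x \<partial>lb R) = (nnlb x. indicator (cball 0 R) x * f x)"
 unfolding lb_def by (rule nn_integral_density) (auto intro!: borel_measurable_indicator)

lemma energy_nn:
 assumes e: "\<And>j. e j > 0" and c: "c >= 0" and t: "t >= 0"
  and ca: "cts a" and cb: "\<And>j. cts (b j)"
 shows "ennreal (energy e c \<rho> a b t) = (nnint x. cw c \<rho> (t, x) * ((a (t, x))^2 + (\<Sum>j\<in>UNIV. e j * (b j (t, x))^2)))"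
proof -
 interpret cmeas "lb (\<rho> + 1)" "cball 0 (\<rho> + 1)" by (rule cmeas_lb)
 let ?f = "\<lambda>x. cw c \<rho> (t, x) * ((a (t, x))^2 + (\<Sum>j\<in>UNIV. e j * (b j (t, x))^2))"
 have cf: "cts ?f" by (intro continuous_intros cts_comp[OF ca] cts_comp[OF cb])
 have nn: "0 <= ?f x" for x
  using e by (intro mult_nonneg_nonneg add_nonneg_nonneg sum_nonneg cw_nonneg) (auto simp: less_imp_le)
 have "ennreal (energy e c \<rho> a b t) = (\<integral>\<^sup>+x. ennreal (?f x) \<partial>lb (\<rho> + 1))"
  unfolding energy_def by (rule nn_integral_eq_integral[symmetric, OF integrable_cont[OF cf]]) (use nn in simp)
 also have "... = (nnint x. ?f x)" using c t by (subst nn_integral_lb)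
   (auto intro!: borel_measurable_continuous_onI cf nn_integral_cong measurable_compose[OF _ measurable_ennreal] simp: indicator_def cw_zero)
 finally show ?thesis .
qed

context ellip
begin

lemma AA_energy_mono:
 assumes N: "CX (Suc (Suc k)) N" and c: "c >= (\<Sum>j\<in>UNIV. sqrt (e j))" and r: "r >= 0"
 shows "energy e c \<rho> (\<lambda>z. AA e None N (fst z) s (snd z)) (\<lambda>j z. AA e (Some j) N (fst z) s (snd z)) r
  <= energy e c \<rho> (\<lambda>z. AA e None N (fst z) s (snd z)) (\<lambda>j z. AA e (Some j) N (fst z) s (snd z)) 0"
proof (cases "r = 0")
 case False
 let ?E = "energy e c \<rho> (\<lambda>z. AA e None N (fst z) s (snd z)) (\<lambda>j z. AA e (Some j) N (fst z) s (snd z))"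
 have cont: "cts (\<lambda>z. AA e b N (fst z) s (snd z))" for b
  by (intro AA_cont_comp[OF N] continuous_intros)
 have cont1: "cts (\<lambda>z. AA e b (sd j N) (fst z) s (snd z))" for b j
  by (intro AA_cont_comp[OF CX_sd[OF N]] continuous_intros)
 have hx: "hasdd (spv j) (\<lambda>z. AA e b N (fst z) s (snd z)) (t, x) (AA e b (sd j N) t s x)" for b j t x
  using AA_deriv_x[OF N, of b t s x j 0] by (simp add: hasdd_def)
 have "\<exists>D. DERIV (?E) t :> D \<and> D <= 0" if t: "t > 0" for t
 proof -
  have "\<exists>D. DERIV (?E) t :> D \<and> D <= (LINT x|lb (\<rho> + 1). cw c \<rho> (t, x) *
    (2 * (AA e None N (fst (t, x)) s (snd (t, x)) * (\<lambda>_::spacetime. 0) (t, x))))"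
  proof (rule energy_ineq[where att="\<lambda>z. \<Sum>i\<in>UNIV. e i * AA e (Some i) (sd i N) (fst z) s (snd z)"
    and ax="\<lambda>j z. AA e None (sd j N) (fst z) s (snd z)" and bx="\<lambda>j z. AA e (Some j) (sd j N) (fst z) s (snd z)", OF e_pos c])
  qed (use t AA_None_deriv_r[OF N] AA_Some_deriv_r[OF N] hx in \<open>auto intro!: continuous_intros cont cont1 simp del: AA.simps\<close>)
  then show ?thesis by simp
 qed
 then show ?thesis using r False
  by (intro DERIV_nonpos_imp_decreasing_open[of 0 r ?E]) (auto intro: continuous_on_subset[OF energy_cont[OF cont cont]])
qed simp

text \<open>The weight of the cone of size \<open>n\<close>, divided by \<open>n^2\<close>, is at
  most 1 at time 0 and tends to 1 at every point, so the local energy inequality becomes global by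
  Fatou. At elapsed time 0 the energy density is just \<open>(N (s, x))^2\<close>.\<close>

lemma AA_L2_sum_pos:
 assumes N: "CX (Suc (Suc k)) N" and r: "r >= 0"
 shows "(nnint x. (AA e None N r s x)^2 + (\<Sum>j\<in>UNIV. e j * (AA e (Some j) N r s x)^2)) <= n2 N s"
proof -
 define c where "c = (\<Sum>j\<in>UNIV. sqrt (e j))"
 have c0: "c >= 0" unfolding c_def using e_pos by (intro sum_nonneg) (auto simp: less_imp_le)
 let ?a = "\<lambda>z. AA e None N (fst z) s (snd z)" and ?b = "\<lambda>j z. AA e (Some j) N (fst z) s (snd z)"
 let ?F = "\<lambda>t x. (AA e None N t s x)^2 + (\<Sum>j\<in>UNIV. e j * (AA e (Some j) N t s x)^2)"
 have cont: "cts (\<lambda>z. AA e b N (fst z) s (snd z))" for b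
  by (intro AA_cont_comp[OF N] continuous_intros)
 have cF: "cts (\<lambda>x. ?F r x)" by (intro continuous_intros AA_cont_comp[OF N])
 have F0: "?F r x >= 0" for x
  using e_pos by (intro add_nonneg_nonneg sum_nonneg mult_nonneg_nonneg) (auto simp: less_imp_le)
 have m[measurable]: "(\<lambda>x. N (s, x)) \<in> borel_measurable borel"
  by (rule slice_measurable[OF CX_cont[OF N]])
 show ?thesis
 proof (rule nn_integral_Fatou_real)
  fix n :: nat
  show "(\<lambda>x. cw c (real n) (r, x) / (real n)^2 * ?F r x) \<in> borel_measurable lborel"
   by (rule borel_measurable_continuous_onI2, cases "n = 0") (auto intro!: continuous_intros cF)
 next
  fix x
  have "(\<lambda>n. (max 0 (1 - (c * r + sqrt (1 + x \<bullet> x)) / real n))^2 * ?F r x) \<longlonglongrightarrow> (max 0 (1 - 0))^2 * ?F r x"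
   by (intro tendsto_intros lim_const_over_n)
  moreover have "\<forall>\<^sub>F n in sequentially. (max 0 (1 - (c * r + sqrt (1 + x \<bullet> x)) / real n))^2 * ?F r x = cw c (real n) (r, x) / (real n)^2 * ?F r x"
   using eventually_gt_at_top[of 0]
  proof eventually_elim
   fix n :: nat assume n: "n > 0"
   have "max 0 (1 - (c * r + sqrt (1 + x \<bullet> x)) / real n) = cm c (real n) (r, x) / real n"
    using n by (simp add: cm_def max_def field_simps)
   then show "(max 0 (1 - (c * r + sqrt (1 + x \<bullet> x)) / real n))^2 * ?F r x = cw c (real n) (r, x) / (real n)^2 * ?F r x"
    by (simp add: cw_def power_divide)
  qed
  ultimately show "(\<lambda>n. cw c (real n) (r, x) / (real n)^2 * ?F r x) \<longlonglongrightarrow> ?F r x"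
   using Lim_transform_eventually by fastforce
 next
  show "\<forall>\<^sub>F n in sequentially. (nnint x. cw c (real n) (r, x) / (real n)^2 * ?F r x) <= n2 N s"
   using eventually_gt_at_top[of 0]
  proof eventually_elim
   fix n :: nat assume n: "n > 0"
   have A: "(nnint x. cw c (real n) (t, x) / (real n)^2 * ?F t x) = ennreal (1 / (real n)^2) * ennreal (energy e c (real n) ?a ?b t)"
    if t: "t >= 0" for t
   proof -
    have cFt: "cts (\<lambda>x. ?F t x)" by (intro continuous_intros AA_cont_comp[OF N])
    have "(nnint x. cw c (real n) (t, x) / (real n)^2 * ?F t x) = (nnlb x. ennreal (1 / (real n)^2) * ennreal (cw c (real n) (t, x) * ?F t x))"
     by (intro nn_integral_cong) (simp add: ennreal_mult'[symmetric])
    also have "... = ennreal (1 / (real n)^2) * (nnint x. cw c (real n) (t, x) * ?F t x)"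
     by (rule nn_integral_cmult, rule measurable_compose[OF _ measurable_ennreal], rule borel_measurable_continuous_onI2)
       (intro continuous_intros cFt)
    also have "(nnint x. cw c (real n) (t, x) * ?F t x) = ennreal (energy e c (real n) ?a ?b t)"
     using energy_nn[OF e_pos c0 t cont cont, where \<rho>="real n"] by simp
    finally show ?thesis .
   qed
   have "(nnint x. cw c (real n) (r, x) / (real n)^2 * ?F r x)
    <= (nnint x. cw c (real n) (0, x) / (real n)^2 * ?F 0 x)" unfolding A[OF r] A[OF order_refl]
    by (intro mult_left_mono ennreal_leI AA_energy_mono[OF N _ r]) (auto simp: c_def)
   also have "... <= n2 N s" unfolding n2_def
   proof (intro nn_integral_mono ennreal_leI)
    fix x :: "real^3"
    have "cm c (real n) (0, x) <= real n" using real_sqrt_ge_zero[of "1 + x \<bullet> x"] by (simp add: cm_def)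
    then have "cw c (real n) (0, x) <= (real n)^2" unfolding cw_def by (intro power_mono cm_nonneg)
    then have "cw c (real n) (0, x) / (real n)^2 <= 1" using n by simp
    then have "cw c (real n) (0, x) / (real n)^2 * (N (s, x))^2 <= 1 * (N (s, x))^2" by (rule mult_right_mono) simp
    then show "cw c (real n) (0, x) / (real n)^2 * ?F 0 x <= (N (s, x))^2" by (simp add: AA_zero del: AA.simps)
   qed
   finally show "(nnint x. cw c (real n) (r, x) / (real n)^2 * ?F r x) <= n2 N s" .
  qed
 qed
qed

text \<open>The price of replacing the energy weights \<open>e j\<close> by 1; the summand 1 takes
  care of the time derivative.\<close>

definition ce :: real where "ce = 1 + (\<Sum>j\<in>UNIV. 1 / e j)"

lemma ce_pos: "ce >= 1" "ce > 0"
proof -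
 have "(\<Sum>j\<in>UNIV. 1 / e j) >= 0" using e_pos by (intro sum_nonneg) (auto simp: less_imp_le)
 then show "ce >= 1" "ce > 0" by (auto simp: ce_def)
qed

lemma AA_L2:
 assumes N: "CX (Suc (Suc k)) N" shows "(nnint x. (AA e b N r s x)^2) <= ennreal ce * n2 N s"
proof -
 have sq: "(AA e b N r s x)^2 = (AA e b N (abs r) s x)^2" for x
  using AA_uminus_r[OF N, where r=r and s=s and x=x] by (cases b; cases "r >= 0") (simp_all del: AA.simps)
 let ?F = "\<lambda>x. (AA e None N (abs r) s x)^2 + (\<Sum>j\<in>UNIV. e j * (AA e (Some j) N (abs r) s x)^2)"
 have S0: "(\<Sum>j\<in>UNIV. e j * (AA e (Some j) N (abs r) s x)^2) >= 0" for x
  using e_pos by (intro sum_nonneg mult_nonneg_nonneg) (auto simp: less_imp_le)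
 have b: "(AA e b N r s x)^2 <= ce * ?F x" for x
 proof (cases b)
  case None
  have "(AA e None N (abs r) s x)^2 <= 1 * ?F x" using S0[of x] by simp
  also have "... <= ce * ?F x" using ce_pos S0[of x] by (intro mult_right_mono) auto
  finally show ?thesis unfolding sq unfolding None .
 next
  case (Some j)
  have "1 / e j <= (\<Sum>j\<in>UNIV. 1 / e j)" using e_pos by (intro member_le_sum) (auto simp: less_imp_le)
  then have ej: "1 / e j <= ce" by (simp add: ce_def)
  have "e j * (AA e (Some j) N (abs r) s x)^2 <= (\<Sum>j\<in>UNIV. e j * (AA e (Some j) N (abs r) s x)^2)"
   using e_pos by (intro member_le_sum mult_nonneg_nonneg) (auto simp: less_imp_le)
  then have "e j * (AA e (Some j) N (abs r) s x)^2 <= ?F x" by (simp add: add_increasing)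
  then have "(1 / e j) * (e j * (AA e (Some j) N (abs r) s x)^2) <= (1 / e j) * ?F x"
   using e_pos[of j] by (intro mult_left_mono) auto
  also have "... <= ce * ?F x" using ej S0[of x] by (intro mult_right_mono) auto
  finally show ?thesis using e_pos[of j] unfolding sq unfolding Some by simp
 qed
 have cF: "cts ?F" by (intro continuous_intros AA_cont_comp[OF N])
 have "(nnint x. (AA e b N r s x)^2) <= (nnlb x. ennreal ce * ennreal (?F x))"
 proof (intro nn_integral_mono)
  fix x show "ennreal ((AA e b N r s x)^2) <= ennreal ce * ennreal (?F x)"
   using ennreal_leI[OF b[of x]] ce_pos by (simp only: ennreal_mult' less_imp_le)
 qed
 also have "... = ennreal ce * (nnint x. ?F x)"
  by (rule nn_integral_cmult) (intro measurable_compose[OF _ measurable_ennreal] borel_measurable_continuous_onI2[OF cF])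
 also have "... <= ennreal ce * n2 N s" by (intro mult_left_mono AA_L2_sum_pos[OF N]) auto
 finally show ?thesis .
qed

end

section \<open>Dispersive bounds\<close>

definition HS :: "nat => (spacetime => real) => spacetime => real" where
 "HS k N z = (\<Sum>w | length w <= k. abs (Dx w N z))"

lemma finite_words: "finite {w :: 3 list. length w <= k}"
 using finite_lists_length_le[of "UNIV :: 3 set" k] by simp

lemma HS_cont: assumes "CX k N" shows "cts (HS k N)" unfolding HS_def[abs_def]
 by (intro continuous_intros CX_cont[of 0] CX_Dx'[OF assms]) simp

lemma HS_nonneg: "HS k N z >= 0" unfolding HS_def by (intro sum_nonneg) auto

lemma Dx_le_HS: "length w <= k ==> abs (Dx w N z) <= HS k N z"
 unfolding HS_def by (rule member_le_sum[of w _ "\<lambda>w. abs (Dx w N z)"]) (auto intro: finite_words)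

lemma HS_integral:
 assumes N: "CX k N" and M: "\<And>w. length w <= k ==> n1 (Dx w N) s <= ennreal M" "M >= 0"
 shows "(nnint x. HS k N (s, x)) <= ennreal (real (card {w :: 3 list. length w <= k}) * M)"
proof -
 have "(nnint x. HS k N (s, x)) = (nnlb x. (\<Sum>w | length w <= k. ennreal (abs (Dx w N (s, x)))))"
  unfolding HS_def by (intro nn_integral_cong) (simp add: sum_ennreal)
 also have "... = (\<Sum>w | length w <= k. n1 (Dx w N) s)" unfolding n1_def
 proof (rule nn_integral_sum)
  fix w :: "3 list" assume "w \<in> {w. length w <= k}"
  then have "CX 0 (Dx w N)" by (intro CX_Dx'[OF N]) simp
  from slice_measurable[OF CX_cont[OF this]]
  show "(\<lambda>x. ennreal (abs (Dx w N (s, x)))) \<in> borel_measurable lborel" by measurable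
 qed
 also have "... <= (\<Sum>w\<in>{w :: 3 list. length w <= k}. ennreal M)" by (intro sum_mono M) auto
 also have "... = ennreal (real (card {w :: 3 list. length w <= k}) * M)"
  using M(2) by (simp add: ennreal_mult ennreal_of_nat_eq_real_of_nat)
 finally show ?thesis .
qed

lemma ftc_abs:
 fixes F f :: "real => real"
 assumes F: "\<And>t. t \<in> {a..b} ==> DERIV F t :> f t" and f: "cts f" and ab: "a <= b"
 shows "ennreal (abs (F b - F a)) <= (nnlb t. ennreal (abs (f t)) * indicator {a..b} t)"
proof -
 have c: "isCont f x" for x using f by (simp add: continuous_on_eq_continuous_at)
 have eq: "(LINT x|lborel. f x * indicator {a..b} x) = F b - F a"
  by (rule integral_FTC_Icc_real[OF ab]) (use F c in auto)
 have "integrable lborel (\<lambda>x. indicator {a..b} x *R f x)"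
  using borel_integrable_compact[of "{a..b}" f] continuous_on_subset[OF f] by (simp add: indicator_def if_distrib cong: if_cong)
 then have "integrable lborel (\<lambda>x. f x * indicator {a..b} x)" by (simp add: mult.commute)
 from integral_norm_bound_ennreal[OF this]
 have "ennreal (abs (F b - F a)) <= (nnint x. abs (f x * indicator {a..b} x))" unfolding eq by simp
 also have "... = (nnlb t. ennreal (abs (f t)) * indicator {a..b} t)"
  by (intro nn_integral_cong) (auto simp: indicator_def)
 finally show ?thesis .
qed

lemma sum3_bound: fixes f :: "3 => real" assumes "\<And>i. abs (f i) <= B" shows "abs (\<Sum>i\<in>(UNIV::3 set). f i) <= 3 * B"
proof -
 have "abs (\<Sum>i\<in>(UNIV::3 set). f i) <= (\<Sum>i\<in>(UNIV::3 set). B)"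
  by (rule order_trans[OF sum_abs]) (intro sum_mono assms)
 then show ?thesis by simp
qed

context ellip
begin

text \<open>By Fubini and \<open>sph_polar\<close>, radial integrals against
  \<open>\<rho>^2\<close>, averaged over directions, are volume integrals. The constant does not
  depend on the shell.\<close>

lemma sphere_shell:
 "\<exists>C\<ge>0. \<forall>f x a b. cts f --> (\<forall>y. 0 <= f y) --> 0 <= a -->
  (\<integral>\<^sup>+w. (nnlb \<rho>. ennreal (\<rho>^2 * f (x + \<rho> *R w)) * indicator {a..b} \<rho>) \<partial>sph e)
   <= ennreal C * (nnint y. f y)"
proof -
 interpret S: pair_sigma_finite lborel "sph e"
  by (intro pair_sigma_finite.intro sigma_finite_lborel sigma_finite_measure_axioms)
 obtain C where C0: "C >= 0" and C1: "\<forall>f x. f \<in> borel_measurable borel -->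
  (nnlb \<rho>. (\<integral>\<^sup>+w. f (x + \<rho> *R w) \<partial>sph e) * pweight \<rho>) <= ennreal C * (nnlb y. f y)"
  using sph_polar[of e, OF e_pos] by (elim exE conjE)
 note C = C0 C1[rule_format]
 show ?thesis
 proof (intro exI[of _ C] conjI allI impI C(1))
  fix f :: "real^3 => real" and x and a b :: real
  assume f: "cts f" "\<forall>y. 0 <= f y" and a: "0 <= a"
  have [measurable]: "f \<in> borel_measurable borel" by (rule borel_measurable_continuous_onI[OF f(1)])
  have "(\<integral>\<^sup>+w. (nnlb \<rho>. ennreal (\<rho>^2 * f (x + \<rho> *R w)) * indicator {a..b} \<rho>) \<partial>sph e)
   = (nnlb \<rho>. (\<integral>\<^sup>+w. ennreal (\<rho>^2 * f (x + \<rho> *R w)) * indicator {a..b} \<rho> \<partial>sph e))"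
   by (rule S.Fubini') measurable
  also have "... <= (nnlb \<rho>. (\<integral>\<^sup>+w. ennreal (f (x + \<rho> *R w)) \<partial>sph e) * pweight \<rho>)"
  proof (rule nn_integral_mono)
   fix \<rho> :: real
   have "(\<integral>\<^sup>+w. ennreal (\<rho>^2 * f (x + \<rho> *R w)) * indicator {a..b} \<rho> \<partial>sph e)
    <= (\<integral>\<^sup>+w. ennreal (f (x + \<rho> *R w)) * pweight \<rho> \<partial>sph e)"
    by (rule nn_integral_mono) (use a f in \<open>auto simp: indicator_def ennreal_mult' mult.commute\<close>)
   also have "... = (\<integral>\<^sup>+w. ennreal (f (x + \<rho> *R w)) \<partial>sph e) * pweight \<rho>"
    by (rule nn_integral_multc) measurable
   finally show "(\<integral>\<^sup>+w. ennreal (\<rho>^2 * f (x + \<rho> *R w)) * indicator {a..b} \<rho> \<partial>sph e)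
    <= (\<integral>\<^sup>+w. ennreal (f (x + \<rho> *R w)) \<partial>sph e) * pweight \<rho>" .
  qed
  also have "... <= ennreal C * (nnint y. f y)" by (rule C(2)) measurable
  finally show "(\<integral>\<^sup>+w. (nnlb \<rho>. ennreal (\<rho>^2 * f (x + \<rho> *R w)) * indicator {a..b} \<rho>) \<partial>sph e)
   <= ennreal C * (nnint y. f y)" .
 qed
qed

abbreviation L1bd :: "nat => real => real => (spacetime => real) => bool" where
 "L1bd k M s N \<equiv> CX k N \<and> M >= 0 \<and> (\<forall>w. length w <= k --> n1 (Dx w N) s <= ennreal M)"

text \<open>Common frame of the two pointwise bounds below: whatever is dominated on each ray by a
  radial integral with the volume weight has a spherical mean controlled by L^1 norms of three
  derivatives.\<close>

lemma sphere_mean_le: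
 "\<exists>C\<ge>0. \<forall>N s M x a b Q h. L1bd 3 M s N --> 0 <= Q --> 0 <= a --> cts h --> (\<forall>w. norm w <= sph_rad e -->
   ennreal (abs (h w)) <= (nnlb \<rho>. ennreal (\<rho>^2 * (Q * HS 3 N (s, x + \<rho> *R w))) * indicator {a..b} \<rho>)) -->
   (LINT w|sph e. abs (h w)) <= C * (Q * M)"
proof -
 let ?c = "real (card {w :: 3 list. length w <= 3})"
 obtain C where C0: "C >= 0" and C1: "\<forall>f x a b. cts f --> (\<forall>y. 0 <= f y) --> 0 <= a -->
  (\<integral>\<^sup>+w. (nnlb \<rho>. ennreal (\<rho>^2 * f (x + \<rho> *R w)) * indicator {a..b} \<rho>) \<partial>sph e)
   <= ennreal C * (nnint y. f y)" using sphere_shell by (elim exE conjE)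
 show ?thesis
 proof (rule exI[of _ "C * ?c"], intro conjI allI impI, goal_cases)
  case (2 N s M x a b Q h)
  then have N3: "CX 3 N" and M: "M >= 0" "\<forall>w. length w <= 3 --> n1 (Dx w N) s <= ennreal M" and Q: "Q >= 0" by blast+
  have cH: "cts (\<lambda>y. Q * HS 3 N (s, y))"
   by (intro continuous_intros cts_comp[OF HS_cont[OF N3]])
  have "ennreal (LINT w|sph e. abs (h w)) = (\<integral>\<^sup>+w. ennreal (abs (h w)) \<partial>sph e)"
   by (rule nn_integral_eq_integral[symmetric]) (auto intro!: integrable_cont continuous_intros 2)
  also have "... <= (\<integral>\<^sup>+w. (nnlb \<rho>. ennreal (\<rho>^2 * (Q * HS 3 N (s, x + \<rho> *R w))) * indicator {a..b} \<rho>) \<partial>sph e)"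
   using AE_K 2(5) by (intro nn_integral_mono_AE) (auto elim!: eventually_mono)
  also have "... <= ennreal C * (nnint y. Q * HS 3 N (s, y))"
   by (rule C1[rule_format, where f="\<lambda>y. Q * HS 3 N (s, y)", OF cH]) (use Q HS_nonneg 2 in auto)
  also have "(nnint y. Q * HS 3 N (s, y)) = ennreal Q * (nnint y. HS 3 N (s, y))"
   using Q slice_measurable[OF HS_cont[OF N3], of s] by (simp add: ennreal_mult' nn_integral_cmult)
  also have "ennreal C * (ennreal Q * (nnint y. HS 3 N (s, y))) <= ennreal C * (ennreal Q * ennreal (?c * M))"
   using M by (intro mult_left_mono HS_integral[OF N3]) auto
  also have "... = ennreal (C * ?c * (Q * M))" using C0 Q M by (simp add: ennreal_mult[symmetric] mult_ac)
  finally show ?case by (subst (asm) ennreal_le_iff) (use C0 Q M in auto)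
 qed (use C0 in simp)
qed

lemma rad_pos: "sph_rad e >= 0"
 unfolding sph_rad_def using e_pos by (intro sum_nonneg) (auto simp: less_imp_le)

definition ray1 where "ray1 N s x w r = (\<Sum>i\<in>UNIV. w $ i * sd i N (s, x + r *R w))"
definition ray2 where "ray2 N s x w r = (\<Sum>i\<in>UNIV. w $ i * (\<Sum>j\<in>UNIV. w $ j * sd j (sd i N) (s, x + r *R w)))"
definition ray3 where "ray3 N s x w r = (\<Sum>i\<in>UNIV. w $ i * (\<Sum>j\<in>UNIV. w $ j * (\<Sum>k\<in>UNIV. w $ k * sd k (sd j (sd i N)) (s, x + r *R w))))"

lemma ray_deriv:
 assumes N: "CX (Suc (Suc (Suc 0))) N"
 shows "DERIV (\<lambda>r. N (s, x + r *R w)) r :> ray1 N s x w r"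
  "DERIV (ray1 N s x w) r :> ray2 N s x w r" "DERIV (ray2 N s x w) r :> ray3 N s x w r"
  "cts (ray1 N s x w)" "cts (ray2 N s x w)" "cts (ray3 N s x w)"
proof -
 have N1: "CX (Suc (Suc 0)) (sd i N)" for i by (rule CX_sd[OF N])
 have N2: "CX (Suc 0) (sd j (sd i N))" for i j by (rule CX_sd[OF N1])
 show "DERIV (\<lambda>r. N (s, x + r *R w)) r :> ray1 N s x w r"
  unfolding ray1_def by (rule CX_ray[OF N])
 show "DERIV (ray1 N s x w) r :> ray2 N s x w r"
  unfolding ray1_def[abs_def] ray2_def by (intro DERIV_sum DERIV_cmult CX_ray[OF N1])
 show "DERIV (ray2 N s x w) r :> ray3 N s x w r"
  unfolding ray2_def[abs_def] ray3_def by (intro DERIV_sum DERIV_cmult CX_ray[OF N2])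
 show "cts (ray1 N s x w)" "cts (ray2 N s x w)" "cts (ray3 N s x w)"
  unfolding ray1_def[abs_def] ray2_def[abs_def] ray3_def[abs_def]
  by (intro continuous_intros cts_comp[OF CX_cont_sd[OF N]] cts_comp[OF CX_cont_sd[OF N1]]
    cts_comp[OF CX_cont_sd[OF N2]])+
qed

lemma ray_bound:
 assumes w: "norm w <= sph_rad e" shows "abs (N (s, x + r *R w)) <= HS 3 N (s, x + r *R w)"
  "abs (ray1 N s x w r) <= 3 * sph_rad e * HS 3 N (s, x + r *R w)"
  "abs (ray2 N s x w r) <= 9 * (sph_rad e)^2 * HS 3 N (s, x + r *R w)"
  "abs (ray3 N s x w r) <= 27 * (sph_rad e)^3 * HS 3 N (s, x + r *R w)"
proof -
 let ?R = "sph_rad e"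
 let ?H = "HS 3 N (s, x + r *R w)"
 have wi: "abs (w $ i) <= ?R" for i using component_le_norm_cart[of w i] w by linarith
 have 0: "abs (w $ i * a) <= ?R * B" if "abs a <= B" for a B i
  unfolding abs_mult using wi[of i] that rad_pos by (intro mult_mono) auto
 have "abs (Dx [] N (s, x + r *R w)) <= ?H" by (rule Dx_le_HS) simp
 then show "abs (N (s, x + r *R w)) <= ?H" by simp
 have A: "abs (Dx [i] N (s, x + r *R w)) <= ?H" for i by (rule Dx_le_HS) simp
 have "abs (ray1 N s x w r) <= 3 * (?R * ?H)" unfolding ray1_def
  by (intro sum3_bound 0) (use A in \<open>simp add: Dx_Cons\<close>)
 then show "abs (ray1 N s x w r) <= 3 * ?R * ?H" by simp
 have A: "abs (Dx [j, i] N (s, x + r *R w)) <= ?H" for i j by (rule Dx_le_HS) simp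
 have "abs (ray2 N s x w r) <= 3 * (?R * (3 * (?R * ?H)))" unfolding ray2_def
  by (intro sum3_bound 0) (use A in \<open>simp add: Dx_Cons\<close>)
 then show "abs (ray2 N s x w r) <= 9 * ?R^2 * ?H" by (simp add: power2_eq_square)
 have A: "abs (Dx [k, j, i] N (s, x + r *R w)) <= ?H" for i j k by (rule Dx_le_HS) simp
 have "abs (ray3 N s x w r) <= 3 * (?R * (3 * (?R * (3 * (?R * ?H)))))" unfolding ray3_def
  by (intro sum3_bound 0) (use A in \<open>simp add: Dx_Cons\<close>)
 then show "abs (ray3 N s x w r) <= 27 * ?R^3 * ?H" by (simp add: power3_eq_cube)
qed

text \<open>Integrating \<open>\<rho>\<^sup>2\<close> times the third derivative of \<open>(1 - \<rho>)^3 N\<close> along rays recovers N at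
 the vertex; averaging over directions turns \<open>\<rho>\<^sup>2\<close> into the volume element.\<close>

lemma sup_bound:
 "\<exists>C\<ge>0. \<forall>N s M x. L1bd 3 M s N --> abs (N (s, x)) <= C * M"
proof -
 let ?R = "sph_rad e"
 obtain C where C0: "C >= 0" and C1: "\<forall>N s M x a b Q h. L1bd 3 M s N --> 0 <= Q --> 0 <= a --> cts h --> (\<forall>w. norm w <= ?R -->
   ennreal (abs (h w)) <= (nnlb \<rho>. ennreal (\<rho>^2 * (Q * HS 3 N (s, x + \<rho> *R w))) * indicator {a..b} \<rho>)) -->
   (LINT w|sph e. abs (h w)) <= C * (Q * M)" using sphere_mean_le by (elim exE conjE)
 define Q where "Q = 6 + 18 * (3 * ?R) + 9 * (9 * ?R^2) + 27 * ?R^3"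
 have Q: "Q >= 0" using rad_pos by (simp add: Q_def)
 show ?thesis
 proof (rule exI[of _ "C * Q"], rule conjI, use C0 Q in simp, intro allI impI)
  fix N s M x assume NM: "L1bd 3 M s N"
  then have N: "CX (Suc (Suc (Suc 0))) N" by (simp only: numeral_3_eq_3)
  have main: "ennreal (abs (2 * N (s, x))) <= (nnlb \<rho>. ennreal (\<rho>^2 * (Q * HS 3 N (s, x + \<rho> *R w))) * indicator {0..1} \<rho>)"
   if w: "norm w <= ?R" for w
  proof -
   define h0 where "h0 r = N (s, x + r *R w)" for r
   define h1 where "h1 = ray1 N s x w"
   define h2 where "h2 = ray2 N s x w"
   define h3 where "h3 = ray3 N s x w"
   note h = ray_deriv(1-3)[OF N, where s=s and x=x and w=w, folded h0_def h1_def h2_def h3_def]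
   note hc = ray_deriv(4-6)[OF N, where s=s and x=x and w=w, folded h1_def h2_def h3_def]
   note hb = ray_bound[OF w, where N=N and s=s and x=x, folded h0_def h1_def h2_def h3_def]
   have hc0: "cts h0"
    by (intro continuous_at_imp_continuous_on ballI) (use h(1) DERIV_isCont in blast)
   \<comment> \<open>Let \<open>g r = (1 - r)^3 * h0 r\<close>. Then \<open>f3\<close> is the third
     derivative of \<open>g\<close>, and \<open>F\<close> is \<open>r^2 g'' - 2 r g' + 2 g\<close>,
     whose derivative is \<open>r^2 g'''\<close>; moreover \<open>F 1 = 0\<close> and
     \<open>F 0 = 2 * N (s, x)\<close>.\<close>
   define f3 where "f3 r = (1 - r)^3 * h3 r - 9 * (1 - r)^2 * h2 r + 18 * (1 - r) * h1 r - 6 * h0 r" for r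
   define F where "F r = r^2 * ((1 - r)^3 * h2 r - 6 * (1 - r)^2 * h1 r + 6 * (1 - r) * h0 r)
    - 2 * r * ((1 - r)^3 * h1 r - 3 * (1 - r)^2 * h0 r) + 2 * ((1 - r)^3 * h0 r)" for r
   have dF: "DERIV F r :> r^2 * f3 r" for r
    unfolding F_def[abs_def] f3_def by (rule derivative_eq_intros h refl)+ (simp add: algebra_simps power2_eq_square power3_eq_cube)
   have cf: "cts (\<lambda>r. r^2 * f3 r)" unfolding f3_def by (intro continuous_intros hc hc0)
   have "ennreal (abs (F 1 - F 0)) <= (nnlb r. ennreal (abs (r^2 * f3 r)) * indicator {0..1} r)"
    by (rule ftc_abs[OF dF cf]) simp
   also have "... <= (nnlb r. ennreal (r^2 * (Q * HS 3 N (s, x + r *R w))) * indicator {0..1} r)"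
   proof (rule nn_integral_mono)
    fix r :: real
    have "abs (f3 r) <= Q * HS 3 N (s, x + r *R w)" if r: "r \<in> {0..1}"
    proof -
     have a: "abs ((1 - r)^k * y) <= abs y" for y and k :: nat
      unfolding abs_mult using r by (intro mult_left_le_one_le) (auto intro: power_le_one)
     have "abs (f3 r) <= abs ((1 - r)^3 * h3 r) + 9 * abs ((1 - r)^2 * h2 r) + 18 * abs ((1 - r)^1 * h1 r) + 6 * abs ((1 - r)^0 * h0 r)"
      unfolding f3_def mult.assoc power_one_right power_0 mult_1_left by linarith
     also have "... <= abs (h3 r) + 9 * abs (h2 r) + 18 * abs (h1 r) + 6 * abs (h0 r)"
      by (intro add_mono mult_left_mono a) auto
     also have "... <= 27 * ?R^3 * HS 3 N (s, x + r *R w) + 9 * (9 * ?R^2 * HS 3 N (s, x + r *R w))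
       + 18 * (3 * ?R * HS 3 N (s, x + r *R w)) + 6 * HS 3 N (s, x + r *R w)"
      by (intro add_mono mult_left_mono hb) auto
     also have "... = Q * HS 3 N (s, x + r *R w)" by (simp add: Q_def algebra_simps)
     finally show ?thesis .
    qed
    then show "ennreal (abs (r^2 * f3 r)) * indicator {0..1} r <= ennreal (r^2 * (Q * HS 3 N (s, x + r *R w))) * indicator {0..1} r"
     by (cases "r \<in> {0..1}") (auto simp: abs_mult intro!: ennreal_leI mult_left_mono)
   qed
   also have "abs (F 1 - F 0) = abs (2 * N (s, x))" by (simp add: F_def h0_def)
   finally show ?thesis .
  qed
  have "(LINT w|sph e. abs (2 * N (s, x))) <= C * (Q * M)"
   by (rule C1[THEN spec, THEN spec, THEN spec, THEN spec, THEN spec, THEN spec, THEN spec, THEN spec, THEN mp, THEN mp, THEN mp, THEN mp, THEN mp, OF NM Q, of 0 _ x 1])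
     (use main in auto)
  then show "abs (N (s, x)) <= C * Q * M" using abs_ge_zero[of "N (s, x)"] by (simp add: abs_mult mult.assoc)
 qed
qed

end

context ellip
begin

text \<open>For \<open>r <= 1\<close> the sup bound suffices. For \<open>r > 1\<close> the value at
  distance \<open>r\<close> is minus the increment of \<open>(r + 1 - \<rho>) * h0 \<rho>\<close>
  over the shell from \<open>r\<close> to \<open>r + 1\<close>, on which
  \<open>r^2 <= \<rho>^2\<close>; thus \<open>r^2\<close> times the mean is bounded by L^1
  norms.\<close>

lemma sphere_mean_bound:
 "\<exists>C\<ge>0. \<forall>N s M r x. L1bd 3 M s N --> (LINT w|sph e. abs (N (s, x + r *R w))) <= C * M / (1 + abs r)^2"
proof -
 let ?R = "sph_rad e"
 obtain C where C0: "C >= 0" and C1: "\<forall>N s M x a b Q h. L1bd 3 M s N --> 0 <= Q --> 0 <= a --> cts h --> (\<forall>w. norm w <= ?R -->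
   ennreal (abs (h w)) <= (nnlb \<rho>. ennreal (\<rho>^2 * (Q * HS 3 N (s, x + \<rho> *R w))) * indicator {a..b} \<rho>)) -->
   (LINT w|sph e. abs (h w)) <= C * (Q * M)" using sphere_mean_le by (elim exE conjE)
 obtain Cs where Cs0: "Cs >= 0" and Cs: "\<forall>N s M x. L1bd 3 M s N --> abs (N (s, x)) <= Cs * M"
  using sup_bound by (elim exE conjE)
 define Q where "Q = 1 + 3 * ?R"
 have Q: "Q >= 0" using rad_pos by (simp add: Q_def)
 \<comment> \<open>The factor 4 because \<open>(1 + r)^2\<close> is at most 4 for
   \<open>r <= 1\<close> and at most \<open>4 * r^2\<close> for \<open>r > 1\<close>.\<close>
 define B where "B = 4 * (Cs + C * Q)"
 have B: "B >= 0" unfolding B_def using C0 Cs0 Q by (intro mult_nonneg_nonneg add_nonneg_nonneg) auto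
 show ?thesis
 proof (intro exI[of _ B] conjI[OF B] allI impI)
  fix N s M r x assume NM: "L1bd 3 M s N"
  then have N: "CX (Suc (Suc (Suc 0))) N" and M: "M >= 0" by (simp_all only: numeral_3_eq_3)
  let ?I = "\<lambda>r. \<integral>w. abs (N (s, x + r *R w)) \<partial>sph e"
  have cN: "cts (\<lambda>w. abs (N (s, x + r *R w)))" for r
   by (intro continuous_intros cts_comp[OF CX_cont[OF N]])
  have pos: "?I r <= B * M / (1 + abs r)^2" if r: "r >= 0" for r
  proof (cases "r <= 1")
   case True
   have "?I r <= Cs * M * measure (sph e) UNIV"
    using integral_bound[OF cN[of r], of "Cs * M"] Cs NM by fastforce
   then have 1: "?I r <= Cs * M" by simp
   have r2: "(1 + abs r)^2 <= 4" using True r power_mono[of "1 + abs r" 2 2] by simp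
   have "Cs * M * (1 + abs r)^2 <= Cs * M * 4" using Cs0 M r2 by (intro mult_left_mono) auto
   also have "... <= B * M" unfolding B_def using C0 Q M by (simp add: algebra_simps)
   finally have "Cs * M <= B * M / (1 + abs r)^2" using r by (simp add: pos_le_divide_eq)
   with 1 show ?thesis by linarith
  next
   case False
   then have r1: "r > 1" by simp
   have main: "ennreal (abs (r^2 * N (s, x + r *R w))) <= (nnlb \<rho>. ennreal (\<rho>^2 * (Q * HS 3 N (s, x + \<rho> *R w))) * indicator {r..r+1} \<rho>)"
    if w: "norm w <= ?R" for w
   proof -
    define h0 where "h0 r = N (s, x + r *R w)" for r
    define h1 where "h1 = ray1 N s x w"
    define h2 where "h2 = ray2 N s x w"
    define h3 where "h3 = ray3 N s x w"
    note h = ray_deriv(1-3)[OF N, where s=s and x=x and w=w, folded h0_def h1_def h2_def h3_def]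
    note hc = ray_deriv(4-6)[OF N, where s=s and x=x and w=w, folded h1_def h2_def h3_def]
    note hb = ray_bound[OF w, where N=N and s=s and x=x, folded h0_def h1_def h2_def h3_def]
    have hc0: "cts h0"
     by (intro continuous_at_imp_continuous_on ballI) (use h(1) DERIV_isCont in blast)
    define F where "F \<rho> = r^2 * ((r + 1 - \<rho>) * h0 \<rho>)" for \<rho>
    define f where "f \<rho> = r^2 * ((r + 1 - \<rho>) * h1 \<rho> - h0 \<rho>)" for \<rho>
    have p1: "DERIV (\<lambda>\<rho>::real. r + 1 - \<rho>) \<rho> :> (- 1)" for \<rho>
     by (auto intro!: derivative_eq_intros)
    have dF: "DERIV F \<rho> :> f \<rho>" for \<rho> unfolding F_def[abs_def] f_def
     by (rule DERIV_cong[OF DERIV_cmult[OF DERIV_mult[OF p1 h(1)]]]) (simp add: algebra_simps)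
    have cf: "cts f" unfolding f_def[abs_def] by (intro continuous_intros hc hc0)
    have "ennreal (abs (F (r+1) - F r)) <= (nnlb \<rho>. ennreal (abs (f \<rho>)) * indicator {r..r+1} \<rho>)"
     by (rule ftc_abs[OF dF cf]) simp
    also have "... <= (nnlb \<rho>. ennreal (\<rho>^2 * (Q * HS 3 N (s, x + \<rho> *R w))) * indicator {r..r+1} \<rho>)"
    proof (rule nn_integral_mono)
     fix \<rho> :: real
     have "abs (f \<rho>) <= \<rho>^2 * (Q * HS 3 N (s, x + \<rho> *R w))" if \<rho>: "\<rho> \<in> {r..r+1}"
     proof -
      have "abs ((r + 1 - \<rho>) * h1 \<rho>) <= abs (h1 \<rho>)"
       unfolding abs_mult using \<rho> by (intro mult_left_le_one_le) auto
      then have "abs ((r + 1 - \<rho>) * h1 \<rho> - h0 \<rho>) <= abs (h1 \<rho>) + abs (h0 \<rho>)" by linarith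
      also have "... <= 3 * ?R * HS 3 N (s, x + \<rho> *R w) + HS 3 N (s, x + \<rho> *R w)"
       by (intro add_mono hb)
      also have "... = Q * HS 3 N (s, x + \<rho> *R w)" by (simp add: Q_def algebra_simps)
      finally have "abs (f \<rho>) <= r^2 * (Q * HS 3 N (s, x + \<rho> *R w))"
       unfolding f_def abs_mult by (intro mult_mono) auto
      also have "... <= \<rho>^2 * (Q * HS 3 N (s, x + \<rho> *R w))"
       using \<rho> r Q HS_nonneg by (intro mult_right_mono power_mono mult_nonneg_nonneg) auto
      finally show ?thesis .
     qed
     then show "ennreal (abs (f \<rho>)) * indicator {r..r+1} \<rho> <= ennreal (\<rho>^2 * (Q * HS 3 N (s, x + \<rho> *R w))) * indicator {r..r+1} \<rho>"
      by (cases "\<rho> \<in> {r..r+1}") (auto intro!: ennreal_leI)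
    qed
    also have "abs (F (r+1) - F r) = abs (r^2 * N (s, x + r *R w))" by (simp add: F_def h0_def)
    finally show ?thesis .
   qed
   have "cts (\<lambda>w. r^2 * N (s, x + r *R w))"
    by (intro continuous_intros cts_comp[OF CX_cont[OF N]])
   then have "(LINT w|sph e. abs (r^2 * N (s, x + r *R w))) <= C * (Q * M)"
    using main by (intro C1[THEN spec, THEN spec, THEN spec, THEN spec, THEN spec, THEN spec, THEN spec, THEN spec, THEN mp, THEN mp, THEN mp, THEN mp, THEN mp, OF NM Q r, of _ x "r+1"]) auto
   then have A: "r^2 * ?I r <= C * (Q * M)" by (simp add: abs_mult)
   have "(1 + abs r)^2 <= (2 * r)^2" using r1 by (intro power_mono) auto
   then have r2: "(1 + abs r)^2 <= 4 * r^2" by (simp add: power_mult_distrib)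
   have "?I r * (1 + abs r)^2 <= ?I r * (4 * r^2)" by (rule mult_left_mono[OF r2]) simp
   also have "... = 4 * (r^2 * ?I r)" by simp
   also have "... <= 4 * (C * (Q * M))" using A by simp
   also have "... <= B * M" unfolding B_def using Cs0 M by (simp add: algebra_simps)
   finally show ?thesis using r by (simp add: pos_le_divide_eq)
  qed
  show "?I r <= B * M / (1 + abs r)^2"
  proof (cases "r >= 0")
   case True then show ?thesis by (rule pos)
  next
   case False
   have "(LINT w|sph e. abs (N (s, x + (- r) *R (- w)))) = (LINT w|sph e. abs (N (s, x + (- r) *R w)))"
    by (rule integral_sph_uminus) (rule borel_measurable_continuous_onI[OF cN])
   with pos[of "- r"] False show ?thesis by simp
  qed
 qed
qed

text \<open>The spherical means decay like \<open>(1 + r)^(-2)\<close>, and the factor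
  \<open>r\<close> in Kirchhoff's formula uses up one power. The fourth derivative is the one that
  \<open>AA\<close> puts on \<open>N\<close>.\<close>

lemma AA_TT_sup:
 "\<exists>C\<ge>0. \<forall>N s M. L1bd 4 M s N -->
  (\<forall>r x. abs (TT e N r s x) <= C * M / (1 + abs r) \<and> (\<forall>b. abs (AA e b N r s x) <= C * M / (1 + abs r)))"
proof -
 let ?R = "sph_rad e"
 obtain C where C: "C >= 0" "\<forall>N s M r x. L1bd 3 M s N --> (LINT w|sph e. abs (N (s, x + r *R w))) <= C * M / (1 + abs r)^2"
  using sphere_mean_bound by (elim exE conjE)
 define B where "B = C * (1 + 3 * ?R)"
 have B: "B >= 0" "C <= B" unfolding B_def using C(1) rad_pos by (auto simp: algebra_simps)
 show ?thesis
 proof (intro exI[of _ B] conjI allI impI B)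
  fix N s x and M r :: real assume NM: "L1bd 4 M s N"
  then have N4: "CX (Suc 3) N" and M: "M >= 0" "\<forall>w. length w <= 4 --> n1 (Dx w N) s <= ennreal M" by (simp_all del: CD.simps)
  have N': "L1bd 3 M s N" using M CD_Suc_lower[OF N4] by auto
  have Nj: "L1bd 3 M s (sd j N)" for j
  proof (intro conjI M(1) CX_sd[OF N4] allI impI)
   fix w :: "3 list" assume w: "length w <= 3"
   have "Dx w (sd j N) = Dx (w @ [j]) N" by (simp add: Dx_append Dx_Cons)
   then show "n1 (Dx w (sd j N)) s <= ennreal M" using M(2) w by simp
  qed
  let ?q = "1 / (1 + abs r)"
  have q: "abs r * (1 / (1 + abs r)^2) <= ?q" "1 / (1 + abs r)^2 <= ?q"
   by (auto simp: field_simps power2_eq_square add_pos_nonneg)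
  have S: "abs (SW e g P r s x) <= D * (C * M * (1 / (1 + abs r)^2))"
   if P: "L1bd 3 M s P" and g: "cts g" "\<And>w. norm w <= ?R ==> abs (g w) <= D" and D: "D >= 0"
   for P g D
  proof -
   have cP: "cts (\<lambda>w. P (s, x + r *R w))"
    by (intro continuous_intros cts_comp[OF CX_cont[OF conjunct1[OF P]]])
   have "abs (SW e g P r s x) <= (LINT w|sph e. abs (g w * P (s, x + r *R w)))"
    unfolding SW_def by (rule integral_abs_bound)
   also have "... <= (LINT w|sph e. D * abs (P (s, x + r *R w)))"
   proof (rule integral_mono_AE)
    show "AE w in sph e. abs (g w * P (s, x + r *R w)) <= D * abs (P (s, x + r *R w))"
     using AE_K by (rule eventually_mono) (auto simp: abs_mult intro!: mult_right_mono g(2))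
   qed (auto intro!: integrable_cont continuous_intros cP g(1))
   also have "... = D * (LINT w|sph e. abs (P (s, x + r *R w)))" by simp
   also have "... <= D * (C * M / (1 + abs r)^2)"
    by (rule mult_left_mono[OF C(2)[rule_format, OF P] D])
   finally show ?thesis by simp
  qed
  have CM: "C * M >= 0" using C(1) M(1) by simp
  have T: "abs (r * SW e (\<lambda>_. 1) P r s x) <= C * M * ?q"
   if P: "L1bd 3 M s P" for P
  proof -
   have "abs (r * SW e (\<lambda>_. 1) P r s x) <= abs r * (1 * (C * M * (1 / (1 + abs r)^2)))"
    unfolding abs_mult by (intro mult_left_mono S P) auto
   also have "... = C * M * (abs r * (1 / (1 + abs r)^2))" by simp
   also have "... <= C * M * ?q" by (rule mult_left_mono[OF q(1) CM])
   finally show ?thesis .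
  qed
  have CB: "C * M * ?q <= B * M / (1 + abs r)"
   using mult_right_mono[OF mult_right_mono[OF B(2) M(1)], of ?q] by simp
  show "abs (TT e N r s x) <= B * M / (1 + abs r)" unfolding TT_def using T[OF N'] CB by linarith
  fix b
  show "abs (AA e b N r s x) <= B * M / (1 + abs r)"
  proof (cases b)
   case (Some j)
   show ?thesis unfolding Some AA.simps using T[OF Nj[of j]] CB by linarith
  next
   case None
   let ?p = "1 / (1 + abs r)^2"
   have "abs (\<Sum>j\<in>UNIV. SW e (\<lambda>w. w $ j) (sd j N) r s x) <= 3 * (?R * (C * M * ?p))"
   proof (intro sum3_bound S Nj rad_pos)
    fix j :: 3 and w :: "real^3" assume "norm w <= ?R"
    then show "abs (w $ j) <= ?R" using component_le_norm_cart[of w j] by linarith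
   qed (intro continuous_intros)
   then have "abs r * abs (\<Sum>j\<in>UNIV. SW e (\<lambda>w. w $ j) (sd j N) r s x) <= abs r * (3 * (?R * (C * M * ?p)))"
    by (rule mult_left_mono) simp
   also have "... = (3 * ?R * (C * M)) * (abs r * ?p)" by simp
   also have "... <= (3 * ?R * (C * M)) * ?q" using CM rad_pos by (intro mult_left_mono q(1)) auto
   finally have 1: "abs (r * (\<Sum>j\<in>UNIV. SW e (\<lambda>w. w $ j) (sd j N) r s x)) <= (3 * ?R * (C * M)) * ?q"
    unfolding abs_mult .
   have "abs (SW e (\<lambda>_. 1) N r s x) <= 1 * (C * M * ?p)" by (intro S N') auto
   also have "... <= C * M * ?q" using mult_left_mono[OF q(2) CM] by simp
   finally have "abs (AA e None N r s x) <= C * M * ?q + (3 * ?R * (C * M)) * ?q"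
    unfolding AA.simps using 1 by linarith
   also have "... = B * M / (1 + abs r)" by (simp add: B_def algebra_simps add_divide_distrib)
   finally show ?thesis unfolding None .
  qed
 qed
qed

end

section \<open>The Duhamel operator\<close>

context cmeas begin

lemma Tonelli_param:
 fixes g :: "'b => real^3 => real"
 assumes g: "cts (\<lambda>p. g (fst p) (snd p))" and g0: "\<And>\<theta> x. g \<theta> x >= 0"
 shows "(nnint x. \<integral>\<theta>. g \<theta> x \<partial>\<mu>) = (\<integral>\<^sup>+\<theta>. (nnint x. g \<theta> x) \<partial>\<mu>)"
proof -
 interpret S: pair_sigma_finite \<mu> "lborel :: (real^3) measure"
  by (intro pair_sigma_finite.intro sigma_finite_lborel sigma_finite_measure_axioms)
 have "(\<lambda>p. g (fst p) (snd p)) \<in> borel_measurable (borel \<Otimes>\<^sub>M borel)"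
  using borel_measurable_continuous_onI[OF g] by (simp add: borel_prod)
 then have m[measurable]: "(\<lambda>(\<theta>, x). g \<theta> x) \<in> borel_measurable (\<mu> \<Otimes>\<^sub>M lborel)"
  by (simp add: case_prod_beta' cong: measurable_cong_sets sets_pair_measure_cong add: sets_mu)
 have c: "cts (\<lambda>\<theta>. g \<theta> x)" for x
  using cts_comp[OF g, of UNIV "\<lambda>\<theta>. (\<theta>, x)"] by (simp add: continuous_on_Pair)
 have "(nnint x. \<integral>\<theta>. g \<theta> x \<partial>\<mu>) = (nnlb x. (\<integral>\<^sup>+\<theta>. ennreal (g \<theta> x) \<partial>\<mu>))"
  by (intro nn_integral_cong nn_integral_eq_integral[symmetric] integrable_cont c) (simp add: g0)
 also have "... = (\<integral>\<^sup>+\<theta>. (nnint x. g \<theta> x) \<partial>\<mu>)"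
  by (rule S.Fubini') measurable
 finally show ?thesis .
qed

lemma integral_nonneg_cont: "(\<And>w. (h w :: real) >= 0) ==> (LINT w|\<mu>. h w) >= 0"
 by (rule Bochner_Integration.integral_nonneg) auto

text \<open>Cauchy-Schwarz with weight \<open>W\<close>: the integral of
  \<open>(h w - c * W w)^2 / W w\<close> is a nonnegative quadratic polynomial in
  \<open>c\<close>.\<close>

lemma weighted_square:
 fixes h W :: "'b => real"
 assumes h: "cts h" and W: "cts W" "\<And>w. W w > 0"
 shows "(LINT w|\<mu>. h w)^2 <= (LINT w|\<mu>. W w) * (LINT w|\<mu>. (h w)^2 / W w)"
proof -
 define I where "I = (LINT w|\<mu>. h w)"
 define A where "A = (LINT w|\<mu>. W w)"
 define B where "B = (LINT w|\<mu>. (h w)^2 / W w)"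
 have W0: "W w \<noteq> 0" for w using W(2)[of w] by simp
 have A0: "A >= 0" unfolding A_def by (rule integral_nonneg_cont) (simp add: W(2) less_imp_le)
 have c2: "cts (\<lambda>w. (h w)^2 / W w)" using W0 by (intro continuous_intros h W) auto
 have q: "0 <= B - 2 * c * I + c^2 * A" for c
 proof -
  have "0 <= (LINT w|\<mu>. (h w)^2 / W w - 2 * c * h w + c^2 * W w)"
  proof (rule integral_nonneg_cont)
   fix w
   have "(h w)^2 / W w - 2 * c * h w + c^2 * W w = (h w - c * W w)^2 / W w"
    using W0[of w] by (simp add: field_simps power2_eq_square)
   then show "0 <= (h w)^2 / W w - 2 * c * h w + c^2 * W w" using W(2)[of w] by simp
  qed
  also have "... = B - 2 * c * I + c^2 * A"
   unfolding B_def I_def A_def by (simp add: integrable_cont h W(1) c2 continuous_intros)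
  finally show ?thesis .
 qed
 have "I^2 <= A * B"
 proof (cases "A = 0")
  case True
  have "I = 0"
  proof (rule ccontr)
   assume I: "I \<noteq> 0"
   \<comment> \<open>For \<open>A = 0\<close> the polynomial is affine in \<open>c\<close>; this
     \<open>c\<close> makes it equal to -1.\<close>
   have "0 <= B - 2 * ((B + 1) / (2 * I)) * I + ((B + 1) / (2 * I))^2 * A" by (rule q)
   also have "... = - 1" using I True by (simp add: field_simps)
   finally show False by simp
  qed
  then show ?thesis using True by simp
 next
  case False
  have "0 <= A * (B - 2 * (I / A) * I + (I / A)^2 * A)" using A0 q[of "I / A"] by simp
  also have "... = A * B - I^2" using False by (simp add: field_simps power2_eq_square)
  finally show ?thesis by simp
 qed
 then show ?thesis by (simp add: I_def A_def B_def)
qed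

lemma weighted_fourth:
 fixes h W :: "'b => real"
 assumes h: "cts h" and W: "cts W" "\<And>w. W w > 0"
 shows "(LINT w|\<mu>. h w)^4 <= (LINT w|\<mu>. W w)^3 * (LINT w|\<mu>. (h w)^4 / (W w)^3)"
proof -
 let ?A = "\<integral>w. W w \<partial>\<mu>"
 have W0: "W w \<noteq> 0" for w using W(2)[of w] by simp
 have A0: "?A >= 0" by (rule integral_nonneg_cont) (simp add: W(2) less_imp_le)
 have c2: "cts (\<lambda>w. (h w)^2 / W w)" using W0 by (intro continuous_intros h W) auto
 have "(LINT w|\<mu>. h w)^4 = ((LINT w|\<mu>. h w)^2)^2" by simp
 also have "... <= (?A * (LINT w|\<mu>. (h w)^2 / W w))^2"
  by (rule power_mono[OF weighted_square[OF h W]]) simp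
 also have "... = ?A^2 * (LINT w|\<mu>. (h w)^2 / W w)^2" by (simp add: power_mult_distrib)
 also have "... <= ?A^2 * (?A * (LINT w|\<mu>. ((h w)^2 / W w)^2 / W w))"
  by (rule mult_left_mono[OF weighted_square[OF c2 W]]) simp
 also have "... = ?A^3 * (LINT w|\<mu>. (h w)^4 / (W w)^3)"
  by (simp add: power_divide power2_eq_square power3_eq_cube power4_eq_xxxx mult.assoc)
 finally show ?thesis .
qed

end

section \<open>Time integration of the kernel bounds\<close>

lemma lam_measure [simp]: "measure lam UNIV = 1" by (simp add: lam_def measure_def emeasure_density)

lemma lam_integral_mono:
 fixes f g :: "real => real"
 assumes "cts f" "cts g" "\<And>\<theta>. 0 <= \<theta> ==> \<theta> <= 1 ==> f \<theta> <= g \<theta>"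
 shows "(LINT \<theta>|lam. f \<theta>) <= (LINT \<theta>|lam. g \<theta>)"
 by (rule integral_mono_AE[OF lam.integrable_cont[OF assms(1)] lam.integrable_cont[OF assms(2)]],
   rule eventually_mono[OF lam.AE_K]) (simp add: assms(3))

lemma lam_nn_mono:
 assumes "\<And>\<theta>. 0 <= \<theta> ==> \<theta> <= 1 ==> f \<theta> <= g \<theta>"
 shows "(\<integral>\<^sup>+\<theta>. f \<theta> \<partial>lam) <= (\<integral>\<^sup>+\<theta>. g \<theta> \<partial>lam)"
 by (rule nn_integral_mono_AE, rule eventually_mono[OF lam.AE_K]) (simp add: assms)

lemma sets_lam [measurable_cong]: "sets lam = sets borel" by (rule lam.sets_mu)

text \<open>Stands in for Minkowski's integral inequality. The bounds \<open>W \<theta>\<close> on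
  the L^p norms of the slices are known in advance, so Hoelder with the weight \<open>W\<close> and
  Tonelli give the integral of \<open>W\<close> as a bound for the norm of the integral. Dividing by
  powers of \<open>W\<close> is the reason for the strict positivity.\<close>

lemma weighted_Minkowski:
 fixes H :: "real => real^3 => real" and p :: nat
 assumes p: "p = 2 \<or> p = 4"
  and H: "cts (\<lambda>z. H (fst z) (snd z))" and W: "cts W" "\<And>\<theta>. W \<theta> > 0"
  and K: "K >= 0" and b: "\<And>\<theta>. 0 <= \<theta> ==> \<theta> <= 1 ==> (nnint x. H \<theta> x ^ p) <= ennreal (K * W \<theta> ^ p)"
  and A: "(LINT \<theta>|lam. W \<theta>) <= A"
 shows "(nnint x. (LINT \<theta>|lam. H \<theta> x) ^ p) <= ennreal (K * A ^ p)"
proof -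
 let ?I = "\<integral>\<theta>. W \<theta> \<partial>lam"
 obtain q where q: "p = Suc q" "even p" using p by (cases p) auto
 have W0: "W \<theta> \<noteq> 0" for \<theta> using W(2)[of \<theta>] by simp
 have I0: "?I >= 0" by (rule lam.integral_nonneg_cont) (simp add: W(2) less_imp_le)
 define g where "g \<theta> x = H \<theta> x ^ p / W \<theta> ^ q" for \<theta> x
 have cg: "cts (\<lambda>z. g (fst z) (snd z))"
  unfolding g_def using W0 by (intro continuous_intros H cts_comp[OF W(1)]) auto
 have g0: "g \<theta> x >= 0" for \<theta> x
  unfolding g_def by (rule divide_nonneg_nonneg[OF zero_le_even_power[OF q(2)]]) (simp add: W(2) less_imp_le)
 have cH: "cts (\<lambda>\<theta>. H \<theta> x)" for x
  using cts_comp[OF H, of UNIV "\<lambda>\<theta>. (\<theta>, x)"] by (simp add: continuous_on_Pair)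
 have pt: "(LINT \<theta>|lam. H \<theta> x) ^ p <= ?I ^ q * (LINT \<theta>|lam. g \<theta> x)" for x
  using p
 proof
  assume p2: "p = 2"
  then have q1: "q = 1" using q(1) by simp
  show ?thesis
   using lam.weighted_square[OF cH W, of x] unfolding g_def q1 p2 by (simp only: power_one_right)
 next
  assume p2: "p = 4"
  then have q1: "q = 3" using q(1) by simp
  show ?thesis using lam.weighted_fourth[OF cH W, of x] unfolding g_def q1 p2 .
 qed
 have G0: "(LINT \<theta>|lam. g \<theta> x) >= 0" for x by (rule lam.integral_nonneg_cont) (rule g0)
 have cG: "cts (\<lambda>x. \<integral>\<theta>. g \<theta> x \<partial>lam)"
  by (rule lam.continuous_param) (rule cts_comp[OF cg, of _ "\<lambda>p. (snd p, fst p)", simplified], intro continuous_intros)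
 have "(nnint x. (LINT \<theta>|lam. H \<theta> x) ^ p) <= (nnlb x. ennreal (?I ^ q) * ennreal (LINT \<theta>|lam. g \<theta> x))"
  by (rule nn_integral_mono) (use pt I0 G0 in \<open>simp add: ennreal_mult[symmetric] ennreal_leI\<close>)
 also have "... = ennreal (?I ^ q) * (nnint x. \<integral>\<theta>. g \<theta> x \<partial>lam)"
  by (rule nn_integral_cmult) (rule cts_ennreal[OF cG])
 also have "(nnint x. \<integral>\<theta>. g \<theta> x \<partial>lam) = (\<integral>\<^sup>+\<theta>. (nnint x. g \<theta> x) \<partial>lam)"
  by (rule lam.Tonelli_param[OF cg g0])
 also have "... <= (\<integral>\<^sup>+\<theta>. ennreal (K * W \<theta>) \<partial>lam)"
 proof (rule lam_nn_mono)
  fix \<theta> :: real assume \<theta>: "0 <= \<theta>" "\<theta> <= 1"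
  have cs: "cts (H \<theta>)" by (rule continuous_slice[OF H])
  have m: "(\<lambda>x. ennreal (H \<theta> x ^ p)) \<in> borel_measurable lborel"
   by (rule cts_ennreal) (intro continuous_intros cs)
  have Wq: "W \<theta> ^ q > 0" using W(2)[of \<theta>] by simp
  have "(nnint x. g \<theta> x) = (nnlb x. ennreal (1 / W \<theta> ^ q) * ennreal (H \<theta> x ^ p))"
   by (rule nn_integral_cong) (use Wq in \<open>simp add: g_def ennreal_mult'[symmetric]\<close>)
  also have "... = ennreal (1 / W \<theta> ^ q) * (nnint x. H \<theta> x ^ p)"
   by (rule nn_integral_cmult[OF m])
  also have "... <= ennreal (1 / W \<theta> ^ q) * ennreal (K * W \<theta> ^ p)"
   by (rule mult_left_mono[OF b[OF \<theta>]]) simp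
  also have "... = ennreal (K * W \<theta>)"
   using Wq W0[of \<theta>] by (simp add: ennreal_mult'[symmetric] q(1))
  finally show "(nnint x. g \<theta> x) <= ennreal (K * W \<theta>)" .
 qed
 also have "(\<integral>\<^sup>+\<theta>. ennreal (K * W \<theta>) \<partial>lam) = ennreal (LINT \<theta>|lam. K * W \<theta>)"
  by (rule nn_integral_eq_integral) (use K W in \<open>auto intro!: lam.integrable_cont continuous_intros simp: less_imp_le\<close>)
 also have "(LINT \<theta>|lam. K * W \<theta>) = K * ?I" by simp
 also have "ennreal (?I ^ q) * ennreal (K * ?I) = ennreal (K * ?I ^ p)"
  using I0 K by (simp add: ennreal_mult'[symmetric] q(1) mult_ac)
 also have "... <= ennreal (K * A ^ p)"
  using K I0 A by (intro ennreal_leI mult_left_mono power_mono) auto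
 finally show ?thesis by (simp add: mult_left_mono)
qed

text \<open>An integrable majorant. The exponent 5/4 is the power of 1 + s left in the L^4 estimate:
  1/2 from the square root of the sup bound 1/((1+r)(1+s)), and 3/4 from the square root of the L^2
  bound (1+s)^(-3/2).\<close>

definition kap :: "real => real" where "kap s = (1 + abs s) powr (-5/4)"

lemma kap_pos: "kap s > 0" and kap_cont: "continuous_on S f ==> continuous_on S (\<lambda>x. kap (f x))"
 by (auto simp: kap_def intro!: continuous_intros)

lemma kap_FTC:
 assumes "a >= 0" "a + T >= 0"
 shows "(LINT \<theta>|lam. T * kap (a + T * \<theta>)) = 4 * (1 + a) powr (-1/4) - 4 * (1 + (a + T)) powr (-1/4)"
proof -
 have "DERIV (\<lambda>\<theta>. - 4 * (1 + (a + T * \<theta>)) powr (-1/4)) \<theta> :> T * kap (a + T * \<theta>)" if "0 <= \<theta>" "\<theta> <= 1" for \<theta>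
 proof -
  have "a + T * \<theta> >= 0"
   using mult_nonneg_nonneg[of "1 - \<theta>" a] mult_nonneg_nonneg[of \<theta> "a + T"] that assms by (simp add: algebra_simps)
  then show ?thesis by (auto intro!: derivative_eq_intros simp: kap_def)
 qed
 from lam_FTC[OF this] show ?thesis by (simp add: continuous_intros kap_cont)
qed

lemma kap_integral:
 assumes t: "t >= 0"
 shows "(LINT \<theta>|lam. t * kap (t * \<theta>)) <= 4" "(LINT \<theta>|lam. t * kap (t * (1 - \<theta>))) <= 4"
proof -
 show "(LINT \<theta>|lam. t * kap (t * \<theta>)) <= 4" using kap_FTC[of 0 t] t by simp
 have "- 4 <= (LINT \<theta>|lam. - t * kap (t + - t * \<theta>))" using t by (subst kap_FTC) simp_all
 then show "(LINT \<theta>|lam. t * kap (t * (1 - \<theta>))) <= 4" by (simp add: right_diff_distrib)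
qed

text \<open>Any exponent between 1/2 and 1 is slower than the linear rate by enough to absorb the
  logarithm of the Duhamel integral; with 3/4 the majorant is again \<open>kap\<close>.\<close>

definition dec :: "real => real" where "dec t = (1 + abs t) powr (-3/4)"

text \<open>The larger number \<open>d\<close> is at least (1 + t)/2: the power \<open>s\<close> of
  it yields the decay, and its remaining power is moved to \<open>c\<close>.\<close>

lemma powr_kernel_ordered:
 fixes c d :: real
 assumes c: "1 <= c" "c <= d" and t: "0 <= t" "1 + t <= 2 * d" and s: "0 <= s" "s <= 1" and p: "p <= 5/4" "p + q = s + 5/4"
 shows "c powr - p * d powr - q <= 2 * (1 + t) powr - s * c powr (-5/4)"
proof -
 have "d powr - s <= ((1 + t) / 2) powr - s" using c t s by (intro powr_mono2') auto
 also have "... = 2 powr s * (1 + t) powr - s" using t by (simp add: powr_divide powr_minus field_simps)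
 also have "... <= 2 * (1 + t) powr - s" using powr_mono[of s 1 2] s by (intro mult_right_mono) auto
 finally have d: "d powr - s <= 2 * (1 + t) powr - s" .
 have "- q = - s + (p - 5/4)" using p(2) by simp
 then have "c powr - p * d powr - q = c powr - p * (d powr - s * d powr (p - 5/4))"
  unfolding powr_add[symmetric] by simp
 also have "... <= c powr - p * ((2 * (1 + t) powr - s) * c powr (p - 5/4))"
  using c p by (intro mult_left_mono mult_mono d powr_mono2') auto
 also have "... = 2 * (1 + t) powr - s * (c powr - p * c powr (p - 5/4))" by (simp only: mult_ac)
 also have "c powr - p * c powr (p - 5/4) = c powr (-5/4)" by (simp add: powr_add[symmetric])
 finally show ?thesis .
qed

text \<open>Used with \<open>a\<close> = 1 + source time and \<open>b\<close> = 1 + elapsed time,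
  whose sum is at least 1 + t. The kernels split into decay in t times a sum of functions integrable
  in the source time, whichever of the two times is the larger.\<close>

lemma powr_kernel:
 fixes a b :: real
 assumes a: "a >= 1" "b >= 1" and t: "t >= 0" "1 + t <= a + b"
 shows "1 / (a * b) <= 2 * (1 + t) powr (-3/4) * (a powr (-5/4) + b powr (-5/4))"
  and "b powr (-1/2) * a powr (-5/4) <= 2 * (1 + t) powr (-1/2) * (a powr (-5/4) + b powr (-5/4))"
proof -
 have K: "a powr - p * b powr - q <= 2 * (1 + t) powr - s * (a powr (-5/4) + b powr (-5/4))"
  if s: "0 <= s" "s <= 1" and p: "p <= 5/4" "q <= 5/4" "p + q = s + 5/4" for p q s
 proof (cases "a <= b")
  case True
  have "a powr - p * b powr - q <= 2 * (1 + t) powr - s * a powr (-5/4)"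
   using True a t s p by (intro powr_kernel_ordered) auto
  also have "... <= 2 * (1 + t) powr - s * (a powr (-5/4) + b powr (-5/4))" by (rule mult_left_mono) simp_all
  finally show ?thesis .
 next
  case False
  have "b powr - q * a powr - p <= 2 * (1 + t) powr - s * b powr (-5/4)"
   using False a t s p by (intro powr_kernel_ordered) auto
  also have "... <= 2 * (1 + t) powr - s * (a powr (-5/4) + b powr (-5/4))" by (rule mult_left_mono) simp_all
  finally show ?thesis by (simp only: mult.commute)
 qed
 have "1 / (a * b) = a powr - 1 * b powr - 1" using a by (simp add: powr_minus field_simps)
 with K[of "3/4" 1 1] show "1 / (a * b) <= 2 * (1 + t) powr (-3/4) * (a powr (-5/4) + b powr (-5/4))" by simp
 show "b powr (-1/2) * a powr (-5/4) <= 2 * (1 + t) powr (-1/2) * (a powr (-5/4) + b powr (-5/4))"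
  using K[of "1/2" "5/4" "1/2"] by (simp add: mult.commute)
qed

lemma n_scale_square:
 assumes u: "cts u" shows "(nnint x. (c * u x)^2) = ennreal (c^2) * (nnint x. (u (x::real^3))^2)"
proof -
 have "(nnint x. (c * u x)^2) = (nnlb x. ennreal (c^2) * ennreal ((u x)^2))"
  by (rule nn_integral_cong) (simp add: power_mult_distrib ennreal_mult)
 also have "... = ennreal (c^2) * (nnint x. (u x)^2)"
  by (rule nn_integral_cmult) (rule cts_ennreal, intro continuous_intros u)
 finally show ?thesis .
qed

lemma fourth_le_sup_square:
 assumes u: "cts u" and S: "\<And>x. abs (u x) <= S" and b: "(nnint x. (u (x::real^3))^2) <= ennreal Q" and Q: "Q >= 0"
 shows "(nnint x. (u x)^4) <= ennreal (S^2 * Q)"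
proof -
 have "(nnint x. (u x)^4) <= (nnlb x. ennreal (S^2) * ennreal ((u x)^2))"
 proof (rule nn_integral_mono)
  fix x
  have "(u x)^2 <= S^2" using power_mono[OF S[of x], of 2] by simp
  then have "(u x)^2 * (u x)^2 <= S^2 * (u x)^2" by (rule mult_right_mono) simp
  then show "ennreal ((u x)^4) <= ennreal (S^2) * ennreal ((u x)^2)"
   by (simp add: ennreal_mult[symmetric] power4_eq_xxxx power2_eq_square mult.assoc ennreal_leI)
 qed
 also have "... = ennreal (S^2) * (nnint x. (u x)^2)"
  by (rule nn_integral_cmult) (rule cts_ennreal, intro continuous_intros u)
 also have "... <= ennreal (S^2) * ennreal Q" by (rule mult_left_mono[OF b]) simp
 finally show ?thesis using Q by (simp add: ennreal_mult)
qed

lemma ennreal_mult3: "a >= 0 ==> b >= 0 ==> c >= 0 ==> ennreal a * (ennreal b * ennreal c) = ennreal (a * (b * c))"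
 by (simp add: ennreal_mult)

lemma kap_sq: "s >= 0 ==> 1 / (1 + s)^3 <= (kap s)^2"
proof -
 assume s: "s >= 0"
 have "1 / (1 + s)^3 = (1 + s) powr (-3)" using s powr_realpow[of "1 + s" 3] by (simp add: powr_minus_divide)
 also have "... <= (1 + s) powr (-5/2)" using s by (intro powr_mono) auto
 also have "... = (kap s)^2" using s by (simp add: kap_def power2_eq_square powr_add[symmetric])
 finally show ?thesis .
qed

lemma powr_half_4:
 fixes t :: real
 assumes "t >= 0" shows "((1 + t) powr (-1/2))^4 = 1 / (1 + t)^2"
proof -
 have "((1 + t) powr (-1/2))^4 = (1 + t) powr (-2)" using assms by (simp add: powr_realpow[symmetric] powr_powr)
 then show ?thesis using assms powr_realpow[of "1 + t" 2] by (simp add: powr_minus_divide)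
qed

context ellip
begin

lemma AA_slice_cont: "CX (Suc k) N ==> cts (\<lambda>x. AA e b N r s x)"
 by (intro AA_cont_comp[of k] continuous_intros)

lemma Duh_zero: "Duh e b N (0, x) = 0" by (simp add: Duh_def)

lemma AA_L2_source:
 assumes N: "CX (Suc (Suc k)) N" and b: "n2 N s <= ennreal (B^2 / (1 + s)^3)" and s: "s >= 0"
 shows "(nnint x. (t * AA e c N r s x)^2) <= ennreal (t^2 * (ce * (B^2 / (1 + s)^3)))"
  "(nnint x. (t * AA e c N r s x)^2) <= ennreal (ce * B^2 * (t * kap s)^2)"
proof -
 have "(nnint x. (t * AA e c N r s x)^2) = ennreal (t^2) * (nnint x. (AA e c N r s x)^2)"
  by (rule n_scale_square[OF AA_slice_cont[OF N]])
 also have "... <= ennreal (t^2) * (ennreal ce * n2 N s)" by (intro mult_left_mono AA_L2[OF N]) auto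
 also have "... <= ennreal (t^2) * (ennreal ce * ennreal (B^2 / (1 + s)^3))" by (intro mult_left_mono b) auto
 also have "... = ennreal (t^2 * (ce * (B^2 / (1 + s)^3)))" by (rule ennreal_mult3) (use ce_pos s in auto)
 finally show 1: "(nnint x. (t * AA e c N r s x)^2) <= ennreal (t^2 * (ce * (B^2 / (1 + s)^3)))" .
 have "(ce * B^2 * t^2) * (1 / (1 + s)^3) <= (ce * B^2 * t^2) * (kap s)^2"
  using ce_pos by (intro mult_left_mono kap_sq s) auto
 then have "t^2 * (ce * (B^2 / (1 + s)^3)) <= ce * B^2 * (t * kap s)^2" by (simp add: power_mult_distrib mult_ac)
 then show "(nnint x. (t * AA e c N r s x)^2) <= ennreal (ce * B^2 * (t * kap s)^2)"
  by (rule order_trans[OF 1 ennreal_leI])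
qed

text \<open>By \<open>kap_sq\<close> the root of \<open>(1 + s)^(-3)\<close> is below
  \<open>kap s\<close>, whose integral over [0, t] is at most 4. At t = 0 the weight of
  \<open>weighted_Minkowski\<close> would vanish.\<close>

lemma Duh_L2:
 assumes N: "CX (Suc (Suc k)) N" and B: "B >= 0" and b: "\<And>s. s >= 0 ==> n2 N s <= ennreal (B^2 / (1 + s)^3)" and t: "t >= 0"
 shows "n2 (Duh e c N) t <= ennreal (ce * (4 * B)^2)"
proof (cases "t = 0")
 case True
 then show ?thesis by (simp add: n2_def Duh_zero)
next
 case False
 then have t0: "t > 0" using t by simp
 define H where "H \<theta> x = t * AA e c N (t * (1 - \<theta>)) (t * \<theta>) x" for \<theta> x
 have "(nnint x. (LINT \<theta>|lam. H \<theta> x) ^ 2) <= ennreal ((ce * B^2) * 4 ^ 2)"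
 proof (rule weighted_Minkowski[where W="\<lambda>\<theta>. t * kap (t * \<theta>)"])
  show "cts (\<lambda>z. H (fst z) (snd z))"
   unfolding H_def by (intro continuous_intros AA_cont_comp[OF N])
  show "cts (\<lambda>\<theta>. t * kap (t * \<theta>))" by (intro continuous_intros kap_cont)
  show "0 < t * kap (t * \<theta>)" for \<theta> using t0 kap_pos by simp
  show "0 <= ce * B^2" using ce_pos by simp
  show "(LINT \<theta>|lam. t * kap (t * \<theta>)) <= 4" by (rule kap_integral[OF t])
  show "(nnint x. H \<theta> x ^ 2) <= ennreal (ce * B^2 * (t * kap (t * \<theta>)) ^ 2)" if "0 <= \<theta>" "\<theta> <= 1" for \<theta>
   unfolding H_def using t that by (intro AA_L2_source(2)[OF N b]) auto
 qed simp
 moreover have "(ce * B^2) * 4 ^ 2 = ce * (4 * B)^2" by (simp add: power_mult_distrib)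
 ultimately show ?thesis unfolding n2_def Duh_def H_def fst_conv snd_conv by (simp only:)
qed

text \<open>The sup bound integrates the product of the kernel rate and the L^1 rate of the source.
  For L^4 each slice is first interpolated between its sup and its L^2 norm, and the slices are then
  added by \<open>weighted_Minkowski\<close>.\<close>

lemma Duh_decay:
 "\<exists>C\<ge>1. ce * 16 <= C^2 \<and> (\<forall>c N B t. CX (Suc (Suc (Suc (Suc 0)))) N --> B >= 0 --> (\<forall>s\<ge>0. n2 N s <= ennreal (B^2 / (1 + s)^3)) -->
   (\<forall>s\<ge>0. \<forall>w. length w <= 4 --> n1 (Dx w N) s <= ennreal (B / (1 + s))) --> t >= 0 -->
   n4 (Duh e c N) t <= ennreal ((C * B)^4 / (1 + t)^2) \<and> (\<forall>x. abs (Duh e c N (t, x)) <= C * B * dec t))"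
proof -
 obtain D where D0: "D >= 0" and D1: "\<forall>N s M. L1bd 4 M s N -->
  (\<forall>r x. abs (TT e N r s x) <= D * M / (1 + abs r) \<and> (\<forall>b. abs (AA e b N r s x) <= D * M / (1 + abs r)))"
  using AA_TT_sup by (elim exE conjE)
 \<comment> \<open>The number 16 is the factor 2 of \<open>powr_kernel\<close> times 8, the bound
   for the integral of the two \<open>kap\<close> terms in \<open>V\<close>.\<close>
 define C where "C = 16 * (D + ce)"
 have C1: "C >= 1" "ce * 16 <= C * 1" using D0 ce_pos by (simp_all add: C_def)
 have C2: "ce * 16 <= C^2" using order_trans[OF C1(2) mult_left_mono[OF C1(1)]] C1(1) by (simp add: power2_eq_square)
 show ?thesis
 proof (intro exI[of _ C], rule conjI[OF C1(1)], rule conjI[OF C2], intro allI impI)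
  fix c N B t
  assume N: "CX (Suc (Suc (Suc (Suc 0)))) N" and B: "B >= 0" and b2: "\<forall>s\<ge>0. n2 N s <= ennreal (B^2 / (1 + s)^3)"
   and b1: "\<forall>s\<ge>0. \<forall>w. length w <= 4 --> n1 (Dx w N) s <= ennreal (B / (1 + s))" and t: "t >= (0::real)"
  define H where "H \<theta> x = t * AA e c N (t * (1 - \<theta>)) (t * \<theta>) x" for \<theta> x
  have cH: "cts (\<lambda>z. H (fst z) (snd z))"
   unfolding H_def by (intro continuous_intros AA_cont_comp[OF N])
  have cH1: "cts (\<lambda>\<theta>. H \<theta> x)" for x
   unfolding H_def by (intro continuous_intros AA_cont_comp[OF N])
  have cHs: "cts (H \<theta>)" for \<theta>
   unfolding H_def[abs_def] by (intro continuous_intros AA_cont_comp[OF N])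
  define V where "V \<theta> = t * kap (t * \<theta>) + t * kap (t * (1 - \<theta>))" for \<theta>
  have cV: "cts V" unfolding V_def[abs_def] by (intro continuous_intros kap_cont)
  have IV: "(LINT \<theta>|lam. V \<theta>) <= 8"
  proof -
   have "cts (\<lambda>\<theta>. t * kap (t * \<theta>))" "cts (\<lambda>\<theta>. t * kap (t * (1 - \<theta>)))"
    by (intro continuous_intros kap_cont)+
   then have "(LINT \<theta>|lam. V \<theta>) = (LINT \<theta>|lam. t * kap (t * \<theta>)) + (LINT \<theta>|lam. t * kap (t * (1 - \<theta>)))"
    unfolding V_def by (intro Bochner_Integration.integral_add lam.integrable_cont)
   then show ?thesis using kap_integral[OF t] by simp
  qed
  have pt: "abs (H \<theta> x) <= t * (D * B * (1 / ((1 + t * \<theta>) * (1 + t * (1 - \<theta>)))))" if \<theta>: "0 <= \<theta>" "\<theta> <= 1" for \<theta> x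
  proof -
   have s: "t * \<theta> >= 0" "t * (1 - \<theta>) >= 0" using t \<theta> by auto
   have "abs (AA e c N (t * (1 - \<theta>)) (t * \<theta>) x) <= D * (B / (1 + t * \<theta>)) / (1 + t * (1 - \<theta>))"
   proof -
    have M: "B / (1 + t * \<theta>) >= 0" using B s by simp
    have "L1bd 4 (B / (1 + t * \<theta>)) (t * \<theta>) N" using b1 s N M by (simp add: eval_nat_numeral del: CD.simps)
    from D1[THEN spec, THEN spec, THEN spec, THEN mp, OF this]
    have "abs (AA e c N (t * (1 - \<theta>)) (t * \<theta>) x) <= D * (B / (1 + t * \<theta>)) / (1 + abs (t * (1 - \<theta>)))" by blast
    then show ?thesis unfolding abs_of_nonneg[OF s(2)] .
   qed
   then show ?thesis unfolding H_def abs_mult using s t by (intro mult_mono) (auto simp: mult_ac)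
  qed
  have ker: "1 / ((1 + t * \<theta>) * (1 + t * (1 - \<theta>))) <= 2 * dec t * (kap (t * \<theta>) + kap (t * (1 - \<theta>)))"
    "(1 + t * (1 - \<theta>)) powr (-1/2) * kap (t * \<theta>) <= 2 * (1 + t) powr (-1/2) * (kap (t * \<theta>) + kap (t * (1 - \<theta>)))"
   if \<theta>: "0 <= \<theta>" "\<theta> <= 1" for \<theta>
  proof -
   have s: "0 <= t * \<theta>" "0 <= t * (1 - \<theta>)" using t \<theta> by auto
   have sum: "1 + t <= (1 + t * \<theta>) + (1 + t * (1 - \<theta>))" by (simp add: algebra_simps)
   show "1 / ((1 + t * \<theta>) * (1 + t * (1 - \<theta>))) <= 2 * dec t * (kap (t * \<theta>) + kap (t * (1 - \<theta>)))"
    "(1 + t * (1 - \<theta>)) powr (-1/2) * kap (t * \<theta>) <= 2 * (1 + t) powr (-1/2) * (kap (t * \<theta>) + kap (t * (1 - \<theta>)))"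
    unfolding kap_def dec_def abs_of_nonneg[OF s(1)] abs_of_nonneg[OF s(2)] abs_of_nonneg[OF t]
    using s by (intro powr_kernel t sum; simp)+
  qed
  have rs: "abs (Duh e c N (t, x)) <= C * B * dec t" for x
  proof -
   have "abs (Duh e c N (t, x)) <= (LINT \<theta>|lam. abs (H \<theta> x))"
    unfolding Duh_def H_def fst_conv snd_conv by (rule integral_abs_bound)
   also have "... <= (LINT \<theta>|lam. (2 * D * B * dec t) * V \<theta>)"
   proof (rule lam_integral_mono)
    fix \<theta> :: real assume \<theta>: "0 <= \<theta>" "\<theta> <= 1"
    have "abs (H \<theta> x) <= t * (D * B * (1 / ((1 + t * \<theta>) * (1 + t * (1 - \<theta>)))))" by (rule pt[OF \<theta>])
    also have "... <= t * (D * B * (2 * dec t * (kap (t * \<theta>) + kap (t * (1 - \<theta>)))))"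
     using t D0 B by (intro mult_left_mono ker(1)[OF \<theta>]) auto
    also have "... = (2 * D * B * dec t) * V \<theta>" by (simp add: V_def algebra_simps)
    finally show "abs (H \<theta> x) <= (2 * D * B * dec t) * V \<theta>" .
   qed (intro continuous_intros cH1 cV)+
   also have "... = (2 * D * B * dec t) * (LINT \<theta>|lam. V \<theta>)" by simp
   also have "... <= (2 * D * B * dec t) * 8"
    using D0 B by (intro mult_left_mono IV) (auto simp: dec_def)
   also have "... = (16 * D) * (B * dec t)" by simp
   also have "... <= C * (B * dec t)"
    using ce_pos B by (intro mult_right_mono) (auto simp: C_def dec_def)
   finally show ?thesis by simp
  qed
  have r4: "n4 (Duh e c N) t <= ennreal ((C * B)^4 / (1 + t)^2)"
  proof (cases "t = 0")
   case True
   then show ?thesis by (simp add: n4_def Duh_zero)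
  next
   case False
   then have t0: "t > 0" using t by simp
   define K where "K = D^2 * ce * B^4"
   have K: "K >= 0" using ce_pos by (simp add: K_def)
   define T where "T = 2 * (1 + t) powr (-1/2)"
   have T: "T > 0" using t by (simp add: T_def)
   have "(nnint x. (LINT \<theta>|lam. H \<theta> x) ^ 4) <= ennreal (K * (T * 8) ^ 4)"
   proof (rule weighted_Minkowski[where W="\<lambda>\<theta>. T * V \<theta>"])
    show "cts (\<lambda>z. H (fst z) (snd z))" by (rule cH)
    show "cts (\<lambda>\<theta>. T * V \<theta>)" by (intro continuous_intros cV)
    show "0 < T * V \<theta>" for \<theta> unfolding V_def using t0 kap_pos T by (simp add: add_pos_pos)
    show "0 <= K" by (rule K)
    show "(LINT \<theta>|lam. T * V \<theta>) <= T * 8" using IV T by simp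
    fix \<theta> :: real assume \<theta>: "0 <= \<theta>" "\<theta> <= 1"
    define s where "s = t * \<theta>"
    define r where "r = t * (1 - \<theta>)"
    have s: "s >= 0" "r >= 0" using t \<theta> by (auto simp: s_def r_def)
    have h2: "(nnint x. (H \<theta> x)^2) <= ennreal (t^2 * (ce * (B^2 / (1 + s)^3)))"
     unfolding H_def s_def[symmetric] using b2 s by (intro AA_L2_source(1)[OF N]) auto
    have "(nnint x. H \<theta> x ^ 4) <= ennreal ((t * (D * B * (1 / ((1 + s) * (1 + r)))))^2 * (t^2 * (ce * (B^2 / (1 + s)^3))))"
     using fourth_le_sup_square[OF cHs _ h2] pt[OF \<theta>] ce_pos s by (simp add: s_def r_def)
    also have "... <= ennreal (K * (T * V \<theta>) ^ 4)"
    proof (rule ennreal_leI)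
     \<comment> \<open>The fourth root of the time factor in the interpolated bound;
       \<open>ker(2)\<close> compares it with the weight \<open>T * V \<theta>\<close>.\<close>
     define y where "y = (1 + r) powr (-1/2) * kap s"
     have y4: "1 / ((1 + r)^2 * (1 + s)^5) = y^4"
     proof -
      have b: "(kap s)^4 = 1 / (1 + s)^5"
      proof -
       have "(kap s)^4 = (1 + s) powr (-5)"
        using s by (simp add: kap_def powr_realpow[symmetric] powr_powr)
       also have "... = 1 / (1 + s)^5" using s powr_realpow[of "1 + s" 5] by (simp add: powr_minus_divide)
       finally show ?thesis .
      qed
      show ?thesis unfolding y_def power_mult_distrib b powr_half_4[OF s(2)] by simp
     qed
     have "(t * (D * B * (1 / ((1 + s) * (1 + r)))))^2 * (t^2 * (ce * (B^2 / (1 + s)^3)))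
      = K * t^4 * (1 / ((1 + r)^2 * (1 + s)^5))"
      using s by (simp add: K_def power_mult_distrib power_divide power2_eq_square power3_eq_cube power4_eq_xxxx eval_nat_numeral mult_ac)
     also have "... = K * (t * y)^4" unfolding y4 by (simp add: power_mult_distrib)
     also have "... <= K * (T * V \<theta>)^4"
     proof (intro mult_left_mono power_mono K)
      have "t * y <= t * (T * (kap s + kap r))"
       using t ker(2)[OF \<theta>] by (intro mult_left_mono) (auto simp: y_def T_def s_def r_def)
      also have "... = T * V \<theta>" by (simp add: V_def s_def r_def algebra_simps)
      finally show "t * y <= T * V \<theta>" .
      show "0 <= t * y" using t kap_pos[of s] by (simp add: y_def)
     qed
     finally show "(t * (D * B * (1 / ((1 + s) * (1 + r)))))^2 * (t^2 * (ce * (B^2 / (1 + s)^3))) <= K * (T * V \<theta>) ^ 4" .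
    qed
    finally show "(nnint x. H \<theta> x ^ 4) <= ennreal (K * (T * V \<theta>) ^ 4)" .
   qed simp
   also have "... <= ennreal ((C * B)^4 / (1 + t)^2)"
   proof (rule ennreal_leI)
    have T4: "T^4 = 16 / (1 + t)^2" unfolding T_def power_mult_distrib powr_half_4[OF t] by simp
    have "D^2 * ce <= (D + ce)^4"
    proof -
     have "D^2 * ce <= (D + ce)^2 * (D + ce)" using D0 ce_pos by (intro mult_mono power_mono) auto
     also have "... = (D + ce)^3 * 1" by (simp add: power2_eq_square power3_eq_cube)
     also have "... <= (D + ce)^3 * (D + ce)" using D0 ce_pos by (intro mult_left_mono) auto
     finally show ?thesis by (simp add: power3_eq_cube power4_eq_xxxx)
    qed
    then have "D^2 * ce * B^4 * (16 * 8^4) <= (D + ce)^4 * B^4 * (16 * 8^4)"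
     by (intro mult_right_mono) auto
    also have "... = (C * B)^4" unfolding C_def power_mult_distrib by simp
    finally have "D^2 * ce * B^4 * (16 * 8^4) / (1 + t)^2 <= (C * B)^4 / (1 + t)^2" by (rule divide_right_mono) simp
    then show "K * (T * 8) ^ 4 <= (C * B)^4 / (1 + t)^2"
     unfolding K_def power_mult_distrib[of T] T4 by simp
   qed
   finally show ?thesis by (simp add: n4_def Duh_def H_def)
  qed
  show "n4 (Duh e c N) t <= ennreal ((C * B)^4 / (1 + t)^2) \<and> (\<forall>x. abs (Duh e c N (t, x)) <= C * B * dec t)"
   using r4 rs by blast
 qed
qed

lemma LA_decay:
 "\<exists>C\<ge>1. ce <= C^2 \<and> (\<forall>c g B t. CX (Suc (Suc (Suc (Suc 0)))) g --> B >= 0 --> n2 g 0 <= ennreal (B^2) -->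
   (\<forall>w. length w <= 4 --> n1 (Dx w g) 0 <= ennreal B) --> t >= 0 -->
   n4 (LA e c g) t <= ennreal ((C * B)^4 / (1 + t)^2) \<and> (\<forall>x. abs (LA e c g (t, x)) <= C * B * dec t))"
proof -
 obtain D where D0: "D >= 0" and D1: "\<forall>N s M. L1bd 4 M s N -->
  (\<forall>r x. abs (TT e N r s x) <= D * M / (1 + abs r) \<and> (\<forall>b. abs (AA e b N r s x) <= D * M / (1 + abs r)))"
  using AA_TT_sup by (elim exE conjE)
 define C where "C = D + ce"
 have C1: "C >= 1" "ce <= C * 1" "C >= D" using D0 ce_pos by (auto simp: C_def)
 have C2: "ce <= C^2" using order_trans[OF C1(2) mult_left_mono[OF C1(1)]] C1(1) by (simp add: power2_eq_square)
 show ?thesis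
 proof (intro exI[of _ C], rule conjI[OF C1(1)], rule conjI[OF C2], intro allI impI)
  fix c g B t
  assume g: "CX (Suc (Suc (Suc (Suc 0)))) g" and B: "B >= 0" and b2: "n2 g 0 <= ennreal (B^2)"
   and b1: "\<forall>w. length w <= 4 --> n1 (Dx w g) 0 <= ennreal B" and t: "t >= (0::real)"
  have q2: "n2 (LA e c g) t <= ennreal (ce * B^2)"
  proof -
   have "n2 (LA e c g) t <= ennreal ce * n2 g 0" unfolding n2_def[of "LA e c g"] LA_def using AA_L2[OF g] by simp
   also have "... <= ennreal ce * ennreal (B^2)" by (rule mult_left_mono[OF b2]) simp
   finally show ?thesis using ce_pos by (simp add: ennreal_mult)
  qed
  have s1: "abs (LA e c g (t, x)) <= D * B / (1 + t)" for x
   unfolding LA_def using D1[rule_format, of g B 0 t x] g B b1 t by (auto simp: eval_nat_numeral simp del: CD.simps)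
  have r4: "n4 (LA e c g) t <= ennreal ((D * B / (1 + t))^2 * (ce * B^2))" unfolding n4_def
  proof (rule fourth_le_sup_square)
   show "cts (\<lambda>x. LA e c g (t, x))" unfolding LA_def using AA_slice_cont[OF g] by simp
   show "(nnint x. (LA e c g (t, x))^2) <= ennreal (ce * B^2)" using q2 unfolding n2_def .
  qed (use s1 ce_pos in auto)
  have "(D * B / (1 + t))^2 * (ce * B^2) <= (C * B)^4 / (1 + t)^2"
  proof -
   have "D^2 * ce <= C^2 * C^2" by (intro mult_mono power_mono C2) (use D0 C1 ce_pos in auto)
   then have "D^2 * ce * B^4 / (1 + t)^2 <= C^2 * C^2 * B^4 / (1 + t)^2"
    by (intro divide_right_mono mult_right_mono) auto
   then show ?thesis by (simp add: power_mult_distrib power_divide power2_eq_square power4_eq_xxxx mult_ac)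
  qed
  then have "n4 (LA e c g) t <= ennreal ((C * B)^4 / (1 + t)^2)" using r4 by (meson ennreal_leI order_trans)
  moreover have "abs (LA e c g (t, x)) <= C * B * dec t" for x
  proof -
   have "1 / (1 + t) = (1 + t) powr (-1)" using t by (simp add: powr_minus_divide)
   also have "... <= (1 + t) powr (-3/4)" using t by (intro powr_mono) auto
   also have "... = dec t" using t by (simp add: dec_def)
   finally have d: "1 / (1 + t) <= dec t" .
   have "abs (LA e c g (t, x)) <= (D * B) * (1 / (1 + t))" using s1 by simp
   also have "... <= (C * B) * dec t" using d D0 B C1 t by (intro mult_mono) auto
   finally show ?thesis .
  qed
  ultimately show "n4 (LA e c g) t <= ennreal ((C * B)^4 / (1 + t)^2) \<and> (\<forall>x. abs (LA e c g (t, x)) <= C * B * dec t)" by blast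
 qed
qed

end

section \<open>Mollification\<close>

text \<open>Compactly supported and of class C^1, so that \<open>J\<close> gains one space
  derivative and \<open>JJ\<close> two, as many as the kernel estimates ask for.\<close>

definition molk :: "real^3 => real" where "molk y = (max 0 (1 - y \<bullet> y))^2"
definition molk' :: "3 => real^3 => real" where "molk' j y = - 4 * max 0 (1 - y \<bullet> y) * y $ j"
definition kc :: real where "kc = (LINT y|lb 2. molk y)"

text \<open>The ball of radius 2 is twice the support of \<open>molk\<close>, which leaves room for
  the translation in \<open>lb2_translate\<close>.\<close>

definition J :: "real => (spacetime => real) => spacetime => real" where
 "J h N z = (LINT y|lb 2. molk y * N (fst z, snd z + h *R y)) / kc"

definition JJ :: "real => (spacetime => real) => spacetime => real" where
 "JJ h N = J h (J h N)"

interpretation lb2: cmeas "lb 2" "cball 0 2" by (rule cmeas_lb)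

lemma molk_cont: "continuous_on S f ==> continuous_on S (\<lambda>x. molk (f x))"
 and molk'_cont: "continuous_on S f ==> continuous_on S (\<lambda>x. molk' j (f x))"
 unfolding molk_def molk'_def by (intro continuous_intros; assumption)+

lemma molk_nonneg: "molk y >= 0" by (simp add: molk_def)

lemma inner_ge1: "norm (y::real^3) >= 1 ==> y \<bullet> y >= 1"
 by (metis norm_ge_zero one_le_power power2_norm_eq_inner)

lemma molk_zero: "norm y >= 1 ==> molk y = 0" using inner_ge1[of y] by (simp add: molk_def)

lemma molk_deriv: "DERIV (\<lambda>s. molk (y + s *R axis j 1)) s :> molk' j (y + s *R axis j 1)"
proof -
 have e: "1 - (y + s *R axis j 1) \<bullet> (y + s *R axis j 1) = 1 - (y \<bullet> y + 2 * s * y $ j + s^2)" for s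
  by (simp add: inner_add_left inner_add_right inner_axis inner_axis' power2_eq_square) (simp add: algebra_simps)
 have "DERIV (\<lambda>s. 1 - (y \<bullet> y + 2 * s * y $ j + s^2)) s :> (- (2 * (y $ j + s)))"
  by (auto intro!: derivative_eq_intros)
 from DERIV_chain2[OF DERIV_max_square this]
 have "DERIV (\<lambda>s. (max 0 (1 - (y \<bullet> y + 2 * s * y $ j + s^2)))^2) s :> (- 4 * max 0 (1 - (y \<bullet> y + 2 * s * y $ j + s^2)) * (y $ j + s))"
  by (rule DERIV_cong) (simp add: algebra_simps)
 then show ?thesis unfolding molk_def molk'_def e by (simp add: axis_def)
qed

lemma kc_pos: "kc > 0"
proof -
 have c: "cts molk" by (intro molk_cont continuous_intros)
 have "(LINT y|lb 2. molk y) \<noteq> 0"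
 proof
  assume "(LINT y|lb 2. molk y) = 0"
  then have "AE y in lb 2. molk y = 0"
   by (subst (asm) integral_nonneg_eq_0_iff_AE) (auto simp: molk_nonneg lb2.integrable_cont c)
  then have "AE y in lborel. 0 < (indicator (cball 0 2) y :: ennreal) --> molk y = 0"
   unfolding lb_def by (subst (asm) AE_density) (auto intro!: borel_measurable_indicator)
  then have "AE y in lborel. y \<in> cball 0 2 --> molk y = 0"
   by (rule eventually_mono) (auto simp: indicator_def)
  then have "AE y in lborel. y \<notin> ball (0::real^3) 1"
  proof (rule eventually_mono)
   fix y :: "real^3" assume y: "y \<in> cball 0 2 --> molk y = 0"
   show "y \<notin> ball 0 1"
   proof
    assume "y \<in> ball 0 1"
    then have n: "norm y < 1" by simp
    then have "y \<bullet> y < 1" by (metis norm_ge_zero power2_norm_eq_inner power_less_one_iff zero_less_numeral)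
    then have "molk y > 0" by (simp add: molk_def)
    then show False using y n by auto
   qed
  qed
  then have "ball (0::real^3) 1 \<in> null_sets lborel" by (simp add: AE_iff_null_sets)
  then have "emeasure lborel (ball (0::real^3) 1) = 0" by (rule null_setsD1)
  then show False
   using open_not_negligible[of "ball (0::real^3) 1"] by (simp add: negligible_iff_null_sets null_sets_def)
 qed
 moreover have "kc >= 0" unfolding kc_def by (rule lb2.integral_nonneg_cont) (rule molk_nonneg)
 ultimately show ?thesis unfolding kc_def by simp
qed

lemma J_integrand_cont:
 fixes N :: "spacetime => real"
 assumes N: "cts N" shows "cts (\<lambda>y. molk y * N (s, x + h *R y))"
 by (intro continuous_intros molk_cont cts_comp[OF N])

lemma smooth_opI:
 assumes "\<And>N. CX m N ==> cts (Q N)"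
  and "\<And>N j z. CX (Suc m) N ==> hasdd (spv j) (Q N) z (Q (sd j N) z)" shows "smooth_op m Q"
 using assms unfolding smooth_op_def by blast

lemma smooth_op_J: "smooth_op 0 (J h)"
proof (rule smooth_opI)
 fix N :: "spacetime => real" assume "CX 0 N"
 then have N: "cts N" by simp
 have "cts (\<lambda>z. (LINT y|lb 2. molk y * N (fst z, snd z + h *R y)))"
  by (rule lb2.continuous_param) (intro continuous_intros molk_cont cts_comp[OF N])
 then show "cts (J h N)" unfolding J_def[abs_def] using kc_pos by (intro continuous_intros) auto
next
 fix N j z assume N: "CX (Suc 0) N"
 note cN = CX_cont[OF N] and cj = CX_cont_sd[OF N]
 have "((\<lambda>r. \<integral>y. molk y * N (fst z, (snd z + r *R axis j 1) + h *R y) \<partial>lb 2) has_real_derivative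
   (LINT y|lb 2. molk y * sd j N (fst z, (snd z + 0 *R axis j 1) + h *R y))) (at 0)"
 proof (rule lb2.deriv_param[where U=UNIV and H'="\<lambda>r y. molk y * sd j N (fst z, (snd z + r *R axis j 1) + h *R y)"])
  show "cts (\<lambda>p. molk (snd p) * sd j N (fst z, (snd z + fst p *R axis j 1) + h *R snd p))"
   by (intro continuous_intros molk_cont cts_comp[OF cj])
  fix r y
  have "DERIV (\<lambda>r. N (fst z, (snd z + h *R y) + r *R axis j 1)) r :> sd j N (fst z, (snd z + h *R y) + r *R axis j 1)"
   by (rule CX_line[OF N])
  from DERIV_cmult[OF this, of "molk y"]
  show "((\<lambda>r. molk y * N (fst z, (snd z + r *R axis j 1) + h *R y)) has_real_derivative
   molk y * sd j N (fst z, (snd z + r *R axis j 1) + h *R y)) (at r)" by (simp add: add_ac)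
 qed (auto intro!: J_integrand_cont cN)
 from DERIV_cdivide[OF this, of kc]
 show "hasdd (spv j) (J h N) z (J h (sd j N) z)" unfolding hasdd_def J_def by simp
qed

lemma lb2_translate:
 fixes f :: "real^3 => real"
 assumes f: "cts f" and z: "\<And>y. norm y > 1 ==> f y = 0" and a: "norm a <= 1"
 shows "(LINT y|lb 2. f y) = (LINT y|lb 2. f (y + a))"
proof -
 have "(LINT y|lb 2. f y) = (LINT y|lborel. f y)" by (rule integral_lb[OF f]) (use z in auto)
 also have "... = (LINT y|lborel. f (y + a))"
  by (rule integral_translate[symmetric]) (rule borel_measurable_continuous_onI[OF f])
 also have "... = (LINT y|lb 2. f (y + a))"
 proof (rule integral_lb[symmetric])
  show "cts (\<lambda>y. f (y + a))" by (intro cts_comp[OF f] continuous_intros)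
  fix y :: "real^3" assume "2 < norm y"
  moreover have "norm y <= norm (y + a) + norm a" by (metis add_diff_cancel_right' norm_triangle_ineq4)
  ultimately show "f (y + a) = 0" using a by (intro z) simp
 qed
 finally show ?thesis .
qed

text \<open>Moving the point of evaluation by \<open>r\<close> along an axis amounts to moving the
  kernel by \<open>- r / h\<close>, so the derivative falls on \<open>molk\<close> and
  \<open>N\<close> need only be continuous.\<close>

lemma J_gain_base:
 assumes N: "cts N" and h: "h > 0" shows "CX (Suc 0) (J h N)"
proof -
 let ?u = "\<lambda>j z. \<integral>y. molk' j y * N (fst z, snd z + h *R y) \<partial>lb 2"
 show ?thesis
 proof (rule CX_SucI[where u'="\<lambda>j z. - ?u j z / (h * kc)"])
  show "cts (J h N)" by (rule smooth_op_cont[OF smooth_op_J]) (simp add: N)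
  show "CX 0 (\<lambda>z. - ?u j z / (h * kc))" for j
  proof -
   have "cts (\<lambda>z. ?u j z)"
    by (rule lb2.continuous_param) (intro continuous_intros molk'_cont cts_comp[OF N])
   then show ?thesis using h kc_pos by (auto intro!: continuous_intros)
  qed
  fix j z
  define F where "F r = (LINT y|lb 2. molk (y + r *R axis j 1) * N (fst z, snd z + h *R y))" for r
  have dF: "DERIV F 0 :> (LINT y|lb 2. molk' j (y + 0 *R axis j 1) * N (fst z, snd z + h *R y))"
   unfolding F_def[abs_def]
  proof (rule lb2.deriv_param[where U=UNIV and H'="\<lambda>r y. molk' j (y + r *R axis j 1) * N (fst z, snd z + h *R y)"])
   show "cts (\<lambda>p. molk' j (snd p + fst p *R axis j 1) * N (fst z, snd z + h *R snd p))"
    by (intro continuous_intros molk'_cont cts_comp[OF N])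
   show "cts (\<lambda>y. molk (y + r *R axis j 1) * N (fst z, snd z + h *R y))" for r
    by (intro continuous_intros molk_cont cts_comp[OF N])
   show "((\<lambda>r. molk (y + r *R axis j 1) * N (fst z, snd z + h *R y)) has_real_derivative
    molk' j (y + r *R axis j 1) * N (fst z, snd z + h *R y)) (at r)" for r y
    by (rule DERIV_cmult_right[OF molk_deriv])
  qed auto
  have eq: "J h N (z + r *R spv j) = F (- (1 / h) * r) / kc" if r: "abs r < h" for r
  proof -
   let ?a = "(- (1 / h) * r) *R axis j (1::real)"
   have na: "norm ?a <= 1" using r h by (simp add: norm_axis_1)
   have cf: "cts (\<lambda>y. molk y * N (fst z, snd z + r *R axis j 1 + h *R y))"
    by (intro continuous_intros molk_cont cts_comp[OF N])
   have "(LINT y|lb 2. molk y * N (fst z, snd z + r *R axis j 1 + h *R y))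
    = (LINT y|lb 2. molk (y + ?a) * N (fst z, snd z + r *R axis j 1 + h *R (y + ?a)))"
    by (rule lb2_translate[OF cf _ na]) (simp add: molk_zero)
   also have "... = F (- (1 / h) * r)"
   proof -
    have "snd z + r *R axis j 1 + h *R (y + ?a) = snd z + h *R y" for y
     using h by (simp add: algebra_simps)
    then show ?thesis unfolding F_def by (simp only:)
   qed
   finally show ?thesis by (simp add: J_def)
  qed
  have d1: "DERIV (\<lambda>r. - (1 / h) * r) 0 :> (- (1 / h))" by (rule DERIV_cong[OF DERIV_cmult[OF DERIV_ident]]) simp
  have dF': "DERIV F (- (1 / h) * 0) :> ?u j z" using dF by simp
  have "((\<lambda>r. F (- (1 / h) * r) / kc) has_real_derivative
    ?u j z * - (1 / h) / kc) (at 0)" by (rule DERIV_cdivide[OF DERIV_chain2[OF dF' d1]])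
  then have "((\<lambda>r. J h N (z + r *R spv j)) has_real_derivative
    ?u j z * - (1 / h) / kc) (at 0)"
  proof (rule has_field_derivative_transform_within[OF _ h UNIV_I])
   fix r :: real assume "dist r 0 < h"
   then have "abs r < h" by simp
   from eq[OF this] show "F (- (1 / h) * r) / kc = J h N (z + r *R spv j)" by (rule sym)
  qed
  then show "hasdd (spv j) (J h N) z (- ?u j z / (h * kc))" unfolding hasdd_def by simp
 qed
qed

lemma J_gain:
 assumes "CX k N" "h > 0" shows "CX (Suc k) (J h N)" using assms(1)
proof (induction k arbitrary: N)
 case 0 then show ?case using J_gain_base[OF _ assms(2)] by simp
next
 case (Suc k)
 have 1: "CX (Suc 0) N" by (rule CD_mono[OF Suc.prems]) simp
 have 2: "CX 0 N" by (rule CD_mono[OF Suc.prems]) simp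
 show ?case
 proof (rule CX_SucI[where u'="\<lambda>j. J h (sd j N)"])
  show "cts (J h N)" by (rule smooth_op_cont[OF smooth_op_J 2])
  show "hasdd (spv j) (J h N) z (J h (sd j N) z)" for j z by (rule smooth_op_hasdd[OF smooth_op_J 1])
  show "CX (Suc k) (J h (sd j N))" for j by (rule Suc.IH[OF CX_sd[OF Suc.prems]])
 qed
qed

lemma smooth_op_comp0:
 assumes P: "smooth_op m P" and Q: "smooth_op 0 Q" shows "smooth_op m (\<lambda>N. P (Q N))"
proof (rule smooth_opI)
 fix N assume N: "CX m N"
 show "cts (P (Q N))" by (rule smooth_op_cont[OF P smooth_op_CX[OF Q]]) (use N in simp)
next
 fix N j z assume N: "CX (Suc m) N"
 have 1: "CX (Suc m) (Q N)" by (rule smooth_op_CX[OF Q]) (use N in \<open>simp del: CD.simps\<close>)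
 have 2: "CX (Suc 0) N" by (rule CD_mono[OF N]) simp
 have "sd j (Q N) = Q (sd j N)" by (rule ext, rule hasdd_imp_dd, rule smooth_op_hasdd[OF Q 2])
 then show "hasdd (spv j) (P (Q N)) z (P (Q (sd j N)) z)"
  using smooth_op_hasdd[OF P 1, of j z] by simp
qed

lemma smooth_op_JJ: "smooth_op 0 (JJ h)"
 unfolding JJ_def[abs_def] by (rule smooth_op_comp0[OF smooth_op_J smooth_op_J])

lemma JJ_gain: "CX k N ==> h > 0 ==> CX (Suc (Suc k)) (JJ h N)" unfolding JJ_def by (intro J_gain)

text \<open>\<open>molk / kc\<close> is a probability density on the unit ball, so an average of
  slices whose integrals are at most \<open>B\<close> has integral at most \<open>B\<close>.\<close>

lemma molk_average:
 fixes G :: "real^3 => real^3 => real"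
 assumes G: "cts (\<lambda>p. G (fst p) (snd p))" and G0: "\<And>y x. G y x >= 0"
  and B: "\<And>y. norm y <= 1 ==> (nnint x. G y x) <= B"
 shows "(nnint x. (LINT y|lb 2. molk y * G y x) / kc) <= B"
proof -
 have cg: "cts (\<lambda>p. molk (fst p) / kc * G (fst p) (snd p))"
  using kc_pos by (intro continuous_intros molk_cont G) auto
 have cm: "cts (\<lambda>y. molk y / kc)" using kc_pos by (intro continuous_intros molk_cont) auto
 have cy: "cts (G y)" for y by (rule continuous_slice[OF G])
 have "(nnint x. (LINT y|lb 2. molk y * G y x) / kc) = (nnint x. \<integral>y. molk y / kc * G y x \<partial>lb 2)"
  by (simp only: times_divide_eq_left Bochner_Integration.integral_divide_zero)
 also have "... = (\<integral>\<^sup>+y. (nnint x. molk y / kc * G y x) \<partial>lb 2)"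
  by (rule lb2.Tonelli_param[OF cg]) (use G0 molk_nonneg kc_pos in auto)
 also have "... <= (\<integral>\<^sup>+y. ennreal (molk y / kc) * B \<partial>lb 2)"
 proof (rule nn_integral_mono)
  fix y
  have "(nnint x. molk y / kc * G y x) = ennreal (molk y / kc) * (nnint x. G y x)"
  proof -
   have "(nnint x. molk y / kc * G y x) = (nnlb x. ennreal (molk y / kc) * ennreal (G y x))"
    using molk_nonneg[of y] kc_pos by (intro nn_integral_cong ennreal_mult') simp
   also have "... = ennreal (molk y / kc) * (nnint x. G y x)"
    by (rule nn_integral_cmult) (rule cts_ennreal[OF cy])
   finally show ?thesis .
  qed
  also have "... <= ennreal (molk y / kc) * B"
   using B[of y] molk_zero[of y] by (cases "norm y <= 1") (auto intro: mult_left_mono)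
  finally show "(nnint x. molk y / kc * G y x) <= ennreal (molk y / kc) * B" .
 qed
 also have "... = (\<integral>\<^sup>+y. ennreal (molk y / kc) \<partial>lb 2) * B"
  by (rule nn_integral_multc) (rule measurable_compose[OF lb2.meas_cont[OF cm] measurable_ennreal])
 also have "(\<integral>\<^sup>+y. ennreal (molk y / kc) \<partial>lb 2) = ennreal (LINT y|lb 2. molk y / kc)"
  by (rule nn_integral_eq_integral) (use molk_nonneg kc_pos in \<open>auto intro!: lb2.integrable_cont cm\<close>)
 also have "(LINT y|lb 2. molk y / kc) = 1" using kc_pos by (simp add: kc_def[symmetric])
 finally show ?thesis by simp
qed

lemma molk_square:
 fixes f :: "real^3 => real"
 assumes f: "cts f"
 shows "((LINT y|lb 2. molk y * f y) / kc)^2 <= (LINT y|lb 2. molk y * (f y)^2) / kc"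
proof -
 define c where "c = (LINT y|lb 2. molk y * f y) / kc"
 have cm: "cts molk" by (intro molk_cont continuous_intros)
 have I: "integrable (lb 2) (\<lambda>y. molk y * (f y)^2)" "integrable (lb 2) (\<lambda>y. molk y * f y)" "integrable (lb 2) molk"
  by (intro lb2.integrable_cont continuous_intros cm f)+
 have "0 <= (LINT y|lb 2. molk y * (f y - c)^2)"
  by (rule lb2.integral_nonneg_cont) (simp add: molk_nonneg)
 also have "... = (LINT y|lb 2. molk y * (f y)^2 - 2 * c * (molk y * f y) + c^2 * molk y)"
  by (rule Bochner_Integration.integral_cong) (auto simp: power2_eq_square algebra_simps)
 also have "... = (LINT y|lb 2. molk y * (f y)^2) - 2 * c * (LINT y|lb 2. molk y * f y) + c^2 * kc"
  using I by (simp add: kc_def)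
 also have "(LINT y|lb 2. molk y * f y) = c * kc" using kc_pos by (simp add: c_def)
 finally have "c^2 * kc <= (LINT y|lb 2. molk y * (f y)^2)" by (simp add: power2_eq_square mult_ac)
 then show ?thesis using kc_pos by (simp add: c_def[symmetric] pos_le_divide_eq)
qed

lemma n_translate:
 assumes "cts u" shows "(nnint x. u (x + a)) = (nnint x. u (x::real^3))"
 by (rule nn_integral_translate) (rule measurable_compose[OF borel_measurable_continuous_onI[OF assms] measurable_ennreal])

lemma n2_J: assumes N: "cts N" shows "n2 (J h N) t <= n2 N t"
proof -
 have cs: "cts (\<lambda>x. (N (t, x))^2)" by (intro continuous_intros cts_comp[OF N])
 have "n2 (J h N) t <= (nnint x. (LINT y|lb 2. molk y * (N (t, x + h *R y))^2) / kc)"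
  unfolding n2_def J_def fst_conv snd_conv
  by (intro nn_integral_mono ennreal_leI molk_square continuous_intros cts_comp[OF N])
 also have "... <= n2 N t"
 proof (rule molk_average)
  show "cts (\<lambda>p. (N (t, snd p + h *R fst p))^2)" by (intro continuous_intros cts_comp[OF N])
  show "(nnint x. (N (t, x + h *R y))^2) <= n2 N t" for y
   unfolding n2_def using n_translate[OF cs] by simp
 qed simp
 finally show ?thesis .
qed

lemma n1_J: assumes N: "cts N" shows "n1 (J h N) t <= n1 N t"
proof -
 have cs: "cts (\<lambda>x. abs (N (t, x)))" by (intro continuous_intros cts_comp[OF N])
 have "n1 (J h N) t <= (nnint x. (LINT y|lb 2. molk y * abs (N (t, x + h *R y))) / kc)"
  unfolding n1_def J_def fst_conv snd_conv
 proof (intro nn_integral_mono ennreal_leI)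
  fix x
  have "abs (LINT y|lb 2. molk y * N (t, x + h *R y)) <= (LINT y|lb 2. abs (molk y * N (t, x + h *R y)))" by (rule integral_abs_bound)
  also have "... = (LINT y|lb 2. molk y * abs (N (t, x + h *R y)))" by (simp add: abs_mult molk_nonneg)
  finally show "abs ((LINT y|lb 2. molk y * N (t, x + h *R y)) / kc) <= (LINT y|lb 2. molk y * abs (N (t, x + h *R y))) / kc"
   using kc_pos by (simp add: divide_right_mono)
 qed
 also have "... <= n1 N t"
 proof (rule molk_average)
  show "cts (\<lambda>p. abs (N (t, snd p + h *R fst p)))" by (intro continuous_intros cts_comp[OF N])
  show "(nnint x. abs (N (t, x + h *R y))) <= n1 N t" for y
   unfolding n1_def using n_translate[OF cs] by simp
 qed simp
 finally show ?thesis .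
qed

lemma J_cont: "cts N ==> cts (J h N)" by (rule smooth_op_cont[OF smooth_op_J]) simp

lemma n2_JJ: "cts N ==> n2 (JJ h N) t <= n2 N t"
 and n1_JJ: "cts N ==> n1 (JJ h N) t <= n1 N t" unfolding JJ_def
 by (rule order_trans[OF n2_J[OF J_cont] n2_J], assumption, assumption, rule order_trans[OF n1_J[OF J_cont] n1_J])

lemma J_diff:
 assumes "cts M" "cts N" shows "J h (\<lambda>z. M z - N z) z = J h M z - J h N z"
 unfolding J_def using assms
 by (simp add: right_diff_distrib lb2.integrable_cont J_integrand_cont diff_divide_distrib)

lemma J_sup:
 assumes N: "cts N" and S: "\<And>x. abs (N (t, x)) <= S" shows "abs (J h N (t, x)) <= S"
proof -
 have cm: "cts molk" by (intro molk_cont continuous_intros)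
 have "abs (LINT y|lb 2. molk y * N (t, x + h *R y)) <= (LINT y|lb 2. abs (molk y * N (t, x + h *R y)))" by (rule integral_abs_bound)
 also have "... <= (LINT y|lb 2. S * molk y)"
 proof (rule integral_mono[OF lb2.integrable_cont lb2.integrable_cont])
  show "cts (\<lambda>y. abs (molk y * N (t, x + h *R y)))" by (intro continuous_on_rabs J_integrand_cont N)
  show "cts (\<lambda>y. S * molk y)" by (intro continuous_intros cm)
  show "abs (molk y * N (t, x + h *R y)) <= S * molk y" for y
   using mult_right_mono[OF S molk_nonneg, of "x + h *R y" y] by (simp add: abs_mult molk_nonneg mult.commute)
 qed
 also have "... = S * kc" by (simp add: kc_def)
 finally show ?thesis using kc_pos by (simp add: J_def pos_divide_le_eq)
qed

lemma J_minus_self: "J h N (t, x) - N (t, x) = (LINT y|lb 2. molk y * (N (t, x + h *R y) - N (t, x))) / kc"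
 if N: "cts N"
proof -
 have cm: "cts molk" by (intro molk_cont continuous_intros)
 have "(LINT y|lb 2. molk y * (N (t, x + h *R y) - N (t, x))) = (LINT y|lb 2. molk y * N (t, x + h *R y) - N (t, x) * molk y)"
  by (rule Bochner_Integration.integral_cong) (auto simp: algebra_simps)
 also have "... = (LINT y|lb 2. molk y * N (t, x + h *R y)) - N (t, x) * kc"
  by (simp add: lb2.integrable_cont J_integrand_cont N cm kc_def)
 finally show ?thesis using kc_pos by (simp add: J_def diff_divide_distrib)
qed

text \<open>The fundamental theorem along the segment, followed by Cauchy-Schwarz once in \<theta>
  and once in the three components; the 3 is the dimension.\<close>

lemma ray_difference_square:
 assumes N: "CX (Suc 0) N" and y: "norm y <= 1"
 shows "(N (t, x + h *R y) - N (t, x))^2 <= (LINT \<theta>|lam. 3 * h^2 * (\<Sum>j\<in>UNIV. (sd j N (t, x + \<theta> *R (h *R y)))^2))"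
proof -
 let ?S = "\<lambda>\<theta>. \<Sum>j\<in>UNIV. (sd j N (t, x + \<theta> *R (h *R y)))^2"
 define f where "f \<theta> = (\<Sum>i\<in>UNIV. (h *R y) $ i * sd i N (t, x + \<theta> *R (h *R y)))" for \<theta>
 have cj: "cts (\<lambda>\<theta>. sd j N (t, x + \<theta> *R (h *R y)))" for j
  by (intro continuous_intros cts_comp[OF CX_cont_sd[OF N]])
 have cf: "cts f" unfolding f_def[abs_def] by (intro continuous_intros cj)
 have "(LINT \<theta>|lam. f \<theta>) = N (t, x + 1 *R (h *R y)) - N (t, x + 0 *R (h *R y))"
  by (rule lam_FTC[OF _ cf]) (use CX_ray[OF N, of t x "h *R y"] in \<open>auto simp: f_def\<close>)
 then have "(N (t, x + h *R y) - N (t, x))^2 = (LINT \<theta>|lam. f \<theta>)^2" by simp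
 also have "... <= (LINT \<theta>|lam. (f \<theta>)^2)" using lam.square_integral_le[OF cf] by simp
 also have "... <= (LINT \<theta>|lam. 3 * h^2 * ?S \<theta>)"
 proof (rule lam_integral_mono)
  fix \<theta> :: real
  have "(f \<theta>)^2 <= (\<Sum>i\<in>UNIV. ((h *R y) $ i)^2) * ?S \<theta>"
   unfolding f_def by (rule Cauchy_Schwarz_ineq_sum)
  also have "... <= (3 * h^2) * ?S \<theta>"
  proof (rule mult_right_mono)
   have "((h *R y) $ i)^2 <= h^2" for i
   proof -
    have "abs (y $ i) <= 1" using component_le_norm_cart[of y i] y by linarith
    then have "(y $ i)^2 <= 1" by (simp add: abs_square_le_1)
    then have "h^2 * (y $ i)^2 <= h^2 * 1" by (rule mult_left_mono) simp
    then show ?thesis by (simp add: power_mult_distrib)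
   qed
   then have "(\<Sum>i\<in>(UNIV::3 set). ((h *R y) $ i)^2) <= (\<Sum>i\<in>(UNIV::3 set). h^2)" by (intro sum_mono)
   then show "(\<Sum>i\<in>UNIV. ((h *R y) $ i)^2) <= 3 * h^2" by simp
  qed (simp add: sum_nonneg)
  finally show "(f \<theta>)^2 <= 3 * h^2 * ?S \<theta>" .
 qed (intro continuous_intros cf cj)+
 finally show ?thesis .
qed

text \<open>The mollification error is of order \<open>h\<close> in L^2 at the price of one
  derivative. Translation invariance removes the shift by \<open>\<theta> *R (h *R y)\<close> from
  the segment bound.\<close>

lemma n2_J_diff:
 assumes N: "CX (Suc 0) N"
 shows "n2 (\<lambda>z. J h N z - N z) t <= ennreal (3 * h^2) * (\<Sum>j\<in>UNIV. n2 (sd j N) t)"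
proof -
 note cN = CX_cont[OF N]
 have cj: "cts (\<lambda>x. (sd j N (t, x))^2)" for j
  by (intro continuous_intros cts_comp[OF CX_cont_sd[OF N]])
 have cc: "cts (\<lambda>y. N (t, x + h *R y) - N (t, x))" for x
  by (intro continuous_intros cts_comp[OF cN])
 have "n2 (\<lambda>z. J h N z - N z) t <= (nnint x. (LINT y|lb 2. molk y * (N (t, x + h *R y) - N (t, x))^2) / kc)"
  unfolding n2_def J_minus_self[OF cN] by (intro nn_integral_mono ennreal_leI molk_square cc)
 also have "... <= ennreal (3 * h^2) * (\<Sum>j\<in>UNIV. n2 (sd j N) t)"
 proof (rule molk_average)
  show "cts (\<lambda>p. (N (t, snd p + h *R fst p) - N (t, snd p))^2)"
   by (intro continuous_intros cts_comp[OF cN])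
  fix y :: "real^3" assume y: "norm y <= 1"
  let ?S = "\<lambda>x \<theta>. \<Sum>j\<in>UNIV. (sd j N (t, x + \<theta> *R (h *R y)))^2"
  have "(nnint x. (N (t, x + h *R y) - N (t, x))^2)
   <= (nnint x. \<integral>\<theta>. 3 * h^2 * ?S x \<theta> \<partial>lam)"
   by (intro nn_integral_mono ennreal_leI ray_difference_square[OF N y])
  also have "... = (\<integral>\<^sup>+\<theta>. (nnint x. 3 * h^2 * ?S x \<theta>) \<partial>lam)"
   by (rule lam.Tonelli_param) (auto intro!: continuous_intros cts_comp[OF CX_cont_sd[OF N]] mult_nonneg_nonneg sum_nonneg)
  also have "... = (\<integral>\<^sup>+\<theta>. ennreal (3 * h^2) * (\<Sum>j\<in>UNIV. n2 (sd j N) t) \<partial>lam)"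
  proof (rule nn_integral_cong)
   fix \<theta> :: real
   have m: "(\<lambda>x. ennreal ((sd j N (t, x))^2)) \<in> borel_measurable lborel" for j
    by (rule cts_ennreal[OF cj])
   have cs: "cts (\<lambda>x. 3 * h^2 * (\<Sum>j\<in>UNIV. (sd j N (t, x))^2))" by (intro continuous_intros cj)
   have "(nnint x. 3 * h^2 * ?S x \<theta>)
    = (nnint x. 3 * h^2 * (\<Sum>j\<in>UNIV. (sd j N (t, x))^2))" by (rule n_translate[OF cs])
   also have "... = (nnlb x. ennreal (3 * h^2) * (\<Sum>j\<in>UNIV. ennreal ((sd j N (t, x))^2)))"
    by (rule nn_integral_cong) (simp add: ennreal_mult sum_nonneg sum_ennreal)
   also have "... = ennreal (3 * h^2) * (nnlb x. (\<Sum>j\<in>UNIV. ennreal ((sd j N (t, x))^2)))"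
    by (rule nn_integral_cmult) (intro borel_measurable_sum m)
   also have "(nnlb x. (\<Sum>j\<in>UNIV. ennreal ((sd j N (t, x))^2))) = (\<Sum>j\<in>UNIV. n2 (sd j N) t)"
    unfolding n2_def by (rule nn_integral_sum) (rule m)
   finally show "(nnint x. 3 * h^2 * ?S x \<theta>)
    = ennreal (3 * h^2) * (\<Sum>j\<in>UNIV. n2 (sd j N) t)" .
  qed
  also have "... = ennreal (3 * h^2) * (\<Sum>j\<in>UNIV. n2 (sd j N) t)"
   by (simp add: lam.emeasure_eq_measure lam.space_mu)
  finally show "(nnint x. (N (t, x + h *R y) - N (t, x))^2) <= ennreal (3 * h^2) * (\<Sum>j\<in>UNIV. n2 (sd j N) t)" .
 qed simp
 finally show ?thesis .
qed

lemma n2_add: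
 assumes "cts f" "cts g" shows "n2 (\<lambda>z. f z + g z) t <= 2 * (n2 f t + n2 g t)"
proof -
 have m: "(\<lambda>x. ennreal ((f (t, x))^2)) \<in> borel_measurable lborel" "(\<lambda>x. ennreal ((g (t, x))^2)) \<in> borel_measurable lborel"
  by (rule cts_ennreal, intro continuous_intros cts_comp[OF assms(1)] cts_comp[OF assms(2)])+
 have "n2 (\<lambda>z. f z + g z) t <= (nnlb x. 2 * (ennreal ((f (t, x))^2) + ennreal ((g (t, x))^2)))"
  unfolding n2_def
 proof (rule nn_integral_mono)
  fix x
  have "(f (t, x) + g (t, x))^2 <= 2 * ((f (t, x))^2 + (g (t, x))^2)"
   using sum_squares_bound[of "f (t, x)" "g (t, x)"] by (simp add: power2_eq_square algebra_simps)
  then have "ennreal ((f (t, x) + g (t, x))^2) <= ennreal (2 * ((f (t, x))^2 + (g (t, x))^2))" by (rule ennreal_leI)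
  also have "... = 2 * (ennreal ((f (t, x))^2) + ennreal ((g (t, x))^2))" by (simp add: ennreal_mult)
  finally show "ennreal ((f (t, x) + g (t, x))^2) <= 2 * (ennreal ((f (t, x))^2) + ennreal ((g (t, x))^2))" .
 qed
 also have "... = 2 * (n2 f t + n2 g t)"
  unfolding n2_def using m by (simp add: nn_integral_cmult nn_integral_add)
 finally show ?thesis .
qed

lemma n2_JJ_diff:
 assumes N: "CX (Suc 0) N"
 shows "n2 (\<lambda>z. JJ h N z - N z) t <= ennreal (12 * h^2) * (\<Sum>j\<in>UNIV. n2 (sd j N) t)"
proof -
 note cN = CX_cont[OF N]
 let ?d = "\<lambda>z. J h N z - N z"
 have cd: "cts ?d" by (intro continuous_intros J_cont cN)
 have "n2 (\<lambda>z. JJ h N z - N z) t = n2 (\<lambda>z. J h ?d z + ?d z) t"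
  unfolding JJ_def by (simp add: J_diff[OF J_cont[OF cN] cN])
 also have "... <= 2 * (n2 (J h ?d) t + n2 ?d t)" by (rule n2_add[OF J_cont[OF cd] cd])
 also have "... <= 2 * (n2 ?d t + n2 ?d t)" by (intro mult_left_mono add_right_mono n2_J cd) auto
 also have "... = 4 * n2 ?d t" by (simp add: distrib_left[symmetric] flip: mult_2)
 also have "... <= 4 * (ennreal (3 * h^2) * (\<Sum>j\<in>UNIV. n2 (sd j N) t))" by (intro mult_left_mono n2_J_diff N) auto
 also have "... = ennreal (12 * h^2) * (\<Sum>j\<in>UNIV. n2 (sd j N) t)"
  by (simp add: mult.assoc[symmetric]) (simp add: ennreal_mult[symmetric] flip: ennreal_numeral)
 finally show ?thesis .
qed

lemma JJ_sup_diff: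
 assumes N: "CX (Suc 0) N" and G: "\<And>j x. abs (sd j N (t, x)) <= G" and h: "h > 0"
 shows "abs (JJ h N (t, x) - N (t, x)) <= 6 * h * G"
proof -
 note cN = CX_cont[OF N]
 have G0: "G >= 0" using G[of undefined undefined] by linarith
 let ?d = "\<lambda>z. J h N z - N z"
 have cd: "cts ?d" by (intro continuous_intros J_cont cN)
 have d: "abs (?d (t, x)) <= 3 * h * G" for x
 proof -
  have cm: "cts molk" by (intro molk_cont continuous_intros)
  have "abs (N (t, x + h *R y) - N (t, x)) <= 3 * h * G" if y: "norm y <= 1" for y
  proof -
   have "norm (N (t, x + 1 *R (h *R y)) - N (t, x + 0 *R (h *R y))) <= (3 * (h * G)) * norm (1 - 0 :: real)"
   proof (rule field_differentiable_bound[where S=UNIV])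
    show "((\<lambda>r. N (t, x + r *R h *R y)) has_field_derivative (\<Sum>i\<in>UNIV. (h *R y) $ i * sd i N (t, x + r *R h *R y))) (at r within UNIV)" for r
     by (rule has_field_derivative_at_within[OF CX_ray[OF N]])
    show "norm (\<Sum>i\<in>UNIV. (h *R y) $ i * sd i N (t, x + r *R h *R y)) <= 3 * (h * G)" for r
     unfolding real_norm_def
    proof (rule sum3_bound)
     fix i
     have "abs (y $ i) <= 1" using component_le_norm_cart[of y i] y by linarith
     then have "abs ((h *R y) $ i) <= h" using h by (simp add: abs_mult mult_left_le)
     then show "abs ((h *R y) $ i * sd i N (t, x + r *R h *R y)) <= h * G"
      unfolding abs_mult using G h by (intro mult_mono) auto
    qed
   qed auto
   then show ?thesis by (simp add: mult.assoc)
  qed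
  then have b: "abs (molk y * (N (t, x + h *R y) - N (t, x))) <= (3 * h * G) * molk y" for y
   using molk_zero[of y] molk_nonneg[of y] by (cases "norm y <= 1") (auto simp: abs_mult mult.commute[of "molk y"] intro: mult_right_mono)
  have "abs (LINT y|lb 2. molk y * (N (t, x + h *R y) - N (t, x))) <= (LINT y|lb 2. abs (molk y * (N (t, x + h *R y) - N (t, x))))"
   by (rule integral_abs_bound)
  also have "... <= (LINT y|lb 2. (3 * h * G) * molk y)"
   by (rule integral_mono) (auto intro!: lb2.integrable_cont continuous_intros cts_comp[OF cN] cm b)
  also have "... = (3 * h * G) * kc" by (simp add: kc_def)
  finally show ?thesis unfolding J_minus_self[OF cN] using kc_pos by (simp add: pos_divide_le_eq)
 qed
 have "JJ h N (t, x) - N (t, x) = J h ?d (t, x) + ?d (t, x)"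
  unfolding JJ_def by (simp add: J_diff[OF J_cont[OF cN] cN])
 moreover have "abs (J h ?d (t, x)) <= 3 * h * G" by (rule J_sup[OF cd d])
 ultimately show ?thesis using d[of x] by linarith
qed

lemma JJ_diff:
 assumes "cts M" "cts N" shows "JJ h (\<lambda>z. M z - N z) z = JJ h M z - JJ h N z"
proof -
 have "J h (\<lambda>z. M z - N z) = (\<lambda>z. J h M z - J h N z)" using J_diff[OF assms] by blast
 then show ?thesis unfolding JJ_def by (simp add: J_diff J_cont assms)
qed

lemma JJ_cont: "cts N ==> cts (JJ h N)" unfolding JJ_def by (intro J_cont)

section \<open>Smooth nonlinearities\<close>

lemma Ck_on_differentiable: "Ck_on (Suc k) UNIV G ==> G differentiable (at x)"
 by (auto simp: differentiable_on_def)

lemma Ck_on_cont: "Ck_on k UNIV G ==> cts G"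
 by (cases k) (auto intro: differentiable_imp_continuous_on)

lemma Ck_on_add: "Ck_on k UNIV f ==> Ck_on k UNIV g ==> Ck_on k UNIV (\<lambda>x. f x + g x)"
proof (induction k arbitrary: f g)
 case 0 then show ?case by (auto intro: continuous_intros)
next
 case (Suc k)
 have D: "((\<lambda>x. f x + g x) has_derivative (\<lambda>h. frechet_derivative f (at x) h + frechet_derivative g (at x) h)) (at x)" for x
  by (rule has_derivative_add[OF frechet_derivative_works[THEN iffD1, OF Ck_on_differentiable[OF Suc.prems(1)]] frechet_derivative_works[THEN iffD1, OF Ck_on_differentiable[OF Suc.prems(2)]]])
 have "frechet_derivative (\<lambda>x. f x + g x) (at x) = (\<lambda>h. frechet_derivative f (at x) h + frechet_derivative g (at x) h)" for x
  using frechet_derivative_at[OF D] by simp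
 then show ?case using Suc D by (auto simp: differentiable_on_def intro!: differentiableI)
qed

lemma Ck_on_const: "Ck_on k UNIV (\<lambda>_. c)" by (induction k arbitrary: c) auto

lemma Ck_on_cmult: "Ck_on k UNIV f ==> Ck_on k UNIV (\<lambda>x. c * f x)"
proof (induction k arbitrary: f)
 case 0 then show ?case by (auto intro: continuous_intros)
next
 case (Suc k)
 have D: "((\<lambda>x. c * f x) has_derivative (\<lambda>h. c * frechet_derivative f (at x) h)) (at x)" for x
  by (rule has_derivative_mult_right[OF frechet_derivative_works[THEN iffD1, OF Ck_on_differentiable[OF Suc.prems(1)]]])
 have "frechet_derivative (\<lambda>x. c * f x) (at x) = (\<lambda>h. c * frechet_derivative f (at x) h)" for x
  using frechet_derivative_at[OF D] by simp
 then show ?case using Suc D by (auto simp: differentiable_on_def intro!: differentiableI)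
qed

lemma Ck_on_sum: "finite I ==> (\<And>i. i \<in> I ==> Ck_on k UNIV (f i)) ==> Ck_on k UNIV (\<lambda>x. \<Sum>i\<in>I. f i x)"
 by (induction I rule: finite_induct) (auto intro: Ck_on_const Ck_on_add)

text \<open>\<open>Ck_on\<close> speaks of basis directions, and \<open>L h\<close> is in general
  not one of them; hence the derivative in direction \<open>L h\<close> is expanded in the basis
  before the induction hypothesis is used.\<close>

lemma Ck_on_linear:
 fixes L :: "'a::euclidean_space => 'b::euclidean_space"
 assumes L: "bounded_linear L" shows "Ck_on k UNIV G ==> Ck_on k UNIV (\<lambda>x. G (L x))"
proof (induction k arbitrary: G)
 case 0 then show ?case using cts_comp[of G UNIV L] linear_continuous_on[OF L] by simp
next
 case (Suc k)
 have D: "((\<lambda>x. G (L x)) has_derivative (\<lambda>h. frechet_derivative G (at (L x)) (L h))) (at x)" for x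
  using has_derivative_compose[OF bounded_linear_imp_has_derivative[OF L] frechet_derivative_works[THEN iffD1, OF Ck_on_differentiable[OF Suc.prems]]] .
 have eq: "frechet_derivative (\<lambda>x. G (L x)) (at x) = (\<lambda>h. frechet_derivative G (at (L x)) (L h))" for x
  using frechet_derivative_at[OF D] by simp
 have lin: "linear (frechet_derivative G (at y))" for y
  using linear_frechet_derivative[OF Ck_on_differentiable[OF Suc.prems]] .
 have exp: "frechet_derivative G (at (L x)) (L h) = (\<Sum>b\<in>Basis. (L h \<bullet> b) * frechet_derivative G (at (L x)) b)" for x h
 proof -
  have "frechet_derivative G (at (L x)) (\<Sum>b\<in>Basis. (L h \<bullet> b) *R b) = (\<Sum>b\<in>Basis. (L h \<bullet> b) * frechet_derivative G (at (L x)) b)"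
   using lin by (simp add: linear_sum linear_cmul)
  then show ?thesis by (simp add: euclidean_representation)
 qed
 have "Ck_on k UNIV (\<lambda>x. \<Sum>b\<in>Basis. (L h \<bullet> b) * frechet_derivative G (at (L x)) b)" for h
  by (intro Ck_on_sum Ck_on_cmult Suc.IH[of "\<lambda>y. frechet_derivative G (at y) _"]) (use Suc.prems in auto)
 then show ?case using D by (auto simp: differentiable_on_def differentiable_def eq exp)
qed

section \<open>Partial derivatives and order of vanishing at the origin\<close>

definition pdv :: "'c::finite => (real^'c => real) => real^'c => real" where
 "pdv c G P = frechet_derivative G (at P) (axis c 1)"

lemma smooth_pdv: "smooth_on UNIV G ==> smooth_on UNIV (pdv c G)" unfolding smooth_on_def
proof (intro allI)
 fix k assume "\<forall>k. Ck_on k UNIV G"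
 then have "Ck_on (Suc k) UNIV G" by blast
 moreover have "axis c (1::real) \<in> Basis" by (auto simp: Basis_vec_def)
 ultimately show "Ck_on k UNIV (pdv c G)" unfolding pdv_def[abs_def] by simp
qed

lemma smooth_cont: "smooth_on UNIV G ==> cts G" unfolding smooth_on_def using Ck_on_cont by blast

lemma smooth_derivative:
 assumes "smooth_on UNIV (G :: real^'c::finite => real)"
 shows "(G has_derivative (\<lambda>h. \<Sum>c\<in>UNIV. h $ c * pdv c G P)) (at P)"
proof -
 have d: "G differentiable (at P)" using assms unfolding smooth_on_def using Ck_on_differentiable by blast
 have lin: "linear (frechet_derivative G (at P))" using linear_frechet_derivative[OF d] .
 have "frechet_derivative G (at P) h = (\<Sum>c\<in>UNIV. h $ c * pdv c G P)" for h
 proof -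
  have "h = (\<Sum>c\<in>UNIV. h $ c *R axis c 1)"
   using basis_expansion[of h] by (simp add: scalar_mult_eq_scaleR)
  then have "frechet_derivative G (at P) h = frechet_derivative G (at P) (\<Sum>c\<in>UNIV. h $ c *R axis c 1)" by simp
  also have "... = (\<Sum>c\<in>UNIV. h $ c * pdv c G P)"
   unfolding pdv_def using lin by (simp add: linear_sum linear_cmul)
  finally show ?thesis .
 qed
 then show ?thesis using frechet_derivative_works[THEN iffD1, OF d] by (metis (no_types, lifting) ext has_derivative_eq_rhs)
qed

lemma smooth_line:
 assumes "smooth_on UNIV (G :: real^'c::finite => real)"
 shows "DERIV (\<lambda>r. G (P + r *R axis c 1)) r :> pdv c G (P + r *R axis c 1)"
proof -
 have 1: "((\<lambda>r. P + r *R axis c 1) has_derivative (\<lambda>h. h *R axis c 1)) (at r)"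
  by (auto intro!: derivative_eq_intros)
 from has_derivative_compose[OF 1 smooth_derivative[OF assms]]
 have "((\<lambda>r. G (P + r *R axis c 1)) has_derivative (\<lambda>h. \<Sum>d\<in>UNIV. (h *R axis c 1) $ d * pdv d G (P + r *R axis c 1))) (at r)" .
 moreover have "(\<Sum>d\<in>UNIV. (h *R axis c 1) $ d * pdv d G (P + r *R axis c 1)) = pdv c G (P + r *R axis c 1) * h" for h
  by (simp add: axis_def if_distrib[of "\<lambda>x. _ * x * _"] cong: if_cong)
 ultimately show ?thesis unfolding has_field_derivative_def by simp
qed

lemma smooth_bounded:
 assumes "smooth_on UNIV G" shows "\<exists>B\<ge>0. \<forall>P. norm P <= R --> abs (G P) <= B"
proof -
 have "bounded (G ` cball 0 R)"
  by (intro compact_imp_bounded compact_continuous_image continuous_on_subset[OF smooth_cont[OF assms]]) auto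
 then obtain B where B: "\<forall>P\<in>cball 0 R. norm (G P) <= B" by (auto simp: bounded_iff)
 have "abs (G P) <= abs B" if "norm P <= R" for P using B[rule_format, of P] that by auto
 then show ?thesis by (intro exI[of _ "abs B"]) auto
qed

lemma smooth_Lipschitz:
 assumes F: "smooth_on UNIV (F :: real^'c::finite => real)" and S: "convex S" and B: "\<And>c P. P \<in> S ==> abs (pdv c F P) <= B"
  and PQ: "P \<in> S" "Q \<in> S"
 shows "abs (F P - F Q) <= B * (\<Sum>c\<in>UNIV. abs (P $ c - Q $ c))"
proof -
 let ?g = "\<lambda>r. Q + r *R (P - Q)"
 have inS: "?g r \<in> S" if "r \<in> {0..1}" for r
  using convexD_alt[OF S PQ(2,1), of r] that by (simp add: algebra_simps)
 have 1: "(?g has_derivative (\<lambda>h. h *R (P - Q))) (at r)" for r by (auto intro!: derivative_eq_intros)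
 have D: "DERIV (\<lambda>r. F (?g r)) r :> ((\<Sum>c\<in>UNIV. (P $ c - Q $ c) * pdv c F (?g r)))" for r
  unfolding has_field_derivative_def
  by (rule has_derivative_eq_rhs[OF has_derivative_compose[OF 1 smooth_derivative[OF F]]])
    (auto simp: sum_distrib_left sum_distrib_right mult_ac fun_eq_iff)
 have "norm (F (?g 1) - F (?g 0)) <= (B * (\<Sum>c\<in>UNIV. abs (P $ c - Q $ c))) * norm (1 - 0 :: real)"
 proof (rule field_differentiable_bound[of "{0..1::real}", OF _ has_field_derivative_at_within[OF D]])
  fix r :: real assume r: "r \<in> {0..1}"
  have "abs (\<Sum>c\<in>UNIV. (P $ c - Q $ c) * pdv c F (?g r)) <= (\<Sum>c\<in>UNIV. abs (P $ c - Q $ c) * B)"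
   by (rule order_trans[OF sum_abs]) (intro sum_mono, simp add: abs_mult mult_left_mono B inS[OF r])
  then show "norm (\<Sum>c\<in>UNIV. (P $ c - Q $ c) * pdv c F (?g r)) <= B * (\<Sum>c\<in>UNIV. abs (P $ c - Q $ c))"
   by (simp add: sum_distrib_left mult.commute)
 qed auto
 then show ?thesis by simp
qed

text \<open>A cubic bound on the values of the nonlinearity says nothing directly about its
  derivatives. This Taylor condition at 0, extracted from the bound once and for all by
  \<open>vanish_3I\<close>, passes to partial derivatives with the order lowered by one.\<close>

primrec vanish :: "nat => (real^'c::finite => real) => bool" where
 "vanish 0 G \<longleftrightarrow> smooth_on UNIV G"
| "vanish (Suc m) G \<longleftrightarrow> smooth_on UNIV G \<and> G 0 = 0 \<and> (\<forall>c. vanish m (pdv c G))"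

lemma vanish_smooth: "vanish m G ==> smooth_on UNIV G" by (cases m) auto

lemma vanish_pdv: "vanish m G ==> vanish (m - 1) (pdv c G)" by (cases m) (auto simp: smooth_pdv)

text \<open>Each order gains one power: the mean value inequality on the ball of radius
  \<open>norm P\<close> bounds \<open>G P - G 0\<close> by \<open>norm P\<close> times the size of
  the partial derivatives there.\<close>

lemma vanish_bound: "vanish m (G :: real^'c::finite => real) ==> \<exists>K\<ge>0. \<forall>P. norm P <= 1 --> abs (G P) <= K * norm P ^ m"
proof (induction m arbitrary: G)
 case 0 then show ?case using smooth_bounded[of G 1] by simp
next
 case (Suc m)
 then have "\<forall>c. \<exists>K\<ge>0. \<forall>P. norm P <= 1 --> abs (pdv c G P) <= K * norm P ^ m" by auto
 then obtain K where K: "\<And>c. K c >= 0" "\<And>c P. norm P <= 1 ==> abs (pdv c G P) <= K c * norm P ^ m" by metis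
 let ?S = "\<Sum>c\<in>UNIV. K c"
 have S: "?S >= 0" by (intro sum_nonneg K)
 have "abs (G P) <= ?S * real CARD('c) * norm P ^ Suc m" if P: "norm P <= 1" for P
 proof -
  have "abs (G P - G 0) <= (?S * norm P ^ m) * (\<Sum>c\<in>UNIV. abs (P $ c - 0 $ c))"
  proof (rule smooth_Lipschitz[OF vanish_smooth[OF Suc.prems] convex_cball[of 0 "norm P"]])
   fix c Q assume "Q \<in> cball (0 :: real^'c) (norm P)"
   then have Q: "norm Q <= norm P" by simp
   have "abs (pdv c G Q) <= K c * norm Q ^ m" using Q P by (intro K) simp
   also have "... <= ?S * norm P ^ m" using Q by (intro mult_mono member_le_sum power_mono S) (auto simp: K)
   finally show "abs (pdv c G Q) <= ?S * norm P ^ m" .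
  qed auto
  also have "... <= (?S * norm P ^ m) * (real CARD('c) * norm P)"
   using S sum_bounded_above[of UNIV "\<lambda>c. abs (P $ c)" "norm P"] component_le_norm_cart[of P] by (intro mult_left_mono) auto
  finally show ?thesis using Suc.prems by (simp add: mult_ac)
 qed
 then show ?case using S by (intro exI[of _ "?S * real CARD('c)"]) auto
qed

text \<open>The first two derivatives at 0 are read off along \<open>r\<^sup>2\<close> times a basis vector: there the difference
 quotient of G with step \<open>r\<^sup>3\<close> gives a first derivative of size \<open>O(r\<^sup>3)\<close>, which is \<open>o(r^2)\<close>.\<close>

lemma vanish_3I:
 fixes G :: "real^'c::finite => real"
 assumes G: "smooth_on UNIV G" and \<rho>: "\<rho> > 0" and K: "\<And>P. norm P <= \<rho> ==> abs (G P) <= K * norm P ^ 3"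
 shows "vanish 3 G"
proof -
 define s where "s = min 1 (\<rho> / 2)"
 have s: "0 < s" "s <= 1" "2 * s <= \<rho>" using \<rho> by (auto simp: s_def)
 have 0: "pdv c G 0 = 0 \<and> pdv d (pdv c G) 0 = 0" for c d
 proof -
  note G1 = smooth_pdv[OF G, of c]
  obtain B where B: "B >= 0" "\<And>P. norm P <= 2 ==> abs (pdv c (pdv c G) P) <= B"
   using smooth_bounded[OF smooth_pdv[OF G1, of c], of 2] by blast
  \<comment> \<open>Two values of \<open>G\<close> of size \<open>8 * abs K * r ^ 6\<close>, divided
    by the step \<open>r ^ 3\<close>, give 16; \<open>B\<close> is the cost of returning from the
    intermediate point \<open>?P q\<close> to \<open>?P 0\<close>.\<close>
  let ?C = "16 * abs K + B"
  have b: "abs (pdv c G (r^2 *R axis d 1)) <= ?C * r ^ 3" if r: "0 < r" "r <= s" for r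
  proof -
   let ?P = "\<lambda>q. r^2 *R axis d 1 + q *R axis c (1::real)"
   have r2: "r ^ 3 <= r^2" "r^2 <= r" "0 < r ^ 3" using r s power_decreasing[of 2 3 r] power_decreasing[of 1 2 r] by auto
   have n: "norm (?P q) <= 2 * r^2" if "0 <= q" "q <= r ^ 3" for q
    by (rule order_trans[OF norm_triangle_ineq]) (use that r2 in \<open>simp add: norm_axis_1\<close>)
   have GP: "abs (G (?P q)) <= 8 * abs K * r ^ 6" if "0 <= q" "q <= r ^ 3" for q
   proof -
    have "abs (G (?P q)) <= K * norm (?P q) ^ 3" by (rule K) (use n[OF that] r r2 s in linarith)
    also have "... <= abs K * (2 * r^2) ^ 3" by (intro mult_mono power_mono n that) auto
    finally show ?thesis by (simp add: power_mult_distrib)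
   qed
   obtain q where q: "0 < q" "q < r ^ 3" "G (?P (r ^ 3)) - G (?P 0) = (r ^ 3 - 0) * pdv c G (?P q)"
    using MVT2[OF r2(3) smooth_line[OF G]] by blast
   obtain q' where q': "0 < q'" "q' < q" "pdv c G (?P q) - pdv c G (?P 0) = (q - 0) * pdv c (pdv c G) (?P q')"
    using MVT2[OF q(1) smooth_line[OF G1]] by blast
   have "r ^ 3 * abs (pdv c G (?P q)) = abs (G (?P (r ^ 3)) - G (?P 0))" unfolding q(3) using r by (simp add: abs_mult)
   also have "... <= 8 * abs K * r ^ 6 + 8 * abs K * r ^ 6"
    using GP[of "r ^ 3"] GP[of 0] r2(3) by linarith
   also have "... = r ^ 3 * (16 * abs K * r ^ 3)" by (simp add: mult_ac power_add[symmetric])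
   finally have 1: "abs (pdv c G (?P q)) <= 16 * abs K * r ^ 3" using r2(3) by simp
   have "abs ((q - 0) * pdv c (pdv c G) (?P q')) <= r ^ 3 * B"
    unfolding abs_mult using q q' B(1) n[of q'] r r2 s by (intro mult_mono B(2)) auto
   then show ?thesis using 1 unfolding q'(3)[symmetric] by (simp add: algebra_simps)
  qed
  define r where "r n = s / real (Suc n)" for n
  have r: "0 < r n" "r n <= s" for n using s by (auto simp: r_def divide_le_eq mult_le_cancel_left1)
  have rl: "r \<longlonglongrightarrow> 0" unfolding r_def[abs_def] using tendsto_mult_right_zero[OF LIMSEQ_inverse_real_of_nat, of s] by (simp add: divide_inverse)
  let ?f = "\<lambda>q. pdv c G (0 + q *R axis d 1)"
  have D: "DERIV (?f) 0 :> pdv d (pdv c G) 0" using smooth_line[OF G1, of 0 d 0] by simp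
  have r2: "(\<lambda>n. (r n)^2) \<longlonglongrightarrow> 0" using tendsto_power[OF rl, of 2] by simp
  have "(\<lambda>n. ?f ((r n)^2)) \<longlonglongrightarrow> ?f 0"
   by (rule isCont_tendsto_compose[OF DERIV_isCont[OF D] r2])
  moreover have "(\<lambda>n. ?f ((r n)^2)) \<longlonglongrightarrow> 0"
   by (rule Lim_null_comparison[OF always_eventually tendsto_mult_right_zero[OF tendsto_null_power[OF rl, of 3]]])
     (use b[OF r] in auto)
  ultimately have f0: "?f 0 = 0" by (rule LIMSEQ_unique)
  have "(\<lambda>n. (?f ((r n)^2) - ?f 0) / ((r n)^2 - 0)) \<longlonglongrightarrow> pdv d (pdv c G) 0"
  proof (rule filterlim_compose[OF D[unfolded has_field_derivative_iff] filterlim_atI[OF r2]])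
   show "\<forall>\<^sub>F n in sequentially. (r n)^2 \<noteq> 0" using r(1) by (intro always_eventually) (simp add: less_imp_neq[symmetric])
  qed
  moreover have "(\<lambda>n. (?f ((r n)^2) - ?f 0) / ((r n)^2 - 0)) \<longlonglongrightarrow> 0"
  proof (rule Lim_null_comparison[OF always_eventually tendsto_mult_right_zero[OF rl]], rule allI)
   fix n
   have "abs (?f ((r n)^2)) / (r n)^2 <= ?C * r n ^ 3 / (r n)^2" by (intro divide_right_mono) (use b[OF r] in auto)
   then show "norm ((?f ((r n)^2) - ?f 0) / ((r n)^2 - 0)) <= ?C * r n"
    unfolding f0 using r(1)[of n] by (simp add: power2_eq_square power3_eq_cube)
  qed
  ultimately show ?thesis using f0 LIMSEQ_unique by auto
 qed
 have "G 0 = 0" using K[of 0] \<rho> by simp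
 then show ?thesis using 0 G by (simp add: numeral_3_eq_3 smooth_pdv)
qed

section \<open>Leibniz expansion of derivatives of the nonlinearity\<close>

definition PP :: "('c::finite => spacetime => real) => spacetime => real^'c" where
 "PP p z = (\<chi> c. p c z)"

lemma PP_cont: "(\<And>c. cts (p c)) ==> cts (PP p)"
 unfolding PP_def[abs_def] by (intro continuous_on_vec_lambda) simp

lemma PP_chain:
 fixes G :: "real^'c::finite => real"
 assumes G: "smooth_on UNIV G" and p: "\<And>c. CX (Suc k) (p c)"
 shows "hasdd (spv j) (\<lambda>z. G (PP p z)) z (\<Sum>c\<in>UNIV. pdv c G (PP p z) * sd j (p c) z)"
proof -
 have "((\<lambda>s. PP p (z + s *R spv j)) has_derivative (\<lambda>h. \<chi> c. h * sd j (p c) z)) (at 0)"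
  unfolding PP_def
 proof (subst has_derivative_componentwise_within, rule ballI)
  fix b :: "real^'c" assume "b \<in> Basis"
  then obtain c where b: "b = axis c 1" by (auto simp: Basis_vec_def)
  have "((\<lambda>s. p c (z + s *R spv j)) has_derivative (\<lambda>h. h * sd j (p c) z)) (at 0)"
   using CX_hasdd[OF p[of c], of j z] unfolding hasdd_def has_field_derivative_def by (simp add: mult.commute[of _ "sd j (p c) z"])
  then show "((\<lambda>s. (\<chi> c. p c (z + s *R spv j)) \<bullet> b) has_derivative (\<lambda>h. (\<chi> c. h * sd j (p c) z) \<bullet> b)) (at 0)"
   by (simp add: b inner_axis)
 qed
 from has_derivative_compose[OF this smooth_derivative[OF G]]
 show ?thesis unfolding hasdd_def has_field_derivative_def
  by (rule has_derivative_eq_rhs) (auto simp: sum_distrib_left sum_distrib_right mult_ac fun_eq_iff zero_prod_def[symmetric])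
qed

lemma CX_PP:
 "smooth_on UNIV G ==> (\<And>c. CX k (p c)) ==> CX k (\<lambda>z. G (PP p z))"
proof (induction k arbitrary: G)
 case 0
 then show ?case using cts_comp[OF smooth_cont[OF 0(1)] PP_cont[of p]] by simp
next
 case (Suc k)
 have c: "cts (p c)" for c using CX_cont[OF Suc.prems(2)] .
 show ?case
 proof (rule CX_SucI[where u'="\<lambda>j z. \<Sum>c\<in>UNIV. pdv c G (PP p z) * sd j (p c) z"])
  show "cts (\<lambda>z. G (PP p z))"
   by (rule cts_comp[OF smooth_cont[OF Suc.prems(1)] PP_cont[OF c]])
  show "hasdd (spv j) (\<lambda>z. G (PP p z)) z (\<Sum>c\<in>UNIV. pdv c G (PP p z) * sd j (p c) z)" for j z
   by (rule PP_chain[OF Suc.prems])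
  show "CX k (\<lambda>z. \<Sum>c\<in>UNIV. pdv c G (PP p z) * sd j (p c) z)" for j
   by (intro CD_sum CD_mult Suc.IH smooth_pdv Suc.prems(1) CD_Suc_lower[OF Suc.prems(2)] CX_sd[OF Suc.prems(2)]) simp
 qed
qed

definition BB :: "nat => ('c::finite => spacetime => real) => spacetime => real" where
 "BB k p z = (\<Sum>c\<in>UNIV. HS k (p c) z)"

lemma BB_nonneg: "BB k p z >= 0" unfolding BB_def by (intro sum_nonneg HS_nonneg)

lemma HS_le_BB: "HS k (p c) z <= BB k p z"
 unfolding BB_def by (rule member_le_sum[of c UNIV "\<lambda>c. HS k (p c) z"]) (auto simp: HS_nonneg)

lemma Dx_le_BB: "length w <= k ==> abs (Dx w (p c) z) <= BB k p z"
 by (rule order_trans[OF Dx_le_HS HS_le_BB])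

lemma BB_mono: "k <= l ==> BB k p z <= BB l p z"
 unfolding BB_def HS_def by (intro sum_mono sum_mono2) (auto intro: finite_words)

lemma norm_PP_le: "norm (PP p z) <= BB k p z"
proof -
 have "norm (PP p z) <= (\<Sum>c\<in>UNIV. abs (PP p z $ c))" by (rule norm_le_l1_cart)
 also have "... <= BB k p z"
  unfolding BB_def PP_def using Dx_le_HS[of "[]" k] by (intro sum_mono) auto
 finally show ?thesis .
qed

lemma Dx_sum:
 assumes "finite I" "\<And>i. i \<in> I ==> CX (length w) (f i)"
 shows "Dx w (\<lambda>z. \<Sum>i\<in>I. f i z) = (\<lambda>z. \<Sum>i\<in>I. Dx w (f i) z)"
 using assms(2)
proof (induction w)
 case (Cons j w)
 have C: "CX (Suc 0) (Dx w (f i))" if "i \<in> I" for i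
  by (rule CX_Dx) (use Cons.prems[OF that] in \<open>simp del: CD.simps\<close>)
 have "Dx w (\<lambda>z. \<Sum>i\<in>I. f i z) = (\<lambda>z. \<Sum>i\<in>I. Dx w (f i) z)"
  by (rule Cons.IH) (use Cons.prems CD_Suc_lower in \<open>auto simp del: CD.simps\<close>)
 then show ?case
  unfolding Dx_Cons by (auto intro!: ext hasdd_imp_dd hasdd_sum CX_hasdd[OF C] simp del: CD.simps)
qed simp

lemma Dx_add:
 assumes "CX (length w) f" "CX (length w) g"
 shows "Dx w (\<lambda>z. f z + g z) = (\<lambda>z. Dx w f z + Dx w g z)"
 using Dx_sum[of "UNIV :: bool set" w "\<lambda>b. if b then f else g"] assms by (simp add: UNIV_bool add.commute)

text \<open>Space derivatives of \<open>F (PP p z)\<close> are sums of terms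
  \<open>G (PP p z) * mon p vs z\<close> with \<open>G\<close> a partial derivative of
  \<open>F\<close>; \<open>dmon\<close> lists the terms of the product rule, so that this class is
  closed under \<open>sd\<close>.\<close>

fun mon :: "('c => spacetime => real) => (3 list \<times> 'c) list => spacetime => real" where
 "mon p [] = (\<lambda>z. 1)"
| "mon p (v # vs) = (\<lambda>z. Dx (fst v) (p (snd v)) z * mon p vs z)"

fun dmon :: "3 => (3 list \<times> 'c) list => (3 list \<times> 'c) list list" where
 "dmon j [] = []"
| "dmon j (v # vs) = ((j # fst v, snd v) # vs) # map ((#) v) (dmon j vs)"

abbreviation total :: "(3 list \<times> 'c) list => nat" where
 "total vs \<equiv> (\<Sum>v\<leftarrow>vs. length (fst v))"

lemma dmon_props: "us \<in> set (dmon j vs) ==> length us = length vs \<and> total us = Suc (total vs)"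
 by (induction vs arbitrary: us) auto

lemma mon_CX: "(\<And>c. CX (total vs + k) (p c)) ==> CX k (mon p vs)"
proof (induction vs)
 case (Cons v vs)
 show ?case unfolding mon.simps
  by (intro CD_mult CX_Dx'[OF Cons.prems] Cons.IH CD_mono[OF Cons.prems]) auto
qed (auto intro: CD_const)

lemma mon_hasdd:
 assumes "\<And>c. CX (Suc (total vs)) (p c)"
 shows "hasdd (spv j) (mon p vs) z (\<Sum>us\<leftarrow>dmon j vs. mon p us z)" using assms
proof (induction vs)
 case Nil show ?case by (simp add: hasdd_const del: CD.simps)
next
 case (Cons v vs)
 have 1: "hasdd (spv j) (Dx (fst v) (p (snd v))) z (Dx (j # fst v) (p (snd v)) z)"
  unfolding Dx_Cons by (rule CX_hasdd[where k=0], rule CX_Dx'[OF Cons.prems]) simp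
 have "hasdd (spv j) (mon p vs) z (\<Sum>us\<leftarrow>dmon j vs. mon p us z)"
  by (rule Cons.IH, rule CD_mono[OF Cons.prems]) simp
 from hasdd_mult[OF 1 this] show ?case
  unfolding dmon.simps list.map sum_list.Cons mon.simps map_map o_def fst_conv snd_conv sum_list_const_mult
  by (simp add: algebra_simps)
qed

lemma mon_bound_low:
 assumes "\<And>v. v \<in> set vs ==> length (fst v) <= L"
 shows "abs (mon p vs z) <= BB L p z ^ length vs" using assms
proof (induction vs)
 case (Cons v vs)
 have "abs (Dx (fst v) (p (snd v)) z) <= BB L p z" using Cons.prems by (intro Dx_le_BB) simp
 moreover have "abs (mon p vs z) <= BB L p z ^ length vs" using Cons by simp
 ultimately show ?case by (simp add: abs_mult mult_mono BB_nonneg)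
qed simp

lemma total_ge: "v \<in> set vs ==> length (fst v) <= total vs" by (induction vs) auto

text \<open>If a factor carries more than \<open>L\<close> derivatives, fewer than
  \<open>K - L\<close> of the total are left, so by \<open>K <= 2 * L + 1\<close> all other factors
  have order at most \<open>L\<close>. Only that one factor is measured in
  \<open>BB K\<close>.\<close>

lemma mon_bound_high:
 assumes "vs \<noteq> []" "total vs <= K" "K <= 2 * L + 1" "L <= K"
 shows "abs (mon p vs z) <= BB K p z * BB L p z ^ (length vs - 1)" using assms(1,2)
proof (induction vs)
 case (Cons v vs)
 show ?case
 proof (cases "length (fst v) <= L \<and> vs \<noteq> []")
  case True
  have "abs (mon p (v # vs) z) = abs (Dx (fst v) (p (snd v)) z) * abs (mon p vs z)" by (simp add: abs_mult)
  also have "... <= BB L p z * (BB K p z * BB L p z ^ (length vs - 1))"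
   using True Cons by (intro mult_mono Dx_le_BB Cons.IH) (auto simp: BB_nonneg)
  also have "... = BB K p z * BB L p z ^ (length (v # vs) - 1)" using True by (cases vs) auto
  finally show ?thesis .
 next
  case False
  have "abs (mon p vs z) <= BB L p z ^ length vs"
  proof (rule mon_bound_low)
   fix u assume u: "u \<in> set vs"
   then have "\<not> length (fst v) <= L" using False by auto
   then show "length (fst u) <= L" using total_ge[OF u] Cons.prems(2) assms(3) by simp
  qed
  moreover have "abs (Dx (fst v) (p (snd v)) z) <= BB K p z" using Cons.prems by (intro Dx_le_BB) simp
  ultimately show ?thesis by (auto simp: abs_mult intro!: mult_mono BB_nonneg)
 qed
qed simp

text \<open>The constant is uniform in the family \<open>p\<close>, and the statement concerns the
  map \<open>U\<close> acting on families: in this form it is stable under finite sums and can be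
  proved by induction on the derivative.\<close>

definition cubic_bounded :: "nat => nat => (('c::finite => spacetime => real) => spacetime => real) => bool" where
 "cubic_bounded K L U \<longleftrightarrow> (\<exists>C\<ge>0. \<forall>p z. (\<forall>c. CX K (p c)) --> BB L p z <= 1 -->
   abs (U p z) <= C * (BB K p z * (BB L p z)^2))"

lemma cubic_bounded_zero: "cubic_bounded K L (\<lambda>p z. 0)"
 unfolding cubic_bounded_def by (intro exI[of _ 0]) auto

lemma cubic_bounded_add:
 fixes U V :: "('c::finite => spacetime => real) => spacetime => real"
 assumes "cubic_bounded K L U" "cubic_bounded K L V"
 shows "cubic_bounded K L (\<lambda>p z. U p z + V p z)"
proof -
 obtain C where U: "C >= 0" "\<forall>p z. (\<forall>c. CX K (p c)) --> BB L p z <= 1 --> abs (U p z) <= C * (BB K p z * (BB L p z)^2)"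
  using assms(1) unfolding cubic_bounded_def by (elim exE conjE)
 obtain C' where V: "C' >= 0" "\<forall>p z. (\<forall>c. CX K (p c)) --> BB L p z <= 1 --> abs (V p z) <= C' * (BB K p z * (BB L p z)^2)"
  using assms(2) unfolding cubic_bounded_def by (elim exE conjE)
 show ?thesis unfolding cubic_bounded_def
 proof (rule exI[of _ "C + C'"], intro conjI allI impI)
  fix p :: "'c => spacetime => real" and z assume p: "\<forall>c. CX K (p c)" "BB L p z <= 1"
  show "abs (U p z + V p z) <= (C + C') * (BB K p z * (BB L p z)^2)"
   using U(2)[rule_format, of p z] V(2)[rule_format, of p z] p unfolding distrib_right by fastforce
 qed (use U V in auto)
qed

lemma cubic_bounded_sum:
 "finite I ==> (\<And>i. i \<in> I ==> cubic_bounded K L (U i)) ==> cubic_bounded K L (\<lambda>p z. \<Sum>i\<in>I. U i p z)"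
 by (induction I rule: finite_induct) (auto intro: cubic_bounded_zero cubic_bounded_add)

lemma cubic_bounded_cong:
 assumes "cubic_bounded K L U" "\<And>p z. (\<And>c. CX K (p c)) ==> V p z = U p z"
 shows "cubic_bounded K L V" using assms unfolding cubic_bounded_def by metis

text \<open>The \<open>m\<close> orders of vanishing of \<open>G\<close> and the factors of the
  monomial together supply at least three small factors; one of them may be the high-order one, and
  surplus factors are bounded by 1.\<close>

lemma cubic_bounded_base:
 assumes "vanish m G" "3 <= m + length vs" "total vs <= K" "K <= 2 * L + 1" "L <= K"
 shows "cubic_bounded K L (\<lambda>p z. G (PP p z) * mon p vs z)"
proof -
 obtain A where G: "A >= 0" "\<forall>P. norm P <= 1 --> abs (G P) <= A * norm P ^ m"
  using vanish_bound[OF assms(1)] by (elim exE conjE)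
 show ?thesis unfolding cubic_bounded_def
 proof (rule exI[of _ A], intro conjI allI impI G(1))
  fix p :: "'a => spacetime => real" and z assume b: "BB L p z <= 1"
  let ?A = "BB K p z" and ?B = "BB L p z"
  have B: "0 <= ?B" "?B <= 1" "?B <= ?A" using b BB_nonneg[of L p z] BB_mono[OF assms(5), of p z] by auto
  have n: "norm (PP p z) <= ?B" by (rule norm_PP_le)
  have "abs (G (PP p z)) <= A * norm (PP p z) ^ m" using G(2) n b by auto
  also have "... <= A * ?B ^ m" using n G(1) by (intro mult_left_mono power_mono) auto
  finally have g: "abs (G (PP p z)) <= A * ?B ^ m" .
  have "?B ^ m * abs (mon p vs z) <= ?A * ?B^2"
  proof (cases "vs = []")
   case True
   then have "?B ^ m <= ?B ^ 3" using B assms(2) by (intro power_decreasing) auto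
   also have "... = ?B * ?B^2" by (simp add: power3_eq_cube power2_eq_square)
   also have "... <= ?A * ?B^2" using B by (intro mult_right_mono) auto
   finally show ?thesis using True by simp
  next
   case False
   have "?B ^ m * abs (mon p vs z) <= ?B ^ m * (?A * ?B ^ (length vs - 1))"
    using B by (intro mult_left_mono mon_bound_high False assms(3-5)) auto
   also have "... = ?A * ?B ^ (m + (length vs - 1))" by (simp add: power_add)
   also have "... <= ?A * ?B^2"
    using B assms(2) False by (intro mult_left_mono power_decreasing) (auto simp: BB_nonneg Suc_le_eq)
   finally show ?thesis .
  qed
  then have "A * ?B ^ m * abs (mon p vs z) <= A * (?A * ?B^2)" using G(1) by (simp add: mult.assoc mult_left_mono)
  moreover have "abs (G (PP p z) * mon p vs z) <= A * ?B ^ m * abs (mon p vs z)"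
   unfolding abs_mult using g by (intro mult_right_mono) auto
  ultimately show "abs (G (PP p z) * mon p vs z) <= A * (?A * ?B^2)" by linarith
 qed
qed

text \<open>Induction on the last letter, the derivative applied first, hence for all
  \<open>G\<close> and all monomials at once. A derivative on \<open>G\<close> lowers the order of
  vanishing by at most one and adds a factor; one on the monomial keeps the number of factors. So
  \<open>m + length vs\<close> never falls below 3.\<close>

lemma cubic_bounded_Dx:
 assumes "K <= 2 * L + 1" "L <= K"
 shows "vanish m G ==> 3 <= m + length vs ==> total vs + length w <= K
  ==> cubic_bounded K L (\<lambda>p. Dx w (\<lambda>z. G (PP p z) * mon p vs z))"
proof (induction w arbitrary: m G vs rule: rev_induct)
 case Nil
 then show ?case using cubic_bounded_base[OF Nil(1,2) _ assms] by simp
next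
 case (snoc j w)
 have G: "smooth_on UNIV G" by (rule vanish_smooth[OF snoc.prems(1)])
 have len: "total vs + Suc (length w) <= K" using snoc.prems by simp
 let ?I = "{..<length (dmon j vs)}"
 let ?u = "\<lambda>i. dmon j vs ! i"
 have up: "length (?u i) = length vs" "total (?u i) = Suc (total vs)" if "i \<in> ?I" for i
  using dmon_props[of "?u i" j vs] that by auto
 show ?case
 proof (rule cubic_bounded_cong[OF cubic_bounded_add[OF
    cubic_bounded_sum[of UNIV K L "\<lambda>c p. Dx w (\<lambda>z. pdv c G (PP p z) * mon p (([j], c) # vs) z)"]
    cubic_bounded_sum[of ?I K L "\<lambda>i p. Dx w (\<lambda>z. G (PP p z) * mon p (?u i) z)"]]])
  show "cubic_bounded K L (\<lambda>p. Dx w (\<lambda>z. pdv c G (PP p z) * mon p (([j], c) # vs) z))" for c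
   by (rule snoc.IH[OF vanish_pdv[OF snoc.prems(1)]]) (use snoc.prems in auto)
  show "cubic_bounded K L (\<lambda>p. Dx w (\<lambda>z. G (PP p z) * mon p (?u i) z))" if "i \<in> ?I" for i
   by (rule snoc.IH[OF snoc.prems(1)]) (use snoc.prems up[OF that] in auto)
  fix p :: "'a => spacetime => real" and z assume p: "\<And>c. CX K (p c)"
  have p': "CX n (p c)" if "n <= K" for n c by (rule CD_mono[OF p that])
  have cx1: "CX (length w) (\<lambda>z. pdv c G (PP p z) * mon p (([j], c) # vs) z)" for c
   by (intro CD_mult CX_PP smooth_pdv G mon_CX p') (use len in auto)
  have cx2: "CX (length w) (\<lambda>z. G (PP p z) * mon p (?u i) z)" if "i \<in> ?I" for i
   by (intro CD_mult CX_PP G mon_CX p') (use len up[OF that] in auto)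
  have "sd j (\<lambda>z. G (PP p z) * mon p vs z) = (\<lambda>z. (\<Sum>c\<in>UNIV. pdv c G (PP p z) * mon p (([j], c) # vs) z) +
    (\<Sum>i\<in>?I. G (PP p z) * mon p (?u i) z))"
  proof (intro ext hasdd_imp_dd)
   fix z
   have a: "hasdd (spv j) (\<lambda>z. G (PP p z)) z (\<Sum>c\<in>UNIV. pdv c G (PP p z) * sd j (p c) z)"
    by (rule PP_chain[where k=0, OF G p']) (use len in auto)
   have b: "hasdd (spv j) (mon p vs) z (\<Sum>us\<leftarrow>dmon j vs. mon p us z)"
    by (rule mon_hasdd[OF p']) (use len in auto)
   from hasdd_mult[OF a b] show "hasdd (spv j) (\<lambda>z. G (PP p z) * mon p vs z) z
     ((\<Sum>c\<in>UNIV. pdv c G (PP p z) * mon p (([j], c) # vs) z) + (\<Sum>i\<in>?I. G (PP p z) * mon p (?u i) z))"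
    by (simp add: sum_list_sum_nth atLeast0LessThan sum_distrib_left sum_distrib_right Dx_Cons mult_ac)
  qed
  moreover have "Dx w (\<lambda>z. (\<Sum>c\<in>UNIV. pdv c G (PP p z) * mon p (([j], c) # vs) z) + (\<Sum>i\<in>?I. G (PP p z) * mon p (?u i) z))
   = (\<lambda>z. (\<Sum>c\<in>UNIV. Dx w (\<lambda>z. pdv c G (PP p z) * mon p (([j], c) # vs) z) z) + (\<Sum>i\<in>?I. Dx w (\<lambda>z. G (PP p z) * mon p (?u i) z) z))"
   by (subst Dx_add[OF CD_sum[OF _ cx1] CD_sum[OF _ cx2]], simp, simp, assumption)
     (subst Dx_sum[OF _ cx1], simp, subst Dx_sum[OF _ cx2], simp_all)
  ultimately show "Dx (w @ [j]) (\<lambda>z. G (PP p z) * mon p vs z) z =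
   (\<Sum>c\<in>UNIV. Dx w (\<lambda>z. pdv c G (PP p z) * mon p (([j], c) # vs) z) z) + (\<Sum>i\<in>?I. Dx w (\<lambda>z. G (PP p z) * mon p (?u i) z) z)"
   by (simp only: Dx_append Dx_Cons Dx_Nil)
 qed auto
qed

lemma Dx_nonlinearity:
 assumes "K <= 2 * L + 1" "L <= K" "vanish 3 F"
 shows "\<exists>C\<ge>0. \<forall>p z. (\<forall>c. CX K (p c)) --> BB L p z <= 1 -->
   (\<forall>w. length w <= K --> abs (Dx w (\<lambda>z. F (PP p z)) z) <= C * (BB K p z * (BB L p z)^2))"
proof -
 have "\<forall>w\<in>{w. length w <= K}. cubic_bounded K L (\<lambda>p. Dx w (\<lambda>z. F (PP p z) * mon p [] z))"
  by (intro ballI cubic_bounded_Dx[OF assms]) auto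
 then obtain C where w: "\<forall>w\<in>{w. length w <= K}. C w >= 0 \<and> (\<forall>p z. (\<forall>c. CX K (p c)) --> BB L p z <= 1 --> abs (Dx w (\<lambda>z. F (PP p z)) z) <= C w * (BB K p z * (BB L p z)^2))"
  unfolding cubic_bounded_def mon.simps mult_1_right by metis
 show ?thesis
 proof (rule exI[of _ "\<Sum>w | length w <= K. C w"], intro conjI allI impI)
  show "0 <= (\<Sum>w | length w <= K. C w)" using w by (intro sum_nonneg) auto
  fix p :: "'a => spacetime => real" and z and u :: "3 list"
  assume p: "\<forall>c. CX K (p c)" "BB L p z <= 1" "length u <= K"
  then have "abs (Dx u (\<lambda>z. F (PP p z)) z) <= C u * (BB K p z * (BB L p z)^2)" using w[THEN bspec, of u] by blast
  also have "C u <= (\<Sum>w | length w <= K. C w)" using w p by (intro member_le_sum finite_words) auto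
  finally show "abs (Dx u (\<lambda>z. F (PP p z)) z) <= (\<Sum>w | length w <= K. C w) * (BB K p z * (BB L p z)^2)"
   by (simp add: mult_right_mono BB_nonneg)
 qed
qed

lemma nonlinearity_Lipschitz:
 assumes "vanish 3 F"
 shows "\<exists>C\<ge>0. \<forall>P Q r. norm P <= r --> norm Q <= r --> r <= 1 --> abs (F P - F Q) <= C * r^2 * (\<Sum>c\<in>UNIV. abs (P $ c - Q $ c))"
proof -
 have "\<forall>c. \<exists>K\<ge>0. \<forall>P. norm P <= 1 --> abs (pdv c F P) <= K * norm P ^ (3 - 1)"
  by (intro allI vanish_bound vanish_pdv assms)
 then obtain K where K: "\<And>c. K c >= 0" "\<And>c P. norm P <= 1 ==> abs (pdv c F P) <= K c * norm P ^ (3 - 1)" by metis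
 show ?thesis
 proof (rule exI[of _ "\<Sum>c\<in>UNIV. K c"], intro conjI allI impI)
  show "0 <= (\<Sum>c\<in>UNIV. K c)" using K by (intro sum_nonneg) auto
  fix P Q :: "real^'a" and r :: real assume r: "norm P <= r" "norm Q <= r" "r <= 1"
  show "abs (F P - F Q) <= (\<Sum>c\<in>UNIV. K c) * r^2 * (\<Sum>c\<in>UNIV. abs (P $ c - Q $ c))"
  proof (rule smooth_Lipschitz[OF vanish_smooth[OF assms] convex_cball[of 0 r]])
   fix c R assume R: "R \<in> cball (0::real^'a) r"
   then have "abs (pdv c F R) <= K c * norm R ^ (3 - 1)" using r by (intro K) auto
   also have "... <= (\<Sum>c\<in>UNIV. K c) * r^2"
    using R K(1) by (simp, intro mult_mono member_le_sum power_mono sum_nonneg) auto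
   finally show "abs (pdv c F R) <= (\<Sum>c\<in>UNIV. K c) * r^2" .
  qed (use r in auto)
 qed
qed

section \<open>The norms of the iteration\<close>

definition good :: "nat => nat => real => (spacetime => real) => bool" where
 "good K L M u \<longleftrightarrow> CX K u \<and> (\<forall>t\<ge>0. \<forall>w.
   (length w <= K --> n2 (Dx w u) t <= ennreal (M^2)) \<and>
   (length w <= L --> n4 (Dx w u) t <= ennreal (M^4 / (1 + t)^2) \<and> (\<forall>x. abs (Dx w u (t, x)) <= M * dec t)))"

definition good_source :: "nat => real => (spacetime => real) => bool" where
 "good_source K B N \<longleftrightarrow> CX K N \<and> (\<forall>s\<ge>0. \<forall>w. length w <= K -->
   n2 (Dx w N) s <= ennreal (B^2 / (1 + s)^3) \<and> n1 (Dx w N) s <= ennreal (B / (1 + s)))"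

lemma goodD:
 assumes "good K L M u" shows "CX K u" "t >= 0 ==> length w <= K ==> n2 (Dx w u) t <= ennreal (M^2)"
  "t >= 0 ==> length w <= L ==> n4 (Dx w u) t <= ennreal (M^4 / (1 + t)^2)"
  "t >= 0 ==> length w <= L ==> abs (Dx w u (t, x)) <= M * dec t"
 using assms unfolding good_def by (blast+)

lemma dec_bounds: "0 < dec t" "dec t <= 1" "t >= 0 ==> dec t ^ 4 = 1 / (1 + t)^3"
proof -
 show "0 < dec t" unfolding dec_def by simp
 show "dec t <= 1" unfolding dec_def using powr_mono[of "-3/4" 0 "1 + abs t"] by (simp split: if_splits)
 show "dec t ^ 4 = 1 / (1 + t)^3" if "t >= 0"
 proof -
  have "dec t ^ 4 = (1 + t) powr (- 3)" using that unfolding dec_def by (simp add: powr_power)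
  also have "... = 1 / (1 + t)^3" using that by (simp add: powr_minus powr_numeral divide_inverse)
  finally show ?thesis .
 qed
qed

lemma fourth_add: "((a::real) + b)^4 <= 8 * (a^4 + b^4)"
proof -
 have sq: "((x::real) + y)^2 <= 2 * (x^2 + y^2)" for x y
  using sum_squares_bound[of x y] by (simp add: power2_sum)
 have e: "x ^ 4 = (x^2)^2" for x :: real by simp
 have "(a + b)^4 = ((a + b)^2)^2" by (rule e)
 also have "... <= (2 * (a^2 + b^2))^2" by (intro power_mono sq) auto
 also have "... = 4 * (a^2 + b^2)^2" unfolding power_mult_distrib by simp
 also have "... <= 4 * (2 * ((a^2)^2 + (b^2)^2))" by (intro mult_left_mono sq) auto
 finally show ?thesis by (simp add: e[symmetric])
qed

lemma n4_add:
 assumes "cts f" "cts g" shows "n4 (\<lambda>z. f z + g z) t <= 8 * (n4 f t + n4 g t)"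
proof -
 have m: "(\<lambda>x. ennreal ((f (t, x))^4)) \<in> borel_measurable lborel" "(\<lambda>x. ennreal ((g (t, x))^4)) \<in> borel_measurable lborel"
  by (rule cts_ennreal, intro continuous_intros cts_comp[OF assms(1)] cts_comp[OF assms(2)])+
 have "n4 (\<lambda>z. f z + g z) t <= (nnlb x. 8 * (ennreal ((f (t, x))^4) + ennreal ((g (t, x))^4)))"
  unfolding n4_def
 proof (rule nn_integral_mono)
  fix x
  have "ennreal ((f (t, x) + g (t, x))^4) <= ennreal (8 * ((f (t, x))^4 + (g (t, x))^4))"
   by (intro ennreal_leI fourth_add)
  also have "... = 8 * (ennreal ((f (t, x))^4) + ennreal ((g (t, x))^4))" by (simp add: ennreal_mult ennreal_plus)
  finally show "ennreal ((f (t, x) + g (t, x))^4) <= 8 * (ennreal ((f (t, x))^4) + ennreal ((g (t, x))^4))" .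
 qed
 also have "... = 8 * (n4 f t + n4 g t)"
  unfolding n4_def using m by (simp add: nn_integral_cmult nn_integral_add)
 finally show ?thesis .
qed

lemma ennreal_8: "0 <= a ==> 0 <= b ==> 8 * (ennreal a + ennreal b) = ennreal (8 * (a + b))"
 by (simp add: ennreal_mult ennreal_plus)

text \<open>The factor 2 absorbs the constants 2 and 8 with which squares and fourth powers of sums
  are estimated.\<close>

lemma good_add:
 assumes f: "good K L M f" and g: "good K L M' g" and M: "0 <= M" "0 <= M'" and LK: "L <= K"
 shows "good K L (2 * (M + M')) (\<lambda>z. f z + g z)"
proof -
 note cf = goodD(1)[OF f] and cg = goodD(1)[OF g]
 have sq: "2 * (M^2 + M'^2) <= (2 * (M + M'))^2" using M by (simp add: power2_eq_square algebra_simps)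
 have "8 * (M^4 + M'^4) <= 2 * (2 * (M^2 + M'^2))^2" using M by (simp add: power2_eq_square eval_nat_numeral algebra_simps)
 also have "... <= 2 * ((M + M')^2 * 2)^2" using M by (intro mult_left_mono power_mono) (auto simp: power2_eq_square algebra_simps)
 also have "... = 8 * (M + M')^4" by (simp add: power_mult_distrib)
 also have "... <= 16 * (M + M')^4" by simp
 also have "... = (2 * (M + M'))^4" unfolding power_mult_distrib by simp
 finally have fo: "8 * (M^4 + M'^4) <= (2 * (M + M'))^4" .
 have D: "Dx w (\<lambda>z. f z + g z) = (\<lambda>z. Dx w f z + Dx w g z)" if "length w <= K" for w
  by (rule Dx_add; rule CD_mono[OF _ that]; fact)
 have c: "cts (Dx w f)" "cts (Dx w g)" if "length w <= K" for w
  using CX_Dx'[OF cf, of w 0] CX_Dx'[OF cg, of w 0] that by auto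
 show ?thesis unfolding good_def
 proof (intro conjI allI impI)
  show "CX K (\<lambda>z. f z + g z)" by (rule CD_add[OF cf cg])
  fix t :: real and w :: "3 list" assume t: "t >= 0"
  { assume w: "length w <= K"
   have "n2 (Dx w (\<lambda>z. f z + g z)) t <= 2 * (n2 (Dx w f) t + n2 (Dx w g) t)"
    unfolding D[OF w] by (rule n2_add[OF c[OF w]])
   also have "... <= 2 * (ennreal (M^2) + ennreal (M'^2))"
    by (intro mult_left_mono add_mono goodD(2)[OF f] goodD(2)[OF g] t w) auto
   also have "... = ennreal (2 * (M^2 + M'^2))" by (simp add: ennreal_mult ennreal_plus)
   finally show "n2 (Dx w (\<lambda>z. f z + g z)) t <= ennreal ((2 * (M + M'))^2)" using sq by (meson ennreal_leI order_trans) }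
  assume w: "length w <= L"
  then have wK: "length w <= K" using LK by simp
  show "abs (Dx w (\<lambda>z. f z + g z) (t, x)) <= 2 * (M + M') * dec t" for x
  proof -
   have "abs (Dx w (\<lambda>z. f z + g z) (t, x)) <= M * dec t + M' * dec t"
    unfolding D[OF wK] using goodD(4)[OF f t w, of x] goodD(4)[OF g t w, of x] by linarith
   also have "... <= 2 * (M + M') * dec t" using M dec_bounds(1)[of t] by (simp add: algebra_simps)
   finally show ?thesis .
  qed
  show "n4 (Dx w (\<lambda>z. f z + g z)) t <= ennreal ((2 * (M + M'))^4 / (1 + t)^2)"
  proof -
   have "n4 (Dx w (\<lambda>z. f z + g z)) t <= 8 * (n4 (Dx w f) t + n4 (Dx w g) t)"
    unfolding D[OF wK] by (rule n4_add[OF c[OF wK]])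
   also have "... <= 8 * (ennreal (M^4 / (1 + t)^2) + ennreal (M'^4 / (1 + t)^2))"
    by (intro mult_left_mono add_mono goodD(3)[OF f] goodD(3)[OF g] t w) auto
   also have "... = ennreal (8 * (M^4 + M'^4) / (1 + t)^2)"
    by (subst ennreal_8) (simp_all add: add_divide_distrib)
   also have "... <= ennreal ((2 * (M + M'))^4 / (1 + t)^2)"
    by (intro ennreal_leI divide_right_mono fo) simp
   finally show ?thesis .
  qed
 qed
qed

lemma good_mono: "good K L M u ==> 0 <= M ==> M <= M' ==> good K L M' u" unfolding good_def
proof (elim conjE, intro conjI allI impI, goal_cases)
 case (2 t w) then show ?case by (meson ennreal_leI order_trans power_mono)
next
 case (3 t w)
 have "M ^ 4 / (1 + t)^2 <= M' ^ 4 / (1 + t)^2" using 3 by (intro divide_right_mono power_mono) auto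
 then show ?case using 3 by (meson ennreal_leI order_trans)
next
 case (4 t w x)
 have "M * dec t <= M' * dec t" using 4 dec_bounds(1)[of t] by (intro mult_right_mono) auto
 then show ?case using 4 by (meson order_trans)
qed

lemma n4_cmult:
 assumes "cts u" shows "n4 (\<lambda>z. c * u z) t = ennreal (c^4) * n4 u t"
proof -
 have "n4 (\<lambda>z. c * u z) t = (nnlb x. ennreal (c^4) * ennreal ((u (t, x))^4))"
  unfolding n4_def by (rule nn_integral_cong) (simp add: power_mult_distrib ennreal_mult)
 also have "... = ennreal (c^4) * n4 u t" unfolding n4_def
  by (rule nn_integral_cmult) (rule cts_ennreal, intro continuous_intros cts_comp[OF assms])
 finally show ?thesis .
qed

lemma good_cmult:
 assumes u: "good K L M u" and M: "0 <= M" and LK: "L <= K"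
 shows "good K L (abs c * M) (\<lambda>z. c * u z)"
proof -
 note cu = goodD(1)[OF u]
 have op: "smooth_op 0 (\<lambda>u z. c * u z)"
  by (rule smooth_opI) (auto intro!: continuous_intros hasdd_cmult CX_hasdd simp del: CD.simps dest: CX_cont)
 have D: "Dx w (\<lambda>z. c * u z) = (\<lambda>z. c * Dx w u z)" if "length w <= K" for w
  by (rule smooth_op_Dx[OF op]) (simp add: CD_mono[OF cu that] del: CD.simps)
 have co: "cts (Dx w u)" if "length w <= K" for w using CX_Dx'[OF cu, of w 0] that by auto
 show ?thesis unfolding good_def
 proof (intro conjI allI impI)
  show "CX K (\<lambda>z. c * u z)" by (rule CD_cmult[OF cu])
  fix t :: real and w :: "3 list" assume t: "t >= 0"
  { assume w: "length w <= K"
   have "n2 (\<lambda>z. c * Dx w u z) t = ennreal (c^2) * n2 (Dx w u) t"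
    unfolding n2_def by (rule n_scale_square) (intro continuous_intros cts_comp[OF co[OF w]])
   also have "... <= ennreal (c^2) * ennreal (M^2)" by (intro mult_left_mono goodD(2)[OF u t w]) simp
   also have "... = ennreal ((abs c * M)^2)" by (simp add: ennreal_mult[symmetric] power_mult_distrib)
   finally show "n2 (Dx w (\<lambda>z. c * u z)) t <= ennreal ((abs c * M)^2)" unfolding D[OF w] . }
  assume w: "length w <= L"
  then have wK: "length w <= K" using LK by simp
  show "abs (Dx w (\<lambda>z. c * u z) (t, x)) <= abs c * M * dec t" for x
   unfolding D[OF wK] abs_mult mult.assoc by (intro mult_left_mono goodD(4)[OF u t w]) auto
  have "n4 (\<lambda>z. c * Dx w u z) t = ennreal (c^4) * n4 (Dx w u) t" by (rule n4_cmult[OF co[OF wK]])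
  also have "... <= ennreal (c^4) * ennreal (M^4 / (1 + t)^2)" by (intro mult_left_mono goodD(3)[OF u t w]) simp
  also have "... = ennreal ((abs c * M)^4 / (1 + t)^2)" by (simp add: ennreal_mult[symmetric] power_mult_distrib)
  finally show "n4 (Dx w (\<lambda>z. c * u z)) t <= ennreal ((abs c * M)^4 / (1 + t)^2)" unfolding D[OF wK] .
 qed
qed

text \<open>Two derivatives more are required to exist than are bounded: the kernel identities
  differentiate the data twice, while the constants depend on the bounded ones.\<close>

definition good_data :: "nat => real => (spacetime => real) => bool" where
 "good_data K B g \<longleftrightarrow> CX (Suc (Suc K)) g \<and> (\<forall>w. length w <= K --> n2 (Dx w g) 0 <= ennreal (B^2) \<and> n1 (Dx w g) 0 <= ennreal B)"

lemma good_smooth_op: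
 assumes Q: "smooth_op 1 Q" and u: "CX (Suc (Suc K)) u" and LK: "L <= K"
  and n2: "\<And>w t. length w <= K ==> t >= 0 ==> n2 (Q (Dx w u)) t <= ennreal (M^2)"
  and n4: "\<And>w t. length w <= L ==> t >= 0 ==> n4 (Q (Dx w u)) t <= ennreal (M^4 / (1 + t)^2) \<and> (\<forall>x. abs (Q (Dx w u) (t, x)) <= M * dec t)"
 shows "good K L M (Q u)"
proof -
 have D: "Dx w (Q u) = Q (Dx w u)" if "length w <= K" for w
  by (rule smooth_op_Dx[OF Q]) (rule CD_mono[OF u], use that in simp)
 have "CX K (Q u)" by (rule smooth_op_CX[OF Q]) (rule CD_mono[OF u], simp)
 then show ?thesis using n2 n4 LK unfolding good_def by (simp add: D)
qed

context ellip begin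

text \<open>The hypothesis \<open>L + 4 <= K\<close> pays for the four derivatives of the dispersive
  bound. The regularity \<open>CX (Suc (Suc K)) N\<close> is qualitative and is what
  \<open>JJ\<close> supplies.\<close>

lemma good_Duh:
 assumes KL: "L + 4 <= K"
 shows "\<exists>C\<ge>1. \<forall>c N B. CX (Suc (Suc K)) N --> B >= 0 --> good_source K B N --> good K L (C * B) (Duh e c N)"
proof -
 obtain C where C: "C >= 1" "ce * 16 <= C^2" and Cd: "\<forall>c N B t. CX (Suc (Suc (Suc (Suc 0)))) N --> B >= 0 --> (\<forall>s\<ge>0. n2 N s <= ennreal (B^2 / (1 + s)^3)) -->
   (\<forall>s\<ge>0. \<forall>w. length w <= 4 --> n1 (Dx w N) s <= ennreal (B / (1 + s))) --> t >= 0 -->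
   n4 (Duh e c N) t <= ennreal ((C * B)^4 / (1 + t)^2) \<and> (\<forall>x. abs (Duh e c N (t, x)) <= C * B * dec t)"
  using Duh_decay by (elim exE conjE)
 have "good K L (C * B) (Duh e c N)" if N: "CX (Suc (Suc K)) N" and B: "B >= 0" and src: "good_source K B N" for c N B
 proof (rule good_smooth_op[OF smooth_op_Duh N])
  fix w :: "3 list" and t :: real assume t: "t >= 0"
  { assume w: "length w <= K"
   have "n2 (Duh e c (Dx w N)) t <= ennreal (ce * (4 * B)^2)"
    by (rule Duh_L2[where k=0, OF CX_Dx'[OF N] B _ t]) (use src w in \<open>auto simp: good_source_def\<close>)
   also have "... <= ennreal ((C * B)^2)"
    using mult_right_mono[OF C(2), of "B^2"] by (intro ennreal_leI) (simp add: power_mult_distrib)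
   finally show "n2 (Duh e c (Dx w N)) t <= ennreal ((C * B)^2)" . }
  assume w: "length w <= L"
  have cx: "CX (Suc (Suc (Suc (Suc 0)))) (Dx w N)" by (rule CX_Dx'[OF N]) (use w KL in simp)
  have "n1 (Dx v (Dx w N)) s <= ennreal (B / (1 + s))" if "s >= 0" "length v <= 4" for v s
   unfolding Dx_append[symmetric] using src that w KL by (auto simp: good_source_def)
  then show "n4 (Duh e c (Dx w N)) t <= ennreal ((C * B)^4 / (1 + t)^2) \<and> (\<forall>x. abs (Duh e c (Dx w N) (t, x)) <= C * B * dec t)"
   using Cd[rule_format, OF cx B _ _ t] src w KL by (auto simp: good_source_def)
 qed (use KL in simp)
 then show ?thesis using C by (intro exI[of _ C]) auto
qed

lemma good_LA:
 assumes KL: "L + 4 <= K"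
 shows "\<exists>C\<ge>1. \<forall>c g B. B >= 0 --> good_data K B g --> good K L (C * B) (LA e c g)"
proof -
 obtain C where C: "C >= 1" "ce <= C^2" and Cd: "\<forall>c g B t. CX (Suc (Suc (Suc (Suc 0)))) g --> B >= 0 --> n2 g 0 <= ennreal (B^2) -->
   (\<forall>w. length w <= 4 --> n1 (Dx w g) 0 <= ennreal B) --> t >= 0 -->
   n4 (LA e c g) t <= ennreal ((C * B)^4 / (1 + t)^2) \<and> (\<forall>x. abs (LA e c g (t, x)) <= C * B * dec t)"
  using LA_decay by (elim exE conjE)
 have "good K L (C * B) (LA e c g)" if B: "B >= 0" and dat: "good_data K B g" for c g B
 proof -
  have g: "CX (Suc (Suc K)) g" using dat by (simp add: good_data_def del: CD.simps)
  show ?thesis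
  proof (rule good_smooth_op[OF smooth_op_LA g])
   fix w :: "3 list" and t :: real assume t: "t >= 0"
   { assume w: "length w <= K"
    have "n2 (LA e c (Dx w g)) t <= ennreal ce * n2 (Dx w g) 0"
     unfolding n2_def[of "LA e c (Dx w g)"] LA_def fst_conv snd_conv by (rule AA_L2[where k=0, OF CX_Dx'[OF g]]) (use w in simp)
    also have "... <= ennreal ce * ennreal (B^2)" using dat w by (intro mult_left_mono) (auto simp: good_data_def)
    also have "... <= ennreal ((C * B)^2)"
     using mult_right_mono[OF C(2), of "B^2"] ce_pos by (simp add: ennreal_mult[symmetric] ennreal_leI power_mult_distrib)
    finally show "n2 (LA e c (Dx w g)) t <= ennreal ((C * B)^2)" . }
   assume w: "length w <= L"
   have cx: "CX (Suc (Suc (Suc (Suc 0)))) (Dx w g)" by (rule CX_Dx'[OF g]) (use w KL in simp)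
   have "n1 (Dx v (Dx w g)) 0 <= ennreal B" if "length v <= 4" for v
    unfolding Dx_append[symmetric] using dat that w KL by (auto simp: good_data_def)
   then show "n4 (LA e c (Dx w g)) t <= ennreal ((C * B)^4 / (1 + t)^2) \<and> (\<forall>x. abs (LA e c (Dx w g) (t, x)) <= C * B * dec t)"
    using Cd[rule_format, OF cx B _ _ t] dat w KL by (auto simp: good_data_def)
  qed (use KL in simp)
 qed
 then show ?thesis using C by (intro exI[of _ C]) auto
qed

end

lemma ennreal_lin: "0 <= a ==> 0 <= b ==> 0 <= c ==> 0 <= d ==> ennreal (a * b + c * d) = ennreal a * ennreal b + ennreal c * ennreal d"
 by (simp add: ennreal_plus ennreal_mult)

lemma sum_n2:
 assumes I: "finite I" and u: "\<And>i. i \<in> I ==> cts (u i)" and b: "\<And>i. i \<in> I ==> n2 (u i) t <= ennreal B"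
 shows "n2 (\<lambda>z. \<Sum>i\<in>I. abs (u i z)) t <= ennreal ((real (card I))^2 * B)"
proof -
 have m: "(\<lambda>x. ennreal ((u i (t, x))^2)) \<in> borel_measurable lborel" if "i \<in> I" for i
  by (rule cts_ennreal) (intro continuous_intros cts_comp[OF u[OF that]])
 have "n2 (\<lambda>z. \<Sum>i\<in>I. abs (u i z)) t <= (nnlb x. ennreal (card I) * (\<Sum>i\<in>I. ennreal ((u i (t, x))^2)))"
  unfolding n2_def
 proof (rule nn_integral_mono)
  fix x
  have "(\<Sum>i\<in>I. abs (u i (t, x)))^2 <= (\<Sum>i\<in>I. \<bar>u i (t, x)\<bar>\<^sup>2) * card I"
   by (rule sum_squared_le_sum_of_squares)
  also have "... = card I * (\<Sum>i\<in>I. (u i (t, x))^2)" by (simp add: mult.commute)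
  finally show "ennreal ((\<Sum>i\<in>I. abs (u i (t, x)))^2) <= ennreal (card I) * (\<Sum>i\<in>I. ennreal ((u i (t, x))^2))"
   by (simp add: sum_ennreal ennreal_mult[symmetric] sum_nonneg ennreal_leI)
 qed
 also have "... = ennreal (card I) * (\<Sum>i\<in>I. n2 (u i) t)"
  unfolding n2_def by (subst nn_integral_cmult[OF borel_measurable_sum[OF m]], assumption, subst nn_integral_sum[OF m], assumption, rule refl)
 also have "... <= ennreal (card I) * (\<Sum>i\<in>I. ennreal B)" by (intro mult_left_mono sum_mono b) auto
 also have "... = ennreal ((real (card I))^2 * B)"
  by (simp add: ennreal_mult' ennreal_of_nat_eq_real_of_nat power2_eq_square mult.assoc)
 finally show ?thesis .
qed

lemma sum_n4:
 assumes I: "finite I" and u: "\<And>i. i \<in> I ==> cts (u i)" and b: "\<And>i. i \<in> I ==> n4 (u i) t <= ennreal B"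
 shows "n4 (\<lambda>z. \<Sum>i\<in>I. abs (u i z)) t <= ennreal (real (card I)^4 * B)"
proof -
 let ?k = "real (card I)"
 have cs: "cts (\<lambda>z. (u i z)^2)" if "i \<in> I" for i by (intro continuous_intros u[OF that])
 have cS: "cts (\<lambda>z. \<Sum>i\<in>I. abs ((u i z)^2))" by (intro continuous_intros cs)
 have "n4 (\<lambda>z. \<Sum>i\<in>I. abs (u i z)) t <= (nnint x. (?k * (\<Sum>i\<in>I. abs ((u i (t, x))^2)))^2)"
  unfolding n4_def
 proof (intro nn_integral_mono ennreal_leI)
  fix x
  have "(\<Sum>i\<in>I. abs (u i (t, x)))^2 <= (\<Sum>i\<in>I. \<bar>u i (t, x)\<bar>\<^sup>2) * card I"
   by (rule sum_squared_le_sum_of_squares)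
  also have "... = ?k * (\<Sum>i\<in>I. abs ((u i (t, x))^2))" by (simp add: mult.commute)
  finally have "((\<Sum>i\<in>I. abs (u i (t, x)))^2)^2 <= (?k * (\<Sum>i\<in>I. abs ((u i (t, x))^2)))^2" by (rule power_mono) simp
  then show "(\<Sum>i\<in>I. abs (u i (t, x)))^4 <= (?k * (\<Sum>i\<in>I. abs ((u i (t, x))^2)))^2" by (simp only: power_mult[symmetric]) simp
 qed
 also have "... = ennreal (?k^2) * n2 (\<lambda>z. \<Sum>i\<in>I. abs ((u i z)^2)) t"
  unfolding n2_def by (rule n_scale_square) (intro cts_comp[OF cS] continuous_intros)
 also have "... <= ennreal (?k^2) * ennreal (?k^2 * B)"
  by (intro mult_left_mono sum_n2[OF I cs]) (use b in \<open>auto simp: n2_def n4_def\<close>)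
 also have "... = ennreal (?k^4 * B)" by (simp add: ennreal_mult'[symmetric] mult.assoc[symmetric] power_add[symmetric])
 finally show ?thesis .
qed

lemma BB_sum:
 "BB l p = (\<lambda>z. \<Sum>i\<in>UNIV \<times> {w. length w <= l}. abs ((case i of (c, w) => Dx w (p c)) z))"
 unfolding BB_def HS_def by (auto simp: sum.cartesian_product split_beta intro!: ext sum.cong)

text \<open>In every term of the expansion the high-order factor is taken in L^2. The two low-order
  factors are taken in sup for the L^2 bound of the source and in L^4 for its L^1 bound.\<close>

lemma good_nonlinear:
 assumes KL: "K <= 2 * L + 1" "L <= K" and F: "vanish 3 (F :: real^'c::finite => real)"
 shows "\<exists>C\<ge>1. \<exists>\<delta>>0. \<forall>p M. 0 < M --> M <= \<delta> --> (\<forall>c. good K L M (p c)) --> good_source K (C * M^3) (\<lambda>z. F (PP p z))"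
proof -
 obtain C0 where C0: "C0 >= 0" and Dw: "\<forall>p z. (\<forall>c. CX K (p c)) --> BB L p z <= 1 -->
   (\<forall>w. length w <= K --> abs (Dx w (\<lambda>z. F (PP p z)) z) <= C0 * (BB K p z * (BB L p z)^2))"
  using Dx_nonlinearity[OF KL F] by (elim exE conjE)
 define I :: "nat => ('c \<times> 3 list) set" where "I l = UNIV \<times> {w. length w <= l}" for l
 have fI: "finite (I l)" for l unfolding I_def by (intro finite_cartesian_product finite_words) simp
 define k where "k = real (card (I K)) + 1"
 have k: "k >= 1" "real (card (I K)) <= k" by (auto simp: k_def)
 have kL: "real (card (I L)) <= k"
 proof -
  have "I L \<subseteq> I K" using KL(2) by (auto simp: I_def)
  from card_mono[OF fI this] show ?thesis unfolding k_def by linarith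
 qed
 \<comment> \<open>With \<open>M <= 1 / k\<close> the sum \<open>BB L p\<close> of at most
   \<open>k\<close> terms is at most 1, as \<open>Dx_nonlinearity\<close> demands.\<close>
 let ?C = "C0 * k^4 + 1" and ?\<delta> = "1 / k"
 have main: "good_source K (?C * M^3) (\<lambda>z. F (PP p z))"
  if M: "0 < M" "M <= ?\<delta>" and p: "\<forall>c. good K L M (p c)" for p M
 proof -
  note gp = p[rule_format]
  let ?N = "\<lambda>z. F (PP p z)"
  have sF: "smooth_on UNIV F" using F by (rule vanish_smooth)
  have cN: "CX K ?N" by (rule CX_PP[OF sF goodD(1)[OF gp]])
  have cB: "cts (BB l p)" if "l <= K" for l
   unfolding BB_def[abs_def] by (intro continuous_intros HS_cont CD_mono[OF goodD(1)[OF gp] that])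
  have cDx: "cts (Dx w (p c))" if "length w <= K" for w c
   using CX_Dx'[OF goodD(1)[OF gp], of w 0] that by auto
  show ?thesis unfolding good_source_def
  proof (intro conjI allI impI cN)
   fix s :: real and w :: "3 list" assume s: "s >= 0" and w: "length w <= K"
   have cw: "cts (Dx w ?N)" using CX_Dx'[OF cN, of w 0] w by auto
   have sup: "BB L p (s, x) <= k * M * dec s" for x
   proof -
    have "BB L p (s, x) <= (\<Sum>i\<in>I L. M * dec s)"
     unfolding BB_sum I_def by (intro sum_mono) (auto intro: goodD(4)[OF gp s])
    also have "... <= k * (M * dec s)" using kL M dec_bounds(1)[of s] by (simp add: mult_right_mono)
    finally show ?thesis by (simp add: mult.assoc)
   qed
   have kM: "k * M * dec s <= 1"
   proof -
    have "k * M * dec s <= k * M * 1" using k M dec_bounds(2)[of s] by (intro mult_left_mono) auto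
    also have "... <= 1" using M(2) k by (simp add: field_simps)
    finally show ?thesis .
   qed
   have pw: "abs (Dx w ?N (s, x)) <= C0 * (BB K p (s, x) * (BB L p (s, x))^2)" for x
    using Dw[rule_format, of p "(s,x)" w] goodD(1)[OF gp] order_trans[OF sup kM] w by blast
   have A2: "n2 (BB K p) s <= ennreal (k^2 * M^2)"
   proof -
    have "n2 (BB K p) s <= ennreal ((real (card (I K)))^2 * M^2)" unfolding BB_sum I_def[symmetric]
     by (rule sum_n2[OF fI]) (auto simp: I_def intro: cDx goodD(2)[OF gp s])
    also have "... <= ennreal (k^2 * M^2)" using k by (intro ennreal_leI mult_right_mono power_mono) auto
    finally show ?thesis .
   qed
   have B4: "n4 (BB L p) s <= ennreal (k^4 * (M^4 / (1 + s)^2))"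
   proof -
    have "n4 (BB L p) s <= ennreal (real (card (I L))^4 * (M^4 / (1 + s)^2))"
     unfolding BB_sum I_def[symmetric]
     by (rule sum_n4[OF fI]) (use KL in \<open>auto simp: I_def intro: cDx goodD(3)[OF gp s]\<close>)
    also have "... <= ennreal (k^4 * (M^4 / (1 + s)^2))" using kL by (intro ennreal_leI mult_right_mono power_mono) auto
    finally show ?thesis .
   qed
   have C3: "C0 * k^3 <= ?C" "C0 * k^4 <= ?C"
   proof -
    have "C0 * k^3 <= C0 * k^4" using k C0 by (intro mult_left_mono power_increasing) auto
    then show "C0 * k^3 <= ?C" by simp
   qed simp
   show "n2 (Dx w ?N) s <= ennreal ((?C * M^3)^2 / (1 + s)^3)"
   proof -
    have "n2 (Dx w ?N) s <= (nnint x. (C0 * (k * M * dec s)^2 * BB K p (s, x))^2)" unfolding n2_def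
    proof (intro nn_integral_mono ennreal_leI)
     fix x
     have "abs (Dx w ?N (s, x)) <= C0 * (BB K p (s, x) * (k * M * dec s)^2)"
      by (rule order_trans[OF pw]) (intro mult_left_mono power_mono sup BB_nonneg C0)
     then have "abs (Dx w ?N (s, x)) <= C0 * (k * M * dec s)^2 * BB K p (s, x)" by (simp only: mult_ac)
     then have "\<bar>Dx w ?N (s, x)\<bar>\<^sup>2 <= (C0 * (k * M * dec s)^2 * BB K p (s, x))^2" by (rule power_mono) simp
     then show "(Dx w ?N (s, x))^2 <= (C0 * (k * M * dec s)^2 * BB K p (s, x))^2" by simp
    qed
    also have "... = ennreal ((C0 * (k * M * dec s)^2)^2) * n2 (BB K p) s"
     unfolding n2_def by (rule n_scale_square) (intro cts_comp[OF cB] continuous_intros order_refl)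
    also have "... <= ennreal ((C0 * (k * M * dec s)^2)^2) * ennreal (k^2 * M^2)" by (intro mult_left_mono A2) simp
    also have "... = ennreal ((C0 * (k * M * dec s)^2)^2 * (k^2 * M^2))" by (simp add: ennreal_mult)
    also have "(C0 * (k * M * dec s)^2)^2 * (k^2 * M^2) = (C0 * k^3 * M^3)^2 * dec s ^ 4"
     by (simp add: power_mult_distrib power_mult[symmetric] power_add[symmetric] mult_ac)
    also have "... = (C0 * k^3 * M^3)^2 / (1 + s)^3" using dec_bounds(3)[OF s] by simp
    also have "... <= (?C * M^3)^2 / (1 + s)^3"
     using C3(1) C0 k M s by (intro divide_right_mono power_mono mult_right_mono) auto
    finally show ?thesis by (simp add: ennreal_leI)
   qed
   show "n1 (Dx w ?N) s <= ennreal (?C * M^3 / (1 + s))"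
   proof -
    \<comment> \<open>The elementary inequality \<open>am\<close> replaces Hoelder; this parameter
      balances the contributions of \<open>M^2\<close> from \<open>n2\<close> and of
      \<open>M^4 / (1 + s)^2\<close> from \<open>n4\<close>, both becoming
      \<open>M^3 / (1 + s)\<close>.\<close>
    define \<mu> where "\<mu> = M / (1 + s)"
    have l: "\<mu> > 0" using M s by (simp add: \<mu>_def)
    have am: "a * b^2 <= \<mu> / 2 * a^2 + 1 / (2 * \<mu>) * b^4" for a b :: real
    proof -
     have "0 <= (\<mu> * a - b^2)^2" by simp
     then have "2 * \<mu> * (a * b^2) <= \<mu>^2 * a^2 + b^4" by (simp add: power2_eq_square eval_nat_numeral algebra_simps)
     then have "a * b^2 <= (\<mu>^2 * a^2 + b^4) / (2 * \<mu>)" using l by (simp add: field_simps)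
     also have "... = \<mu> / 2 * a^2 + 1 / (2 * \<mu>) * b^4" using l by (simp add: field_simps power2_eq_square)
     finally show ?thesis .
    qed
    let ?a = "C0 * \<mu> / 2" and ?b = "C0 / (2 * \<mu>)"
    have ab: "?a >= 0" "?b >= 0" using C0 l by auto
    have mA: "(\<lambda>x. ennreal ((BB K p (s, x))^2)) \<in> borel_measurable lborel" "(\<lambda>x. ennreal ((BB L p (s, x))^4)) \<in> borel_measurable lborel"
     by (rule cts_ennreal, intro continuous_intros cts_comp[OF cB] KL order_refl)+
    have "n1 (Dx w ?N) s <= (nnlb x. ennreal ?a * ennreal ((BB K p (s, x))^2) + ennreal ?b * ennreal ((BB L p (s, x))^4))"
     unfolding n1_def
    proof (rule nn_integral_mono)
     fix x
     have "abs (Dx w ?N (s, x)) <= C0 * (\<mu> / 2 * (BB K p (s, x))^2 + 1 / (2 * \<mu>) * (BB L p (s, x))^4)"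
      by (rule order_trans[OF pw]) (intro mult_left_mono am C0)
     also have "... = ?a * (BB K p (s, x))^2 + ?b * (BB L p (s, x))^4" by (simp add: algebra_simps)
     finally have "ennreal (abs (Dx w ?N (s, x))) <= ennreal (?a * (BB K p (s, x))^2 + ?b * (BB L p (s, x))^4)" by (rule ennreal_leI)
     also have "... = ennreal ?a * ennreal ((BB K p (s, x))^2) + ennreal ?b * ennreal ((BB L p (s, x))^4)"
      by (rule ennreal_lin) (use ab in auto)
     finally show "ennreal (abs (Dx w ?N (s, x))) <= ennreal ?a * ennreal ((BB K p (s, x))^2) + ennreal ?b * ennreal ((BB L p (s, x))^4)" .
    qed
    also have "... = ennreal ?a * n2 (BB K p) s + ennreal ?b * n4 (BB L p) s"
     unfolding n2_def n4_def using mA by (simp add: nn_integral_add nn_integral_cmult)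
    also have "... <= ennreal ?a * ennreal (k^2 * M^2) + ennreal ?b * ennreal (k^4 * (M^4 / (1 + s)^2))"
     by (intro add_mono mult_left_mono A2 B4) auto
    also have "... = ennreal (?a * (k^2 * M^2) + ?b * (k^4 * (M^4 / (1 + s)^2)))"
     by (rule ennreal_lin[symmetric]) (use ab in auto)
    also have "?a * (k^2 * M^2) + ?b * (k^4 * (M^4 / (1 + s)^2)) = C0 / 2 * (k^2 + k^4) * M^3 / (1 + s)"
    proof -
     obtain q where q: "q = 1 + s" "q > 0" using s by simp
     have "C0 * (M / q) / 2 * (k^2 * M^2) = C0 / 2 * k^2 * M^3 / q" using q(2) by (simp add: power2_eq_square eval_nat_numeral field_simps)
     moreover have "C0 / (2 * (M / q)) * (k^4 * (M^4 / q^2)) = C0 / 2 * k^4 * M^3 / q"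
      using q(2) M by (simp add: power2_eq_square eval_nat_numeral)
     ultimately show ?thesis unfolding \<mu>_def q(1)[symmetric] by (simp add: algebra_simps add_divide_distrib)
    qed
    also have "... <= ?C * M^3 / (1 + s)"
    proof -
     have "k^2 <= k^4" using k by (intro power_increasing) auto
     then have "C0 / 2 * (k^2 + k^4) <= C0 / 2 * (k^4 + k^4)" using C0 by (intro mult_left_mono) auto
     also have "... <= ?C" by simp
     finally show ?thesis using M s by (intro divide_right_mono mult_right_mono) auto
    qed
    finally show ?thesis by (simp add: ennreal_leI)
   qed
  qed
 qed
 have C1: "?C >= 1" "?\<delta> > 0" using C0 k by auto
 show ?thesis
  by (rule exI[of _ ?C], intro conjI C1, rule exI[of _ ?\<delta>], intro conjI C1 allI impI) (rule main)
qed

text \<open>The Lipschitz constant of \<open>F\<close> near 0 is quadratic in the size of its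
  arguments. After squaring, the two sup bounds contribute \<open>M^4 * dec s ^ 4\<close>, which is
  \<open>M^4 / (1 + s)^3\<close>.\<close>

lemma source_difference:
 assumes F: "vanish 3 (F :: real^'c::finite => real)"
 shows "\<exists>C\<ge>0. \<exists>\<delta>>0. \<forall>p q M D s. 0 <= M --> M <= \<delta> --> 0 <= s --> 0 <= D -->
  (\<forall>c. cts (p c) \<and> cts (q c) \<and> n2 (\<lambda>z. p c z - q c z) s <= ennreal D \<and>
    (\<forall>x. abs (p c (s, x)) <= M * dec s \<and> abs (q c (s, x)) <= M * dec s)) -->
  n2 (\<lambda>z. F (PP p z) - F (PP q z)) s <= ennreal (C * M^4 * D / (1 + s)^3)"
proof -
 obtain C0 where C0: "C0 >= 0" and Lip: "\<forall>P Q r. norm P <= r --> norm Q <= r --> r <= 1 -->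
   abs (F P - F Q) <= C0 * r^2 * (\<Sum>c\<in>UNIV. abs (P $ c - Q $ c))"
  using nonlinearity_Lipschitz[OF F] by (elim exE conjE)
 define k where "k = real CARD('c)"
 have k: "k > 0" by (simp add: k_def)
 have main: "n2 (\<lambda>z. F (PP p z) - F (PP q z)) s <= ennreal (C0^2 * k^6 * M^4 * D / (1 + s)^3)"
  if M: "0 <= M" "M <= 1 / k" and s: "0 <= s" and D: "0 <= D" and
   h: "\<forall>c. cts (p c) \<and> cts (q c) \<and> n2 (\<lambda>z. p c z - q c z) s <= ennreal D \<and>
    (\<forall>x. abs (p c (s, x)) <= M * dec s \<and> abs (q c (s, x)) <= M * dec s)" for p q M D s
 proof -
  let ?r = "k * M * dec s"
  have r: "?r <= 1"
  proof -
   have "k * M * dec s <= k * M * 1" using k M dec_bounds(2)[of s] by (intro mult_left_mono) auto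
   also have "... <= 1" using M(2) k by (simp add: field_simps)
   finally show ?thesis .
  qed
  have nP: "norm (PP u (s, x)) <= ?r" if "\<And>c. abs (u c (s, x)) <= M * dec s" for u :: "'c => spacetime => real" and x
  proof -
   have "norm (PP u (s, x)) <= (\<Sum>c\<in>UNIV. abs (u c (s, x)))" using norm_le_l1_cart[of "PP u (s, x)"] by (simp add: PP_def)
   also have "... <= (\<Sum>c\<in>(UNIV::'c set). M * dec s)" by (intro sum_mono that)
   finally show ?thesis by (simp add: k_def mult.assoc)
  qed
  have cd: "cts (\<lambda>z. p c z - q c z)" for c using h by (intro continuous_intros) auto
  have cS: "cts (\<lambda>z. \<Sum>c\<in>UNIV. abs (p c z - q c z))" by (intro continuous_intros cd)
  have "n2 (\<lambda>z. F (PP p z) - F (PP q z)) s <= (nnint x. (C0 * ?r^2 * (\<Sum>c\<in>UNIV. abs (p c (s, x) - q c (s, x))))^2)"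
   unfolding n2_def
  proof (intro nn_integral_mono ennreal_leI)
   fix x
   have "abs (F (PP p (s, x)) - F (PP q (s, x))) <= C0 * ?r^2 * (\<Sum>c\<in>UNIV. abs (PP p (s, x) $ c - PP q (s, x) $ c))"
    using h by (intro Lip[rule_format] nP r) auto
   then have "\<bar>F (PP p (s, x)) - F (PP q (s, x))\<bar>\<^sup>2 <= (C0 * ?r^2 * (\<Sum>c\<in>UNIV. abs (PP p (s, x) $ c - PP q (s, x) $ c)))^2"
    by (rule power_mono) simp
   then show "(F (PP p (s, x)) - F (PP q (s, x)))^2 <= (C0 * ?r^2 * (\<Sum>c\<in>UNIV. abs (p c (s, x) - q c (s, x))))^2" by (simp add: PP_def)
  qed
  also have "... = ennreal ((C0 * ?r^2)^2) * n2 (\<lambda>z. \<Sum>c\<in>UNIV. abs (p c z - q c z)) s"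
   unfolding n2_def by (rule n_scale_square) (intro cts_comp[OF cS] continuous_intros)
  also have "... <= ennreal ((C0 * ?r^2)^2) * ennreal ((real CARD('c))^2 * D)"
   by (intro mult_left_mono sum_n2 cd) (use h in auto)
  also have "... = ennreal ((C0 * ?r^2)^2 * (k^2 * D))" using D by (simp add: ennreal_mult' k_def)
  also have "(C0 * ?r^2)^2 * (k^2 * D) = C0^2 * k^6 * M^4 * D * dec s ^ 4"
   by (simp add: power_mult_distrib eval_nat_numeral mult_ac)
  also have "... = C0^2 * k^6 * M^4 * D / (1 + s)^3" using dec_bounds(3)[OF s] by simp
  finally show ?thesis .
 qed
 show ?thesis
  by (rule exI[of _ "C0^2 * k^6"], rule conjI[OF _ exI[of _ "1 / k"]]) (use C0 k main in auto)
qed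

text \<open>Estimates hold for t >= 0 only. Continuing the value at t = 0 to negative times keeps
  continuity and space derivatives, and lets uniform convergence and continuity be stated on all of
  spacetime.\<close>

definition time_clamp :: "(spacetime => real) => spacetime => real" where
 "time_clamp u z = u (max 0 (fst z), snd z)"

lemma smooth_op_time_clamp: "smooth_op 0 time_clamp"
proof (rule smooth_opI)
 show "cts (time_clamp N)" if "CX 0 N" for N
 proof -
  have "cts N" using that by simp
  then show ?thesis unfolding time_clamp_def[abs_def] by (rule cts_comp) (intro continuous_intros)
 qed
 show "hasdd (spv j) (time_clamp N) z (time_clamp (sd j N) z)" if "CX (Suc 0) N" for N j z
  using CX_hasdd[OF that, of j "(max 0 (fst z), snd z)"] unfolding hasdd_def time_clamp_def by simp
qed

text \<open>Interpolation between L^2 and the gradient: mollifying at scale \<open>h\<close> changes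
  \<open>u\<close> by at most \<open>6 * h * G\<close>, and the mollified function is bounded by the
  L^2 norm times \<open>h^(-3/2)\<close>. The scale is left free.\<close>

lemma sup_from_n2:
 assumes u: "CX (Suc 0) u" and G: "\<And>j x. abs (sd j u (t, x)) <= G" and Q: "n2 u t <= ennreal Q" "Q >= 0" and h: "h > 0"
 shows "abs (u (t, x)) <= 6 * h * G + sqrt (Q / (kc * h^3))"
proof -
 note cu = CX_cont[OF u]
 let ?S = "sqrt (Q / (kc * h^3))"
 have J: "abs (J h u (t, x)) <= ?S" for x
 proof -
  let ?q = "\<lambda>y. (u (t, x + h *R y))^2"
  have c: "cts (\<lambda>y. ?q y)" by (intro continuous_intros cts_comp[OF cu])
  have cm: "cts (\<lambda>y. molk y * ?q y)" by (intro continuous_intros molk_cont c cts_comp[OF cu])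
  have cs: "cts (\<lambda>y. (u (t, y))^2)" by (intro continuous_intros cts_comp[OF cu])
  have "(J h u (t, x))^2 <= (LINT y|lb 2. molk y * ?q y) / kc"
   unfolding J_def fst_conv snd_conv by (rule molk_square) (intro continuous_intros cts_comp[OF cu])
  moreover have "ennreal (LINT y|lb 2. molk y * ?q y) <= ennreal (Q / h^3)"
  proof -
   have "ennreal (LINT y|lb 2. molk y * ?q y) = (\<integral>\<^sup>+y. ennreal (molk y * ?q y) \<partial>lb 2)"
    by (rule nn_integral_eq_integral[symmetric, OF lb2.integrable_cont[OF cm] AE_I2]) (simp add: molk_nonneg)
   also have "... <= (nnint y. ?q y)"
   proof (subst nn_integral_lb)
    show "(\<lambda>y. ennreal (molk y * ?q y)) \<in> borel_measurable borel"
     using measurable_compose[OF borel_measurable_continuous_onI[OF cm] measurable_ennreal] .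
    show "(nnlb y. indicator (cball 0 2) y * ennreal (molk y * ?q y)) <= (nnint y. ?q y)"
    proof (rule nn_integral_mono)
     fix y
     have "molk y <= 1" by (auto simp: molk_def power_le_one)
     then have "molk y * ?q y <= 1 * ?q y" by (intro mult_right_mono) auto
     then show "indicator (cball 0 2) y * ennreal (molk y * ?q y) <= ennreal (?q y)"
      by (auto simp: indicator_def ennreal_leI)
    qed
   qed
   also have "... <= ennreal (Q / h^3)"
   proof -
    have "n2 u t = (nnint y. (u (t, y + x))^2)" unfolding n2_def by (rule n_translate[OF cs, symmetric])
    also have "... = ennreal (h ^ DIM(real^3)) * (nnint y. (u (t, h *R y + x))^2)"
     by (rule nn_integral_scale[OF measurable_compose[OF borel_measurable_continuous_onI measurable_ennreal] h])
       (intro cts_comp[OF cs] continuous_intros cts_comp[OF cu])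
    finally have e: "n2 u t = ennreal (h^3) * (nnint y. ?q y)" by (simp add: add.commute power3_eq_cube mult.assoc)
    have "(nnint y. ?q y) = ennreal (1 / h^3) * n2 u t"
     unfolding e mult.assoc[symmetric] using h by (simp add: ennreal_mult[symmetric])
    also have "... <= ennreal (1 / h^3) * ennreal Q" by (intro mult_left_mono Q) simp
    finally show ?thesis using h Q by (simp add: ennreal_mult[symmetric])
   qed
   finally show ?thesis .
  qed
  ultimately have "(J h u (t, x))^2 <= Q / h^3 / kc"
   using kc_pos Q h by (meson divide_right_mono ennreal_le_iff less_imp_le order_trans zero_le_divide_iff zero_le_power)
  then have "(J h u (t, x))^2 <= Q / (kc * h^3)" by (simp add: mult.commute)
  then show ?thesis by (intro real_le_rsqrt) simp
 qed
 have "abs (JJ h u (t, x)) <= ?S" unfolding JJ_def by (rule J_sup[OF J_cont[OF cu] J])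
 moreover have "abs (JJ h u (t, x) - u (t, x)) <= 6 * h * G" by (rule JJ_sup_diff[OF u G h])
 ultimately show ?thesis by linarith
qed

text \<open>Landau's inequality: on a segment of length \<open>r\<close> some point has slope at
  most \<open>2 * a / r\<close>, and the slope varies by at most \<open>b * r\<close>.\<close>

lemma Landau:
 assumes u: "CX (Suc (Suc 0)) u" and a: "\<And>x. abs (u (t, x)) <= a" and b: "\<And>x. abs (sd j (sd j u) (t, x)) <= b" and r: "r > 0"
 shows "abs (sd j u (t, x)) <= 2 * a / r + b * r"
proof -
 let ?p = "\<lambda>s. (t, x) + s *R spv j"
 have e: "?p s = (t, x + s *R axis j 1)" for s by simp
 have d: "DERIV (\<lambda>s. u (?p s)) s :> sd j u (?p s)" for s
  by (rule hasdd_line[OF CX_hasdd[OF u]])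
 have d2: "DERIV (\<lambda>s. sd j u (?p s)) s :> sd j (sd j u) (?p s)" for s
  by (rule hasdd_line[OF CX_hasdd[OF CX_sd[OF u]]])
 have diff: "abs (sd j u (?p s) - sd j u (?p 0)) <= b * r" if "s \<in> {0..r}" for s
 proof -
  have "norm (sd j u (?p s) - sd j u (?p 0)) <= b * norm (s - 0)"
   by (rule field_differentiable_bound[of "{0..r}", OF _ has_field_derivative_at_within[OF d2]]) (use b e that r in auto)
  also have "... <= b * r" using that b[of x] by (intro mult_left_mono) auto
  finally show ?thesis by simp
 qed
 obtain z where z: "0 < z" "z < r" "u (?p r) - u (?p 0) = (r - 0) * sd j u (?p z)"
  using MVT2[OF r d] by blast
 have "r * abs (sd j u (?p z)) <= 2 * a" using a[of "x + r *R axis j 1"] a[of x] z(3) r unfolding e by (simp add: abs_mult[symmetric])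
 then have "abs (sd j u (?p z)) <= 2 * a / r" using r by (simp add: field_simps)
 moreover have "abs (sd j u (?p z) - sd j u (?p 0)) <= b * r" using z by (intro diff) auto
 ultimately show ?thesis by (simp add: zero_prod_def[symmetric])
qed

text \<open>Geometric decay in L^2 passes to the sup by \<open>sup_from_n2\<close> and then to one
  derivative after another by \<open>Landau\<close>, with a worse ratio each time.
  \<open>Landau\<close> uses one derivative beyond the one it bounds, hence
  \<open>length w < L\<close>.\<close>

lemma geometric_decay:
 assumes d: "\<And>n. CX L (d n)" and G: "\<And>n w t x. t >= 0 ==> length w <= L ==> abs (Dx w (d n) (t, x)) <= G"
  and A: "\<And>n t. t >= 0 ==> n2 (d n) t <= ennreal (A * (1/4)^n)" "A >= 0"
 shows "length w < L ==> \<exists>C\<ge>0. \<exists>q>0. q < 1 \<and> (\<forall>n t x. t >= 0 --> abs (Dx w (d n) (t, x)) <= C * q^n)"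
proof (induction w)
 case Nil
 have G0: "G >= 0" using G[of 0 "[]"] by fastforce
 let ?C = "6 * G + sqrt (A / kc)"
 have "abs (d n (t, x)) <= ?C * (4/5)^n" if t: "t >= 0" for n t x
 proof -
  have "CX (Suc 0) (d n)" by (rule CD_mono[OF d]) (use Nil in simp)
  moreover have "abs (sd j (d n) (t, x)) <= G" for j x using G[OF t, of "[j]"] Nil by (simp add: Dx_Cons)
  \<comment> \<open>The scale \<open>(3/4)^n\<close> tends to 0 slowly enough:
    \<open>(1/4)^n\<close> divided by its cube is \<open>(16/27)^n\<close>, whose root is below
    \<open>(4/5)^n\<close>.\<close>
  ultimately have "abs (d n (t, x)) <= 6 * (3/4)^n * G + sqrt (A * (1/4)^n / (kc * ((3/4)^n)^3))"
   by (rule sup_from_n2) (use A t in auto)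
  also have "A * (1/4)^n / (kc * ((3/4)^n)^3) = A / kc * (16/27)^n"
  proof -
   have "((3/4::real)^n)^3 = ((3/4)^3)^n" by (simp only: power_mult[symmetric] mult.commute)
   then have "((3/4::real)^n)^3 = (27/64)^n" by (simp add: power3_eq_cube)
   moreover have "(1/4::real)^n / (27/64)^n = (16/27)^n" by (simp add: power_divide[symmetric])
   moreover have "A * x / (kc * y) = A / kc * (x / y)" for x y by simp
   ultimately show ?thesis by (simp only:)
  qed
  also have "sqrt (A / kc * (16/27)^n) <= sqrt (A / kc) * (4/5)^n"
  proof -
   have "(16/27::real)^n <= (16/25)^n" by (intro power_mono) auto
   also have "... = ((4/5)^n)^2" by (simp add: power_mult[symmetric] mult.commute[of n]) (simp add: power_mult power2_eq_square)
   finally have "sqrt (A / kc * (16/27)^n) <= sqrt (A / kc * ((4/5)^n)^2)" using A kc_pos by (intro real_sqrt_le_mono mult_left_mono) auto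
   also have "... = sqrt (A / kc) * (4/5)^n" by (simp only: real_sqrt_mult real_sqrt_abs) simp
   finally show ?thesis .
  qed
  also have "6 * (3/4)^n * G <= 6 * (4/5)^n * G" using G0 by (intro mult_right_mono mult_left_mono power_mono) auto
  finally show ?thesis by (simp add: algebra_simps)
 qed
 then show ?case using G0 A kc_pos by (intro exI[of _ ?C] conjI exI[of _ "4/5::real"]) auto
next
 case (Cons j w)
 then obtain C q where C: "C >= 0" "q > 0" "q < 1" and b: "\<forall>n t x. t >= 0 --> abs (Dx w (d n) (t, x)) <= C * q^n" by auto
 have G0: "G >= 0" using G[of 0 "[]"] by fastforce
 have "abs (Dx (j # w) (d n) (t, x)) <= (2 * C + G) * sqrt q ^ n" if t: "t >= 0" for n t x
 proof -
  have "CX (Suc (Suc 0)) (Dx w (d n))" by (rule CX_Dx'[OF d]) (use Cons.prems in simp)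
  moreover have "abs (Dx w (d n) (t, x)) <= C * q^n" for x using b t by blast
  moreover have "abs (sd j (sd j (Dx w (d n))) (t, x)) <= G" for x using G[OF t, of "j # j # w"] Cons.prems by (simp add: Dx_Cons)
  moreover have sq: "sqrt q ^ n > 0" using C by simp
  \<comment> \<open>The length \<open>sqrt q ^ n\<close> balances the two terms of
    \<open>Landau\<close>; the new ratio is \<open>sqrt q\<close>.\<close>
  ultimately have "abs (sd j (Dx w (d n)) (t, x)) <= 2 * (C * q^n) / sqrt q ^ n + G * sqrt q ^ n" by (rule Landau)
  also have "q^n = sqrt q ^ n * sqrt q ^ n" using C by (simp add: power_mult_distrib[symmetric])
  finally show ?thesis using sq C(2) by (simp add: Dx_Cons algebra_simps)
 qed
 then show ?case using C G0 by (intro exI[of _ "2 * C + G"] conjI exI[of _ "sqrt q"]) (auto simp: real_sqrt_lt_1_iff)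
qed

text \<open>The telescoping series converges uniformly for each word by the Weierstrass test;
  differentiating the sequence along lines identifies the limit for \<open>j # w\<close> with the
  derivative of the limit for \<open>w\<close>.\<close>

lemma CX_limit:
 assumes u: "\<And>n. CX k (u n)"
  and g: "\<And>w. length w <= k ==> \<exists>C q. 0 < q \<and> q < 1 \<and> (\<forall>n z. abs (Dx w (u (Suc n)) z - Dx w (u n) z) <= C * q^n)"
 shows "\<exists>v. CX k v \<and> (\<forall>w z. length w <= k --> (\<lambda>n. Dx w (u n) z) \<longlonglongrightarrow> Dx w v z)"
proof -
 have "\<exists>v. uniform_limit UNIV (\<lambda>n. Dx w (u n)) v sequentially" if l: "length w <= k" for w
 proof -
  obtain C q where q: "0 < q" "q < 1" "\<forall>n z. abs (Dx w (u (Suc n)) z - Dx w (u n) z) <= C * q^n" using g[OF l] by blast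
  have "summable (\<lambda>n. C * q^n)" using q by (intro summable_mult summable_geometric) auto
  from Weierstrass_m_test[OF _ this, of UNIV "\<lambda>n z. Dx w (u (Suc n)) z - Dx w (u n) z"] q(3)
  obtain S where "uniform_limit UNIV (\<lambda>n z. \<Sum>i<n. Dx w (u (Suc i)) z - Dx w (u i) z) S sequentially" by auto
  then have "uniform_limit UNIV (\<lambda>n z. Dx w (u 0) z + (\<Sum>i<n. Dx w (u (Suc i)) z - Dx w (u i) z)) (\<lambda>z. Dx w (u 0) z + S z) sequentially"
   by (intro uniform_limit_intros)
  moreover have "Dx w (u 0) z + (\<Sum>i<n. Dx w (u (Suc i)) z - Dx w (u i) z) = Dx w (u n) z" for n z
   using sum_lessThan_telescope[of "\<lambda>i. Dx w (u i) z" n] by linarith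
  ultimately show ?thesis by (intro exI) (simp only:)
 qed
 then obtain v where v: "\<And>w. length w <= k ==> uniform_limit UNIV (\<lambda>n. Dx w (u n)) (v w) sequentially" by metis
 have cont: "cts (v w)" if "length w <= k" for w
  by (rule uniform_limit_theorem[OF _ v[OF that]]) (use CX_Dx'[OF u, of w 0] that in auto)
 have hd: "hasdd (spv j) (v w) z (v (j # w) z)" if "length w < k" for w j z
 proof -
  let ?p = "\<lambda>s. z + s *R spv j"
  have "\<exists>g. \<forall>s\<in>UNIV. (\<lambda>n. Dx w (u n) (?p s)) \<longlonglongrightarrow> g s \<and> (g has_derivative (\<lambda>h. h * v (j # w) (?p s))) (at s within UNIV)"
  proof (rule has_derivative_sequence[where f'="\<lambda>n s h. h * Dx (j # w) (u n) (?p s)" and ?x0.0=0])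
   show "((\<lambda>s. Dx w (u n) (?p s)) has_derivative (\<lambda>h. h * Dx (j # w) (u n) (?p s))) (at s within UNIV)" for n s
   proof -
    have "CX (Suc 0) (Dx w (u n))" by (rule CX_Dx'[OF u]) (use that in simp)
    from hasdd_line[OF CX_hasdd[OF this, of j "?p s"]]
    show ?thesis unfolding has_field_derivative_def by (rule has_derivative_eq_rhs) (simp add: fun_eq_iff Dx_Cons mult.commute)
   qed
   show "(\<lambda>n. Dx w (u n) (?p 0)) \<longlonglongrightarrow> v w (?p 0)" using tendsto_uniform_limitI[OF v] that by auto
   fix \<epsilon> :: real assume "\<epsilon> > 0"
   then have "\<forall>\<^sub>F n in sequentially. \<forall>z. dist (Dx (j # w) (u n) z) (v (j # w) z) < \<epsilon>"
    using uniform_limitD[OF v[of "j # w"]] that by auto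
   then show "\<forall>\<^sub>F n in sequentially. \<forall>s\<in>UNIV. \<forall>h. norm (h * Dx (j # w) (u n) (?p s) - h * v (j # w) (?p s)) <= \<epsilon> * norm h"
   proof (rule eventually_mono, intro ballI allI)
    fix n s and h :: real assume "\<forall>z. dist (Dx (j # w) (u n) z) (v (j # w) z) < \<epsilon>"
    then have "abs (Dx (j # w) (u n) (?p s) - v (j # w) (?p s)) <= \<epsilon>" unfolding dist_real_def using less_imp_le by blast
    then show "norm (h * Dx (j # w) (u n) (?p s) - h * v (j # w) (?p s)) <= \<epsilon> * norm h"
     unfolding right_diff_distrib[symmetric] real_norm_def abs_mult mult.commute[of "abs h"] by (rule mult_right_mono) simp
   qed
  qed auto
  then obtain g where g: "\<And>s. (\<lambda>n. Dx w (u n) (?p s)) \<longlonglongrightarrow> g s" "\<And>s. (g has_derivative (\<lambda>h. h * v (j # w) (?p s))) (at s)" by auto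
  have "g s = v w (?p s)" for s
   using LIMSEQ_unique[OF g(1)] tendsto_uniform_limitI[OF v] that by auto
  then have "g = (\<lambda>s. v w (?p s))" by blast
  then have "((\<lambda>s. v w (?p s)) has_derivative (\<lambda>h. h * v (j # w) (?p 0))) (at 0)" using g(2)[of 0] by (simp only:)
  then show ?thesis unfolding hasdd_def has_field_derivative_def
   by (rule has_derivative_eq_rhs) (simp add: fun_eq_iff zero_prod_def[symmetric])
 qed
 have cx: "CX m (v w)" if "length w + m <= k" for w m using that
 proof (induction m arbitrary: w)
  case 0 then show ?case using cont by simp
 next
  case (Suc m)
  show ?case by (rule CX_SucI[where u'="\<lambda>j. v (j # w)"]) (use Suc in \<open>auto intro: cont hd simp del: CD.simps\<close>)
 qed
 have Dv: "Dx w (v []) = v w" if "length w <= k" for w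
  using that by (induction w) (auto simp: Dx_Cons intro!: ext hasdd_imp_dd hd)
 show ?thesis
  by (rule exI[of _ "v []"]) (use cx[of "[]" k] tendsto_uniform_limitI[OF v] in \<open>auto simp: Dv\<close>)
qed

lemma Dx_diff:
 "CX (length w) f ==> CX (length w) g ==> Dx w (\<lambda>z. f z - g z) = (\<lambda>z. Dx w f z - Dx w g z)"
proof (induction w)
 case (Cons j w)
 have 1: "CX (Suc 0) (Dx w f)" "CX (Suc 0) (Dx w g)"
  by (rule CX_Dx, use Cons.prems in \<open>simp del: CD.simps\<close>)+
 have "Dx w (\<lambda>z. f z - g z) = (\<lambda>z. Dx w f z - Dx w g z)"
  by (rule Cons.IH) (use Cons.prems CD_Suc_lower in \<open>auto simp del: CD.simps\<close>)
 moreover have "sd j (\<lambda>z. Dx w f z - Dx w g z) z = sd j (Dx w f) z - sd j (Dx w g) z" for z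
  using DERIV_diff[OF CX_hasdd[OF 1(1), unfolded hasdd_def] CX_hasdd[OF 1(2), unfolded hasdd_def]]
  by (intro hasdd_imp_dd) (simp only: hasdd_def)
 ultimately show ?case unfolding Dx_Cons by (intro ext) (simp only:)
qed simp

lemma CX_diff: "CX k f ==> CX k g ==> CX k (\<lambda>z. f z - g z)"
 using CD_add[of _ k f "\<lambda>z. (-1) * g z"] CD_cmult[of _ k g "-1"] by simp

lemma n2_minus: "n2 (\<lambda>z. f z - g z) t = n2 (\<lambda>z. g z - f z) t"
 by (simp add: n2_def power2_commute)

lemma n2_diff_add:
 assumes "cts f" "cts g" "cts h"
 shows "n2 (\<lambda>z. f z - h z) t <= 2 * (n2 (\<lambda>z. f z - g z) t + n2 (\<lambda>z. g z - h z) t)"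
 using n2_add[of "\<lambda>z. f z - g z" "\<lambda>z. g z - h z" t] assms by (simp add: continuous_on_diff)

text \<open>Scale 0 is no mollification. The limit equation can therefore be compared with the
  iterates by the same estimate as two iterates with each other.\<close>

lemma J_0: "J 0 N = N"
proof
 fix z
 have "(LINT y|lb 2. molk y * N z) = (LINT y|lb 2. molk y) * N z"
  using molk_cont[of UNIV "\<lambda>y. y"] by simp
 then show "J 0 N z = N z" using kc_pos by (simp add: J_def kc_def[symmetric])
qed

lemma JJ_0: "JJ 0 N = N" by (simp add: JJ_def J_0)

lemma n2_eq_0:
 assumes u: "cts u" and z: "n2 u t = 0" shows "u (t, x) = 0"
proof (rule ccontr)
 assume "u (t, x) \<noteq> 0"
 let ?S = "{x. u (t, x) \<noteq> 0}"
 have c: "cts (\<lambda>x. u (t, x))" by (intro cts_comp[OF u] continuous_intros)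
 have op: "open ?S" using open_Collect_neq[OF c continuous_on_const] .
 have "AE x in lborel. ennreal ((u (t, x))^2) = 0"
  using z slice_measurable[OF u] unfolding n2_def by (subst (asm) nn_integral_0_iff_AE) simp_all
 then have "AE x in lborel. x \<notin> ?S" by (rule eventually_mono) simp
 then have "?S \<in> null_sets lborel" using op by (subst AE_iff_null_sets) auto
 then have "negligible ?S" unfolding negligible_iff_null_sets by (rule null_sets_completionI)
 then show False using open_not_negligible[OF op] \<open>u (t, x) \<noteq> 0\<close> by blast
qed

lemma good_source_JJ:
 assumes N: "good_source K B N" shows "good_source K B (JJ h N)"
proof -
 have cN: "CX K N" using N by (simp add: good_source_def del: CD.simps)
 show ?thesis unfolding good_source_def
 proof (intro conjI allI impI)
  show "CX K (JJ h N)" by (rule smooth_op_CX[OF smooth_op_JJ]) (use cN in simp)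
  fix s :: real and w :: "3 list" assume s: "s >= 0" and w: "length w <= K"
  have D: "Dx w (JJ h N) = JJ h (Dx w N)" by (rule smooth_op_Dx[OF smooth_op_JJ]) (use CD_mono[OF cN w] in simp)
  have c: "cts (Dx w N)" using CX_Dx'[OF cN, of w 0] w by simp
  show "n2 (Dx w (JJ h N)) s <= ennreal (B^2 / (1 + s)^3)"
   unfolding D by (rule order_trans[OF n2_JJ[OF c]]) (use N s w in \<open>auto simp: good_source_def\<close>)
  show "n1 (Dx w (JJ h N)) s <= ennreal (B / (1 + s))"
   unfolding D by (rule order_trans[OF n1_JJ[OF c]]) (use N s w in \<open>auto simp: good_source_def\<close>)
 qed
qed

lemma ennreal_2_2: "0 <= a ==> 0 <= b ==> 0 <= c ==> 2 * (ennreal a + 2 * (ennreal b + ennreal c)) = ennreal (2 * (a + 2 * (b + c)))"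
 by (simp add: ennreal_mult ennreal_plus)

text \<open>Compare through \<open>JJ h N\<close> and \<open>N\<close>. Each triangle inequality for
  squares doubles: 144 is 4 times 36, where 36 is 12 from \<open>n2_JJ_diff\<close> times the three
  directions. The factor \<open>2 * E\<close> shows that mollification does not spoil the
  contraction.\<close>

lemma mollified_difference:
 assumes M: "good_source (Suc k) B M" and N: "good_source (Suc k) B N" and s: "s >= 0" and E: "E >= 0" "n2 (\<lambda>z. M z - N z) s <= ennreal (E / (1 + s)^3)"
 shows "n2 (\<lambda>z. JJ h M z - JJ h' N z) s <= ennreal ((2 * E + 144 * (h^2 + h'^2) * B^2) / (1 + s)^3)"
proof -
 have k: "CX (Suc k) M" "CX (Suc k) N" using M N unfolding good_source_def by blast+
 note cM = CX_cont[OF k(1)]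
 have N1: "CX (Suc 0) N" by (rule CD_mono[OF k(2)]) simp
 note cN = CX_cont[OF N1]
 let ?q = "(1 + s)^3"
 have q: "?q > 0" using s by simp
 have X: "n2 (\<lambda>z. JJ h N z - N z) s <= ennreal (36 * h^2 * B^2 / ?q)" for h
 proof -
  have sd: "n2 (sd j N) s <= ennreal (B^2 / ?q)" for j
  proof -
   have "length [j] <= Suc k" by simp
   then have "n2 (Dx [j] N) s <= ennreal (B^2 / ?q)" using N s unfolding good_source_def by blast
   then show ?thesis by (simp add: Dx_Cons)
  qed
  have "n2 (\<lambda>z. JJ h N z - N z) s <= ennreal (12 * h^2) * (\<Sum>j\<in>UNIV. n2 (sd j N) s)" by (rule n2_JJ_diff[OF N1])
  also have "... <= ennreal (12 * h^2) * (\<Sum>j\<in>(UNIV::3 set). ennreal (B^2 / ?q))" by (intro mult_left_mono sum_mono sd) auto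
  also have "... = ennreal (12 * h^2) * ennreal (\<Sum>j\<in>(UNIV::3 set). B^2 / ?q)" using q by (subst sum_ennreal) auto
  also have "... = ennreal (36 * h^2 * B^2 / ?q)" using q by (simp add: ennreal_mult[symmetric])
  finally show ?thesis .
 qed
 have "n2 (\<lambda>z. JJ h M z - JJ h' N z) s <= 2 * (n2 (\<lambda>z. JJ h M z - JJ h N z) s + n2 (\<lambda>z. JJ h N z - JJ h' N z) s)"
  by (rule n2_diff_add; rule JJ_cont; fact)
 also have "... <= 2 * (n2 (\<lambda>z. JJ h M z - JJ h N z) s + 2 * (n2 (\<lambda>z. JJ h N z - N z) s + n2 (\<lambda>z. N z - JJ h' N z) s))"
  by (intro mult_left_mono add_left_mono n2_diff_add JJ_cont cN) auto
 also have "n2 (\<lambda>z. N z - JJ h' N z) s = n2 (\<lambda>z. JJ h' N z - N z) s" by (rule n2_minus)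
 also have "n2 (\<lambda>z. JJ h M z - JJ h N z) s = n2 (JJ h (\<lambda>z. M z - N z)) s" by (simp add: JJ_diff[OF cM cN, symmetric])
 also have "2 * (n2 (JJ h (\<lambda>z. M z - N z)) s + 2 * (n2 (\<lambda>z. JJ h N z - N z) s + n2 (\<lambda>z. JJ h' N z - N z) s)) <=
   2 * (ennreal (E / ?q) + 2 * (ennreal (36 * h^2 * B^2 / ?q) + ennreal (36 * h'^2 * B^2 / ?q)))"
  by (intro mult_left_mono add_mono X order_trans[OF n2_JJ E(2)] continuous_intros cM cN) auto
 also have "... = ennreal (2 * (E / ?q + 2 * (36 * h^2 * B^2 / ?q + 36 * h'^2 * B^2 / ?q)))"
  by (rule ennreal_2_2) (use q E in auto)
 also have "2 * (E / ?q + 2 * (36 * h^2 * B^2 / ?q + 36 * h'^2 * B^2 / ?q)) = (2 * E + 144 * (h^2 + h'^2) * B^2) / ?q"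
  using q by (simp add: add_divide_distrib algebra_simps)
 finally show ?thesis .
qed

context ellip begin

lemma Duh_diff:
 assumes M: "CX (Suc k) M" and N: "CX (Suc k) N"
 shows "Duh e b (\<lambda>z. M z - N z) z = Duh e b M z - Duh e b N z"
proof -
 have i: "integrable lam (\<lambda>\<theta>. fst z * AA e b N (fst z * (1 - \<theta>)) (fst z * \<theta>) (snd z))" if "CX (Suc k) N" for N
  by (intro lam.integrable_cont continuous_intros AA_cont_comp[OF that])
 show ?thesis unfolding Duh_def AA_diff[OF M N] right_diff_distrib[of "fst z" "AA _ _ _ _ _ _"]
  by (rule Bochner_Integration.integral_diff[OF i[OF M] i[OF N]])
qed

lemma Duh_difference:
 assumes M: "CX (Suc (Suc k)) M" and N: "CX (Suc (Suc k)) N" and E: "E >= 0" "\<And>s. s >= 0 ==> n2 (\<lambda>z. M z - N z) s <= ennreal (E / (1 + s)^3)" and t: "t >= 0"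
 shows "n2 (\<lambda>z. Duh e b M z - Duh e b N z) t <= ennreal (16 * ce * E)"
proof -
 have "n2 (Duh e b (\<lambda>z. M z - N z)) t <= ennreal (ce * (4 * sqrt E)^2)"
  by (rule Duh_L2[OF CX_diff[OF M N] _ _ t]) (use E in auto)
 also have "ce * (4 * sqrt E)^2 = 16 * ce * E" using E by (simp add: power_mult_distrib)
 finally show ?thesis unfolding n2_def by (simp add: Duh_diff[OF M N])
qed

end

lemma n2_Fatou:
 assumes c: "\<And>n. cts (u n)" and l: "\<And>x. (\<lambda>n. u n (t, x)) \<longlonglongrightarrow> v (t, x)" and b: "\<forall>\<^sub>F n in sequentially. n2 (u n) t <= B"
 shows "n2 v t <= B" unfolding n2_def
proof (rule nn_integral_Fatou_real[where u="\<lambda>n x. (u n (t, x))^2"])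
 show "(\<lambda>x. (u n (t, x))^2) \<in> borel_measurable lborel" for n
  by (rule borel_measurable_continuous_onI2) (intro continuous_intros cts_comp[OF c])
 show "(\<lambda>n. (u n (t, x))^2) \<longlonglongrightarrow> (v (t, x))^2" for x by (intro tendsto_intros l)
qed (use b in \<open>simp add: n2_def\<close>)

text \<open>All three bounds pass to pointwise limits, the integrals by Fatou, without convergence
  in the norms themselves.\<close>

lemma good_limit:
 assumes u: "\<And>n. good K L M (u n)" and v: "CX k v" and k: "k <= L" "k <= K" and l: "\<And>w t x. t >= 0 ==> length w <= k ==> (\<lambda>n. Dx w (u n) (t, x)) \<longlonglongrightarrow> Dx w v (t, x)"
 shows "good k k M v"
proof -
 have c: "cts (Dx w (u n))" if "length w <= k" for w n
  using CX_Dx'[OF goodD(1)[OF u], of w 0] that k by simp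
 show ?thesis unfolding good_def
 proof (intro conjI allI impI v)
  fix t :: real and w :: "3 list" assume t: "t >= 0" and w: "length w <= k"
  show "n2 (Dx w v) t <= ennreal (M^2)"
   by (rule n2_Fatou[OF c[OF w] l[OF t w]]) (use goodD(2)[OF u t] w k in auto)
  show "n4 (Dx w v) t <= ennreal (M^4 / (1 + t)^2)" unfolding n4_def
  proof (rule nn_integral_Fatou_real[where u="\<lambda>n x. (Dx w (u n) (t, x))^4"])
   show "(\<lambda>x. (Dx w (u n) (t, x))^4) \<in> borel_measurable lborel" for n
    by (rule borel_measurable_continuous_onI2) (intro continuous_intros cts_comp[OF c[OF w]])
   show "(\<lambda>n. (Dx w (u n) (t, x))^4) \<longlonglongrightarrow> (Dx w v (t, x))^4" for x by (intro tendsto_intros l t w)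
  qed (use goodD(3)[OF u t] w k in \<open>auto simp: n4_def\<close>)
  show "abs (Dx w v (t, x)) <= M * dec t" for x
   by (rule LIMSEQ_le_const2[OF tendsto_rabs[OF l[OF t w]]]) (use goodD(4)[OF u t] w k in auto)
 qed
qed

section \<open>The iteration\<close>

text \<open>The mollified iteration: the two derivatives gained by \<open>JJ\<close> compensate the loss in the
 Duhamel operator, so that every iterate has as many derivatives as the data allow.\<close>

locale iteration =
 fixes e :: "'m::finite => 3 => real" and F :: "'m => real^('m \<times> 3 option) => real"
  and CD CN CN' CS :: "'m => real" and M :: real and u0 :: "'m \<times> 3 option => spacetime => real"
 assumes ellip: "ellip (e i)" and smooth: "smooth_on UNIV (F i)" and M: "M > 0"
  and CN: "CN i >= 0" "CN' i >= 0" and CS: "CS i >= 0"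
  and Duh: "CX (Suc (Suc 12)) N ==> B >= 0 ==> good_source 12 B N ==> good 12 8 (CD i * B) (Duh (e i) b N)"
  and source: "(\<And>c. good 12 8 M (p c)) ==> good_source 12 (CN i * M^3) (\<lambda>z. F i (PP p z))"
  and source': "(\<And>c. good 7 7 M (p c)) ==> good_source 7 (CN' i * M^3) (\<lambda>z. F i (PP p z))"
  and difference: "0 <= s ==> 0 <= D ==> (\<And>c. cts (p c)) ==> (\<And>c. cts (q c)) ==>
   (\<And>c. n2 (\<lambda>z. p c z - q c z) s <= ennreal D) ==>
   (\<And>c x. abs (p c (s, x)) <= M * dec s) ==> (\<And>c x. abs (q c (s, x)) <= M * dec s) ==>
   n2 (\<lambda>z. F i (PP p z) - F i (PP q z)) s <= ennreal (CS i * M^4 * D / (1 + s)^3)"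
  and small: "CD i * (CN i * M^3) <= M / 4" "0 <= CD i" "32 * ellip.ce (e i) * (CS i * M^4) <= 1 / 8"
  and u0: "good 12 8 (M / 4) (u0 c)"
begin

primrec iter :: "nat => 'm \<times> 3 option => spacetime => real" where
 "iter 0 = u0"
| "iter (Suc n) = (\<lambda>c z. u0 c z + Duh (e (fst c)) (snd c) (JJ ((1/2)^n) (\<lambda>z. F (fst c) (PP (iter n) z))) z)"

abbreviation "NL n i \<equiv> \<lambda>z. F i (PP (iter n) z)"

text \<open>Linear part and Duhamel part have size \<open>M / 4\<close> each, and
  \<open>good_add\<close> doubles the sum. The factor \<open>M^3\<close> from the source makes the
  second part small.\<close>

lemma iter_good: "good 12 8 M (iter n c)"
proof (induction n arbitrary: c)
 case 0 show ?case using good_mono[OF u0] M by simp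
next
 case (Suc n)
 let ?i = "fst c" and ?N = "JJ ((1/2)^n) (NL n (fst c))"
 have s: "good_source 12 (CN ?i * M^3) (NL n ?i)" by (rule source[OF Suc])
 have cx: "CX (Suc (Suc 12)) ?N" by (rule JJ_gain) (use s in \<open>auto simp: good_source_def\<close>)
 have "good 12 8 (CD ?i * (CN ?i * M^3)) (Duh (e ?i) (snd c) ?N)"
  using CN M by (intro Duh cx good_source_JJ s) auto
 then have "good 12 8 (M / 4) (Duh (e ?i) (snd c) ?N)" by (rule good_mono) (use small CN M in auto)
 from good_add[OF u0[of c] this] M show ?case by (simp add: mult_ac)
qed

lemma iter_source: "good_source 12 (CN i * M^3) (NL n i)" by (rule source[OF iter_good])

lemma iter_CX: "CX 12 (iter n c)" and iter_cont: "cts (iter n c)"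
 using goodD(1)[OF iter_good] CX_cont by blast+

lemma iter_sup: "t >= 0 ==> abs (iter n c (t, x)) <= M * dec t"
 using goodD(4)[OF iter_good, of t "[]"] by simp

text \<open>\<open>M^2\<close> covers the first difference; each summand is 8 times the
  mollification error of the later ones.\<close>

definition "A0 = M^2 + (\<Sum>i\<in>UNIV. 16 * 8 * 288 * ellip.ce (e i) * (CN i * M^3)^2)"

lemma ce_pos: "ellip.ce (e i) > 0" by (rule ellip.ce_pos(2)[OF ellip])

lemma A0: "A0 >= M\<^sup>2" "A0 >= 0" "16 * ellip.ce (e i) * (288 * (CN i * M^3)^2) <= A0 / 8"
proof -
 have nn: "16 * 8 * 288 * ellip.ce (e i) * (CN i * M^3)^2 >= 0" for i
  by (intro mult_nonneg_nonneg less_imp_le[OF ce_pos]) auto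
 then have "(\<Sum>i\<in>UNIV. 16 * 8 * 288 * ellip.ce (e i) * (CN i * M^3)^2) >= 0" by (intro sum_nonneg) auto
 then show 1: "A0 >= M\<^sup>2" by (simp add: A0_def)
 then show "A0 >= 0" using zero_le_power2[of M] by linarith
 have "16 * 8 * 288 * ellip.ce (e i) * (CN i * M^3)^2 <= (\<Sum>i\<in>UNIV. 16 * 8 * 288 * ellip.ce (e i) * (CN i * M^3)^2)"
  by (rule member_le_sum) (use nn in auto)
 then have "16 * 8 * 288 * ellip.ce (e i) * (CN i * M^3)^2 <= A0" unfolding A0_def using zero_le_power2[of M] by linarith
 then show "16 * ellip.ce (e i) * (288 * (CN i * M^3)^2) <= A0 / 8" by simp
qed

text \<open>The partner \<open>JJ h' N\<close> is kept general: in \<open>contraction\<close> it is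
  the previous mollified source, in \<open>fixed_point\<close> the source of the limit with
  \<open>h' = 0\<close>.\<close>

lemma step_difference:
 assumes t: "t >= 0"
  and N: "good_source (Suc k) B N" "good_source (Suc k) B (NL n i)" "\<And>s. s >= 0 ==> n2 (\<lambda>z. NL n i z - N z) s <= ennreal (E / (1 + s)^3)" "E >= 0"
  and N': "CX (Suc (Suc 0)) (JJ h' N)"
 shows "n2 (\<lambda>z. Duh (e i) b (JJ ((1/2)^n) (NL n i)) z - Duh (e i) b (JJ h' N) z) t
  <= ennreal (16 * ellip.ce (e i) * (2 * E + 144 * ((1/4)^n + h'^2) * B^2))"
proof -
 have h2: "(1/4::real)^n = ((1/2)^n)^2" by (simp add: power_mult[symmetric] mult.commute[of n]) (simp add: power_mult power2_eq_square)
 show ?thesis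
 proof (rule ellip.Duh_difference[where k=0, OF ellip _ N' _ _ t])
  have "CX 12 (NL n i)" using iter_source by (simp add: good_source_def del: CD.simps)
  then have "CX (Suc (Suc 12)) (JJ ((1/2)^n) (NL n i))" by (rule JJ_gain) simp
  then show "CX (Suc (Suc 0)) (JJ ((1/2)^n) (NL n i))" by (rule CD_mono) simp
  show "n2 (\<lambda>z. JJ ((1/2)^n) (NL n i) z - JJ h' N z) s <= ennreal ((2 * E + 144 * ((1/4)^n + h'^2) * B^2) / (1 + s)^3)" if "s >= 0" for s
   unfolding h2 by (rule mollified_difference[OF N(2,1) that N(4) N(3)[OF that]])
 qed (use N(4) in auto)
qed

text \<open>The ratio 1/4 is made of 1/8 from the Lipschitz bound, by the choice of
  \<open>M\<close>, and 1/8 from the mollification error, by the choice of \<open>A0\<close>. That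
  error is of order \<open>(1/4)^n\<close> because scales enter squared.\<close>

lemma contraction: "t >= 0 ==> n2 (\<lambda>z. iter (Suc n) c z - iter n c z) t <= ennreal (A0 * (1/4)^n)"
proof (induction n arbitrary: c t)
 case 0
 let ?i = "fst c" and ?N = "JJ ((1/2)^0) (NL 0 (fst c))"
 have s: "good_source 12 (CN ?i * M^3) (NL 0 ?i)" by (rule iter_source)
 have cx: "CX (Suc (Suc 12)) ?N" by (rule JJ_gain) (use s in \<open>auto simp: good_source_def\<close>)
 have "good 12 8 (CD ?i * (CN ?i * M^3)) (Duh (e ?i) (snd c) ?N)"
  using CN M by (intro Duh cx good_source_JJ s) auto
 then have "good 12 8 M (Duh (e ?i) (snd c) ?N)"
  by (rule good_mono) (use small[of ?i] CN[of ?i] M in auto)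
 from goodD(2)[OF this 0, of "[]"] have "n2 (Duh (e ?i) (snd c) ?N) t <= ennreal (M^2)" by simp
 also have "... <= ennreal A0" by (rule ennreal_leI[OF A0(1)])
 finally show ?case by simp
next
 case (Suc n)
 let ?i = "fst c" and ?b = "snd c"
 let ?D = "A0 * (1/4)^n"
 have D: "?D >= 0" using A0 by simp
 have E: "n2 (\<lambda>z. NL (Suc n) ?i z - NL n ?i z) s <= ennreal (CS ?i * M^4 * ?D / (1 + s)^3)" if s: "s >= 0" for s
  by (rule difference[OF s D iter_cont iter_cont Suc.IH[OF s] iter_sup[OF s] iter_sup[OF s]])
 have cx: "CX 12 (NL n ?i)" using iter_source by (simp add: good_source_def del: CD.simps)
 have cxJ: "CX (Suc (Suc 0)) (JJ ((1/2)^n) (NL n ?i))" by (rule CD_mono[OF JJ_gain[OF cx]]) auto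
 have src: "good_source (Suc 11) (CN ?i * M^3) (NL n ?i)" for n using iter_source by simp
 have "n2 (\<lambda>z. iter (Suc (Suc n)) c z - iter (Suc n) c z) t =
  n2 (\<lambda>z. Duh (e ?i) ?b (JJ ((1/2)^Suc n) (NL (Suc n) ?i)) z - Duh (e ?i) ?b (JJ ((1/2)^n) (NL n ?i)) z) t"
  by (subst iter.simps(2), subst (2) iter.simps(2)) simp
 also have "... <= ennreal (16 * ellip.ce (e ?i) * (2 * (CS ?i * M^4 * ?D) + 144 * ((1/4)^Suc n + ((1/2)^n)^2) * (CN ?i * M^3)^2))"
  by (rule step_difference[OF Suc.prems src src E _ cxJ]) (use CS D in auto)
 also have "... <= ennreal (A0 * (1/4)^Suc n)"
 proof (rule ennreal_leI)
  have h2: "((1/2::real)^n)^2 = (1/4)^n" by (simp add: power_mult[symmetric] mult.commute[of n]) (simp add: power_mult power2_eq_square)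
  have "(1/4::real)^Suc n + ((1/2)^n)^2 <= 2 * (1/4)^n" unfolding h2 by simp
  then have "144 * ((1/4)^Suc n + ((1/2)^n)^2) * (CN ?i * M^3)^2 <= 144 * (2 * (1/4)^n) * (CN ?i * M^3)^2"
   by (intro mult_right_mono mult_left_mono) auto
  then have "16 * ellip.ce (e ?i) * (2 * (CS ?i * M^4 * ?D) + 144 * ((1/4)^Suc n + ((1/2)^n)^2) * (CN ?i * M^3)^2)
   <= 16 * ellip.ce (e ?i) * (2 * (CS ?i * M^4 * ?D) + 144 * (2 * (1/4)^n) * (CN ?i * M^3)^2)"
   using ce_pos[of ?i] by (intro mult_left_mono add_left_mono) auto
  also have "... = (32 * ellip.ce (e ?i) * (CS ?i * M^4)) * ?D + (16 * ellip.ce (e ?i) * (288 * (CN ?i * M^3)^2)) * (1/4)^n"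
   by (simp add: algebra_simps)
  also have "... <= 1 / 8 * ?D + A0 / 8 * (1/4)^n"
   using small(3)[of ?i] A0(3)[of ?i] D by (intro add_mono mult_right_mono) auto
  also have "... = A0 * (1/4)^Suc n" by simp
  finally show "16 * ellip.ce (e ?i) * (2 * (CS ?i * M^4 * ?D) + 144 * ((1/4)^Suc n + ((1/2)^n)^2) * (CN ?i * M^3)^2) <= A0 * (1/4)^Suc n" .
 qed
 finally show ?case .
qed

text \<open>The triangle inequality for squares costs a factor 2 at every step, which the ratio 1/4
  outweighs: 2 * (4/4 + 1) = 4.\<close>

lemma iter_Cauchy: "t >= 0 ==> n2 (\<lambda>z. iter (n + k) c z - iter n c z) t <= ennreal (4 * A0 * (1/4)^n)"
proof (induction k arbitrary: n)
 case 0 then show ?case using A0 by (simp add: n2_def)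
next
 case (Suc k)
 have "n2 (\<lambda>z. iter (n + Suc k) c z - iter n c z) t <=
  2 * (n2 (\<lambda>z. iter (n + Suc k) c z - iter (Suc n) c z) t + n2 (\<lambda>z. iter (Suc n) c z - iter n c z) t)"
  by (rule n2_diff_add[OF iter_cont iter_cont iter_cont])
 also have "... <= 2 * (ennreal (4 * A0 * (1/4)^Suc n) + ennreal (A0 * (1/4)^n))"
  using Suc.IH[of "Suc n"] Suc.prems by (intro mult_left_mono add_mono contraction) auto
 also have "... = ennreal (4 * A0 * (1/4)^n)"
  using A0 by (simp add: ennreal_plus[symmetric] ennreal_mult'[symmetric] del: ennreal_plus) (simp add: ennreal_mult[symmetric] flip: ennreal_numeral)
 finally show ?case .
qed

text \<open>Of the 8 derivatives bounded in sup, \<open>geometric_decay\<close> gives up one. The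
  iterates are clamped in time because \<open>CX_limit\<close> works on all of spacetime.\<close>

lemma limit_exists:
 "\<exists>q. \<forall>c. CX 7 (q c) \<and> (\<forall>w t x. t >= 0 --> length w <= 7 --> (\<lambda>n. Dx w (iter n c) (t, x)) \<longlonglongrightarrow> Dx w (q c) (t, x))"
proof (rule choice, rule allI)
 fix c
 let ?d = "\<lambda>n z. iter (Suc n) c z - iter n c z"
 have cx8: "CX 8 (iter n c)" for n by (rule CD_mono[OF iter_CX]) simp
 have Dd: "Dx w (?d n) = (\<lambda>z. Dx w (iter (Suc n) c) z - Dx w (iter n c) z)" if "length w <= 8" for w n
  by (rule Dx_diff; rule CD_mono[OF cx8 that])
 have Dc: "Dx w (time_clamp (iter n c)) = time_clamp (Dx w (iter n c))" if "length w <= 8" for w n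
  by (rule smooth_op_Dx[OF smooth_op_time_clamp]) (use CD_mono[OF cx8 that] in simp)
 have "\<exists>v. CX 7 v \<and> (\<forall>w z. length w <= 7 --> (\<lambda>n. Dx w (time_clamp (iter n c)) z) \<longlonglongrightarrow> Dx w v z)"
 proof (rule CX_limit)
  show "CX 7 (time_clamp (iter n c))" for n
   by (rule smooth_op_CX[OF smooth_op_time_clamp]) (use CD_mono[OF cx8, of 7] in simp)
  fix w :: "3 list" assume w: "length w <= 7"
  have "\<exists>C\<ge>0. \<exists>q>0. q < 1 \<and> (\<forall>n t x. t >= 0 --> abs (Dx w (?d n) (t, x)) <= C * q^n)"
  proof (rule geometric_decay[where L=8 and G="2 * M" and A=A0])
   show "CX 8 (?d n)" for n by (rule CX_diff[OF cx8 cx8])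
   show "abs (Dx v (?d n) (t, x)) <= 2 * M" if "t >= 0" "length v <= 8" for n v t x
   proof -
    have "abs (Dx v (iter k c) (t, x)) <= M" for k
    proof -
     have "abs (Dx v (iter k c) (t, x)) <= M * dec t" by (rule goodD(4)[OF iter_good that])
     also have "... <= M * 1" using M dec_bounds(2)[of t] by (intro mult_left_mono) auto
     finally show ?thesis by simp
    qed
    from this[of n] this[of "Suc n"] show ?thesis unfolding Dd[OF that(2)] by linarith
   qed
   show "n2 (?d n) t <= ennreal (A0 * (1/4)^n)" if "t >= 0" for n t by (rule contraction[OF that])
  qed (use A0 w in auto)
  then obtain C q where q: "q > 0" "q < 1" "\<forall>n t x. t >= 0 --> abs (Dx w (?d n) (t, x)) <= C * q^n" by (elim exE conjE)
  have w8: "length w <= 8" using w by simp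
  have "abs (Dx w (time_clamp (iter (Suc n) c)) z - Dx w (time_clamp (iter n c)) z) <= C * q^n" for n z
   using q(3)[rule_format, of "max 0 (fst z)" n "snd z"] unfolding Dc[OF w8] Dd[OF w8] time_clamp_def by simp
  then show "\<exists>C q. 0 < q \<and> q < 1 \<and> (\<forall>n z. abs (Dx w (time_clamp (iter (Suc n) c)) z - Dx w (time_clamp (iter n c)) z) <= C * q^n)"
   using q(1,2) by blast
 qed
 then obtain v where v: "CX 7 v" "\<forall>w z. length w <= 7 --> (\<lambda>n. Dx w (time_clamp (iter n c)) z) \<longlonglongrightarrow> Dx w v z" by (elim exE conjE)
 have "(\<lambda>n. Dx w (iter n c) (t, x)) \<longlonglongrightarrow> Dx w v (t, x)" if t: "t >= 0" and w: "length w <= 7" for w t x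
 proof -
  have "Dx w (time_clamp (iter n c)) (t, x) = Dx w (iter n c) (t, x)" for n
   using Dc[of w n] w t by (simp add: time_clamp_def)
  then show ?thesis using v(2)[rule_format, OF w, of "(t, x)"] by simp
 qed
 then show "\<exists>q. CX 7 q \<and> (\<forall>w t x. t >= 0 --> length w <= 7 --> (\<lambda>n. Dx w (iter n c) (t, x)) \<longlonglongrightarrow> Dx w q (t, x))"
  using v(1) by blast
qed

text \<open>The equation is first obtained in L^2 at each time: both \<open>q c\<close> and the
  right-hand side are limits of the iterates there. Both are continuous, so equality holds at every
  point.\<close>

lemma fixed_point:
 "\<exists>q. (\<forall>c. good 7 7 M (q c)) \<and> (\<forall>c z. fst z >= 0 --> q c z = u0 c z + Duh (e (fst c)) (snd c) (\<lambda>z. F (fst c) (PP q z)) z)"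
proof -
 obtain q where q: "\<forall>c. CX 7 (q c) \<and> (\<forall>w t x. t >= 0 --> length w <= 7 --> (\<lambda>n. Dx w (iter n c) (t, x)) \<longlonglongrightarrow> Dx w (q c) (t, x))"
  using limit_exists by (elim exE)
 have cxq: "CX 7 (q c)" for c using q by blast
 note cq = CX_cont[OF cxq]
 have lim: "(\<lambda>n. Dx w (iter n c) (t, x)) \<longlonglongrightarrow> Dx w (q c) (t, x)" if "t >= 0" "length w <= 7" for w t x c using q that by blast
 have lim0: "(\<lambda>n. iter n c (t, x)) \<longlonglongrightarrow> q c (t, x)" if "t >= 0" for t x c using lim[OF that, of "[]"] by simp
 have gq: "good 7 7 M (q c)" for c by (rule good_limit[OF iter_good cxq _ _ lim]) auto
 have sup_q: "abs (q c (t, x)) <= M * dec t" if "t >= 0" for c t x using goodD(4)[OF gq that, of "[]"] by simp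
 have L2: "n2 (\<lambda>z. iter n c z - q c z) t <= ennreal (4 * A0 * (1/4)^n)" if t: "t >= 0" for n c t
 proof -
  have "n2 (\<lambda>z. q c z - iter n c z) t <= ennreal (4 * A0 * (1/4)^n)"
  proof (rule n2_Fatou[where u="\<lambda>k z. iter (n + k) c z - iter n c z"])
   show "(\<lambda>k. iter (n + k) c (t, x) - iter n c (t, x)) \<longlonglongrightarrow> q c (t, x) - iter n c (t, x)" for x
    using LIMSEQ_ignore_initial_segment[OF lim0[OF t, of c x], of n] by (intro tendsto_intros) (simp add: add.commute)
  qed (use iter_Cauchy[OF t] in \<open>auto intro!: continuous_intros iter_cont\<close>)
  then show ?thesis by (simp only: n2_minus)
 qed
 have "q c (t, x) = u0 c (t, x) + Duh (e (fst c)) (snd c) (\<lambda>z. F (fst c) (PP q z)) (t, x)" if t: "t >= 0" for c t x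
 proof -
  let ?i = "fst c" and ?b = "snd c"
  let ?N = "\<lambda>z. F (fst c) (PP q z)"
  let ?r = "\<lambda>z. u0 c z + Duh (e ?i) ?b ?N z"
  have cN: "CX 7 ?N" by (rule CX_PP[OF smooth cxq])
  then have N1: "CX (Suc 0) ?N" "CX (Suc (Suc 0)) (JJ 0 ?N)" by (auto simp: JJ_0 simp del: CD.simps intro: CD_mono)
  have cR: "cts (\<lambda>z. ?r z)"
   using smooth_op_cont[OF ellip.smooth_op_Duh[OF ellip], of ?N] N1 CX_cont[OF goodD(1)[OF u0]]
   by (intro continuous_intros) (auto simp del: CD.simps)
  \<comment> \<open>A common size for the sources of the iterates, controlled at level 12, and of
    the limit, controlled at level 7, as \<open>step_difference\<close> takes a single
    bound.\<close>
  let ?B = "max (CN ?i) (CN' ?i) * M^3"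
  have srcmono: "good_source 7 ?B N" if "good_source k B N" "k >= 7" "0 <= B" "B <= ?B" for N k B
   unfolding good_source_def
  proof (intro conjI allI impI)
   show "CX 7 N" by (rule CD_mono[of _ k]) (use that in \<open>auto simp: good_source_def\<close>)
   fix s :: real and w :: "3 list" assume s: "s >= 0" and w: "length w <= 7"
   have a: "B^2 / (1 + s)^3 <= ?B^2 / (1 + s)^3" "B / (1 + s) <= ?B / (1 + s)"
    using that s by (auto intro!: divide_right_mono power_mono)
   show "n2 (Dx w N) s <= ennreal (?B^2 / (1 + s)^3)" "n1 (Dx w N) s <= ennreal (?B / (1 + s))"
    by (rule order_trans[OF _ ennreal_leI[OF a(1)]] order_trans[OF _ ennreal_leI[OF a(2)]],
      use that(1,2) s w in \<open>simp add: good_source_def\<close>)+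
  qed
  have s1: "good_source 7 ?B ?N" by (rule srcmono[OF source'[OF gq]]) (use CN M in auto)
  have s2: "good_source 7 ?B (NL n ?i)" for n by (rule srcmono[OF iter_source]) (use CN M in auto)
  define Z where "Z = 16 * ellip.ce (e ?i) * (2 * (CS ?i * M^4 * (4 * A0)) + 144 * ?B^2)"
  have Z0: "Z >= 0" unfolding Z_def using ce_pos[of ?i] CS[of ?i] A0 M by auto
  have st: "n2 (\<lambda>z. iter (Suc n) c z - ?r z) t <= ennreal (Z * (1/4)^n)" for n
  proof -
   let ?D = "4 * A0 * (1/4)^n"
   have E: "n2 (\<lambda>z. NL n ?i z - ?N z) s <= ennreal (CS ?i * M^4 * ?D / (1 + s)^3)" if s: "s >= 0" for s
    by (rule difference[OF s _ iter_cont cq L2[OF s] iter_sup[OF s] sup_q[OF s]]) (use A0 in simp)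
   have "n2 (\<lambda>z. iter (Suc n) c z - ?r z) t
    = n2 (\<lambda>z. Duh (e ?i) ?b (JJ ((1/2)^n) (NL n ?i)) z - Duh (e ?i) ?b (JJ 0 ?N) z) t"
    by (simp add: JJ_0)
   also have "... <= ennreal (16 * ellip.ce (e ?i) * (2 * (CS ?i * M^4 * ?D) + 144 * ((1/4)^n + 0^2) * ?B^2))"
    by (rule step_difference[where k=6, OF t _ _ E _ N1(2)]) (use s1 s2 CS A0 in auto)
   also have "16 * ellip.ce (e ?i) * (2 * (CS ?i * M^4 * ?D) + 144 * ((1/4)^n + 0^2) * ?B^2) = Z * (1/4)^n"
    unfolding Z_def by (simp add: algebra_simps)
   finally show ?thesis .
  qed
  have "n2 (\<lambda>z. q c z - ?r z) t <= ennreal (Z * (1/4)^m)" for m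
  proof (rule n2_Fatou[where u="\<lambda>n z. iter (Suc n) c z - ?r z"])
   show "(\<lambda>n. iter (Suc n) c (t, x) - (u0 c (t, x) + Duh (e ?i) ?b ?N (t, x))) \<longlonglongrightarrow> q c (t, x) - (u0 c (t, x) + Duh (e ?i) ?b ?N (t, x))" for x
    by (rule tendsto_diff[OF LIMSEQ_Suc[OF lim0[OF t]] tendsto_const])
   show "cts (\<lambda>z. iter (Suc n) c z - ?r z)" for n
    by (rule continuous_on_diff[OF iter_cont cR])
   show "\<forall>\<^sub>F n in sequentially. n2 (\<lambda>z. iter (Suc n) c z - ?r z) t <= ennreal (Z * (1/4)^m)"
   proof (rule eventually_sequentiallyI[of m])
    fix n assume "m <= n"
    then have "Z * (1/4)^n <= Z * (1/4)^m" using Z0 by (intro mult_left_mono power_decreasing) auto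
    then show "n2 (\<lambda>z. iter (Suc n) c z - ?r z) t <= ennreal (Z * (1/4)^m)"
     using st by (meson ennreal_leI order_trans)
   qed
  qed
  moreover have "(\<lambda>m. ennreal (Z * (1/4)^m)) \<longlonglongrightarrow> 0"
  proof -
   have "(\<lambda>m. Z * (1/4)^m) \<longlonglongrightarrow> Z * 0" by (intro tendsto_intros LIMSEQ_power_zero) auto
   then have "(\<lambda>m. ennreal (Z * (1/4)^m)) \<longlonglongrightarrow> ennreal (Z * 0)" by (rule tendsto_ennrealI)
   then show ?thesis by simp
  qed
  ultimately have "n2 (\<lambda>z. q c z - ?r z) t <= 0" by (intro LIMSEQ_le_const) auto
  then have z: "n2 (\<lambda>z. q c z - ?r z) t = 0" by simp
  have "q c (t, x) - (u0 c (t, x) + Duh (e ?i) ?b ?N (t, x)) = 0"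
   by (rule n2_eq_0[OF _ z]) (rule continuous_on_diff[OF cq cR])
  then show ?thesis by simp
 qed
 then show ?thesis using gq by (intro exI[of _ q]) auto
qed

end

section \<open>Classical solutions\<close>

text \<open>The integral of \<open>A (t - s) s x\<close> over \<open>s\<close> from 0 to
  \<open>T\<close>. The upper limit is kept apart from the time: \<open>T = t\<close> gives the
  Duhamel integral, T to infinity the scattering state.\<close>

definition Fx :: "(real => real => real^3 => real) => real => spacetime => real" where
 "Fx A T z = (LINT \<theta>|lam. T * A (fst z - T * \<theta>) (T * \<theta>) (snd z))"

definition jcont :: "(real => real => real^3 => real) => bool" where
 "jcont A \<longleftrightarrow> cts (\<lambda>p. A (fst p) (fst (snd p)) (snd (snd p)))"

lemma jcont_comp:
 assumes "jcont A" "continuous_on S f" "continuous_on S g" "continuous_on S h"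
 shows "continuous_on S (\<lambda>p. A (f p) (g p) (h p))"
 using cts_comp[OF assms(1)[unfolded jcont_def], of S "\<lambda>p. (f p, g p, h p)"] assms
 by (simp add: continuous_on_Pair)

lemma antiderivative_UNIV:
 fixes h :: "real => real"
 assumes h: "cts h" shows "\<exists>H. \<forall>x. DERIV H x :> h x"
proof -
 have "\<exists>H. \<forall>x :: real. -\<infinity> < ereal x --> ereal x < \<infinity> --> (H has_vector_derivative h x) (at x)"
  by (rule einterval_antiderivative) (use h in \<open>auto simp: continuous_on_eq_continuous_at\<close>)
 then show ?thesis by (auto simp: has_real_derivative_iff_has_vector_derivative)
qed

lemma lam_antiderivative:
 fixes H h :: "real => real"
 assumes H: "\<And>x. DERIV H x :> h x" and h: "cts h"
 shows "(LINT \<theta>|lam. T * h (a + T * \<theta>)) = H (a + T) - H a"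
proof -
 have "DERIV (\<lambda>\<theta>. H (a + T * \<theta>)) \<theta> :> T * h (a + T * \<theta>)" for \<theta>
 proof -
  have "DERIV (\<lambda>\<theta>. a + T * \<theta>) \<theta> :> T"
   by (rule DERIV_cong[OF DERIV_add[OF DERIV_const DERIV_cmult[OF DERIV_ident]]]) simp
  from DERIV_chain2[OF H this] show ?thesis by (simp add: mult.commute)
 qed
 from lam_FTC[OF this] show ?thesis by (simp add: continuous_intros cts_comp[OF h])
qed

text \<open>Rescaling to the unit interval hides the dependence on \<open>T\<close>. An
  antiderivative in the source time makes derivatives in \<open>T\<close> and differences of upper
  limits visible again.\<close>

lemma Fx_antiderivative:
 assumes A: "jcont A"
 obtains H where "\<And>s. DERIV H s :> A (fst z - s) s (snd z)" "\<And>T. Fx A T z = H T - H 0"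
  "\<And>a T. (LINT \<theta>|lam. T * A (fst z - (a + T * \<theta>)) (a + T * \<theta>) (snd z)) = H (a + T) - H a"
proof -
 have c: "cts (\<lambda>s. A (fst z - s) s (snd z))" by (intro jcont_comp[OF A] continuous_intros)
 obtain H where H: "\<And>s. DERIV H s :> A (fst z - s) s (snd z)"
  using antiderivative_UNIV[OF c] by blast
 show ?thesis
  by (rule that[OF H]) (use lam_antiderivative[OF H c] lam_antiderivative[OF H c, of _ 0] in \<open>auto simp: Fx_def\<close>)
qed

lemma Fx_cont:
 assumes A: "jcont A" and f: "cts f" "cts (g :: 'a::euclidean_space => spacetime)"
 shows "cts (\<lambda>p. Fx A (f p) (g p))" unfolding Fx_def
 by (rule lam.continuous_param) (intro continuous_intros jcont_comp[OF A] cts_comp[OF f(1)] cts_comp[OF f(2)])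

lemma Fx_t:
 assumes A: "jcont A" and A': "jcont A'" and d: "\<And>r s x. DERIV (\<lambda>r. A r s x) r :> A' r s x"
 shows "hasdd (1, 0) (Fx A T) z (Fx A' T z)"
proof -
 have "((\<lambda>s. \<integral>\<theta>. T * A (fst z + s - T * \<theta>) (T * \<theta>) (snd z) \<partial>lam) has_real_derivative
   (LINT \<theta>|lam. T * A' (fst z + 0 - T * \<theta>) (T * \<theta>) (snd z))) (at 0)"
 proof (rule lam.deriv_param[where U=UNIV and H'="\<lambda>s \<theta>. T * A' (fst z + s - T * \<theta>) (T * \<theta>) (snd z)"])
  fix s \<theta> :: real
  have "DERIV (\<lambda>s. fst z + s - T * \<theta>) s :> 1" by (auto intro!: derivative_eq_intros)
  from DERIV_cmult[OF DERIV_chain2[OF d this]]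
  show "DERIV (\<lambda>s. T * A (fst z + s - T * \<theta>) (T * \<theta>) (snd z)) s :> T * A' (fst z + s - T * \<theta>) (T * \<theta>) (snd z)" by simp
 qed (auto intro!: continuous_intros jcont_comp[OF A] jcont_comp[OF A'])
 then show ?thesis unfolding hasdd_def Fx_def by simp
qed

lemma Fx_x:
 assumes A: "jcont A" and A': "jcont A'" and d: "\<And>r s x h. DERIV (\<lambda>h. A r s (x + h *R axis j 1)) h :> A' r s (x + h *R axis j 1)"
 shows "hasdd (spv j) (Fx A T) z (Fx A' T z)"
proof -
 have "((\<lambda>s. \<integral>\<theta>. T * A (fst z - T * \<theta>) (T * \<theta>) (snd z + s *R axis j 1) \<partial>lam) has_real_derivative
   (LINT \<theta>|lam. T * A' (fst z - T * \<theta>) (T * \<theta>) (snd z + 0 *R axis j 1))) (at 0)"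
  by (rule lam.deriv_param[where U=UNIV and H'="\<lambda>s \<theta>. T * A' (fst z - T * \<theta>) (T * \<theta>) (snd z + s *R axis j 1)"])
    (auto intro!: continuous_intros jcont_comp[OF A] jcont_comp[OF A'] DERIV_cmult d)
 then show ?thesis unfolding hasdd_def Fx_def by simp
qed

text \<open>Time and upper limit move together: the function of both has continuous partial
  derivatives, and the diagonal derivative is their sum. The limit contributes the integrand at
  source time t, that is at elapsed time 0.\<close>

lemma Fx_diagonal:
 assumes A: "jcont A" and A': "jcont A'" and d: "\<And>r s x. DERIV (\<lambda>r. A r s x) r :> A' r s x"
 shows "hasdd (1, 0) (\<lambda>z. Fx A (fst z) z) z (A 0 (fst z) (snd z) + Fx A' (fst z) z)"
proof -
 obtain t x where z: "z = (t, x)" by (cases z)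
 let ?U = "\<lambda>p :: real \<times> real. Fx A (snd p) (fst p, x)"
 let ?U' = "\<lambda>b p. if b = (1, 0) then Fx A' (snd p) (fst p, x) else A (fst p - snd p) (snd p) x"
 have "(?U has_derivative (\<lambda>h. \<Sum>b\<in>Basis. (h \<bullet> b) * ?U' b (t, t))) (at (t, t))"
 proof (rule has_derivative_partials)
  fix b p assume "b \<in> (Basis :: (real \<times> real) set)"
  then consider "b = (1, 0)" | "b = (0, 1)" by (auto simp: Basis_prod_def)
  then show "hasdd b ?U p (?U' b p)"
  proof cases
   case 1
   have "hasdd (1, 0) (Fx A (snd p)) (fst p, x) (Fx A' (snd p) (fst p, x))" by (rule Fx_t[OF A A' d])
   then show ?thesis using 1 by (simp add: hasdd_def)
  next
   case 2
   obtain H where H: "\<And>s. DERIV H s :> A (fst (fst p, x) - s) s (snd (fst p, x))" "\<And>T. Fx A T (fst p, x) = H T - H 0"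
    by (rule Fx_antiderivative[OF A, of "(fst p, x)"]) blast
   have "DERIV (\<lambda>s. H s - H 0) (0 + snd p) :> A (fst p - snd p) (snd p) x"
    using DERIV_diff[OF H(1) DERIV_const[of "H 0"]] by simp
   then have "DERIV (\<lambda>s. H (s + snd p) - H 0) 0 :> A (fst p - snd p) (snd p) x" by (simp only: DERIV_shift)
   then show ?thesis using 2 by (simp add: hasdd_def H(2) add.commute)
  qed
 next
  fix b assume "b \<in> (Basis :: (real \<times> real) set)"
  show "cts (?U' b)"
   by (cases "b = (1, 0)") (auto intro!: Fx_cont[OF A'] jcont_comp[OF A] continuous_intros)
 qed
 from has_derivative_imp_hasdd[OF this, of "(1, 1)"]
 have "hasdd (1, 1) ?U (t, t) (A 0 t x + Fx A' t (t, x))"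
  by (simp add: Basis_prod_def sum.union_disjoint)
 then show ?thesis by (simp add: hasdd_def z)
qed

context ellip begin

lemma jcont_TT: "cts N ==> jcont (TT e N)"
 unfolding jcont_def by (rule TT_cont_comp) (auto intro!: continuous_intros)

lemma jcont_AA: "CX (Suc k) N ==> jcont (AA e b N)"
 unfolding jcont_def by (rule AA_cont_comp) (auto intro!: continuous_intros)

lemma Duh_Fx: "Duh e b N z = Fx (AA e b N) (fst z) z"
 unfolding Duh_def Fx_def by (simp add: right_diff_distrib)

lemma Fx_sum:
 assumes "\<And>j. jcont (A j)"
 shows "Fx (\<lambda>r s x. \<Sum>j\<in>(UNIV::3 set). c j * A j r s x) T z = (\<Sum>j\<in>UNIV. c j * Fx (A j) T z)"
proof -
 have i: "integrable lam (\<lambda>\<theta>. T * A j (fst z - T * \<theta>) (T * \<theta>) (snd z))" for j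
  by (intro lam.integrable_cont continuous_intros jcont_comp[OF assms])
 have "Fx (\<lambda>r s x. \<Sum>j\<in>(UNIV::3 set). c j * A j r s x) T z
  = (LINT \<theta>|lam. (\<Sum>j\<in>UNIV. c j * (T * A j (fst z - T * \<theta>) (T * \<theta>) (snd z))))"
  unfolding Fx_def by (simp add: sum_distrib_left mult_ac)
 also have "... = (\<Sum>j\<in>UNIV. c j * Fx (A j) T z)"
  unfolding Fx_def by (subst Bochner_Integration.integral_sum, rule integrable_mult_right[OF i]) (simp only: integral_mult_right_zero)
 finally show ?thesis .
qed

lemma jcont_sum: "(\<And>j. jcont (A j)) ==> jcont (\<lambda>r s x. \<Sum>j\<in>(UNIV::3 set). c j * A j r s x)"
 unfolding jcont_def by (intro continuous_intros)

lemma wave_kernel_t: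
 assumes N: "CX (Suc (Suc k)) N" shows "hasdd (1, 0) (Fx (TT e N) T) z (Fx (AA e None N) T z)"
  "hasdd (1, 0) (Fx (AA e None N) T) z (\<Sum>i\<in>UNIV. e i * Fx (AA e (Some i) (sd i N)) T z)"
  "hasdd (1, 0) (Fx (AA e (Some j) N) T) z (Fx (AA e None (sd j N)) T z)"
  "hasdd (spv j) (Fx (TT e N) T) z (Fx (AA e (Some j) N) T z)"
  "hasdd (spv j) (Fx (AA e b N) T) z (Fx (AA e b (sd j N)) T z)"
proof -
 note N1 = CX_sd[OF N] and N0 = CD_Suc_lower[OF N]
 note jc = jcont_TT[OF CX_cont[OF N]] jcont_AA[OF N] jcont_AA[OF N1] jcont_sum[OF jcont_AA[OF N1]]
 show "hasdd (1, 0) (Fx (TT e N) T) z (Fx (AA e None N) T z)"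
  by (rule Fx_t[OF jc(1,2) TT_deriv_r[OF N]])
 show "hasdd (1, 0) (Fx (AA e None N) T) z (\<Sum>i\<in>UNIV. e i * Fx (AA e (Some i) (sd i N)) T z)"
  using Fx_t[OF jc(2,4) AA_None_deriv_r[OF N], of T z] Fx_sum[OF jcont_AA[OF N1]] by (simp del: CD.simps)
 show "hasdd (1, 0) (Fx (AA e (Some j) N) T) z (Fx (AA e None (sd j N)) T z)"
  by (rule Fx_t[OF jc(2,3) AA_Some_deriv_r[OF N]])
 show "hasdd (spv j) (Fx (TT e N) T) z (Fx (AA e (Some j) N) T z)"
  by (rule Fx_x[OF jc(1,2) TT_deriv_x[OF N]])
 show "hasdd (spv j) (Fx (AA e b N) T) z (Fx (AA e b (sd j N)) T z)"
  by (rule Fx_x[OF jc(2,3) AA_deriv_x[OF N]])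
qed

text \<open>The boundary term of \<open>Fx_diagonal\<close> is the kernel at elapsed time 0. It
  vanishes for \<open>TT\<close> and for \<open>AA e (Some j)\<close> and equals \<open>N\<close>
  for \<open>AA e None\<close>: this is where the source enters the wave equation.\<close>

lemma Duhamel_t:
 assumes N: "CX (Suc (Suc k)) N"
 shows "hasdd (1, 0) (\<lambda>z. Fx (TT e N) (fst z) z) z (Duh e None N z)"
  "hasdd (1, 0) (Duh e None N) z (N z + (\<Sum>i\<in>UNIV. e i * Duh e (Some i) (sd i N) z))"
  "hasdd (1, 0) (Duh e (Some j) N) z (Duh e None (sd j N) z)"
proof -
 note N1 = CX_sd[OF N]
 note jc = jcont_TT[OF CX_cont[OF N]] jcont_AA[OF N] jcont_AA[OF N1] jcont_sum[OF jcont_AA[OF N1]]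
 show "hasdd (1, 0) (\<lambda>z. Fx (TT e N) (fst z) z) z (Duh e None N z)"
  using Fx_diagonal[OF jc(1,2) TT_deriv_r[OF N], of z] by (simp add: TT_zero Duh_Fx)
 show "hasdd (1, 0) (Duh e None N) z (N z + (\<Sum>i\<in>UNIV. e i * Duh e (Some i) (sd i N) z))"
  using Fx_diagonal[OF jc(2,4) AA_None_deriv_r[OF N], of z] Fx_sum[OF jcont_AA[OF N1]] by (simp add: AA_zero Duh_Fx[abs_def] del: CD.simps)
 show "hasdd (1, 0) (Duh e (Some j) N) z (Duh e None (sd j N) z)"
  using Fx_diagonal[OF jc(2,3) AA_Some_deriv_r[OF N], where z=z] by (simp add: AA_zero Duh_Fx[abs_def] del: CD.simps)
qed

lemma Duhamel_x:
 assumes N: "CX (Suc (Suc k)) N"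
 shows "hasdd (spv j) (\<lambda>z. Fx (TT e N) (fst z) z) z (Duh e (Some j) N z)"
  "hasdd (spv j) (Duh e b N) z (Duh e b (sd j N) z)"
proof -
 show "hasdd (spv j) (\<lambda>z. Fx (TT e N) (fst z) z) z (Duh e (Some j) N z)"
  using wave_kernel_t(4)[OF N, where j=j and T="fst z" and z=z] by (simp add: hasdd_def Duh_Fx)
 show "hasdd (spv j) (Duh e b N) z (Duh e b (sd j N) z)"
  using wave_kernel_t(5)[OF N, where j=j and b=b and T="fst z" and z=z] by (simp add: hasdd_def Duh_Fx)
qed

lemma LA_t:
 assumes g: "CX (Suc (Suc k)) g"
 shows "hasdd (1, 0) (\<lambda>z. TT e g (fst z) 0 (snd z)) z (LA e None g z)"
  "hasdd (1, 0) (LA e None g) z (\<Sum>i\<in>UNIV. e i * LA e (Some i) (sd i g) z)"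
  "hasdd (1, 0) (LA e (Some j) g) z (LA e None (sd j g) z)"
proof -
 have sh: "hasdd (1, 0) (\<lambda>z. f (fst z) (snd z)) z d" if "DERIV (\<lambda>r. f r (snd z)) (fst z) :> d" for f d
 proof -
  have "DERIV (\<lambda>s. f (s + fst z) (snd z)) 0 :> d" using that DERIV_shift[of "\<lambda>r. f r (snd z)" d 0 "fst z"] by simp
  then show ?thesis by (simp add: hasdd_def add.commute)
 qed
 show "hasdd (1, 0) (\<lambda>z. TT e g (fst z) 0 (snd z)) z (LA e None g z)"
  unfolding LA_def by (rule sh[OF TT_deriv_r[OF g]])
 show "hasdd (1, 0) (LA e None g) z (\<Sum>i\<in>UNIV. e i * LA e (Some i) (sd i g) z)"
  unfolding LA_def[abs_def] by (rule sh[OF AA_None_deriv_r[OF g]])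
 show "hasdd (1, 0) (LA e (Some j) g) z (LA e None (sd j g) z)"
  unfolding LA_def[abs_def] by (rule sh[OF AA_Some_deriv_r[OF g]])
qed

lemma LA_x:
 assumes g: "CX (Suc (Suc k)) g"
 shows "hasdd (spv j) (\<lambda>z. TT e g (fst z) 0 (snd z)) z (LA e (Some j) g z)"
  "hasdd (spv j) (LA e b g) z (LA e b (sd j g) z)"
 using TT_deriv_x[OF g, of "fst z" 0 "snd z" j 0] AA_deriv_x[OF g, of b "fst z" 0 "snd z" j 0]
 by (simp_all add: hasdd_def LA_def)

end

section \<open>Classical regularity on the half-space\<close>

lemma Basis_spacetime: "(Basis :: spacetime set) = insert (1, 0) (range spv)"
 by (auto simp: Basis_prod_def Basis_vec_def)

abbreviation CB :: "nat => (spacetime => real) => bool" where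
 "CB \<equiv> CD Basis"

lemma CB_SucI:
 assumes "cts u" "\<And>z. hasdd (1, 0) u z (ut z)" "\<And>j z. hasdd (spv j) u z (ux j z)" "CB k ut" "\<And>j. CB k (ux j)"
 shows "CB (Suc k) u" "dd (1, 0) u = ut" "dd (spv j) u = ux j"
proof -
 show t: "dd (1, 0) u = ut" by (rule ext) (rule hasdd_imp_dd[OF assms(2)])
 have x: "dd (spv j) u = ux j" for j by (rule ext) (rule hasdd_imp_dd[OF assms(3)])
 then show "dd (spv j) u = ux j" .
 show "CB (Suc k) u"
  by (rule CD_SucI[where u'="\<lambda>v. dd v u"]) (use assms t x in \<open>auto simp: Basis_spacetime simp del: CD.simps\<close>)
qed

lemma CB_hasdd: "CB (Suc k) u ==> hasdd (1, 0) u z (dd (1, 0) u z)" "CB (Suc k) u ==> hasdd (spv j) u z (dd (spv j) u z)"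
 by (erule CD_hasdd, simp add: Basis_spacetime)+

lemma CB_dd: "CB (Suc k) u ==> CB k (dd (1, 0) u)" "CB (Suc k) u ==> CB k (dd (spv j) u)"
 by (erule CD_dd, simp add: Basis_spacetime)+

text \<open>Uniqueness of the relative derivative asks only for arbitrarily small nonzero increments
  inside the set, of either sign; at t = 0 the positive time increments suffice.\<close>

lemma future_approach:
 assumes z: "z \<in> future" and b: "b \<in> Basis" and \<epsilon>: "\<epsilon> > 0"
 shows "\<exists>d. 0 < abs d \<and> abs d < \<epsilon> \<and> z + d *R b \<in> future"
 by (rule exI[of _ "\<epsilon> / 2"]) (use assms in \<open>auto simp: future_def Basis_spacetime\<close>)

lemma has_derivative_future:
 assumes "CB (Suc k) u"
 shows "(u has_derivative (\<lambda>h. \<Sum>b\<in>Basis. (h \<bullet> b) * dd b u z)) (at z within future)"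
 by (rule has_derivative_at_withinI, rule has_derivative_partials) (use assms in \<open>auto intro: CD_hasdd CD_cont CD_dd simp del: CD.simps\<close>)

lemma frechet_future_unique:
 assumes D: "(u has_derivative D) (at z within future)" and z: "z \<in> future"
 shows "frechet_derivative u (at z within future) = D"
proof -
 have "u differentiable (at z within future)" using D by (rule differentiableI)
 then have "(u has_derivative frechet_derivative u (at z within future)) (at z within future)"
  unfolding frechet_derivative_works .
 from frechet_derivative_unique_within[OF this D] future_approach[OF z] show ?thesis by blast
qed

lemma frechet_future:
 assumes "CB (Suc k) u" "z \<in> future" "b \<in> Basis"
 shows "frechet_derivative u (at z within future) b = dd b u z"
proof -
 have "frechet_derivative u (at z within future) b = (\<Sum>c\<in>Basis. (b \<bullet> c) * dd c u z)"
  using frechet_future_unique[OF has_derivative_future[OF assms(1)] assms(2)] by simp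
 also have "... = (\<Sum>c\<in>Basis. if b = c then dd c u z else 0)"
  by (rule sum.cong) (auto simp: inner_Basis assms(3))
 also have "... = dd b u z" using assms(3) by (simp add: sum.delta)
 finally show ?thesis .
qed

lemma frechet_derivative_cong:
 assumes "\<And>x. x \<in> S ==> f x = g x" "x \<in> S"
 shows "frechet_derivative f (at x within S) = frechet_derivative g (at x within S)"
proof -
 have "(f has_derivative D) (at x within S) = (g has_derivative D) (at x within S)" for D
  using has_derivative_transform[OF assms(2), of f g D] has_derivative_transform[OF assms(2), of g f D] assms(1) by auto
 then show ?thesis by (simp add: frechet_derivative_def)
qed

lemma Ck_on_cong:
 "(\<And>x. x \<in> S ==> f x = g x) ==> Ck_on k S f ==> Ck_on k S g"
proof (induction k arbitrary: f g)
 case 0 then show ?case by (simp cong: continuous_on_cong)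
next
 case (Suc k)
 have "g differentiable_on S" unfolding differentiable_on_def
 proof
  fix x assume x: "x \<in> S"
  then obtain D where "(f has_derivative D) (at x within S)"
   using Suc.prems(2) by (auto simp: differentiable_on_def differentiable_def)
  then have "(g has_derivative D) (at x within S)"
   by (rule has_derivative_transform[OF x, rotated]) (simp add: Suc.prems(1))
  then show "g differentiable at x within S" by (rule differentiableI)
 qed
 moreover have "Ck_on k S (\<lambda>x. frechet_derivative g (at x within S) b)" if "b \<in> Basis" for b
  by (rule Suc.IH[of "\<lambda>x. frechet_derivative f (at x within S) b"])
    (use Suc.prems that frechet_derivative_cong[of S f g] in auto)
 ultimately show ?case by simp
qed

lemma CB_Ck_on: "CB k u ==> Ck_on k future u"
proof (induction k arbitrary: u)
 case 0 then show ?case using continuous_on_subset by auto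
next
 case (Suc k)
 have "u differentiable_on future"
  using has_derivative_future[OF Suc.prems] by (auto simp: differentiable_on_def differentiable_def)
 moreover have "Ck_on k future (\<lambda>x. frechet_derivative u (at x within future) b)" if "b \<in> Basis" for b
  by (rule Ck_on_cong[OF _ Suc.IH[OF CD_dd[OF Suc.prems that]]]) (simp add: frechet_future[OF Suc.prems _ that])
 ultimately show ?case by simp
qed

lemma dt_eq: "CB (Suc k) u ==> z \<in> future ==> dt u z = dd (1, 0) u z"
 and dx_eq: "CB (Suc k) u ==> z \<in> future ==> dx j u z = dd (spv j) u z"
 unfolding dt_def dx_def by (rule frechet_future; simp add: Basis_spacetime del: CD.simps)+

lemma dt_cong: "(\<And>z. z \<in> future ==> u z = v z) ==> z \<in> future ==> dt u z = dt v z"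
 and dx_cong: "(\<And>z. z \<in> future ==> u z = v z) ==> z \<in> future ==> dx j u z = dx j v z"
 unfolding dt_def dx_def by (simp_all add: frechet_derivative_cong[of future u v])

text \<open>A C^2 function together with its first derivatives \<open>p\<close>. The source has the
  sign of Duhamel's formula: the box operator gives \<open>- N\<close>.\<close>

definition wsol :: "(3 => real) => (spacetime => real) => (3 option => spacetime => real) => (spacetime => real) => bool" where
 "wsol e \<phi> p N \<longleftrightarrow> CB 2 \<phi> \<and> dd (1, 0) \<phi> = p None \<and> (\<forall>j. dd (spv j) \<phi> = p (Some j)) \<and>
   (\<forall>z. - dd (1, 0) (p None) z + (\<Sum>j\<in>UNIV. e j * dd (spv j) (p (Some j)) z) = - N z)"

lemma wsol_add:
 assumes "wsol e \<phi> p N" "wsol e \<psi> q M"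
 shows "wsol e (\<lambda>z. \<phi> z + \<psi> z) (\<lambda>b z. p b z + q b z) (\<lambda>z. N z + M z)"
proof -
 have p: "CB (Suc (Suc 0)) \<phi>" "CB (Suc 0) (p b)" and q: "CB (Suc (Suc 0)) \<psi>" "CB (Suc 0) (q b)" for b
  using assms CB_dd[of "Suc 0"] unfolding wsol_def numeral_2_eq_2 by (cases b; metis)+
 have "dd v (\<lambda>z. f z + g z) = (\<lambda>z. dd v f z + dd v g z)" if "CB (Suc k) f" "CB (Suc k) g" "v \<in> Basis" for f g v k
  using hasdd_add[OF CD_hasdd[OF that(1,3)] CD_hasdd[OF that(2,3)]] by (intro ext hasdd_imp_dd)
 note add = this[of 1] this[of 0] this
 have B: "(1, 0) \<in> (Basis :: spacetime set)" "spv j \<in> Basis" for j by (auto simp: Basis_spacetime)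
 show ?thesis unfolding wsol_def
 proof (intro conjI allI)
  show "CB 2 (\<lambda>z. \<phi> z + \<psi> z)" using CD_add[OF p(1) q(1)] by (simp only: numeral_2_eq_2)
  show "dd (1, 0) (\<lambda>z. \<phi> z + \<psi> z) = (\<lambda>z. p None z + q None z)" using add(3)[OF p(1) q(1) B(1)] assms by (simp add: wsol_def)
  show "dd (spv j) (\<lambda>z. \<phi> z + \<psi> z) = (\<lambda>z. p (Some j) z + q (Some j) z)" for j using add(3)[OF p(1) q(1) B(2)] assms by (simp add: wsol_def)
  show "- dd (1, 0) (\<lambda>z. p None z + q None z) z + (\<Sum>j\<in>UNIV. e j * dd (spv j) (\<lambda>z. p (Some j) z + q (Some j) z) z) = - (N z + M z)" for z
  proof -
   have "- dd (1, 0) (p None) z + (\<Sum>j\<in>UNIV. e j * dd (spv j) (p (Some j)) z) = - N z"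
    "- dd (1, 0) (q None) z + (\<Sum>j\<in>UNIV. e j * dd (spv j) (q (Some j)) z) = - M z"
    using assms unfolding wsol_def by blast+
   then show ?thesis unfolding add(3)[OF p(2) q(2) B(1)] add(3)[OF p(2) q(2) B(2)] distrib_left sum.distrib by linarith
  qed
 qed
qed

lemma wsolI:
 assumes c: "cts \<phi>" "\<And>b. cts (p b)" "cts N" "\<And>i b. cts (p' i b)"
  and 1: "\<And>z. hasdd (1, 0) \<phi> z (p None z)" "\<And>j z. hasdd (spv j) \<phi> z (p (Some j) z)"
  and 2: "\<And>z. hasdd (1, 0) (p None) z (N z + (\<Sum>i\<in>UNIV. e i * p' i (Some i) z))" "\<And>j z. hasdd (1, 0) (p (Some j)) z (p' j None z)"
   "\<And>j b z. hasdd (spv j) (p b) z (p' j b z)" shows "wsol e \<phi> p N"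
proof -
 have cS: "cts (\<lambda>z. N z + (\<Sum>i\<in>UNIV. e i * p' i (Some i) z))" by (intro continuous_intros c)
 have N: "CB (Suc 0) (p None)" "dd (1, 0) (p None) = (\<lambda>z. N z + (\<Sum>i\<in>UNIV. e i * p' i (Some i) z))"
  using CB_SucI(1,2)[where k=0, OF c(2) 2(1) 2(3)] cS c(4) by auto
 have S: "CB (Suc 0) (p (Some j))" "dd (spv i) (p (Some j)) = p' i (Some j)" for i j
  using CB_SucI(1,3)[where k=0, OF c(2) 2(2) 2(3)] c(4) by auto
 have P: "CB (Suc (Suc 0)) \<phi>" "dd (1, 0) \<phi> = p None" "dd (spv j) \<phi> = p (Some j)" for j
  using CB_SucI[OF c(1) 1(1) 1(2) N(1) S(1)] by auto
 show ?thesis unfolding wsol_def numeral_2_eq_2 using P by (simp add: N S del: CD.simps)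
qed

lemma wsol_future:
 assumes w: "wsol e \<phi> p N" and z: "z \<in> future"
 shows "dt \<phi> z = p None z" "dx j \<phi> z = p (Some j) z" "grad \<phi> z = (p None z, \<chi> j. p (Some j) z)" "box_op e \<phi> z = - N z" "Ck_on 2 future \<phi>"
proof -
 have C: "CB (Suc (Suc 0)) \<phi>" using w by (simp only: wsol_def numeral_2_eq_2)
 have p: "dd (1, 0) \<phi> = p None" "dd (spv j) \<phi> = p (Some j)" for j using w by (auto simp: wsol_def)
 have Cp: "CB (Suc 0) (p None)" "CB (Suc 0) (p (Some j))" for j using CB_dd[OF C] by (simp_all only: p)
 have t: "dt \<phi> z = p None z" and x: "dx j \<phi> z = p (Some j) z" if "z \<in> future" for z j
  using dt_eq[OF C that] dx_eq[OF C that] by (simp_all only: p)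
 show "dt \<phi> z = p None z" "dx j \<phi> z = p (Some j) z" "grad \<phi> z = (p None z, \<chi> j. p (Some j) z)"
  by (simp_all add: t[OF z] x[OF z] grad_def)
 have "dt (dt \<phi>) z = dd (1, 0) (p None) z" using dt_cong[OF t z] dt_eq[OF Cp(1) z] by simp
 moreover have "dx j (dx j \<phi>) z = dd (spv j) (p (Some j)) z" for j using dx_cong[OF x z] dx_eq[OF Cp(2) z] by simp
 moreover have "- dd (1, 0) (p None) z + (\<Sum>j\<in>UNIV. e j * dd (spv j) (p (Some j)) z) = - N z"
  using w unfolding wsol_def by blast
 ultimately show "box_op e \<phi> z = - N z" by (simp only: box_op_def)
 show "Ck_on 2 future \<phi>" unfolding numeral_2_eq_2 by (rule CB_Ck_on[OF C])
qed

context ellip begin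

lemma LA_cont: "CX (Suc k) g ==> cts (LA e b g)"
 unfolding LA_def[abs_def] by (intro AA_cont_comp continuous_intros)

lemma Duh_cont: "CX (Suc k) N ==> cts (Duh e b N)"
 unfolding Duh_Fx[abs_def] by (intro Fx_cont jcont_AA continuous_intros)

lemma wsol_Duhamel:
 assumes N: "CX (Suc (Suc k)) N"
 shows "wsol e (\<lambda>z. Fx (TT e N) (fst z) z) (\<lambda>b. Duh e b N) N"
 by (rule wsolI[where p'="\<lambda>i b. Duh e b (sd i N)"])
   (rule Duhamel_t[OF N] Duhamel_x[OF N] Duh_cont[OF N] Duh_cont[OF CX_sd[OF N]] CX_cont[OF N]
    Fx_cont[OF jcont_TT[OF CX_cont[OF N]]] continuous_intros)+

lemma wsol_TT:
 assumes g: "CX (Suc (Suc k)) g"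
 shows "wsol e (\<lambda>z. TT e g (fst z) 0 (snd z)) (\<lambda>b. LA e b g) (\<lambda>_. 0)"
proof (rule wsolI[where p'="\<lambda>i b. LA e b (sd i g)"])
 show "hasdd (1, 0) (LA e None g) z (0 + (\<Sum>i\<in>UNIV. e i * LA e (Some i) (sd i g) z))" for z using LA_t(2)[OF g] by simp
qed (rule LA_t[OF g] LA_x[OF g] LA_cont[OF g] LA_cont[OF CX_sd[OF g]] TT_cont_comp[OF CX_cont[OF g]] continuous_intros)+

text \<open>The first derivatives of \<open>LA e None f\<close>, the solution with data f and zero
  velocity. The wave equation replaces the second time derivative, so that only the gradient of
  \<open>f\<close> occurs: the data norm bounds the gradient, not \<open>f\<close> itself.\<close>

definition LF :: "3 option => (spacetime => real) => spacetime => real" where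
 "LF b f = (case b of None => (\<lambda>z. \<Sum>j\<in>UNIV. e j * LA e (Some j) (sd j f) z) | Some j => LA e None (sd j f))"

lemma wsol_LF:
 assumes f: "CX (Suc (Suc (Suc k))) f"
 shows "wsol e (LA e None f) (\<lambda>b. LF b f) (\<lambda>_. 0)"
proof -
 note f2 = CD_Suc_lower[OF f]
 note f1 = CX_sd[OF f]
 have cLF: "cts (LF b h)" if "CX (Suc (Suc l)) h" for b h l
  unfolding LF_def by (cases b) (auto intro!: continuous_intros LA_cont[OF CX_sd[OF that]] simp del: CD.simps)
 show ?thesis
 proof (rule wsolI[where p'="\<lambda>i b. LF b (sd i f)"])
  show "cts (LA e None f)" by (rule LA_cont[OF f])
  show "cts (LF b f)" "cts (LF b (sd i f))" for i b by (rule cLF[OF f2] cLF[OF f1])+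
  show "hasdd (1, 0) (LA e None f) z (LF None f z)" "hasdd (spv j) (LA e None f) z (LF (Some j) f z)" for z j
   using LA_t(2)[OF f] LA_x(2)[OF f] by (simp_all add: LF_def)
  show "hasdd (1, 0) (LF None f) z (0 + (\<Sum>i\<in>UNIV. e i * LF (Some i) (sd i f) z))" for z
   unfolding LF_def by (simp del: CD.simps) (intro hasdd_sum hasdd_cmult LA_t(3)[OF f1])
  show "hasdd (1, 0) (LF (Some j) f) z (LF None (sd j f) z)" for z j
   unfolding LF_def using LA_t(2)[OF f1] by simp
  show "hasdd (spv j) (LF b f) z (LF b (sd j f) z)" for z j b
  proof (cases b)
   case None
   have "hasdd (spv j) (\<lambda>z. \<Sum>i\<in>UNIV. e i * LA e (Some i) (sd i f) z) z (\<Sum>i\<in>UNIV. e i * LA e (Some i) (sd j (sd i f)) z)"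
    by (intro hasdd_sum hasdd_cmult LA_x(2)[OF f1])
   moreover have "sd j (sd i f) = sd i (sd j f)" for i by (rule sd_commute[OF f2])
   ultimately show ?thesis by (simp add: None LF_def)
  next
   case (Some i)
   then show ?thesis unfolding LF_def using LA_x(2)[OF f1, where b=None and j=j and z=z] sd_commute[OF f2, of i j] by (simp del: CD.simps)
  qed
 qed (rule continuous_intros)
qed

end

section \<open>Uniqueness\<close>

definition gradvec :: "('m => spacetime => real) => 'm \<times> 3 option => spacetime => real" where
 "gradvec \<phi> c = (case snd c of None => dt (\<phi> (fst c)) | Some j => dx j (\<phi> (fst c)))"

text \<open>A relative derivative is a full directional derivative along every line contained in the
  set; in the half-space this covers the space directions even at t = 0.\<close>

lemma hasdd_within:
 assumes D: "(u has_derivative D) (at z within S)" and S: "\<And>s. z + s *R v \<in> S"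
 shows "hasdd v u z (D v)"
proof -
 interpret bounded_linear D using D by (rule has_derivative_bounded_linear)
 have 1: "((\<lambda>s. z + s *R v) has_derivative (\<lambda>s. s *R v)) (at 0)"
  by (auto intro!: derivative_eq_intros)
 have "range (\<lambda>s. z + s *R v) \<subseteq> S" using S by blast
 then have "(u has_derivative D) (at (z + 0 *R v) within range (\<lambda>s. z + s *R v))"
  using has_derivative_subset[OF D] by simp
 from has_derivative_in_compose[OF 1 this]
 have "((\<lambda>s. u (z + s *R v)) has_derivative (\<lambda>s. D (s *R v))) (at 0)" .
 then show ?thesis unfolding hasdd_def has_field_derivative_def
  by (rule has_derivative_eq_rhs) (auto simp: scaleR mult.commute)
qed

lemma future_dx:
 assumes "u differentiable_on future" "z \<in> future" shows "hasdd (spv j) u z (dx j u z)"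
proof -
 have "(u has_derivative frechet_derivative u (at z within future)) (at z within future)"
  using assms frechet_derivative_works by (auto simp: differentiable_on_def)
 from hasdd_within[OF this, of "spv j"] show ?thesis using assms(2) by (simp add: dx_def future_def mem_Times_iff)
qed

lemma future_dt:
 assumes "u differentiable_on future" "fst z > 0" shows "hasdd (1, 0) u z (dt u z)"
proof -
 have zf: "z \<in> future" using assms(2) by (simp add: future_def mem_Times_iff)
 have "open {z :: spacetime. 0 < fst z}" by (intro open_Collect_less continuous_intros)
 then have "{z :: spacetime. 0 < fst z} \<subseteq> interior future" by (intro interior_maximal) (auto simp: future_def)
 then have "at z within future = at z" using assms(2) by (intro at_within_interior) auto
 then have "(u has_derivative frechet_derivative u (at z within future)) (at z)"
  using assms(1) zf frechet_derivative_works by (metis differentiable_on_def)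
 from has_derivative_imp_hasdd[OF this, of "(1,0)"] show ?thesis by (simp add: dt_def)
qed

lemma Ck2_facts:
 assumes "Ck_on 2 future u"
 shows "u differentiable_on future" "dt u differentiable_on future" "dx j u differentiable_on future"
  "continuous_on future (dt u)" "continuous_on future (dx j u)" "continuous_on future (dt (dt u))"
  "continuous_on future (dx i (dt u))" "continuous_on future (dt (dx j u))" "continuous_on future (dx i (dx j u))"
proof -
 have 2: "Ck_on (Suc (Suc 0)) future u" using assms by (simp only: numeral_2_eq_2)
 have B: "(1, 0) \<in> (Basis :: spacetime set)" "spv j \<in> Basis" for j by (auto simp: Basis_spacetime)
 show "u differentiable_on future" using 2 by simp
 have t: "Ck_on (Suc 0) future (dt u)" and x: "Ck_on (Suc 0) future (dx j u)" for j
  using 2 B unfolding dt_def[abs_def] dx_def[abs_def] by (auto simp del: Ck_on.simps(1) simp: Ck_on.simps(2)[of "Suc 0"])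
 show "dt u differentiable_on future" "dx j u differentiable_on future" using t x by auto
 then show "continuous_on future (dt u)" "continuous_on future (dx j u)" by (auto intro: differentiable_imp_continuous_on)
 have "Ck_on 0 future (dt v)" "Ck_on 0 future (dx i v)" if "Ck_on (Suc 0) future v" for v i
  using that B unfolding dt_def[abs_def] dx_def[abs_def] by auto
 then show "continuous_on future (dt (dt u))" "continuous_on future (dx i (dt u))" "continuous_on future (dt (dx j u))" "continuous_on future (dx i (dx j u))"
  using t x by auto
qed

lemma Ck2_mixed:
 assumes "Ck_on 2 future u" "fst z > 0" shows "dt (dx j u) z = dx j (dt u) z"
proof -
 note f = Ck2_facts[OF assms(1)]
 let ?U = "{z :: spacetime. 0 < fst z}"
 have U: "open ?U" by (intro open_Collect_less continuous_intros)
 have sub: "?U \<subseteq> future" by (auto simp: future_def)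
 show ?thesis by (rule clairaut[OF U, of z "spv j" u "dx j u" "(1, 0)" "dt u"])
    (use assms(2) sub in \<open>auto intro!: future_dx future_dt f continuous_on_subset[OF f(7)] continuous_on_subset[OF f(8)]\<close>)
qed

lemma time_clamp_cont:
 assumes "continuous_on future u" shows "cts (time_clamp u)"
proof -
 have "cts (\<lambda>z :: spacetime. (max 0 (fst z), snd z))" by (intro continuous_intros)
 then show ?thesis unfolding time_clamp_def[abs_def]
  by (rule continuous_on_compose2[OF assms]) (auto simp: future_def)
qed

lemma time_clamp_eq: "t >= 0 ==> time_clamp u (t, x) = u (t, x)" by (simp add: time_clamp_def)

text \<open>No smallness or decay of \<open>u\<close> and \<open>v\<close> is assumed. In a bounded
  truncated cone both gradients are bounded, there \<open>F\<close> is Lipschitz, and Gronwall's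
  inequality for the weighted energy of the difference gives zero.\<close>

lemma uniqueness:
 fixes e :: "'m::finite => 3 => real" and F :: "'m => real^('m \<times> 3 option) => real"
 assumes e: "\<And>i j. e i j > 0" and F: "\<And>i. smooth_on UNIV (F i)"
  and C: "\<And>i. Ck_on 2 future (u i)" "\<And>i. Ck_on 2 future (v i)"
  and box: "\<And>i z. z \<in> future ==> box_op (e i) (u i) z = F i (PP (gradvec u) z)"
   "\<And>i z. z \<in> future ==> box_op (e i) (v i) z = F i (PP (gradvec v) z)"
  and init: "\<And>i x. u i (0, x) = v i (0, x)" "\<And>i x. dt (u i) (0, x) = dt (v i) (0, x)"
  and z: "z \<in> future" shows "u i z = v i z"
proof -
 note fu = Ck2_facts[OF C(1)] and fv = Ck2_facts[OF C(2)]
 \<comment> \<open>Clamping makes the differences continuous on all of spacetime, as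
   \<open>energy_ineq\<close> requires; for t >= 0 nothing is changed.\<close>
 define a where "a i = time_clamp (\<lambda>z. dt (u i) z - dt (v i) z)" for i
 define b where "b i j = time_clamp (\<lambda>z. dx j (u i) z - dx j (v i) z)" for i j
 define att where "att i = time_clamp (\<lambda>z. dt (dt (u i)) z - dt (dt (v i)) z)" for i
 define ax where "ax i j = time_clamp (\<lambda>z. dx j (dt (u i)) z - dx j (dt (v i)) z)" for i j
 define bx where "bx i j = time_clamp (\<lambda>z. dx j (dx j (u i)) z - dx j (dx j (v i)) z)" for i j
 have gc: "continuous_on future (gradvec u c)" "continuous_on future (gradvec v c)" for c
  unfolding gradvec_def using fu(4,5) fv(4,5) by (auto split: option.split)
 have cPP: "continuous_on future (PP (gradvec u))" "continuous_on future (PP (gradvec v))"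
  unfolding PP_def[abs_def] by (intro continuous_on_vec_lambda gc)+
 have cFP: "continuous_on future (\<lambda>z. F i (PP (gradvec u) z))" "continuous_on future (\<lambda>z. F i (PP (gradvec v) z))" for i
  by (rule cts_comp[OF smooth_cont[OF F]], rule cPP)+
 define n where "n i = time_clamp (\<lambda>z. F i (PP (gradvec v) z) - F i (PP (gradvec u) z))" for i
 have ct: "cts (a i)" "cts (b i j)" "cts (att i)" "cts (ax i j)"
  "cts (bx i j)" "cts (n i)" for i j unfolding a_def b_def att_def ax_def bx_def n_def
  by (intro time_clamp_cont continuous_on_diff fu fv cFP)+
 note ci = cts_comp[OF ct(1)] cts_comp[OF ct(2)]
 have fut: "(t, x) \<in> future" if "t >= 0" for t x using that by (simp add: future_def)
 have dt_line: "DERIV (\<lambda>t. time_clamp (\<lambda>z. f z - g z) (t, x)) t :> time_clamp (\<lambda>z. dt f z - dt g z) (t, x)"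
  if "f differentiable_on future" "g differentiable_on future" "t > 0" for f g t x
 proof -
  have "hasdd (1, 0) f (t, x) (dt f (t, x))" "hasdd (1, 0) g (t, x) (dt g (t, x))" using that by (auto intro: future_dt)
  then have "DERIV (\<lambda>s. f (t + s, x) - g (t + s, x)) 0 :> dt f (t, x) - dt g (t, x)"
   unfolding hasdd_def by (intro DERIV_diff) auto
  then have "DERIV (\<lambda>s. f (s, x) - g (s, x)) t :> dt f (t, x) - dt g (t, x)"
   using DERIV_shift[of "\<lambda>s. f (s, x) - g (s, x)" _ 0 t] by (simp add: add.commute)
  moreover have "\<forall>\<^sub>F s in nhds t. time_clamp (\<lambda>z. f z - g z) (s, x) = f (s, x) - g (s, x)"
   using eventually_gt_at_top eventually_nhds_in_open[of "{0<..}" t] that(3) by (auto elim!: eventually_mono simp: time_clamp_eq)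
  ultimately show ?thesis using that(3) by (subst DERIV_cong_ev[OF refl _ refl]) (auto simp: time_clamp_eq)
 qed
 have dx_line: "hasdd (spv j) (time_clamp (\<lambda>z. f z - g z)) (t, x) (time_clamp (\<lambda>z. dx j f z - dx j g z) (t, x))"
  if "f differentiable_on future" "g differentiable_on future" "t > 0" for f g t x j
 proof -
  have "hasdd (spv j) f (t, x) (dx j f (t, x))" "hasdd (spv j) g (t, x) (dx j g (t, x))" using that fut by (auto intro: future_dx)
  then show ?thesis unfolding hasdd_def using that(3) by (simp add: time_clamp_def DERIV_diff)
 qed
 define c where "c = (\<Sum>i\<in>UNIV. \<Sum>j\<in>UNIV. sqrt (e i j))"
 have ci_le: "c >= (\<Sum>j\<in>UNIV. sqrt (e i j))" for i
  unfolding c_def by (rule member_le_sum[of i UNIV "\<lambda>i. \<Sum>j\<in>UNIV. sqrt (e i j)"]) (auto intro!: sum_nonneg simp: less_imp_le e)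
 have c0: "c >= 0" unfolding c_def by (intro sum_nonneg) (simp add: less_imp_le e)
 let ?I = "\<lambda>i t \<rho>. \<integral>x. cw c \<rho> (t, x) * (2 * (a i (t, x) * n i (t, x))) \<partial>lb (\<rho> + 1)"
 have exD: "\<exists>D. DERIV (energy (e i) c \<rho> (a i) (b i)) t :> D \<and>
   D <= ?I i t \<rho>" if "t > 0" for i t \<rho>
 proof (rule energy_ineq[OF e ci_le ct(1-6) _ _ _ _ _ that])
  fix s :: real and x j assume s: "s > 0"
  have sf: "(s, x) \<in> future" using s by (simp add: future_def)
  show "DERIV (\<lambda>t. a i (t, x)) s :> att i (s, x)"
   unfolding a_def att_def by (rule dt_line[OF fu(2) fv(2) s])
  show "DERIV (\<lambda>t. b i j (t, x)) s :> ax i j (s, x)"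
   using dt_line[OF fu(3) fv(3) s, of j i j i x] s unfolding b_def ax_def
   by (simp add: time_clamp_eq Ck2_mixed[OF C(1)] Ck2_mixed[OF C(2)])
  show "hasdd (spv j) (a i) (s, x) (ax i j (s, x))" unfolding a_def ax_def by (rule dx_line[OF fu(2) fv(2) s])
  show "hasdd (spv j) (b i j) (s, x) (bx i j (s, x))" unfolding b_def bx_def by (rule dx_line[OF fu(3) fv(3) s])
  have "att i (s, x) - (\<Sum>j\<in>UNIV. e i j * bx i j (s, x)) = box_op (e i) (v i) (s, x) - box_op (e i) (u i) (s, x)"
   using s by (simp add: att_def bx_def time_clamp_eq box_op_def right_diff_distrib sum_subtractf)
  also have "... = n i (s, x)" using s by (simp add: box[OF sf] n_def time_clamp_eq)
  finally show "att i (s, x) = (\<Sum>j\<in>UNIV. e i j * bx i j (s, x)) + n i (s, x)" by simp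
 qed
 \<comment> \<open>\<open>energy_ineq\<close> provides the derivative only as an existential; it is
   fixed here to be summed over the components.\<close>
 define D where "D i t \<rho> = (SOME D. DERIV (energy (e i) c \<rho> (a i) (b i)) t :> D \<and>
   D <= ?I i t \<rho>)" for i t \<rho>
 have D: "DERIV (energy (e i) c \<rho> (a i) (b i)) t :> D i t \<rho>"
  "D i t \<rho> <= ?I i t \<rho>" if "t > 0" for i t \<rho>
  using someI_ex[OF exD[OF that, of i \<rho>]] unfolding D_def[of i t \<rho>, symmetric] by blast+
 define Q where "Q z = (\<Sum>i\<in>UNIV. (a i z)^2 + (\<Sum>j\<in>UNIV. e i j * (b i j z)^2))" for z
 define G where "G \<rho> t = (\<Sum>i\<in>UNIV. energy (e i) c \<rho> (a i) (b i) t)" for \<rho> t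
 have Qi: "0 <= (a i z)^2 + (\<Sum>j\<in>UNIV. e i j * (b i j z)^2)" for i z
  by (intro add_nonneg_nonneg sum_nonneg mult_nonneg_nonneg) (auto simp: less_imp_le e)
 have Q_int: "(LINT x|lb (\<rho> + 1). cw c \<rho> (t, x) * (\<Lambda> * Q (t, x))) = \<Lambda> * G \<rho> t" for \<rho> t \<Lambda>
 proof -
  interpret cmeas "lb (\<rho> + 1)" "cball 0 (\<rho> + 1)" by (rule cmeas_lb)
  have i: "integrable (lb (\<rho> + 1)) (\<lambda>x. cw c \<rho> (t, x) * ((a i (t, x))^2 + (\<Sum>j\<in>UNIV. e i j * (b i j (t, x))^2)))" for i
   by (intro integrable_cont continuous_intros ci)
  have "(LINT x|lb (\<rho> + 1). cw c \<rho> (t, x) * (\<Lambda> * Q (t, x))) =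
   (LINT x|lb (\<rho> + 1). \<Lambda> * (\<Sum>i\<in>UNIV. cw c \<rho> (t, x) * ((a i (t, x))^2 + (\<Sum>j\<in>UNIV. e i j * (b i j (t, x))^2))))"
   unfolding Q_def by (intro Bochner_Integration.integral_cong refl) (simp add: sum_distrib_left mult_ac)
  also have "... = \<Lambda> * G \<rho> t"
   unfolding integral_mult_right_zero G_def energy_def by (subst Bochner_Integration.integral_sum[OF i]) simp
  finally show ?thesis .
 qed
 have ab0: "a i (0, y) = 0" "b i j (0, y) = 0" for i j y
 proof -
  have "hasdd (spv j) (u i) (0, y) (dx j (u i) (0, y))" "hasdd (spv j) (v i) (0, y) (dx j (v i) (0, y))"
   by (auto intro!: future_dx fu fv fut)
  then have "dx j (u i) (0, y) = dx j (v i) (0, y)" unfolding hasdd_def by (simp add: init DERIV_unique)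
  then show "a i (0, y) = 0" "b i j (0, y) = 0" by (simp_all add: a_def b_def time_clamp_eq init)
 qed
 have zero: "a i (T, x) = 0 \<and> b i j (T, x) = 0" if T: "T >= 0" for i j T x
 proof -
  \<comment> \<open>With this size of the cone the weight \<open>cm\<close> at the point (T, x)
    equals 1.\<close>
  define \<rho> where "\<rho> = c * T + sqrt (1 + x \<bullet> x) + 1"
  let ?K = "{0..T} \<times> cball (0::real^3) (\<rho> + 1)"
  have Ksub: "?K \<subseteq> future" by (auto simp: future_def)
  have bd: "\<exists>R. \<forall>z\<in>?K. norm (PP (gradvec w) z) <= R" if "continuous_on future (PP (gradvec w))" for w :: "'m => spacetime => real"
   using compact_imp_bounded[OF compact_continuous_image[OF continuous_on_subset[OF that Ksub] compact_Times]] by (auto simp: bounded_iff)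
  from bd[OF cPP(1)] bd[OF cPP(2)] obtain R1 R2 where R: "\<forall>z\<in>?K. norm (PP (gradvec u) z) <= R1" "\<forall>z\<in>?K. norm (PP (gradvec v) z) <= R2" by blast
  let ?R = "max R1 R2"
  have "\<forall>p :: 'm \<times> ('m \<times> 3 option). \<exists>B\<ge>0. \<forall>P. norm P <= ?R --> abs (pdv (snd p) (F (fst p)) P) <= B"
   by (intro allI smooth_bounded smooth_pdv F)
  then obtain B where B: "\<And>p. B p >= 0" "\<And>p P. norm P <= ?R ==> abs (pdv (snd p) (F (fst p)) P) <= B p" by metis
  define B' where "B' = (\<Sum>p\<in>UNIV. B p)"
  have B': "abs (pdv d (F i) P) <= B'" if "norm P <= ?R" for i d P
  proof -
   have "abs (pdv d (F i) P) <= B (i, d)" using B(2)[OF that, of "(i, d)"] by simp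
   also have "... <= B'" unfolding B'_def using B(1) by (intro member_le_sum) auto
   finally show ?thesis .
  qed
  define k where "k = real CARD('m \<times> 3 option)"
  define \<kappa> where "\<kappa> = 1 + (\<Sum>i\<in>UNIV. \<Sum>j\<in>UNIV. 1 / e i j)"
  have \<kappa>: "\<kappa> >= 1" "1 <= \<kappa> * e i j" for i j
  proof -
   have nn: "0 <= (\<Sum>j\<in>UNIV. 1 / e i j)" for i by (intro sum_nonneg) (simp add: less_imp_le e)
   then show "\<kappa> >= 1" unfolding \<kappa>_def by (simp add: sum_nonneg)
   have "1 / e i j <= (\<Sum>j\<in>UNIV. 1 / e i j)" by (rule member_le_sum) (auto simp: less_imp_le e)
   also have "... <= (\<Sum>i\<in>UNIV. \<Sum>j\<in>UNIV. 1 / e i j)" by (rule member_le_sum) (auto simp: nn)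
   finally show "1 <= \<kappa> * e i j" using e[of i j] unfolding \<kappa>_def by (simp add: field_simps)
  qed
  \<comment> \<open>The Gronwall rate of one component: 1 from the square of \<open>a i\<close>, the
    rest from the square of \<open>n i\<close> by Cauchy-Schwarz over the \<open>k\<close> slots,
    with \<kappa> removing the weights \<open>e i j\<close>.\<close>
  define \<Lambda> where "\<Lambda> = 1 + B'^2 * k * \<kappa>"
  have pw: "2 * (a i (t, y) * n i (t, y)) <= \<Lambda> * Q (t, y)" if ty: "(t, y) \<in> ?K" for i t y
  proof -
   have t: "t >= 0" using ty by auto
   let ?P = "PP (gradvec u) (t, y)" and ?Q = "PP (gradvec v) (t, y)"
   have sq: "(\<Sum>d\<in>UNIV. (?P $ d - ?Q $ d)^2) <= \<kappa> * Q (t, y)"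
   proof -
    have "(\<Sum>d\<in>UNIV. (?P $ d - ?Q $ d)^2) = (\<Sum>i\<in>UNIV. \<Sum>w\<in>UNIV. (?P $ (i, w) - ?Q $ (i, w))^2)"
     by (simp add: sum.cartesian_product case_prod_unfold)
    also have "... = (\<Sum>i\<in>UNIV. (a i (t, y))^2 + (\<Sum>j\<in>UNIV. (b i j (t, y))^2))"
     using t by (simp add: UNIV_option_conv sum.insert sum.reindex PP_def gradvec_def a_def b_def time_clamp_eq)
    also have "... <= (\<Sum>i\<in>UNIV. \<kappa> * ((a i (t, y))^2 + (\<Sum>j\<in>UNIV. e i j * (b i j (t, y))^2)))"
    proof (rule sum_mono)
     fix i
     have "1 * (a i (t, y))^2 <= \<kappa> * (a i (t, y))^2" using \<kappa> by (intro mult_right_mono) auto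
     moreover have "(\<Sum>j\<in>UNIV. 1 * (b i j (t, y))^2) <= (\<Sum>j\<in>UNIV. \<kappa> * e i j * (b i j (t, y))^2)"
      using \<kappa>(2) by (intro sum_mono mult_right_mono) auto
     ultimately show "(a i (t, y))^2 + (\<Sum>j\<in>UNIV. (b i j (t, y))^2) <= \<kappa> * ((a i (t, y))^2 + (\<Sum>j\<in>UNIV. e i j * (b i j (t, y))^2))"
      by (simp add: distrib_left sum_distrib_left mult.assoc)
    qed
    finally show ?thesis by (simp add: Q_def sum_distrib_left)
   qed
   have "abs (n i (t, y)) = abs (F i ?Q - F i ?P)" using t by (simp add: n_def time_clamp_eq)
   also have "... <= B' * (\<Sum>d\<in>UNIV. abs (?Q $ d - ?P $ d))"
   proof (rule smooth_Lipschitz[OF F convex_cball])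
    show "abs (pdv d (F i) P) <= B'" if "P \<in> cball 0 ?R" for d P by (rule B') (use that in simp)
    show "?Q \<in> cball 0 ?R" "?P \<in> cball 0 ?R" by (simp_all add: R[THEN bspec, OF ty] le_max_iff_disj)
   qed
   finally have "\<bar>n i (t, y)\<bar>\<^sup>2 <= (B' * (\<Sum>d\<in>UNIV. abs (?Q $ d - ?P $ d)))^2" by (rule power_mono) simp
   then have "(n i (t, y))^2 <= (B' * (\<Sum>d\<in>UNIV. abs (?Q $ d - ?P $ d)))^2" by simp
   also have "... <= B'^2 * (k * (\<Sum>d\<in>UNIV. (?P $ d - ?Q $ d)^2))"
   proof -
    have "(\<Sum>d\<in>UNIV. abs (?Q $ d - ?P $ d))^2 <= (\<Sum>d\<in>UNIV. \<bar>?Q $ d - ?P $ d\<bar>\<^sup>2) * k"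
     unfolding k_def by (rule sum_squared_le_sum_of_squares)
    then have "(\<Sum>d\<in>UNIV. abs (?Q $ d - ?P $ d))^2 <= k * (\<Sum>d\<in>UNIV. (?P $ d - ?Q $ d)^2)"
     by (simp add: power2_commute mult.commute)
    then show ?thesis unfolding power_mult_distrib by (intro mult_left_mono) auto
   qed
   also have "... <= B'^2 * (k * (\<kappa> * Q (t, y)))" by (intro mult_left_mono sq) (auto simp: k_def)
   finally have n2: "(n i (t, y))^2 <= B'^2 * k * \<kappa> * Q (t, y)" by (simp add: mult.assoc)
   have "(a i (t, y))^2 <= (a i (t, y))^2 + (\<Sum>j\<in>UNIV. e i j * (b i j (t, y))^2)"
    by (simp add: sum_nonneg less_imp_le e)
   also have "... <= Q (t, y)" unfolding Q_def using Qi by (intro member_le_sum) auto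
   finally have "(a i (t, y))^2 + (n i (t, y))^2 <= \<Lambda> * Q (t, y)" using n2 by (simp add: \<Lambda>_def algebra_simps)
   then show ?thesis using sum_squares_bound[of "a i (t, y)" "n i (t, y)"] by (simp add: mult.assoc)
  qed
  have cQ: "cts (\<lambda>y. Q (t, y))" for t unfolding Q_def by (intro continuous_intros ci)
  have Di: "D i t \<rho> <= \<Lambda> * G \<rho> t" if t: "0 < t" "t < T" for i t
  proof -
   interpret cmeas "lb (\<rho> + 1)" "cball 0 (\<rho> + 1)" by (rule cmeas_lb)
   have "?I i t \<rho> <= (LINT x|lb (\<rho> + 1). cw c \<rho> (t, x) * (\<Lambda> * Q (t, x)))"
   proof (rule integral_mono_AE)
    show "integrable (lb (\<rho> + 1)) (\<lambda>x. cw c \<rho> (t, x) * (2 * (a i (t, x) * n i (t, x))))"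
     "integrable (lb (\<rho> + 1)) (\<lambda>x. cw c \<rho> (t, x) * (\<Lambda> * Q (t, x)))"
     by (intro integrable_cont continuous_intros ci cQ cts_comp[OF ct(6)])+
    show "AE x in lb (\<rho> + 1). cw c \<rho> (t, x) * (2 * (a i (t, x) * n i (t, x))) <= cw c \<rho> (t, x) * (\<Lambda> * Q (t, x))"
     by (rule eventually_mono[OF AE_K]) (use t pw cw_nonneg in \<open>auto intro!: mult_left_mono\<close>)
   qed
   then show ?thesis using D(2)[OF t(1), of i \<rho>] unfolding Q_int by linarith
  qed
  let ?\<Lambda> = "real CARD('m) * \<Lambda>"
  have cG: "cts (G \<rho>)" unfolding G_def[abs_def] by (intro continuous_intros energy_cont ct)
  have Ge0: "0 <= energy (e i) c \<rho> (a i) (b i) t" for i t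
   unfolding energy_def by (rule Bochner_Integration.integral_nonneg) (intro mult_nonneg_nonneg cw_nonneg Qi)
  have "G \<rho> T <= 0"
  proof -
   \<comment> \<open>Gronwall with an integrating factor; the energy vanishes at t = 0 because the
     data agree.\<close>
   let ?H = "\<lambda>t. exp (- ?\<Lambda> * t) * G \<rho> t"
   have "?H T <= ?H 0"
   proof (rule DERIV_nonpos_imp_decreasing_open[OF T])
    fix t assume t: "0 < t" "t < T"
    have "DERIV (G \<rho>) t :> (\<Sum>i\<in>UNIV. D i t \<rho>)"
     unfolding G_def[abs_def] by (intro DERIV_sum D(1) t)
    moreover have "DERIV (\<lambda>t. exp (- ?\<Lambda> * t)) t :> exp (- ?\<Lambda> * t) * - ?\<Lambda>"
     by (rule DERIV_fun_exp[OF DERIV_cmult_Id])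
    ultimately have "DERIV (?H) t :> exp (- ?\<Lambda> * t) * - ?\<Lambda> * G \<rho> t + (\<Sum>i\<in>UNIV. D i t \<rho>) * exp (- ?\<Lambda> * t)"
     by (intro DERIV_mult)
    moreover have "exp (- ?\<Lambda> * t) * - ?\<Lambda> * G \<rho> t + (\<Sum>i\<in>UNIV. D i t \<rho>) * exp (- ?\<Lambda> * t) <= 0"
    proof -
     have "(\<Sum>i\<in>UNIV. D i t \<rho>) <= (\<Sum>i\<in>(UNIV::'m set). \<Lambda> * G \<rho> t)" by (intro sum_mono Di t)
     then have "exp (- ?\<Lambda> * t) * ((\<Sum>i\<in>UNIV. D i t \<rho>) - ?\<Lambda> * G \<rho> t) <= 0" by (intro mult_nonneg_nonpos) (auto simp: mult.assoc)
     then show ?thesis by (simp add: algebra_simps)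
    qed
    ultimately show "\<exists>y. DERIV (?H) t :> y \<and> y <= 0" by blast
   next
    show "continuous_on {0..T} ?H" by (intro continuous_intros continuous_on_subset[OF cG]) auto
   qed
   then show ?thesis by (simp add: mult_le_0_iff G_def energy_def ab0)
  qed
  then have "(\<Sum>i\<in>UNIV. energy (e i) c \<rho> (a i) (b i) T) = 0"
   using sum_nonneg[of UNIV "\<lambda>i. energy (e i) c \<rho> (a i) (b i) T"] Ge0 by (auto simp: G_def)
  then have E0: "energy (e i) c \<rho> (a i) (b i) T = 0" using sum_nonneg_eq_0_iff[of UNIV "\<lambda>i. energy (e i) c \<rho> (a i) (b i) T"] Ge0 by auto
  let ?f = "\<lambda>z. cw c \<rho> z * ((a i z)^2 + (\<Sum>j\<in>UNIV. e i j * (b i j z)^2))"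
  have f0: "?f z >= 0" for z by (intro mult_nonneg_nonneg cw_nonneg Qi)
  have "n2 (\<lambda>z. sqrt (?f z)) T = 0"
   using energy_nn[where e="e i" and a="a i" and b="b i" and \<rho>=\<rho>, OF e c0 T ct(1) ct(2)] E0 unfolding n2_def real_sqrt_pow2[OF f0] by simp
  then have "sqrt (?f (T, x)) = 0" by (rule n2_eq_0[rotated]) (intro continuous_intros ct)
  moreover have "cw c \<rho> (T, x) > 0" by (simp add: cw_def cm_def \<rho>_def)
  ultimately have "(a i (T, x))^2 + (\<Sum>j\<in>UNIV. e i j * (b i j (T, x))^2) = 0" by simp
  moreover have "0 <= (\<Sum>j\<in>UNIV. e i j * (b i j (T, x))^2)" by (intro sum_nonneg mult_nonneg_nonneg) (auto simp: less_imp_le e)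
  ultimately have "(a i (T, x))^2 = 0" "(\<Sum>j\<in>UNIV. e i j * (b i j (T, x))^2) = 0"
   using zero_le_power2[of "a i (T, x)"] by linarith+
  moreover from this(2) have "e i j * (b i j (T, x))^2 = 0"
   by (subst (asm) sum_nonneg_eq_0_iff) (auto simp: less_imp_le e)
  ultimately show ?thesis using e[of i j] by auto
 qed
 obtain t x where tx: "z = (t, x)" "t >= 0" using z by (cases z) (auto simp: future_def)
 show "u i z = v i z"
 proof (cases "t = 0")
  case True then show ?thesis using tx init by simp
 next
  case False
  \<comment> \<open>The gradients agree; integrating the time derivative from the common data gives
    equality of the functions.\<close>
  let ?h = "\<lambda>s. time_clamp (\<lambda>z. u i z - v i z) (s, x)"
  have "?h t = ?h 0"
  proof (rule DERIV_isconst2[of 0 t ?h t])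
   show "continuous_on {0..t} ?h"
    by (rule cts_comp[OF time_clamp_cont[OF continuous_on_diff[OF differentiable_imp_continuous_on[OF fu(1)] differentiable_imp_continuous_on[OF fv(1)]]]])
     (intro continuous_intros)
   show "DERIV (?h) s :> 0" if "0 < s" "s < t" for s
    using dt_line[OF fu(1)[of i] fv(1)[of i] that(1), of x] zero[of s i x] that(1) by (simp add: a_def)
  qed (use tx False in auto)
  then show ?thesis using tx init by (simp add: time_clamp_eq)
 qed
qed

section \<open>Scattering\<close>

lemma good_sourceD:
 assumes "good_source K B N" "s >= 0" "length w <= K"
 shows "n2 (Dx w N) s <= ennreal (B^2 / (1 + s)^3)" using assms unfolding good_source_def by blast

lemma kap_tail:
 assumes a: "a >= 0" and T: "T >= 0"
 shows "(LINT \<theta>|lam. T * kap (a + T * \<theta>)) <= 4 * (1 + a) powr (-1/4)"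
 using kap_FTC[of a T] a T by simp

text \<open>Local form of the differentiation step in \<open>CX_limit\<close>: the integrals up to
  \<open>n\<close> converge uniformly on slabs of bounded time only, so uniformity is asked on a set
  containing a short segment through \<open>z\<close>.\<close>

lemma hasdd_limit:
 assumes d: "\<And>n y. hasdd v (u n) y (u' n y)" and S: "\<And>s. abs s < 1 ==> z + s *R v \<in> S"
  and u': "uniform_limit S u' g' sequentially" and l: "\<And>y. y \<in> S ==> (\<lambda>n. u n y) \<longlonglongrightarrow> g y"
 shows "hasdd v g z (g' z)"
proof -
 let ?p = "\<lambda>s. z + s *R v" and ?I = "{-1<..<1::real}"
 have I: "?p s \<in> S" if "s \<in> ?I" for s using S[of s] that by auto
 have "\<exists>h. \<forall>s\<in>?I. (\<lambda>n. u n (?p s)) \<longlonglongrightarrow> h s \<and> (h has_derivative (\<lambda>h. h * g' (?p s))) (at s within ?I)"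
 proof (rule has_derivative_sequence[where f'="\<lambda>n s h. h * u' n (?p s)" and ?x0.0=0])
  show "((\<lambda>s. u n (?p s)) has_derivative (\<lambda>h. h * u' n (?p s))) (at s within ?I)" for n s
   using has_derivative_at_withinI[OF hasdd_line[OF d[of n "?p s"], unfolded has_field_derivative_def]]
   by (rule has_derivative_eq_rhs) (simp add: fun_eq_iff)
  show "(\<lambda>n. u n (?p 0)) \<longlonglongrightarrow> g (?p 0)" by (intro l I) simp
  fix \<epsilon> :: real assume "\<epsilon> > 0"
  then have "\<forall>\<^sub>F n in sequentially. \<forall>y\<in>S. dist (u' n y) (g' y) < \<epsilon>" by (rule uniform_limitD[OF u'])
  then show "\<forall>\<^sub>F n in sequentially. \<forall>s\<in>?I. \<forall>h. norm (h * u' n (?p s) - h * g' (?p s)) <= \<epsilon> * norm h"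
  proof (rule eventually_mono, intro ballI allI)
   fix n s and h :: real assume "\<forall>y\<in>S. dist (u' n y) (g' y) < \<epsilon>" "s \<in> ?I"
   then have "abs (u' n (?p s) - g' (?p s)) <= \<epsilon>" unfolding dist_real_def using I less_imp_le by blast
   then show "norm (h * u' n (?p s) - h * g' (?p s)) <= \<epsilon> * norm h"
    unfolding right_diff_distrib[symmetric] real_norm_def abs_mult mult.commute[of "abs h"] by (rule mult_right_mono) simp
  qed
 qed auto
 then obtain h where h: "\<And>s. s \<in> ?I ==> (\<lambda>n. u n (?p s)) \<longlonglongrightarrow> h s" "\<And>s. s \<in> ?I ==> (h has_derivative (\<lambda>h. h * g' (?p s))) (at s within ?I)" by blast
 have eq: "g (?p s) = h s" if "s \<in> ?I" for s using LIMSEQ_unique[OF l[OF I[OF that]] h(1)[OF that]] .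
 have "(h has_derivative (\<lambda>h. h * g' (?p 0))) (at 0 within ?I)" by (rule h(2)) simp
 then have "((\<lambda>s. g (?p s)) has_derivative (\<lambda>h. h * g' (?p 0))) (at 0 within ?I)"
  by (rule has_derivative_transform[rotated 2]) (simp_all add: eq)
 then have "((\<lambda>s. g (?p s)) has_derivative (\<lambda>h. h * g' (?p 0))) (at 0)" by (subst (asm) at_within_open) auto
 then show ?thesis unfolding hasdd_def has_field_derivative_def
  by (rule has_derivative_eq_rhs) (simp add: fun_eq_iff zero_prod_def[symmetric])
qed

section \<open>The Duhamel integral over infinite time\<close>

definition kdecay :: "(real => real => real^3 => real) => bool" where
 "kdecay A \<longleftrightarrow> jcont A \<and> (\<exists>K\<ge>0. \<forall>r s x. s >= 0 --> abs (A r s x) <= K / ((1 + abs r) * (1 + s)))"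

text \<open>Integral over all source times, written as a series of steps of length 1 in the upper
  limit so that the Weierstrass test applies.\<close>

definition Winf :: "(real => real => real^3 => real) => spacetime => real" where
 "Winf A z = (\<Sum>i. Fx A (real (Suc i)) z - Fx A (real i) z)"

abbreviation slab :: "real => spacetime set" where
 "slab R \<equiv> {z. abs (fst z) <= R}"

lemma Winf_limit:
 assumes A: "kdecay A" shows "uniform_limit (slab R) (\<lambda>n. Fx A (real n)) (Winf A) sequentially"
proof -
 from A obtain K where jA: "jcont A" and K: "K >= 0" "\<forall>r s x. s >= 0 --> abs (A r s x) <= K / ((1 + abs r) * (1 + s))"
  unfolding kdecay_def by (elim exE conjE)
 have b: "norm (Fx A (real (Suc n)) z - Fx A (real n) z) <= K * (1 + R) * (1 / (real (Suc n))^2)" if z: "z \<in> slab R" for n z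
 proof -
  have R: "R >= 0" using z by auto
  obtain H where H: "\<And>T. Fx A T z = H T - H 0" "\<And>a T. (LINT \<theta>|lam. T * A (fst z - (a + T * \<theta>)) (a + T * \<theta>) (snd z)) = H (a + T) - H a"
   by (rule Fx_antiderivative[OF jA, of z]) blast
  have "Fx A (real (Suc n)) z - Fx A (real n) z = (LINT \<theta>|lam. A (fst z - (real n + \<theta>)) (real n + \<theta>) (snd z))"
   using H(2)[of 1 "real n"] by (simp add: H(1) add.commute)
  also have "abs ... <= K * (1 + R) * (1 / (real (Suc n))^2) * measure lam UNIV"
  proof (rule lam.integral_bound)
   show "cts (\<lambda>\<theta>. A (fst z - (real n + \<theta>)) (real n + \<theta>) (snd z))"
    by (intro jcont_comp[OF jA] continuous_intros)
   fix \<theta> :: real assume th: "\<theta> \<in> {0..1}"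
   let ?q = "fst z - (real n + \<theta>)"
   \<comment> \<open>On the slab the elapsed time is at least about \<open>n\<close>, up to the
     factor \<open>1 + R\<close>; with the decay in the source time the n-th step is of order
     \<open>1 / (n + 1)^2\<close>.\<close>
   have q: "real (Suc n) <= (1 + R) * (1 + abs ?q)"
   proof -
    have "real (Suc n) <= 1 + R + abs ?q" using z th by auto
    also have "... <= (1 + R) * (1 + abs ?q)" using R by (simp add: algebra_simps)
    finally show ?thesis .
   qed
   have "abs (A ?q (real n + \<theta>) (snd z)) <= K / ((1 + abs ?q) * (1 + (real n + \<theta>)))" using K(2) th by auto
   also have "... <= K / (real (Suc n) / (1 + R) * real (Suc n))"
   proof (intro divide_left_mono mult_mono K(1))
    show "real (Suc n) / (1 + R) <= 1 + abs ?q" using q R by (simp add: pos_divide_le_eq mult.commute)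
   qed (use th R in \<open>auto intro!: mult_pos_pos divide_pos_pos\<close>)
   also have "... = K * (1 + R) * (1 / (real (Suc n))^2)" by (simp add: power2_eq_square)
   finally show "abs (A ?q (real n + \<theta>) (snd z)) <= K * (1 + R) * (1 / (real (Suc n))^2)" .
  qed
  finally show ?thesis by simp
 qed
 have s: "summable (\<lambda>n. K * (1 + R) * (1 / (real (Suc n))^2))"
  using inverse_power_summable[of 2, where ?'a=real] by (intro summable_mult) (subst summable_Suc_iff, simp add: inverse_eq_divide)
 have "uniform_limit (slab R) (\<lambda>n z. \<Sum>i<n. Fx A (real (Suc i)) z - Fx A (real i) z) (\<lambda>z. \<Sum>i. Fx A (real (Suc i)) z - Fx A (real i) z) sequentially"
  by (rule Weierstrass_m_test[OF b s])
 moreover have "(\<Sum>i<n. Fx A (real (Suc i)) z - Fx A (real i) z) = Fx A (real n) z" for n z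
  using sum_lessThan_telescope[of "\<lambda>i. Fx A (real i) z" n] by (simp add: Fx_def)
 ultimately show ?thesis by (simp only: Winf_def[abs_def])
qed

lemma Winf_tendsto: "kdecay A ==> (\<lambda>n. Fx A (real n) z) \<longlonglongrightarrow> Winf A z"
 by (rule tendsto_uniform_limitI[OF Winf_limit[of A "abs (fst z)"]]) auto

lemma kdecayD: "kdecay A ==> jcont A" by (simp add: kdecay_def)

lemma Winf_cont:
 assumes A: "kdecay A" shows "cts (Winf A)"
proof -
 have "isCont (Winf A) z" for z
 proof -
  let ?S = "{y :: spacetime. abs (fst y) < abs (fst z) + 1}"
  have op: "open ?S" by (intro open_Collect_less continuous_intros)
  have "continuous_on (slab (abs (fst z) + 1)) (Winf A)"
   by (rule uniform_limit_theorem[OF _ Winf_limit[OF A]])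
     (auto intro!: always_eventually continuous_on_subset[OF Fx_cont[OF kdecayD[OF A]]] continuous_intros)
  then have "continuous_on ?S (Winf A)" by (rule continuous_on_subset) auto
  then show ?thesis by (rule continuous_on_eq_continuous_at[OF op, THEN iffD1, rule_format]) simp
 qed
 then show ?thesis by (simp add: continuous_on_eq_continuous_at)
qed

lemma Winf_hasdd:
 assumes A: "kdecay A" and A': "kdecay A'" and d: "\<And>n z. hasdd v (Fx A (real n)) z (Fx A' (real n) z)"
 shows "hasdd v (Winf A) z (Winf A' z)"
proof (rule hasdd_limit[where S="slab (abs (fst z) + abs (fst v))", OF d _ Winf_limit[OF A'] Winf_tendsto[OF A]])
 fix s :: real assume "abs s < 1"
 then have "abs s * abs (fst v) <= 1 * abs (fst v)" by (intro mult_right_mono) auto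
 then have "abs (fst z + s * fst v) <= abs (fst z) + abs (fst v)" using abs_triangle_ineq[of "fst z" "s * fst v"] by (simp add: abs_mult)
 then show "z + s *R v \<in> slab (abs (fst z) + abs (fst v))" by simp
qed

context ellip begin

lemma kdecay_sum:
 assumes "\<And>j. kdecay (A j)"
 shows "kdecay (\<lambda>r s x. \<Sum>j\<in>(UNIV::3 set). c j * A j r s x)"
proof -
 have "\<exists>K. K >= 0 \<and> (\<forall>r s x. s >= 0 --> abs (A j r s x) <= K / ((1 + abs r) * (1 + s)))" for j
  using assms[of j] unfolding kdecay_def by blast
 then obtain K where K: "\<And>j. K j >= 0" "\<And>j r s x. s >= 0 ==> abs (A j r s x) <= K j / ((1 + abs r) * (1 + s))" by metis
 have "abs (\<Sum>j\<in>(UNIV::3 set). c j * A j r s x) <= (\<Sum>j\<in>UNIV. abs (c j) * K j) / ((1 + abs r) * (1 + s))" if "s >= 0" for r s x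
 proof -
  have "abs (\<Sum>j\<in>(UNIV::3 set). c j * A j r s x) <= (\<Sum>j\<in>UNIV. abs (c j) * (K j / ((1 + abs r) * (1 + s))))"
   unfolding abs_mult[symmetric] by (rule order_trans[OF sum_abs]) (unfold abs_mult, intro sum_mono mult_left_mono K that abs_ge_zero)
  then show ?thesis by (simp add: sum_divide_distrib)
 qed
 moreover have "0 <= (\<Sum>j\<in>UNIV. abs (c j) * K j)" using K by (intro sum_nonneg) auto
 moreover have "jcont (\<lambda>r s x. \<Sum>j\<in>(UNIV::3 set). c j * A j r s x)" by (rule jcont_sum) (rule kdecayD[OF assms])
 ultimately show ?thesis unfolding kdecay_def by blast
qed

lemma Winf_sum:
 assumes "\<And>j. kdecay (A j)"
 shows "Winf (\<lambda>r s x. \<Sum>j\<in>(UNIV::3 set). c j * A j r s x) z = (\<Sum>j\<in>UNIV. c j * Winf (A j) z)"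
proof (rule LIMSEQ_unique[OF Winf_tendsto[OF kdecay_sum[OF assms]]])
 show "(\<lambda>n. Fx (\<lambda>r s x. \<Sum>j\<in>UNIV. c j * A j r s x) (real n) z) \<longlonglongrightarrow> (\<Sum>j\<in>UNIV. c j * Winf (A j) z)"
  unfolding Fx_sum[where A=A, OF kdecayD[OF assms]] by (intro tendsto_intros Winf_tendsto assms)
qed

lemma kdecay_source:
 assumes N: "good_source (k + 4) B N" and B: "B >= 0" and w: "length w <= k"
 shows "kdecay (TT e (Dx w N))" "kdecay (AA e b (Dx w N))"
proof -
 obtain C where C: "C >= 0" and Cb: "\<forall>N s M. L1bd 4 M s N -->
  (\<forall>r x. abs (TT e N r s x) <= C * M / (1 + abs r) \<and> (\<forall>b. abs (AA e b N r s x) <= C * M / (1 + abs r)))"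
  using AA_TT_sup by (elim exE conjE)
 have cN: "CX (k + 4) N" using N by (simp add: good_source_def del: CD.simps)
 have cx: "CX (Suc (Suc (Suc (Suc 0)))) (Dx w N)" by (rule CX_Dx'[OF cN]) (use w in simp)
 have bd: "abs (TT e (Dx w N) r s x) <= C * (B / (1 + s)) / (1 + abs r) \<and> (\<forall>b. abs (AA e b (Dx w N) r s x) <= C * (B / (1 + s)) / (1 + abs r))" if s: "s >= 0" for r s x
 proof -
  have "n1 (Dx v (Dx w N)) s <= ennreal (B / (1 + s))" if "length v <= 4" for v
   unfolding Dx_append[symmetric] using N s w that by (auto simp: good_source_def)
  then show ?thesis using Cb[rule_format, of "Dx w N" "B / (1 + s)" s r x] cx B s by (auto simp: eval_nat_numeral simp del: CD.simps)
 qed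
 have eq: "C * (B / (1 + s)) / (1 + abs r) = C * B / ((1 + abs r) * (1 + s))" for r s :: real by (simp add: mult.commute)
 have CB: "C * B >= 0" using C B by simp
 show "kdecay (TT e (Dx w N))" unfolding kdecay_def
  by (intro conjI jcont_TT[OF CX_cont[OF cx]] exI[of _ "C * B"] CB allI impI) (use bd[unfolded eq] in blast)
 show "kdecay (AA e b (Dx w N))" unfolding kdecay_def
  by (intro conjI jcont_AA[OF cx] exI[of _ "C * B"] CB allI impI) (use bd[unfolded eq] in blast)
qed

text \<open>The upper limit does not depend on t, so differentiating produces no boundary term and
  the homogeneous equation results.\<close>

lemma wsol_Winf:
 assumes N: "good_source 7 B N" and B: "B >= 0"
 shows "wsol e (Winf (TT e N)) (\<lambda>b. Winf (AA e b N)) (\<lambda>_. 0)"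
proof -
 have N': "good_source (3 + 4) B N" using N by simp
 have c: "CX (Suc (Suc 5)) N" using N by (simp add: good_source_def del: CD.simps)
 have kT: "kdecay (TT e N)" and kA: "kdecay (AA e b N)" and kS: "kdecay (AA e b (sd j N))" for b j
  using kdecay_source[OF N' B, of "[]"] kdecay_source[OF N' B, of "[j]"] by (simp_all add: Dx_Cons)
 show ?thesis
 proof (rule wsolI[where p'="\<lambda>i b. Winf (AA e b (sd i N))"])
  show "hasdd (1, 0) (Winf (AA e None N)) z (0 + (\<Sum>i\<in>UNIV. e i * Winf (AA e (Some i) (sd i N)) z))" for z
  proof -
   have kS': "kdecay (AA e (Some i) (sd i N))" for i by (rule kS)
   have "hasdd (1, 0) (Winf (AA e None N)) z (Winf (\<lambda>r s x. \<Sum>i\<in>UNIV. e i * AA e (Some i) (sd i N) r s x) z)"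
    by (rule Winf_hasdd[OF kA kdecay_sum[OF kS']])
      (use wave_kernel_t(2)[OF c] Fx_sum[where A="\<lambda>i. AA e (Some i) (sd i N)", OF kdecayD[OF kS']] in simp)
   then show ?thesis by (simp add: Winf_sum[where A="\<lambda>i. AA e (Some i) (sd i N)", OF kS'])
  qed
 qed (rule Winf_cont kT kA kS Winf_hasdd[OF kT kA] Winf_hasdd[OF kA kS] wave_kernel_t[OF c] continuous_on_const)+
qed

text \<open>The difference is the integral over source times beyond t. The elapsed time is negative
  there, but \<open>AA_L2\<close> does not see its sign, and the tail of \<open>kap\<close> decays.
  This is shown for finite upper limits, then Fatou.\<close>

lemma Duhamel_tail:
 assumes N: "good_source 7 B N" and B: "B >= 0" and t: "t >= 0"
 shows "n2 (\<lambda>z. Winf (AA e b N) z - Duh e b N z) t <= ennreal (ce * B^2 * (4 * (1 + t) powr (-1/4))^2)"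
proof -
 have N': "good_source (3 + 4) B N" using N by simp
 have c: "CX (Suc (Suc 5)) N" using N by (simp add: good_source_def del: CD.simps)
 note c1 = CD_Suc_lower[OF c]
 have kA: "kdecay (AA e b N)" using kdecay_source(2)[OF N' B, of "[]"] by simp
 note jA = kdecayD[OF kA]
 show ?thesis
 proof (rule n2_Fatou[where u="\<lambda>n z. Fx (AA e b N) (real n) z - Duh e b N z"])
  show "cts (\<lambda>z. Fx (AA e b N) (real n) z - Duh e b N z)" for n
   by (intro continuous_intros Fx_cont[OF jA] Duh_cont[OF c])
  show "(\<lambda>n. Fx (AA e b N) (real n) (t, x) - Duh e b N (t, x)) \<longlonglongrightarrow> Winf (AA e b N) (t, x) - Duh e b N (t, x)" for x
   by (intro tendsto_intros Winf_tendsto[OF kA])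
  obtain n0 where n0: "t < real n0" using reals_Archimedean2 by blast
  show "\<forall>\<^sub>F n in sequentially. n2 (\<lambda>z. Fx (AA e b N) (real n) z - Duh e b N z) t <= ennreal (ce * B^2 * (4 * (1 + t) powr (-1/4))^2)"
  proof (rule eventually_sequentiallyI[of n0])
   fix n assume "n0 <= n"
   define T where "T = real n - t"
   have T: "T > 0" using n0 \<open>n0 <= n\<close> by (simp add: T_def)
   have "Fx (AA e b N) (real n) (t, x) - Duh e b N (t, x) = (LINT \<theta>|lam. T * AA e b N (t - (t + T * \<theta>)) (t + T * \<theta>) x)" for x
   proof -
    obtain H where H: "\<And>T. Fx (AA e b N) T (t, x) = H T - H 0"
     "\<And>a T. (LINT \<theta>|lam. T * AA e b N (fst (t, x) - (a + T * \<theta>)) (a + T * \<theta>) (snd (t, x))) = H (a + T) - H a"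
     by (rule Fx_antiderivative[OF jA, of "(t, x)"]) blast
    show ?thesis using H(2)[of T t] by (simp add: Duh_Fx H(1) T_def)
   qed
   then have "n2 (\<lambda>z. Fx (AA e b N) (real n) z - Duh e b N z) t = (nnint x. (LINT \<theta>|lam. T * AA e b N (t - (t + T * \<theta>)) (t + T * \<theta>) x)^2)"
    unfolding n2_def by simp
   also have "... <= ennreal ((ce * B^2) * (4 * (1 + t) powr (-1/4))^2)"
   proof (rule weighted_Minkowski[where W="\<lambda>\<theta>. T * kap (t + T * \<theta>)"])
    show "cts (\<lambda>z. T * AA e b N (t - (t + T * fst z)) (t + T * fst z) (snd z))"
     by (intro continuous_intros jcont_comp[OF jA])
    show "cts (\<lambda>\<theta>. T * kap (t + T * \<theta>))" by (intro continuous_intros kap_cont)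
    show "T * kap (t + T * \<theta>) > 0" for \<theta> using T kap_pos by simp
    show "(LINT \<theta>|lam. T * kap (t + T * \<theta>)) <= 4 * (1 + t) powr (-1/4)" using T by (intro kap_tail t) simp
    show "ce * B^2 >= 0" using ce_pos by simp
    fix \<theta> :: real assume th: "0 <= \<theta>" "\<theta> <= 1"
    let ?s = "t + T * \<theta>"
    have s: "?s >= 0" using t T th by simp
    have "n2 N ?s <= ennreal (B^2 / (1 + ?s)^3)" using good_sourceD[OF N s, of "[]"] by simp
    from AA_L2_source(2)[OF c this s]
    show "(nnint x. (T * AA e b N (t - ?s) ?s x)^2) <= ennreal (ce * B^2 * (T * kap ?s)^2)" .
   qed simp
   finally show "n2 (\<lambda>z. Fx (AA e b N) (real n) z - Duh e b N z) t <= ennreal (ce * B^2 * (4 * (1 + t) powr (-1/4))^2)" .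
  qed
 qed
qed

end

text \<open>The 4 in the proof counts the components of the gradient. \<open>L2norm\<close> takes
  its finite branch because the integral is bounded by a real number.\<close>

lemma L2norm_grad_tendsto_0:
 assumes g: "\<And>t x. t >= 0 ==> grad u (t, x) = (p None (t, x), \<chi> j. p (Some j) (t, x))"
  and c: "\<And>b. cts (p b)" and K: "\<And>b t. t >= 0 ==> n2 (p b) t <= ennreal (k t)" and k: "(k \<longlongrightarrow> 0) at_top" "\<And>t. k t >= 0"
 shows "((\<lambda>t. L2norm (\<lambda>x. grad u (t, x))) \<longlongrightarrow> 0) at_top"
proof -
 have m: "(\<lambda>x. ennreal ((p b (t, x))^2)) \<in> borel_measurable lborel" for b t
  by (rule cts_ennreal) (intro continuous_intros cts_comp[OF c])
 have b: "L2norm (\<lambda>x. grad u (t, x)) <= ennreal (sqrt (4 * k t))" if t: "t >= 0" for t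
 proof -
  have sq: "(norm (grad u (t, x)))^2 = (p None (t, x))^2 + (\<Sum>j\<in>UNIV. (p (Some j) (t, x))^2)" for x
   unfolding g[OF t] norm_Pair by (simp add: norm_vec_def L2_set_def sum_nonneg)
  have "(nnint x. (norm (grad u (t, x)))^2) = (nnlb x. ennreal ((p None (t, x))^2) + (\<Sum>j\<in>UNIV. ennreal ((p (Some j) (t, x))^2)))"
   unfolding sq by (intro nn_integral_cong) (simp add: ennreal_plus sum_nonneg sum_ennreal)
  also have "... = n2 (p None) t + (\<Sum>j\<in>UNIV. n2 (p (Some j)) t)"
   unfolding n2_def by (subst nn_integral_add[OF m borel_measurable_sum[OF m]], subst nn_integral_sum[OF m]) rule
  also have "... <= ennreal (k t) + (\<Sum>j\<in>(UNIV::3 set). ennreal (k t))" by (intro add_mono sum_mono K t)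
  also have "... = ennreal (4 * k t)" using k(2)[of t] by (subst sum_ennreal) (auto simp: ennreal_plus[symmetric] simp del: ennreal_plus)
  finally have I: "(nnint x. (norm (grad u (t, x)))^2) <= ennreal (4 * k t)" .
  then have "enn2real (nnint x. (norm (grad u (t, x)))^2) <= 4 * k t"
   using k(2)[of t] by (intro enn2real_leI) auto
  moreover have "(nnint x. (norm (grad u (t, x)))^2) \<noteq> \<infinity>" using I by (auto simp: top_unique)
  ultimately show ?thesis unfolding L2norm_def Let_def by (auto intro!: ennreal_leI)
 qed
 have "((\<lambda>t. sqrt (4 * k t)) \<longlongrightarrow> sqrt (4 * 0)) at_top" by (intro tendsto_intros k)
 then have "((\<lambda>t. ennreal (sqrt (4 * k t))) \<longlongrightarrow> ennreal (sqrt (4 * 0))) at_top" by (rule tendsto_ennrealI)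
 then have l: "((\<lambda>t. ennreal (sqrt (4 * k t))) \<longlongrightarrow> 0) at_top" by simp
 show ?thesis
  by (rule tendsto_sandwich[OF always_eventually eventually_mono[OF eventually_ge_at_top[of 0] b] tendsto_const l]) simp
qed

section \<open>The initial data\<close>

definition slot :: "real^('m::finite \<times> 3 option) => 'm => real \<times> (real^3)" where
 "slot P a = (P $ (a, None), \<chi> j. P $ (a, Some j))"

text \<open>The triple sum as a function of one vector holding all first derivatives of all
  components, the form that the calculus of the preceding parts works with.\<close>

definition Fn :: "('m::finite) nonlinearity => 'm => real^('m \<times> 3 option) => real" where
 "Fn C i P = (\<Sum>a1\<in>UNIV. \<Sum>a2\<in>UNIV. \<Sum>a3\<in>UNIV. C i a1 a2 a3 (slot P a1, slot P a2, slot P a3))"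

lemma bounded_linear_slot: "bounded_linear (\<lambda>P. slot P a)"
proof -
 have "linear (\<lambda>P. slot P a)" by (rule linearI) (auto simp: slot_def vec_eq_iff)
 then show ?thesis by (simp add: linear_conv_bounded_linear)
qed

lemma smooth_Fn:
 fixes C :: "('m::finite) nonlinearity"
 assumes "\<And>i a1 a2 a3. smooth_on UNIV (C i a1 a2 a3)" shows "smooth_on UNIV (Fn C i)"
 unfolding smooth_on_def Fn_def[abs_def]
proof (intro allI Ck_on_sum finite)
 fix k and a1 a2 a3 :: 'm
 have "bounded_linear (\<lambda>P. (slot P a1, slot P a2, slot P a3))"
  by (intro bounded_linear_Pair bounded_linear_slot)
 then show "Ck_on k UNIV (\<lambda>P. C i a1 a2 a3 (slot P a1, slot P a2, slot P a3))"
  by (rule Ck_on_linear) (use assms in \<open>simp add: smooth_on_def\<close>)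
qed

lemma norm_slot_le: "norm (slot P a) <= 4 * norm P"
proof -
 have "norm (slot P a) <= norm (P $ (a, None)) + norm (\<chi> j. P $ (a, Some j))"
  unfolding slot_def by (rule norm_Pair_le)
 also have "norm (\<chi> j. P $ (a, Some j)) <= (\<Sum>j\<in>UNIV. abs (P $ (a, Some j)))"
  using norm_le_l1_cart[of "\<chi> j. P $ (a, Some j)"] by simp
 also have "... <= (\<Sum>j\<in>(UNIV::3 set). norm P)" by (intro sum_mono component_le_norm_cart)
 finally show ?thesis using component_le_norm_cart[of P "(a, None)"] by simp
qed

text \<open>By \<open>norm_slot_le\<close> the radius 1/4 puts every slot in the unit ball, where
  the cubic bound holds; 64 is the cube of the 4 in that lemma. The minus sign fits the convention
  of \<open>wsol\<close>.\<close>

lemma vanish_Fn: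
 fixes C :: "('m::finite) nonlinearity"
 assumes C: "\<And>i a1 a2 a3. smooth_on UNIV (C i a1 a2 a3)" and cub: "cubic_or_higher C"
 shows "vanish 3 (\<lambda>P. - Fn C i P)"
proof -
 obtain K where K: "\<And>p :: 'm => real \<times> (real^3). (\<forall>a. norm (p a) <= 1) ==>
   (\<forall>i a1 a2 a3. abs (C i a1 a2 a3 (p a1, p a2, p a3)) <= K * (\<Sum>a\<in>UNIV. norm (p a) ^ 3))"
  using cub unfolding cubic_or_higher_def by blast
 let ?m = "real CARD('m)"
 have "abs (Fn C i P) <= (?m^3 * (abs K * (?m * 64))) * norm P ^ 3" if P: "norm P <= 1/4" for P
 proof -
  have s: "norm (slot P a) <= 1" for a using norm_slot_le[of P a] P by linarith
  have "(\<Sum>a\<in>UNIV. norm (slot P a) ^ 3) <= (\<Sum>a\<in>(UNIV::'m set). (4 * norm P) ^ 3)"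
   by (intro sum_mono power_mono norm_slot_le) simp
  also have "... = ?m * 64 * norm P ^ 3" by (simp add: power_mult_distrib)
  finally have S: "(\<Sum>a\<in>UNIV. norm (slot P a) ^ 3) <= ?m * 64 * norm P ^ 3" .
  have b: "abs (C i a1 a2 a3 (slot P a1, slot P a2, slot P a3)) <= abs K * (?m * 64 * norm P ^ 3)" for a1 a2 a3
  proof -
   have "abs (C i a1 a2 a3 (slot P a1, slot P a2, slot P a3)) <= K * (\<Sum>a\<in>UNIV. norm (slot P a) ^ 3)" using K[of "slot P"] s by blast
   also have "... <= abs K * (\<Sum>a\<in>UNIV. norm (slot P a) ^ 3)" by (intro mult_right_mono sum_nonneg) auto
   also have "... <= abs K * (?m * 64 * norm P ^ 3)" by (intro mult_left_mono S) simp
   finally show ?thesis .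
  qed
  have "abs (Fn C i P) <= (\<Sum>a1\<in>(UNIV::'m set). \<Sum>a2\<in>(UNIV::'m set). \<Sum>a3\<in>(UNIV::'m set). abs K * (?m * 64 * norm P ^ 3))"
   unfolding Fn_def
   by (rule order_trans[OF sum_abs sum_mono], rule order_trans[OF sum_abs sum_mono], rule order_trans[OF sum_abs sum_mono], rule b)
  also have "... = (?m^3 * (abs K * (?m * 64))) * norm P ^ 3" by (simp add: power3_eq_cube mult_ac)
  finally show ?thesis .
 qed
 moreover have "smooth_on UNIV (\<lambda>P. - Fn C i P)"
  using smooth_Fn[where i=i, OF C] Ck_on_cmult[of _ "Fn C i" "-1"] by (simp add: smooth_on_def)
 ultimately show ?thesis by (intro vanish_3I[of _ "1/4" "?m^3 * (abs K * (?m * 64))"]) simp_all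
qed

lemma nonlin_Fn:
 assumes "\<And>a. grad (\<phi> a) z = (q (a, None) z, \<chi> j. q (a, Some j) z)"
 shows "nonlin C \<phi> i z = Fn C i (PP q z)"
 unfolding nonlin_def Fn_def slot_def by (simp add: assms PP_def)

section \<open>Regularity and size of the Cauchy data\<close>

definition const_t :: "(real^3 => real) => spacetime => real" where
 "const_t f z = f (snd z)"

lemma CX_const_t: "Ck_on k UNIV f ==> CX k (const_t f)"
proof (induction k arbitrary: f)
 case 0
 then have "cts f" by simp
 then show ?case unfolding const_t_def[abs_def] by (simp add: cts_comp continuous_intros)
next
 case (Suc k)
 show ?case
 proof (rule CX_SucI[where u'="\<lambda>j. const_t (\<lambda>x. frechet_derivative f (at x) (axis j 1))"])
  show "cts (const_t f)"
   unfolding const_t_def[abs_def] by (rule cts_comp[OF Ck_on_cont[OF Suc.prems]]) (intro continuous_intros)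
  show "hasdd (spv j) (const_t f) z (const_t (\<lambda>x. frechet_derivative f (at x) (axis j 1)) z)" for j z
   using has_derivative_imp_hasdd[OF frechet_derivative_works[THEN iffD1, OF Ck_on_differentiable[OF Suc.prems]], of "axis j 1" "snd z"]
   by (simp add: hasdd_def const_t_def)
  show "CX k (const_t (\<lambda>x. frechet_derivative f (at x) (axis j 1)))" for j
   by (rule Suc.IH) (use Suc.prems in \<open>auto simp: Basis_vec_def\<close>)
 qed
qed

lemma Dx_const_t: "Dx w (const_t f) (t, x) = Dx w (const_t f) (0, x)"
proof (induction w arbitrary: x)
 case Nil show ?case by (simp add: const_t_def)
next
 case (Cons j w)
 show ?case unfolding Dx_Cons dd_def by (simp add: Cons.IH)
qed

text \<open>On the affine extension a word of translations acts on \<open>f\<close> and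
  \<open>g\<close> separately, and the time derivative leaves the \<open>g\<close> part. One
  gradient at t = 0 thus contains \<open>Dx w\<close> of \<open>g\<close> and all first derivatives
  of \<open>Dx w\<close> of \<open>f\<close>.\<close>

lemma vf_word_cauchy_ext:
 assumes f: "CX (Suc k) (const_t f)" and g: "CX (Suc k) (const_t g)"
 shows "length w <= k ==> (\<forall>z\<in>future. vf_word (map Transl w) (cauchy_ext f g) z = Dx w (const_t f) z + fst z * Dx w (const_t g) z) \<and>
  (\<forall>x. grad (vf_word (map Transl w) (cauchy_ext f g)) (0, x) = (Dx w (const_t g) (0, x), \<chi> j. Dx (j # w) (const_t f) (0, x)))"
proof (induction w)
 have grd: "\<forall>z\<in>future. dt (vf_word (map Transl w) (cauchy_ext f g)) z = Dx w (const_t g) z \<and>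
   dx j (vf_word (map Transl w) (cauchy_ext f g)) z = Dx (j # w) (const_t f) z + fst z * Dx (j # w) (const_t g) z"
  if w: "length w <= k" and e: "\<forall>z\<in>future. vf_word (map Transl w) (cauchy_ext f g) z = Dx w (const_t f) z + fst z * Dx w (const_t g) z" for w j
 proof
  fix z assume z: "z \<in> future"
  let ?u = "\<lambda>z. Dx w (const_t f) z + fst z * Dx w (const_t g) z"
  have cf: "CX (Suc 0) (Dx w (const_t f))" and cg: "CX (Suc 0) (Dx w (const_t g))"
   by (rule CX_Dx'[OF f] CX_Dx'[OF g], use w in simp)+
  have t: "hasdd (1, 0) ?u z (Dx w (const_t g) z)" for z
  proof -
   obtain s x where zx: "z = (s, x)" by (cases z)
   obtain c d where cd: "\<And>r. Dx w (const_t f) (r, x) = c" "\<And>r. Dx w (const_t g) (r, x) = d" using Dx_const_t by metis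
   have "DERIV (\<lambda>h. c + (s + h) * d) 0 :> d" by (auto intro!: derivative_eq_intros)
   then show ?thesis unfolding hasdd_def zx by (simp add: cd)
  qed
  have x: "hasdd (spv j) ?u z (Dx (j # w) (const_t f) z + fst z * Dx (j # w) (const_t g) z)" for j z
   using hasdd_add[OF CX_hasdd[OF cf, of j z] hasdd_cmult[OF CX_hasdd[OF cg, of j z], of "fst z"]]
   by (simp add: hasdd_def Dx_Cons)
  have CBu: "CB (Suc 0) ?u" "dd (1, 0) ?u = Dx w (const_t g)" "dd (spv j) ?u = (\<lambda>z. Dx (j # w) (const_t f) z + fst z * Dx (j # w) (const_t g) z)" for j
   using CB_SucI[where k=0, OF _ t x] CX_cont[OF cf] CX_cont[OF cg] CX_cont_sd[OF cf] CX_cont_sd[OF cg]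
   by (simp_all add: Dx_Cons continuous_intros)
  show "dt (vf_word (map Transl w) (cauchy_ext f g)) z = Dx w (const_t g) z \<and>
   dx j (vf_word (map Transl w) (cauchy_ext f g)) z = Dx (j # w) (const_t f) z + fst z * Dx (j # w) (const_t g) z"
   using dt_cong[of _ ?u z] dx_cong[of _ ?u z j] e z dt_eq[OF CBu(1) z] dx_eq[OF CBu(1) z] by (simp add: CBu del: CD.simps)
 qed
 have gr0: "\<forall>x. grad (vf_word (map Transl w) (cauchy_ext f g)) (0, x) = (Dx w (const_t g) (0, x), \<chi> j. Dx (j # w) (const_t f) (0, x))"
  if "length w <= k" "\<forall>z\<in>future. vf_word (map Transl w) (cauchy_ext f g) z = Dx w (const_t f) z + fst z * Dx w (const_t g) z" for w
 proof
  fix x :: "real^3"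
  have z: "(0, x) \<in> future" by (simp add: future_def)
  show "grad (vf_word (map Transl w) (cauchy_ext f g)) (0, x) = (Dx w (const_t g) (0, x), \<chi> j. Dx (j # w) (const_t f) (0, x))"
   unfolding grad_def using grd[OF that, THEN bspec, OF z] by simp
 qed
 {
  case Nil
  have 1: "\<forall>z\<in>future. vf_word (map Transl []) (cauchy_ext f g) z = Dx [] (const_t f) z + fst z * Dx [] (const_t g) z"
   by (simp add: vf_word_def cauchy_ext_def const_t_def)
  show ?case by (rule conjI[OF 1 gr0[OF _ 1]]) simp
 next
  case (Cons j w)
  have w: "length w <= k" using Cons.prems by simp
  have "vf_word (map Transl (j # w)) (cauchy_ext f g) = dx j (vf_word (map Transl w) (cauchy_ext f g))" by (simp add: vf_word_def)
  then have "\<forall>z\<in>future. vf_word (map Transl (j # w)) (cauchy_ext f g) z = Dx (j # w) (const_t f) z + fst z * Dx (j # w) (const_t g) z"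
   using grd[OF w] Cons.IH[OF w] by auto
  then show ?case using gr0[OF Cons.prems] by blast
 }
qed

text \<open>A single summand of the data norm, that of \<open>map Transl w\<close>, dominates the
  required derivatives of both data. For \<open>f\<close> it controls derivatives of order at least
  1, hence \<open>good_data\<close> for \<open>sd j\<close> of it.\<close>

lemma data_bounds:
 fixes f g :: "'m::finite => real^3 => real"
 assumes f: "Ck_on 31 UNIV (f i)" and g: "Ck_on 30 UNIV (g i)" and d: "data_norm f g <= ennreal \<epsilon>" and \<epsilon>: "\<epsilon> >= 0"
 shows "good_data 12 \<epsilon> (sd j (const_t (f i)))" "good_data 12 \<epsilon> (const_t (g i))"
  "CX 31 (const_t (f i))" "CX 30 (const_t (g i))"
proof -
 show cf: "CX 31 (const_t (f i))" and cg: "CX 30 (const_t (g i))" by (rule CX_const_t[OF f] CX_const_t[OF g])+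
 let ?\<psi> = "cauchy_ext (f i) (g i)"
 have "Gamma_norm_at_0 30 ?\<psi> <= data_norm f g"
  unfolding data_norm_def by (rule member_le_sum) auto
 then have G: "Gamma_norm_at_0 30 ?\<psi> <= ennreal \<epsilon>" using d by (rule order_trans)
 have b: "n1 u 0 <= ennreal \<epsilon> \<and> n2 u 0 <= ennreal (\<epsilon>^2)"
  if w: "length w <= 20" and u: "\<And>x. abs (u (0, x)) <= norm (Dx w (const_t (g i)) (0, x), \<chi> j. Dx (j # w) (const_t (f i)) (0, x))" for u w
 proof -
  let ?G = "\<lambda>x. grad (vf_word (map Transl w) ?\<psi>) (0, x)"
  have f20: "CX (Suc 20) (const_t (f i))" and g20: "CX (Suc 20) (const_t (g i))" by (rule CD_mono[OF cf] CD_mono[OF cg], simp)+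
  have uG: "abs (u (0, x)) <= norm (?G x)" for x using u vf_word_cauchy_ext[OF f20 g20 w] by simp
  have "L2norm ?G + L1norm ?G <= Gamma_norm_at_0 30 ?\<psi>" unfolding Gamma_norm_at_0_def
   by (rule member_le_sum[of "map Transl w" _ "\<lambda>w. L2norm (\<lambda>x. grad (vf_word w ?\<psi>) (0, x)) + L1norm (\<lambda>x. grad (vf_word w ?\<psi>) (0, x))"])
     (use w finite_vf_words in auto)
  then have s: "L2norm ?G + L1norm ?G <= ennreal \<epsilon>" using G by (rule order_trans)
  have L1: "L1norm ?G <= ennreal \<epsilon>" and L2: "L2norm ?G <= ennreal \<epsilon>"
   using s by (meson add_increasing add_increasing2 order_trans zero_le order_refl)+
  have "n1 u 0 <= L1norm ?G" unfolding n1_def L1norm_def by (intro nn_integral_mono ennreal_leI uG)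
  moreover have "n2 u 0 <= ennreal (\<epsilon>^2)"
  proof -
   let ?I = "\<integral>\<^sup>+x. ennreal ((norm (?G x))^2) \<partial>lborel"
   have fin: "?I \<noteq> \<infinity>" using L2 unfolding L2norm_def Let_def by (auto split: if_splits simp: top_unique)
   then have "ennreal (sqrt (enn2real ?I)) <= ennreal \<epsilon>" using L2 unfolding L2norm_def Let_def by (simp split: if_splits)
   then have "sqrt (enn2real ?I) <= \<epsilon>" using \<epsilon> by simp
   then have "enn2real ?I <= \<epsilon>^2" by (metis enn2real_nonneg real_sqrt_ge_zero real_sqrt_pow2 power_mono)
   moreover have "?I = ennreal (enn2real ?I)" using fin by (simp add: top.not_eq_extremum)
   ultimately have I: "?I <= ennreal (\<epsilon>^2)" by (metis ennreal_leI)
   have "n2 u 0 <= ?I" unfolding n2_def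
   proof (intro nn_integral_mono ennreal_leI)
    fix x
    have "\<bar>u (0, x)\<bar>\<^sup>2 <= (norm (?G x))^2" by (intro power_mono uG) simp
    then show "(u (0, x))^2 <= (norm (?G x))^2" by simp
   qed
   then show ?thesis using I by (rule order_trans)
  qed
  ultimately show ?thesis using L1 by (meson order_trans)
 qed
 show "good_data 12 \<epsilon> (const_t (g i))" unfolding good_data_def
 proof (intro conjI allI impI)
  show "CX (Suc (Suc 12)) (const_t (g i))" by (rule CD_mono[OF cg]) simp
  fix w :: "3 list" assume w: "length w <= 12"
  have "n1 (Dx w (const_t (g i))) 0 <= ennreal \<epsilon> \<and> n2 (Dx w (const_t (g i))) 0 <= ennreal (\<epsilon>^2)"
   by (rule b[of w]) (use w norm_fst_le in \<open>auto intro: order_trans[OF _ norm_fst_le]\<close>)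
  then show "n2 (Dx w (const_t (g i))) 0 <= ennreal (\<epsilon>^2)" "n1 (Dx w (const_t (g i))) 0 <= ennreal \<epsilon>" by auto
 qed
 show "good_data 12 \<epsilon> (sd j (const_t (f i)))" unfolding good_data_def
 proof (intro conjI allI impI)
  have "CX (Suc 30) (const_t (f i))" using cf by (simp del: CD.simps)
  from CX_sd[OF this] show "CX (Suc (Suc 12)) (sd j (const_t (f i)))" by (rule CD_mono) simp
  fix w :: "3 list" assume w: "length w <= 12"
  \<comment> \<open>The outermost derivative is split off instead of the innermost: it is the one
    taken by the gradient in the data norm.\<close>
  obtain k v where kv: "w @ [j] = k # v" by (cases "w @ [j]") auto
  have v: "length v <= 12" using arg_cong[OF kv, of length] w by simp
  have e: "Dx w (sd j (const_t (f i))) = Dx (k # v) (const_t (f i))" using Dx_append[of w "[j]"] kv by (simp add: Dx_Cons)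
  have "n1 (Dx (k # v) (const_t (f i))) 0 <= ennreal \<epsilon> \<and> n2 (Dx (k # v) (const_t (f i))) 0 <= ennreal (\<epsilon>^2)"
  proof (rule b[of v])
   fix x
   have "abs (Dx (k # v) (const_t (f i)) (0, x)) <= norm (\<chi> j. Dx (j # v) (const_t (f i)) (0, x))"
    using component_le_norm_cart[of "\<chi> j. Dx (j # v) (const_t (f i)) (0, x)" k] by simp
   also have "... <= norm (Dx v (const_t (g i)) (0, x), \<chi> j. Dx (j # v) (const_t (f i)) (0, x))" by (rule norm_snd_le)
   finally show "abs (Dx (k # v) (const_t (f i)) (0, x)) <= norm (Dx v (const_t (g i)) (0, x), \<chi> j. Dx (j # v) (const_t (f i)) (0, x))" .
  qed (use v in simp)
  then show "n2 (Dx w (sd j (const_t (f i)))) 0 <= ennreal (\<epsilon>^2)" "n1 (Dx w (sd j (const_t (f i)))) 0 <= ennreal \<epsilon>" unfolding e by auto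
 qed
qed

context ellip begin

text \<open>With \<open>Y\<close> the size of a single term, two uses of \<open>good_add\<close>
  give 2 * (2 * (1 + 1) + 1) = 10 for the three terms of \<open>LF None\<close>, and one more gives
  2 * (10 + 1) = 22.\<close>

lemma good_linear_part:
 assumes LA: "\<And>b g B. 0 <= B ==> good_data K B g ==> good K L (C * B) (LA e b g)" and C: "C >= 0" and LK: "L <= K" and \<epsilon>: "\<epsilon> >= 0"
  and f: "\<And>j. good_data K \<epsilon> (sd j f)" and g: "good_data K \<epsilon> g"
 shows "good K L (22 * ((1 + (\<Sum>j\<in>UNIV. e j)) * (C * \<epsilon>))) (\<lambda>z. LF b f z + LA e b g z)"
proof -
 define Y where "Y = (1 + (\<Sum>j\<in>UNIV. e j)) * (C * \<epsilon>)"
 have e0: "0 <= (\<Sum>j\<in>UNIV. e j)" by (intro sum_nonneg less_imp_le e_pos)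
 have ej: "e j <= 1 + (\<Sum>j\<in>UNIV. e j)" for j
  using member_le_sum[of j UNIV e] less_imp_le[OF e_pos] by simp
 have CE: "0 <= C * \<epsilon>" using C \<epsilon> by simp
 have Y: "C * \<epsilon> <= Y" "e j * (C * \<epsilon>) <= Y" "0 <= Y" for j
 proof -
  have "1 * (C * \<epsilon>) <= Y" unfolding Y_def using e0 by (intro mult_right_mono CE) simp
  then show "C * \<epsilon> <= Y" by simp
  then show "0 <= Y" using CE by linarith
  show "e j * (C * \<epsilon>) <= Y" unfolding Y_def by (intro mult_right_mono CE ej)
 qed
 have F: "good K L (10 * Y) (LF b f)"
 proof (cases b)
  case (Some j)
  have "good K L (10 * Y) (LA e None (sd j f))"
   by (rule good_mono[OF LA[OF \<epsilon> f] CE]) (use Y in linarith)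
  then show ?thesis by (simp add: LF_def Some)
 next
  case None
  have t: "good K L Y (\<lambda>z. e j * LA e (Some j) (sd j f) z)" for j
  proof -
   have "good K L (abs (e j) * (C * \<epsilon>)) (\<lambda>z. e j * LA e (Some j) (sd j f) z)"
    by (rule good_cmult[OF LA[OF \<epsilon> f] CE LK])
   then show ?thesis by (rule good_mono) (use Y(2)[of j] less_imp_le[OF e_pos[of j]] CE in auto)
  qed
  have "good K L (2 * (2 * (Y + Y) + Y)) (\<lambda>z. (e 1 * LA e (Some 1) (sd 1 f) z + e 2 * LA e (Some 2) (sd 2 f) z) + e 3 * LA e (Some 3) (sd 3 f) z)"
   by (intro good_add t LK) (use Y in auto)
  then show ?thesis by (simp add: LF_def None sum_3)
 qed
 have G: "good K L Y (LA e b g)" by (rule good_mono[OF LA[OF \<epsilon> g] CE Y(1)])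
 have "good K L (2 * (10 * Y + Y)) (\<lambda>z. LF b f z + LA e b g z)"
  by (rule good_add[OF F G _ _ LK]) (use Y in auto)
 moreover have "2 * (10 * Y + Y) = 22 * Y" by simp
 ultimately show ?thesis unfolding Y_def by (simp only:)
qed

end

section \<open>Choice of the constants and proof of the theorem\<close>

lemma choice_pair:
 assumes "\<And>i. \<exists>C. P i C \<and> (\<exists>\<delta>>0. Q i C \<delta>)"
 obtains C and \<delta> :: "'i => real" where "\<And>i. P i (C i)" "\<And>i. \<delta> i > 0" "\<And>i. Q i (C i) (\<delta> i)"
 using assms by metis

definition integral_solution :: "('m::finite => 3 => real) => ('m => real^('m \<times> 3 option) => real) =>
  ('m => spacetime => real) => ('m => spacetime => real) => ('m \<times> 3 option => spacetime => real) => ('m => real) => bool" where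
 "integral_solution e F f g q B \<longleftrightarrow> (\<forall>i. 0 <= B i \<and> CX 7 (\<lambda>z. F i (PP q z)) \<and> good_source 7 (B i) (\<lambda>z. F i (PP q z))) \<and>
  (\<forall>i b z. 0 <= fst z --> q (i, b) z = (ellip.LF (e i) b (f i) z + LA (e i) b (g i) z) + Duh (e i) b (\<lambda>z. F i (PP q z)) z)"

text \<open>The constants of all components are fixed first, then the size \<open>M\<close> of the
  iterates, and last \<epsilon>, small compared with \<open>M\<close>; none of them depends on the
  data.\<close>

lemma small_data_solution:
 fixes e :: "'m::finite => 3 => real" and F :: "'m => real^('m \<times> 3 option) => real"
 assumes e: "\<And>i j. e i j > 0" and F: "\<And>i. vanish 3 (F i)"
 shows "\<exists>\<epsilon>>0. \<forall>f g. (\<forall>i. (\<forall>j. good_data 12 \<epsilon> (sd j (f i))) \<and> good_data 12 \<epsilon> (g i)) --> (\<exists>q B. integral_solution e F f g q B)"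
proof -
 have el: "ellip (e i)" for i by unfold_locales (rule e)
 let ?D = "\<lambda>i C. \<forall>c N B. CX (Suc (Suc 12)) N --> B >= 0 --> good_source 12 B N --> good 12 8 (C * B) (Duh (e i) c N)"
 have "\<forall>i. \<exists>C. C >= 1 \<and> ?D i C" by (intro allI ellip.good_Duh[OF el]) simp
 from choice[OF this] obtain CD where CD: "\<forall>i. CD i >= 1 \<and> ?D i (CD i)" ..
 let ?L = "\<lambda>i C. \<forall>c g B. B >= 0 --> good_data 12 B g --> good 12 8 (C * B) (LA (e i) c g)"
 have "\<forall>i. \<exists>C. C >= 1 \<and> ?L i C" by (intro allI ellip.good_LA[OF el]) simp
 from choice[OF this] obtain CL where CL: "\<forall>i. CL i >= 1 \<and> ?L i (CL i)" ..
 let ?N = "\<lambda>K L i C \<delta>. \<forall>p M. 0 < M --> M <= \<delta> --> (\<forall>c. good K L M (p c)) --> good_source K (C * M^3) (\<lambda>z. F i (PP p z))"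
 obtain CN dN where N: "\<And>i. CN i >= 1" "\<And>i. dN i > 0" "\<And>i. ?N 12 8 i (CN i) (dN i)"
  by (rule choice_pair[of "\<lambda>_ C. C >= 1" "?N 12 8"], rule good_nonlinear[OF _ _ F]) (simp, simp, rule that)
 obtain CN' dN' where N': "\<And>i. CN' i >= 1" "\<And>i. dN' i > 0" "\<And>i. ?N 7 7 i (CN' i) (dN' i)"
  by (rule choice_pair[of "\<lambda>_ C. C >= 1" "?N 7 7"], rule good_nonlinear[OF _ _ F]) (simp, simp, rule that)
 let ?S = "\<lambda>i C \<delta>. \<forall>p q M D s. 0 <= M --> M <= \<delta> --> 0 <= s --> 0 <= D -->
  (\<forall>c. cts (p c) \<and> cts (q c) \<and> n2 (\<lambda>z. p c z - q c z) s <= ennreal D \<and>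
    (\<forall>x. abs (p c (s, x)) <= M * dec s \<and> abs (q c (s, x)) <= M * dec s)) -->
  n2 (\<lambda>z. F i (PP p z) - F i (PP q z)) s <= ennreal (C * M^4 * D / (1 + s)^3)"
 obtain CS dS where S: "\<And>i. CS i >= 0" "\<And>i. dS i > 0" "\<And>i. ?S i (CS i) (dS i)"
  by (rule choice_pair[of "\<lambda>_ C. C >= 0" ?S], rule source_difference[OF F]) (rule that)
 \<comment> \<open>Each summand is the reciprocal of an upper bound required of \<open>M\<close>:
   the three radii, the size condition on the Duhamel part, and the contraction condition, where 256
   = 8 * 32. Then \<open>M = 1 / X\<close> meets all of them.\<close>
 define T where "T i = 1 / dN i + 1 / dN' i + 1 / dS i + 4 * (CD i * CN i) + 256 * (ellip.ce (e i) * CS i)" for i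
 define X where "X = 1 + (\<Sum>i\<in>UNIV. T i)"
 define M where "M = 1 / X"
 have ce: "ellip.ce (e i) > 0" for i by (rule ellip.ce_pos(2)[OF el])
 have pos: "0 < dN i" "0 < dN' i" "0 < dS i" "1 <= CD i" "1 <= CN i" "1 <= CN' i" "0 <= CS i" "1 <= CL i" for i
  by (rule N N' S conjunct1[OF CD[THEN spec]] conjunct1[OF CL[THEN spec]])+
 have parts: "0 <= 1 / dN i" "0 <= 1 / dN' i" "0 <= 1 / dS i" "0 <= 4 * (CD i * CN i)" "0 <= 256 * (ellip.ce (e i) * CS i)" for i
  using pos[of i] ce[of i] by (auto intro!: mult_nonneg_nonneg)
 then have T0: "0 <= T i" for i unfolding T_def by (intro add_nonneg_nonneg)
 have X1: "1 <= X" unfolding X_def using T0 by (simp add: sum_nonneg)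
 have TX: "T i <= X" for i unfolding X_def using member_le_sum[of i UNIV T] T0 by simp
 have M: "0 < M" "M <= 1" using X1 by (auto simp: M_def)
 have Mle: "M * y <= 1" if "y <= T i" for y i
 proof -
  have "M * y <= M * X" using that TX[of i] M by (intro mult_left_mono) auto
  then show ?thesis using X1 by (simp add: M_def)
 qed
 have small: "M * (1 / dN i) <= 1" "M * (1 / dN' i) <= 1" "M * (1 / dS i) <= 1" "M * (4 * (CD i * CN i)) <= 1" "M * (256 * (ellip.ce (e i) * CS i)) <= 1" for i
  by (rule Mle[of _ i], use parts[of i] in \<open>simp add: T_def\<close>)+
 have d: "M <= dN i" "M <= dN' i" "M <= dS i" for i
  using small(1-3)[of i] pos(1-3)[of i] by (simp_all add: pos_divide_le_eq)
 \<comment> \<open>A common bound for the constants of \<open>good_linear_part\<close>, so that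
   \<epsilon> times \<open>U\<close> is \<open>M / 4\<close>.\<close>
 define U where "U = 1 + (\<Sum>i\<in>UNIV. 22 * ((1 + (\<Sum>j\<in>UNIV. e i j)) * CL i))"
 have U0: "0 <= 22 * ((1 + (\<Sum>j\<in>UNIV. e i j)) * CL i)" for i
  using pos(8)[of i] by (intro mult_nonneg_nonneg add_nonneg_nonneg sum_nonneg) (auto simp: less_imp_le e)
 have U: "1 <= U" "22 * ((1 + (\<Sum>j\<in>UNIV. e i j)) * CL i) <= U" for i
  unfolding U_def using sum_nonneg[of UNIV, OF U0] member_le_sum[of i UNIV "\<lambda>i. 22 * ((1 + (\<Sum>j\<in>UNIV. e i j)) * CL i)"] U0 by auto
 define \<epsilon> where "\<epsilon> = M / (4 * U)"
 have \<epsilon>: "\<epsilon> > 0" using M U by (simp add: \<epsilon>_def)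
 have sol: "\<exists>q B. integral_solution e F f g q B"
  if data: "\<forall>i. (\<forall>j. good_data 12 \<epsilon> (sd j (f i))) \<and> good_data 12 \<epsilon> (g i)" for f g
 proof -
  define u0 where "u0 c z = ellip.LF (e (fst c)) (snd c) (f (fst c)) z + LA (e (fst c)) (snd c) (g (fst c)) z" for c z
  have u0: "good 12 8 (M / 4) (u0 c)" for c
  proof -
   let ?i = "fst c"
   let ?m = "22 * ((1 + (\<Sum>j\<in>UNIV. e ?i j)) * (CL ?i * \<epsilon>))"
   have g: "good 12 8 ?m (u0 c)"
    unfolding u0_def[abs_def] by (rule ellip.good_linear_part[OF el]) (use CL data order_trans[OF zero_le_one pos(8)[of ?i]] \<epsilon> in auto)
   have m: "?m = 22 * ((1 + (\<Sum>j\<in>UNIV. e ?i j)) * CL ?i) * \<epsilon>" by (simp only: mult.assoc)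
   also have "... <= U * \<epsilon>" using U(2) \<epsilon> by (intro mult_right_mono) auto
   also have "... = M / 4" using U(1) by (simp add: \<epsilon>_def)
   finally show ?thesis by (rule good_mono[OF g, rotated]) (unfold m, rule mult_nonneg_nonneg[OF U0 less_imp_le[OF \<epsilon>]])
  qed
  interpret iteration e F CD CN CN' CS M u0
  proof (rule iteration.intro)
   show "ellip (e i)" for i by (rule el)
   show "smooth_on UNIV (F i)" for i by (rule vanish_smooth[OF F])
   show "M > 0" by (rule M)
   show "CN i >= 0" "CN' i >= 0" "CS i >= 0" "0 <= CD i" for i using pos[of i] by linarith+
   show "good 12 8 (CD i * B) (Duh (e i) b N)" if "CX (Suc (Suc 12)) N" "B >= 0" "good_source 12 B N" for i b N B
    using CD that by blast
   show "good_source 12 (CN i * M^3) (\<lambda>z. F i (PP p z))" if "\<And>c. good 12 8 M (p c)" for i p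
    using N(3) that M(1) d(1)[of i] by blast
   show "good_source 7 (CN' i * M^3) (\<lambda>z. F i (PP p z))" if "\<And>c. good 7 7 M (p c)" for i p
    using N'(3) that M(1) d(2)[of i] by blast
   show "n2 (\<lambda>z. F i (PP p z) - F i (PP q z)) s <= ennreal (CS i * M^4 * D / (1 + s)^3)"
    if "0 <= s" "0 <= D" "\<And>c. cts (p c)" "\<And>c. cts (q c)" "\<And>c. n2 (\<lambda>z. p c z - q c z) s <= ennreal D"
     "\<And>c x. abs (p c (s, x)) <= M * dec s" "\<And>c x. abs (q c (s, x)) <= M * dec s" for i s D p q
    using S(3)[rule_format, of M i s D p q] that d(3)[of i] less_imp_le[OF M(1)] by blast
   have M2: "M^3 <= M" "M^4 <= M" using power_decreasing[of 1 3 M] power_decreasing[of 1 4 M] M by auto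
   show "CD i * (CN i * M^3) <= M / 4" for i
   proof -
    have "M * (4 * (CD i * CN i)) * M^2 <= 1 * M^2" using small(4)[of i] by (intro mult_right_mono) auto
    also have "... <= M" using M by (simp add: power2_eq_square mult_left_le)
    finally show ?thesis by (simp add: power2_eq_square power3_eq_cube mult_ac)
   qed
   show "32 * ellip.ce (e i) * (CS i * M^4) <= 1 / 8" for i
   proof -
    have "32 * (ellip.ce (e i) * CS i) * M^4 <= 32 * (ellip.ce (e i) * CS i) * M"
     using parts(5)[of i] by (intro mult_left_mono M2) auto
    also have "... <= 1 / 8" using small(5)[of i] by (simp add: mult_ac)
    finally show ?thesis by (simp add: mult_ac)
   qed
   show "good 12 8 (M / 4) (u0 c)" for c by (rule u0)
  qed
  obtain q where q: "\<forall>c. good 7 7 M (q c)" "\<forall>c z. fst z >= 0 --> q c z = u0 c z + Duh (e (fst c)) (snd c) (\<lambda>z. F (fst c) (PP q z)) z"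
   using fixed_point by (elim exE conjE)
  show ?thesis unfolding integral_solution_def
  proof (intro exI[of _ q] exI[of _ "\<lambda>i. CN' i * M^3"] conjI allI impI)
   show "0 <= CN' i * M^3" for i using pos(6)[of i] M by simp
   show "good_source 7 (CN' i * M^3) (\<lambda>z. F i (PP q z))" for i by (rule source'[OF q(1)[rule_format]])
   then show "CX 7 (\<lambda>z. F i (PP q z))" for i unfolding good_source_def by blast
   show "q (i, b) z = ellip.LF (e i) b (f i) z + LA (e i) b (g i) z + Duh (e i) b (\<lambda>z. F i (PP q z)) z" if "0 <= fst z" for i b z
    using q(2)[rule_format, OF that, of "(i, b)"] by (simp add: u0_def)
  qed
 qed
 show ?thesis by (rule exI[of _ \<epsilon>]) (use \<epsilon> sol in blast)
qed

lemma wsol_diff_grad: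
 assumes w: "wsol e \<phi> p N" "wsol e \<psi> q M" and z: "z \<in> future"
 shows "grad (\<lambda>z. \<phi> z - \<psi> z) z = (p None z - q None z, \<chi> j. p (Some j) z - q (Some j) z)"
proof -
 have C: "CB (Suc (Suc 0)) \<phi>" "CB (Suc (Suc 0)) \<psi>" using w unfolding wsol_def numeral_2_eq_2 by blast+
 have d: "dd (1, 0) \<phi> = p None" "dd (spv j) \<phi> = p (Some j)" "dd (1, 0) \<psi> = q None" "dd (spv j) \<psi> = q (Some j)" for j
  using w unfolding wsol_def by blast+
 note Cp = CB_dd[OF C(1), unfolded d] CB_dd[OF C(2), unfolded d]
 have t: "hasdd (1, 0) (\<lambda>z. \<phi> z - \<psi> z) z (p None z - q None z)" for z
  using CB_hasdd(1)[OF C(1), of z] CB_hasdd(1)[OF C(2), of z] unfolding d hasdd_def by (rule DERIV_diff)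
 have x: "hasdd (spv j) (\<lambda>z. \<phi> z - \<psi> z) z (p (Some j) z - q (Some j) z)" for j z
  using CB_hasdd(2)[OF C(1), of j z] CB_hasdd(2)[OF C(2), of j z] unfolding d hasdd_def by (rule DERIV_diff)
 have CBd: "CB (Suc 0) (\<lambda>z. \<phi> z - \<psi> z)"
  by (rule CB_SucI(1)[OF _ t x]) (auto intro!: continuous_intros CD_cont[OF C(1)] CD_cont[OF C(2)] Cp[THEN CD_cont] simp del: CD.simps(2))
 show ?thesis unfolding grad_def dt_eq[OF CBd z] dx_eq[OF CBd z] hasdd_imp_dd[OF t] hasdd_imp_dd[OF x] ..
qed

theorem theorem1p4:
  fixes e :: "'m::finite \<Rightarrow> 3 \<Rightarrow> real"
    and C :: "'m nonlinearity"
  assumes "CARD('m) \<ge> 2"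
    and "\<And>i j. e i j > 0"
    and "\<And>i a1 a2 a3. smooth_on UNIV (C i a1 a2 a3)"
    and "cubic_or_higher C"
  shows "\<exists>\<epsilon>0>0. \<forall>f g :: 'm \<Rightarrow> real^3 \<Rightarrow> real.
    (\<forall>i. Ck_on 31 UNIV (f i) \<and> Ck_on 30 UNIV (g i)) \<and> data_norm f g \<le> ennreal \<epsilon>0 \<longrightarrow>
    (\<exists>\<phi>. global_solution e C f g \<phi> \<and>
       (\<forall>\<phi>'. global_solution e C f g \<phi>' \<longrightarrow> (\<forall>i. \<forall>z\<in>future. \<phi>' i z = \<phi> i z)) \<and>
       (\<forall>i. scatters_to_linear (e i) (\<phi> i)))"
proof -
 \<comment> \<open>\<open>wsol\<close> with source \<open>N\<close> means that the box operator
   gives \<open>- N\<close>.\<close>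
 let ?F = "\<lambda>i P. - Fn C i P"
 have el: "ellip (e i)" for i by unfold_locales (rule assms(2))
 obtain \<epsilon> where \<epsilon>: "\<epsilon> > 0" and sol: "\<forall>f g. (\<forall>i. (\<forall>j. good_data 12 \<epsilon> (sd j (f i))) \<and> good_data 12 \<epsilon> (g i)) --> (\<exists>q B. integral_solution e ?F f g q B)"
  using small_data_solution[of e ?F, OF assms(2) vanish_Fn[OF assms(3,4)]] by (elim exE conjE)
 show ?thesis
 proof (rule exI[of _ \<epsilon>], rule conjI[OF \<epsilon>], intro allI impI, elim conjE)
  fix f g :: "'m => real^3 => real"
  assume reg: "\<forall>i. Ck_on 31 UNIV (f i) \<and> Ck_on 30 UNIV (g i)" and dat: "data_norm f g <= ennreal \<epsilon>"
  have \<epsilon>0: "\<epsilon> >= 0" using \<epsilon> by simp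
  note db = data_bounds[OF conjunct1[OF reg[rule_format]] conjunct2[OF reg[rule_format]] dat \<epsilon>0]
  let ?f = "\<lambda>i. const_t (f i)" and ?g = "\<lambda>i. const_t (g i)"
  obtain q B where B: "\<And>i. 0 <= B i" and NC: "\<And>i. CX 7 (\<lambda>z. ?F i (PP q z))" and NS: "\<And>i. good_source 7 (B i) (\<lambda>z. ?F i (PP q z))"
   and q: "\<And>i b z. 0 <= fst z ==> q (i, b) z = (ellip.LF (e i) b (?f i) z + LA (e i) b (?g i) z) + Duh (e i) b (\<lambda>z. ?F i (PP q z)) z"
   using sol[rule_format, of ?f ?g] db unfolding integral_solution_def by blast
  let ?N = "\<lambda>i z. ?F i (PP q z)"
  have N5: "CX (Suc (Suc 5)) (?N i)" for i using NC by simp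
  have f3: "CX (Suc (Suc (Suc 0))) (?f i)" and g2: "CX (Suc (Suc 0)) (?g i)" for i
   by (rule CD_mono[OF db(3)], simp, rule CD_mono[OF db(4)], simp)
  \<comment> \<open>The integral equation determines only first derivatives; this is the function
    that has them, with \<open>TT\<close> as the potential of the kernels \<open>AA\<close>.\<close>
  define \<phi> where "\<phi> i z = (LA (e i) None (?f i) z + TT (e i) (?g i) (fst z) 0 (snd z)) + Fx (TT (e i) (?N i)) (fst z) z" for i z
  \<comment> \<open>The same linear part, but the source is integrated over all times instead of
    [0, t]: a homogeneous solution that differs from \<open>\<phi> i\<close> by the tail.\<close>
  define \<psi> where "\<psi> i z = (LA (e i) None (?f i) z + TT (e i) (?g i) (fst z) 0 (snd z)) + Winf (TT (e i) (?N i)) z" for i z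
  let ?p0 = "\<lambda>i b z. ellip.LF (e i) b (?f i) z + LA (e i) b (?g i) z"
  have w0: "wsol (e i) (\<lambda>z. LA (e i) None (?f i) z + TT (e i) (?g i) (fst z) 0 (snd z)) (?p0 i) (\<lambda>z. 0 + 0)" for i
   by (rule wsol_add[OF ellip.wsol_LF[OF el f3] ellip.wsol_TT[OF el g2]])
  have w\<phi>: "wsol (e i) (\<phi> i) (\<lambda>b z. ?p0 i b z + Duh (e i) b (?N i) z) (\<lambda>z. 0 + 0 + ?N i z)" for i
   unfolding \<phi>_def[abs_def] by (rule wsol_add[OF w0 ellip.wsol_Duhamel[OF el N5]])
  have w\<psi>: "wsol (e i) (\<psi> i) (\<lambda>b z. ?p0 i b z + Winf (AA (e i) b (?N i)) z) (\<lambda>z. 0 + 0 + 0)" for i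
   unfolding \<psi>_def[abs_def] by (rule wsol_add[OF w0 ellip.wsol_Winf[OF el NS B]])
  have gr: "grad (\<phi> i) z = (q (i, None) z, \<chi> j. q (i, Some j) z)" if "z \<in> future" for i z
   using wsol_future(3)[OF w\<phi>[of i] that] that by (simp add: q future_def mem_Times_iff)
  have box: "box_op (e i) (\<phi> i) z = nonlin C \<phi> i z" if "z \<in> future" for i z
   using wsol_future(4)[OF w\<phi>[of i] that] nonlin_Fn[where \<phi>=\<phi> and q=q and C=C and i=i, OF gr[OF that]] by simp
  have gl: "global_solution e C f g \<phi>" unfolding global_solution_def
  proof (intro allI conjI ballI)
   fix i x
   show "Ck_on 2 future (\<phi> i)" by (rule wsol_future(5)[OF w\<phi>, where z="(0, 0)"]) (simp add: future_def)
   show "\<phi> i (0, x) = f i x"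
    by (simp add: \<phi>_def LA_def ellip.AA_zero[OF el] ellip.TT_zero[OF el] Fx_def const_t_def)
   have "(0, x) \<in> future" by (simp add: future_def)
   from wsol_future(1)[OF w\<phi>[of i] this] show "dt (\<phi> i) (0, x) = g i x"
    by (simp add: ellip.LF_def[OF el] LA_def ellip.AA_zero[OF el] Duh_def const_t_def)
  qed (rule box)
  have uniq: "\<phi>' i z = \<phi> i z" if gl': "global_solution e C f g \<phi>'" and z: "z \<in> future" for \<phi>' i z
  proof (rule uniqueness[of e "Fn C" \<phi>' \<phi>, OF assms(2) smooth_Fn[OF assms(3)] _ _ _ _ _ _ z])
   have grv: "grad (u a) z = (gradvec u (a, None) z, \<chi> j. gradvec u (a, Some j) z)" for u :: "'m => spacetime => real" and a z
    by (simp add: grad_def gradvec_def)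
   show "Ck_on 2 future (\<phi>' i)" "Ck_on 2 future (\<phi> i)" for i using gl gl' by (auto simp: global_solution_def)
   show "box_op (e i) (\<phi>' i) z = Fn C i (PP (gradvec \<phi>') z)" "box_op (e i) (\<phi> i) z = Fn C i (PP (gradvec \<phi>) z)" if "z \<in> future" for i z
    using gl gl' that nonlin_Fn[where \<phi>=\<phi>' and q="gradvec \<phi>'" and C=C and i=i, OF grv] nonlin_Fn[where \<phi>=\<phi> and q="gradvec \<phi>" and C=C and i=i, OF grv] by (auto simp: global_solution_def)
   show "\<phi>' i (0, x) = \<phi> i (0, x)" "dt (\<phi>' i) (0, x) = dt (\<phi> i) (0, x)" for i x
    using gl gl' by (auto simp: global_solution_def)
  qed
  have scat: "scatters_to_linear (e i) (\<phi> i)" for i unfolding scatters_to_linear_def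
  proof (intro exI[of _ "\<psi> i"] conjI ballI)
   show "Ck_on 2 future (\<psi> i)" by (rule wsol_future(5)[OF w\<psi>, where z="(0, 0)"]) (simp add: future_def)
   show "box_op (e i) (\<psi> i) z = 0" if "z \<in> future" for z using wsol_future(4)[OF w\<psi>[of i] that] by simp
   let ?P = "\<lambda>b z. Duh (e i) b (?N i) z - Winf (AA (e i) b (?N i)) z"
   let ?k = "\<lambda>t. ellip.ce (e i) * (B i)^2 * (4 * (1 + t) powr (-1/4))^2"
   show "((\<lambda>t. L2norm (\<lambda>x. grad (\<lambda>z. \<phi> i z - \<psi> i z) (t, x))) \<longlongrightarrow> 0) at_top"
   proof (rule L2norm_grad_tendsto_0[where p="?P" and k="?k"])
    show "grad (\<lambda>z. \<phi> i z - \<psi> i z) (t, x) = (?P None (t, x), \<chi> j. ?P (Some j) (t, x))" if "t >= 0" for t x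
     using wsol_diff_grad[OF w\<phi>[of i] w\<psi>[of i], of "(t, x)"] that by (simp add: future_def)
    have kd: "kdecay (AA (e i) b (?N i))" for b
     using ellip.kdecay_source(2)[OF el, of 3 "B i" "?N i" "[]"] NS B by simp
    show "cts (?P b)" for b by (intro continuous_on_diff ellip.Duh_cont[OF el N5] Winf_cont kd)
    show "n2 (?P b) t <= ennreal (?k t)" if "t >= 0" for b t
     using ellip.Duhamel_tail[OF el NS B that] by (subst n2_minus)
    show "?k t >= 0" for t using ellip.ce_pos(2)[OF el, of i] by simp
    have "((\<lambda>t::real. (1 + t) powr (-1/4)) \<longlongrightarrow> 0) at_top"
     by (rule tendsto_neg_powr) (auto intro: filterlim_tendsto_add_at_top[OF tendsto_const filterlim_ident])
    then have "(?k \<longlongrightarrow> ellip.ce (e i) * (B i)^2 * (4 * 0)^2) at_top" by (intro tendsto_intros)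
    then show "(?k \<longlongrightarrow> 0) at_top" by simp
   qed
  qed
  show "\<exists>\<phi>. global_solution e C f g \<phi> \<and> (\<forall>\<phi>'. global_solution e C f g \<phi>' --> (\<forall>i. \<forall>z\<in>future. \<phi>' i z = \<phi> i z)) \<and>
   (\<forall>i. scatters_to_linear (e i) (\<phi> i))" using gl uniq scat by blast
 qed
qed

end
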